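(* Let $N\ge 3$ and let $\mathcal A$ be the algebra with weighted operations $\mu_n^{\mathbf w}$ described in the context. Then $\mathcal A$ satisfies the weighted $A_\infty$-relations, i.e. it is a weighted $A_\infty$-algebra: for every $n\ge0$, every weight $\mathbf w$ and all $a_1,\dots,a_n\in\mathcal A$, $$\sum_{\mathbf w'+\mathbf w''=\mathbf w}\ \sum_{\substack{0\le r\le n\\0\le p\le n-r}}\mu^{\mathbf w'}_{n-r+1}\bigl(a_1,\dots,a_p,\mu^{\mathbf w''}_r(a_{p+1},\dots,a_{p+r}),a_{p+r+1},\dots,a_n\bigr)=0 .$$
   Context: **The underlying algebra.** Fix $N\ge 3$, $\mathbb F=\mathbb F_2$, $R=\mathbb F[V_0,\dots,V_{N+1}]$ (the $V_i$ are central scalars). All indices $1,\dots,N$ of generators are read mod $N$. $\mathcal A$ is the $R$-algebra with orthogonal idempotents $I_1,\dots,I_N$ (with $\sum I_i=1$) and generators $U_i$ and $s_i=s_{i(i+1)}$, $1\le i\le N$. $U_i$ has initial and final idempotent $i$; $s_i$ has initial idempotent $i$ and final idempotent $i+1$; i.e. $U_i=I_iU_iI_i$, $s_i=I_is_iI_{i+1}$. Products are read left to right; the product of two elements is zero if the final idempotent of the first is not the initial idempotent of the second, and moreover $U_is_j=s_jU_i=0$ for $1\le i,j\le N$. There are no other relations, so an $R$-basis of $\mathcal A$ is given by the $I_i$, the powers $U_i^p$ ($p\ge1$), and the nonempty paths $s_is_{i+1}\cdots s_{i+m}$. Put $s_{ii}=s_is_{i+1}\cdots s_{i+N-1}$ and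 $U_{N+1}=\sum_{i=1}^Ns_{ii}$. **Weights.** A weight $\mathbf w$ is a finite $\mathbb Z_{\ge0}$-linear combination of $\varepsilon_0,\dots,\varepsilon_{N+1}$. All operations $\mu_n^{\mathbf w}:\mathcal A^{\otimes n}\to\mathcal A$ are $R$-multilinear, vanish unless the final idempotent of each input equals the initial idempotent of the next, and an output "$V_0^j$" means $V_0^j$ times the initial idempotent of the first input (which equals the final idempotent of the last). **Operations.** $\mu_0^{0}=0$, $\mu_1^0=0$, $\mu_2^0$ is the multiplication, $\mu_0^{\varepsilon_i}=U_i$ for $1\le i\le N+1$. In addition there are the operations defined by graphs as follows. A *centered allowable graph* is (up to isotopy) a finite connected planar graph embedded in the closed disk (loops allowed), with $j\ge1$ internal vertices, each of valence $2N$, whose remaining vertices are endpoints of edges on the boundary circle; one of these boundary endpoints is designated as the *root*. The $2N$ corners at each internal vertex are labelled, clockwise, by $U_1,s_1,U_2,s_2,\dots,U_N,s_N$ up to cyclic rotation. An edge-end at an internal vertex has color $i$ if it separates the corner $U_i$ from $s_{i-1}$ or from $s_i$; an edge joining internal vertices must join two ends of the same color $i$, one separating $s_{i-1}$ from $U_i$ and the other separating $U_i$ from $s_i$, so that the labels meeting on its two sides multiply to $U_i\cdot U_i$ and $s_{i-1}\cdot s_i$, except that a loop may close up a single corner $U_i$ (petal). Each complementary region not meeting the boundary circle must be either a *petal cycle*, having exactly one corner, labelled $U_i$ for some $1\le i\le N$ (weight $\varepsilon_i$), or an *internal cycle*, having exactly $N$ corners, labelled $s_1,\dots,s_N$ once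 each (weight $\varepsilon_{N+1}$). The weight $\mathbf w$ of the graph is the sum of the weights of these regions. Each region meeting the boundary is labelled by the product of its corner labels in the order met when going clockwise around the boundary. Reading the labels of these regions clockwise from the root gives a sequence $(a_1,\dots,a_n)$, and the graph contributes $V_0^j$ to $\mu_n^{\mathbf w}(a_1,\dots,a_n)$. *Extended operations:* each centered graph with weight $\mathbf w$ and sequence $(a_1,\dots,a_n)$ also contributes $\alpha V_0^j$ to $\mu_n^{\mathbf w}(\alpha a_1,a_2,\dots,a_n)$ for each nontrivial product $\alpha$ of generators with $\alpha a_1\neq0$ (left extended), and $V_0^j\alpha$ to $\mu_n^{\mathbf w}(a_1,\dots,a_{n-1},a_n\alpha)$ for each nontrivial product $\alpha$ of generators with $a_n\alpha\ne0$ (right extended); no operation is simultaneously left and right extended. There are no other nonzero operations. *)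

theory Defs
  imports "HOL-Library.Poly_Mapping" "HOL-Library.Z2" "HOL-Library.Multiset"
begin

section \<open>Weighted \<open>A\<^sub>\<infinity>\<close>-algebras in characteristic 2\<close>

text \<open>
  Weights are finite formal sums of symbols \<open>\<epsilon>\<^sub>i\<close>, \<open>i \<in> E\<close>, i.e. multisets over \<open>E\<close> (with
  \<open>\<epsilon>\<^sub>i = {#i#}\<close>).  The operation \<open>\<mu>\<^bsub>n\<^esub>\<^sup>w (a\<^sub>1, \<dots>, a\<^sub>n)\<close> is \<open>\<mu> w [a\<^sub>1, \<dots>, a\<^sub>n]\<close>; the arity is the
  length of the list.  \<open>A\<close> is the carrier of an \<open>R\<close>-module with scalar multiplication \<open>scl\<close>.
  There are no signs because the ground ring has characteristic 2.
\<close>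

definition multilinear_op ::
  "'r set \<Rightarrow> ('r \<Rightarrow> 'a \<Rightarrow> 'a) \<Rightarrow> 'a set \<Rightarrow> ('a list \<Rightarrow> 'a::ab_group_add) \<Rightarrow> bool" where
  "multilinear_op R scl A f \<longleftrightarrow>
     (\<forall>as. set as \<subseteq> A \<longrightarrow> f as \<in> A) \<and>
     (\<forall>as bs x y. set as \<subseteq> A \<and> set bs \<subseteq> A \<and> x \<in> A \<and> y \<in> A \<longrightarrow>
        f (as @ [x + y] @ bs) = f (as @ [x] @ bs) + f (as @ [y] @ bs)) \<and>
     (\<forall>as bs c x. set as \<subseteq> A \<and> set bs \<subseteq> A \<and> c \<in> R \<and> x \<in> A \<longrightarrow>
        f (as @ [scl c x] @ bs) = scl c (f (as @ [x] @ bs)))"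

definition A_infinity_sum ::
  "('e multiset \<Rightarrow> 'a list \<Rightarrow> 'a::ab_group_add) \<Rightarrow> 'e multiset \<Rightarrow> 'a list \<Rightarrow> 'a" where
  "A_infinity_sum \<mu> w as =
     (\<Sum>(w', w'') \<in> {(w', w''). w' + w'' = w}.
        \<Sum>(p, r) \<in> {(p, r). r \<le> length as \<and> p \<le> length as - r}.
          \<mu> w' (take p as @ [\<mu> w'' (take r (drop p as))] @ drop (p + r) as))"

definition weighted_A_infinity_algebra ::
  "'r set \<Rightarrow> ('r \<Rightarrow> 'a \<Rightarrow> 'a) \<Rightarrow> 'a set \<Rightarrow> 'e set \<Rightarrow>
   ('e multiset \<Rightarrow> 'a list \<Rightarrow> 'a::ab_group_add) \<Rightarrow> bool" where
  "weighted_A_infinity_algebra R scl A E \<mu> \<longleftrightarrow>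
     (\<forall>w. set_mset w \<subseteq> E \<longrightarrow> multilinear_op R scl A (\<mu> w)) \<and>
     (\<forall>w as. set_mset w \<subseteq> E \<and> set as \<subseteq> A \<longrightarrow> A_infinity_sum \<mu> w as = 0)"

section \<open>The underlying algebra\<close>

text \<open>Polynomials over \<open>\<bbbF>\<^sub>2\<close> in variables \<open>V\<^sub>0, V\<^sub>1, \<dots>\<close>; \<open>ground_ring N\<close> is \<open>\<bbbF>\<^sub>2[V\<^sub>0, \<dots>, V\<^sub>N\<^sub>+\<^sub>1]\<close>.\<close>

type_synonym scalar = "(nat \<Rightarrow>\<^sub>0 nat) \<Rightarrow>\<^sub>0 bit"

definition ground_ring :: "nat \<Rightarrow> scalar set" where
  "ground_ring N = {c. \<forall>m \<in> Poly_Mapping.keys c. Poly_Mapping.keys m \<subseteq> {0..N + 1}}"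

definition Vvar :: "nat \<Rightarrow> scalar" where
  "Vvar i = Poly_Mapping.single (Poly_Mapping.single i 1) 1"

text \<open>
  Basis elements: \<open>Idem i\<close> is \<open>I\<^sub>i\<close>, \<open>Upow i p\<close> is \<open>U\<^sub>i\<^sup>p\<close> and \<open>Path i m\<close> is the path
  \<open>s\<^sub>i s\<^sub>i\<^sub>+\<^sub>1 \<cdots>\<close> with \<open>m\<close> factors.
\<close>

datatype basis_elt = Idem nat | Upow nat nat | Path nat nat

definition basis :: "nat \<Rightarrow> basis_elt set" where
  "basis N = {Idem i | i. i \<in> {1..N}} \<union> {Upow i p | i p. i \<in> {1..N} \<and> p \<ge> 1} \<union>
             {Path i m | i m. i \<in> {1..N} \<and> m \<ge> 1}"

definition cyc_suc :: "nat \<Rightarrow> nat \<Rightarrow> nat" where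
  "cyc_suc N i = i mod N + 1"

primrec initial :: "basis_elt \<Rightarrow> nat" where
  "initial (Idem i) = i"
| "initial (Upow i p) = i"
| "initial (Path i m) = i"

primrec final :: "nat \<Rightarrow> basis_elt \<Rightarrow> nat" where
  "final N (Idem i) = i"
| "final N (Upow i p) = i"
| "final N (Path i m) = (cyc_suc N ^^ m) i"

text \<open>The product of two basis elements is a basis element or zero (\<open>None\<close>).\<close>

definition basis_mult :: "nat \<Rightarrow> basis_elt \<Rightarrow> basis_elt \<Rightarrow> basis_elt option" where
  "basis_mult N x y =
     (if final N x \<noteq> initial y then None
      else case (x, y) of
        (Idem _, _) \<Rightarrow> Some y
      | (_, Idem _) \<Rightarrow> Some x
      | (Upow i p, Upow _ q) \<Rightarrow> Some (Upow i (p + q))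
      | (Path i m, Path _ k) \<Rightarrow> Some (Path i (m + k))
      | _ \<Rightarrow> None)"

fun basis_prod :: "nat \<Rightarrow> basis_elt list \<Rightarrow> basis_elt option" where
  "basis_prod N [] = None"
| "basis_prod N [x] = Some x"
| "basis_prod N (x # y # zs) = Option.bind (basis_prod N (y # zs)) (basis_mult N x)"

type_synonym star = "basis_elt \<Rightarrow>\<^sub>0 scalar"

definition star_algebra :: "nat \<Rightarrow> star set" where
  "star_algebra N =
     {a. \<forall>x \<in> Poly_Mapping.keys a. x \<in> basis N \<and> Poly_Mapping.lookup a x \<in> ground_ring N}"

definition star_scale :: "scalar \<Rightarrow> star \<Rightarrow> star" where
  "star_scale c a = Poly_Mapping.map (\<lambda>d. c * d) a"

definition elt :: "basis_elt \<Rightarrow> star" where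
  "elt x = Poly_Mapping.single x 1"

section \<open>Centered allowable graphs\<close>

text \<open>
  A rooted graph in the disk is encoded, up to isotopy, as a combinatorial map.  The internal
  vertices are \<open>0, \<dots>, nverts - 1\<close>.  In clockwise order around a vertex \<open>v\<close> one meets,
  for \<open>i = 1, \<dots>, N\<close>, the edge-end \<open>In v i\<close>, the corner \<open>UCorner v i\<close>, the edge-end \<open>Out v i\<close> and
  the corner \<open>SCorner v i\<close>.  So the ends of color \<open>i\<close> at \<open>v\<close> are \<open>In v i\<close>, which separates
  \<open>s\<^sub>i\<^sub>-\<^sub>1\<close> from \<open>U\<^sub>i\<close>, and \<open>Out v i\<close>, which separates \<open>U\<^sub>i\<close> from \<open>s\<^sub>i\<close>.

  An edge between internal vertices joins some \<open>Out v i\<close> to some \<open>In w i\<close> and is recorded as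
  \<open>(v, i, w) \<in> arcs\<close>.  The edge-ends lying on no such edge belong to the edges running to
  the boundary circle, so they stand for the boundary endpoints; the root is one of them.
\<close>

datatype edge_end = In nat nat | Out nat nat
datatype corner = UCorner nat nat | SCorner nat nat

record star_graph =
  nverts :: nat
  arcs :: "(nat \<times> nat \<times> nat) set"
  root_end :: edge_end

definition edge_ends :: "nat \<Rightarrow> star_graph \<Rightarrow> edge_end set" where
  "edge_ends N G = {In v i | v i. v < nverts G \<and> i \<in> {1..N}} \<union>
                   {Out v i | v i. v < nverts G \<and> i \<in> {1..N}}"

definition corners :: "nat \<Rightarrow> star_graph \<Rightarrow> corner set" where
  "corners N G = {UCorner v i | v i. v < nverts G \<and> i \<in> {1..N}} \<union>
                 {SCorner v i | v i. v < nverts G \<and> i \<in> {1..N}}"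

definition wf_star_graph :: "nat \<Rightarrow> star_graph \<Rightarrow> bool" where
  "wf_star_graph N G \<longleftrightarrow>
     nverts G \<ge> 1 \<and>
     arcs G \<subseteq> {..<nverts G} \<times> {1..N} \<times> {..<nverts G} \<and>
     (\<forall>v i w w'. (v, i, w) \<in> arcs G \<and> (v, i, w') \<in> arcs G \<longrightarrow> w = w') \<and>
     (\<forall>v v' i w. (v, i, w) \<in> arcs G \<and> (v', i, w) \<in> arcs G \<longrightarrow> v = v')"

definition connected_graph :: "star_graph \<Rightarrow> bool" where
  "connected_graph G \<longleftrightarrow>
     (\<forall>u < nverts G. \<forall>v < nverts G.
        (u, v) \<in> {(x, y). \<exists>i. (x, i, y) \<in> arcs G \<or> (y, i, x) \<in> arcs G}\<^sup>*)"

inductive joined :: "star_graph \<Rightarrow> edge_end \<Rightarrow> edge_end \<Rightarrow> bool" for G where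
  "(v, i, w) \<in> arcs G \<Longrightarrow> joined G (Out v i) (In w i)"
| "(v, i, w) \<in> arcs G \<Longrightarrow> joined G (In w i) (Out v i)"

definition boundary_ends :: "nat \<Rightarrow> star_graph \<Rightarrow> edge_end set" where
  "boundary_ends N G = {e \<in> edge_ends N G. \<nexists>e'. joined G e e'}"

text \<open>The next corner clockwise after an edge-end, and the next edge-end clockwise after a corner.\<close>

primrec next_corner :: "edge_end \<Rightarrow> corner" where
  "next_corner (In v i) = UCorner v i"
| "next_corner (Out v i) = SCorner v i"

primrec next_end :: "nat \<Rightarrow> corner \<Rightarrow> edge_end" where
  "next_end N (UCorner v i) = Out v i"
| "next_end N (SCorner v i) = In v (cyc_suc N i)"

text \<open>
  Successive corners of a region along an edge, in the counterclockwise direction around the region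
  (the region is on the left of the traversed edge).  For a region meeting the boundary circle this
  is the order of its corners in the clockwise direction along that circle.
\<close>

definition corner_step :: "nat \<Rightarrow> star_graph \<Rightarrow> (corner \<times> corner) set" where
  "corner_step N G =
     {(c, c'). c \<in> corners N G \<and> (\<exists>e. joined G (next_end N c) e \<and> c' = next_corner e)}"

text \<open>Complementary regions, each given by its set of corners.\<close>

definition regions :: "nat \<Rightarrow> star_graph \<Rightarrow> corner set set" where
  "regions N G = corners N G // (corner_step N G \<union> (corner_step N G)\<inverse>)\<^sup>*"

definition inner_regions :: "nat \<Rightarrow> star_graph \<Rightarrow> corner set set" where
  "inner_regions N G = {X \<in> regions N G. \<forall>c \<in> X. next_end N c \<notin> boundary_ends N G}"

definition petal_cycle :: "nat \<Rightarrow> corner set \<Rightarrow> bool" where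
  "petal_cycle i X \<longleftrightarrow> (\<exists>v. X = {UCorner v i})"

definition internal_cycle :: "nat \<Rightarrow> corner set \<Rightarrow> bool" where
  "internal_cycle N X \<longleftrightarrow> (\<exists>f. X = (\<lambda>i. SCorner (f i) i) ` {1..N})"

text \<open>
  \<open>boundary_region N G b cs b'\<close>: clockwise along the circle, \<open>b\<close> and \<open>b'\<close> are successive boundary
  endpoints, and \<open>cs\<close> are the corners, in this order, of the region meeting the circle between them.
\<close>

definition boundary_region ::
  "nat \<Rightarrow> star_graph \<Rightarrow> edge_end \<Rightarrow> corner list \<Rightarrow> edge_end \<Rightarrow> bool" where
  "boundary_region N G b cs b' \<longleftrightarrow>
     b \<in> boundary_ends N G \<and> b' \<in> boundary_ends N G \<and> cs \<noteq> [] \<and>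
     hd cs = next_corner b \<and>
     successively (\<lambda>c c'. (c, c') \<in> corner_step N G) cs \<and>
     next_end N (last cs) = b'"

text \<open>
  All boundary endpoints, read clockwise from the root, with the regions between them.  That
  \<open>bs\<close> exhausts the boundary endpoints says that they lie on one and the same circle.
\<close>

definition boundary_reading ::
  "nat \<Rightarrow> star_graph \<Rightarrow> edge_end list \<Rightarrow> corner list list \<Rightarrow> bool" where
  "boundary_reading N G bs css \<longleftrightarrow>
     bs \<noteq> [] \<and> length css = length bs \<and> distinct bs \<and> set bs = boundary_ends N G \<and>
     hd bs = root_end G \<and>
     (\<forall>k < length bs. boundary_region N G (bs ! k) (css ! k) (bs ! (Suc k mod length bs)))"

text \<open>
  Planarity.  Thicken the connected graph to a ribbon surface.  Its boundary components are the
  inner regions and the single component through all boundary endpoints.  Capping them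
  off gives a closed surface of Euler characteristic
  \<open>nverts - |arcs| + |inner_regions| + 1\<close>, and the graph embeds in the disk (the complement of
  the last cap) iff this surface is the sphere.
\<close>

definition disk_graph :: "nat \<Rightarrow> star_graph \<Rightarrow> bool" where
  "disk_graph N G \<longleftrightarrow>
     wf_star_graph N G \<and> connected_graph G \<and> (\<exists>bs css. boundary_reading N G bs css) \<and>
     nverts G + card (inner_regions N G) + 1 = card (arcs G) + 2"

text \<open>
  A loop of color \<open>i\<close> at \<open>v\<close> joins \<open>Out v i\<close> to \<open>In v i\<close> and hence closes up the corner
  \<open>UCorner v i\<close> as a petal cycle, so loops need no separate condition.
\<close>

definition centered_allowable :: "nat \<Rightarrow> star_graph \<Rightarrow> bool" where
  "centered_allowable N G \<longleftrightarrow>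
     disk_graph N G \<and>
     (\<forall>X \<in> inner_regions N G. (\<exists>i \<in> {1..N}. petal_cycle i X) \<or> internal_cycle N X)"

definition graph_weight :: "nat \<Rightarrow> star_graph \<Rightarrow> nat multiset" where
  "graph_weight N G =
     (\<Sum>i \<in> {1..N}. replicate_mset (card {X \<in> inner_regions N G. petal_cycle i X}) i) +
     replicate_mset (card {X \<in> inner_regions N G. internal_cycle N X}) (N + 1)"

primrec corner_label :: "corner \<Rightarrow> basis_elt" where
  "corner_label (UCorner v i) = Upow i 1"
| "corner_label (SCorner v i) = Path i 1"

definition reads_sequence :: "nat \<Rightarrow> star_graph \<Rightarrow> basis_elt list \<Rightarrow> bool" where
  "reads_sequence N G as \<longleftrightarrow>
     (\<exists>bs css. boundary_reading N G bs css \<and>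
        map (\<lambda>cs. basis_prod N (map corner_label cs)) css = map Some as)"

text \<open>Isotopic graphs are those that differ by renaming the internal vertices.\<close>

primrec rename_end :: "(nat \<Rightarrow> nat) \<Rightarrow> edge_end \<Rightarrow> edge_end" where
  "rename_end \<pi> (In v i) = In (\<pi> v) i"
| "rename_end \<pi> (Out v i) = Out (\<pi> v) i"

definition isotopic :: "(star_graph \<times> star_graph) set" where
  "isotopic = {(G, H). nverts H = nverts G \<and>
     (\<exists>\<pi>. bij_betw \<pi> {..<nverts G} {..<nverts H} \<and>
          arcs H = (\<lambda>(v, i, w). (\<pi> v, i, \<pi> w)) ` arcs G \<and>
          root_end H = rename_end \<pi> (root_end G))}"

definition centered_graphs ::
  "nat \<Rightarrow> nat \<Rightarrow> nat multiset \<Rightarrow> basis_elt list \<Rightarrow> star_graph set" where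
  "centered_graphs N j w as =
     {G. centered_allowable N G \<and> nverts G = j \<and> graph_weight N G = w \<and> reads_sequence N G as}"

section \<open>The operations\<close>

text \<open>
  The sum of \<open>V\<^sub>0\<^sup>j\<close> over the isotopy classes of centered graphs with weight \<open>w\<close> and
  sequence \<open>as\<close>.  At most one \<open>j\<close> occurs: counting edge-ends, \<open>2 * |arcs| + length as = 2 * N * j\<close>,
  and with Euler's formula \<open>2 * size w + length as = 2 + 2 * (N - 1) * j\<close>.
\<close>

definition centered_coeff :: "nat \<Rightarrow> nat multiset \<Rightarrow> basis_elt list \<Rightarrow> scalar" where
  "centered_coeff N w as =
     (\<Sum>j \<in> {j. centered_graphs N j w as \<noteq> {}}.
        of_nat (card (centered_graphs N j w as // isotopic)) * Vvar 0 ^ j)"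

text \<open>The nonzero nontrivial products of generators.\<close>

definition nontrivial :: "nat \<Rightarrow> basis_elt set" where
  "nontrivial N = basis N - range Idem"

definition centered_part :: "nat \<Rightarrow> nat multiset \<Rightarrow> basis_elt list \<Rightarrow> star" where
  "centered_part N w as = star_scale (centered_coeff N w as) (elt (Idem (initial (hd as))))"

definition left_extended_part :: "nat \<Rightarrow> nat multiset \<Rightarrow> basis_elt list \<Rightarrow> star" where
  "left_extended_part N w as =
     (\<Sum>(\<alpha>, x) \<in> {(\<alpha>, x). \<alpha> \<in> nontrivial N \<and> x \<in> basis N \<and> basis_mult N \<alpha> x = Some (hd as)}.
        star_scale (centered_coeff N w (x # tl as)) (elt \<alpha>))"

definition right_extended_part :: "nat \<Rightarrow> nat multiset \<Rightarrow> basis_elt list \<Rightarrow> star" where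
  "right_extended_part N w as =
     (\<Sum>(x, \<alpha>) \<in> {(x, \<alpha>). x \<in> basis N \<and> \<alpha> \<in> nontrivial N \<and> basis_mult N x \<alpha> = Some (last as)}.
        star_scale (centered_coeff N w (butlast as @ [x])) (elt \<alpha>))"

text \<open>\<open>\<mu>\<^sub>0\<close>, with \<open>U\<^sub>N\<^sub>+\<^sub>1 = \<Sum>\<^sub>i s\<^sub>i\<^sub>i\<close>.\<close>

definition curvature :: "nat \<Rightarrow> nat multiset \<Rightarrow> star" where
  "curvature N w =
     (\<Sum>i \<in> {1..N}. if w = {#i#} then elt (Upow i 1) else 0) +
     (if w = {#N + 1#} then \<Sum>i \<in> {1..N}. elt (Path i N) else 0)"

definition product_part :: "nat \<Rightarrow> nat multiset \<Rightarrow> basis_elt list \<Rightarrow> star" where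
  "product_part N w as =
     (if w = {#} \<and> length as = 2
      then (case basis_mult N (as ! 0) (as ! 1) of None \<Rightarrow> 0 | Some x \<Rightarrow> elt x) else 0)"

definition basis_op :: "nat \<Rightarrow> nat multiset \<Rightarrow> basis_elt list \<Rightarrow> star" where
  "basis_op N w as =
     (if as = [] then curvature N w
      else product_part N w as + centered_part N w as +
           left_extended_part N w as + right_extended_part N w as)"

text \<open>The multilinear extension; \<open>star_op N w as\<close> has arity \<open>length as\<close>.\<close>

definition star_op :: "nat \<Rightarrow> nat multiset \<Rightarrow> star list \<Rightarrow> star" where
  "star_op N w as =
     (\<Sum>xs \<in> listset (map Poly_Mapping.keys as).
        star_scale (\<Prod>k < length as. Poly_Mapping.lookup (as ! k) (xs ! k)) (basis_op N w xs))"

end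

theory Submission
 imports Defs "HOL-Combinatorics.Permutations"
begin

text \<open>
 Encode a centered graph as an involution on edge-ends, and let \<open>c\<close> be the coefficient that counts
 the graphs with given boundary labels, each label being read as a block of letters \<open>U\<^sub>i\<close>, \<open>s\<^sub>i\<close>.
 By construction \<open>c\<close> is invariant under cyclic rotation of the blocks.  The key identity cuts the edge
 between two consecutive letters of a block \<open>b a\<close>: on the other side of this edge lies either an inner
 face, which the cut turns into a new block \<open>\<kappa>\<close> of \<open>\<mu>\<^sub>0\<close>, or another boundary region, and then
 planarity forces the cut to disconnect the graph.  Hence
 \<open>c (b a, y) = \<Sum>\<kappa>. c (a, y, b, \<kappa>) + \<Sum> c (a, y', x) * c (l, y'', b)\<close>, where the second sum is over
 all ways to write \<open>y = y', x l, y''\<close>.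

 The relations follow formally.  The terms with an idempotent output are a telescoping sum of these
 identities.  For an output \<open>\<gamma>\<close>, the left extended terms are those of the relation for the input with
 \<open>\<gamma>\<close> removed from its first block, similarly on the right; what is left over on either side is the same
 coefficient, since a product of generators is determined by its first letter and its length.
\<close>

section \<open>Cycles of a permutation\<close>

text \<open>An edge-end carries the letter of the corner that follows it clockwise, and the ends
  fixed by the involution are the boundary endpoints. Passing a corner and then applying the
  involution turns the whole boundary circle into one orbit, alongside the inner faces. Cutting an
  arc is then composition with a transposition, so its effect on regions is a statement about cycles
  of permutations. The second kind of cut disconnects because of V - E + F \<le> 2 for connected
  maps: a connected result would have one face more and one arc less than a planar graph. Isotopy
  classes cannot be cut directly, as the vertices of the pieces have to be told apart; graphs are
  counted with labelled vertices instead. A rooted connected graph has no symmetries, so labelling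
  multiplies the count by a factorial, and a binomial coefficient accounts for the distribution of
  the labels over the two pieces. The factorials are cancelled in the natural numbers, since those
  above 1 are even. Characteristic 2 enters only in the algebraic part, where equal terms cancel in
  pairs.\<close>

definition cyc :: "('a => 'a) => 'a list => bool" where
 "cyc f xs \<longleftrightarrow> xs ~= [] \<and> distinct xs \<and> successively (\<lambda>x y. y = f x) xs \<and> hd xs = f (last xs)"

text \<open>The later entry of a consecutive pair always lies in the tail. Knowing this, a relation
  can be replaced by one that differs from it only at the head of the list, which is how a cycle
  survives a transposition of heads.\<close>

lemma successively_mono_tl:
 assumes "successively P xs" "\<And>x y. P x y ==> x \<in> set xs ==> y \<in> set (tl xs) ==> Q x y"
 shows "successively Q xs"
 using assms
proof (induction xs)
 case (Cons a xs)
 have "successively Q xs"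
  using Cons.prems by (intro Cons.IH) (auto simp: successively_Cons dest: list.set_sel(2)[rotated])
 with Cons.prems show ?case
  by (cases xs) (auto simp: successively_Cons)
qed simp

lemma successively_nth_funpow:
 "successively (\<lambda>x y. y = f x) xs ==> k < length xs ==> xs ! k = (f ^^ k) (hd xs)"
proof (induction xs arbitrary: k)
 case (Cons a xs)
 then show ?case
  by (cases k) (auto simp: successively_Cons funpow_swap1 simp del: funpow.simps(2) simp: funpow_Suc_right)
qed simp

lemma successively_conv_nth:
 "successively P xs \<longleftrightarrow> (\<forall>k. Suc k < length xs \<longrightarrow> P (xs ! k) (xs ! Suc k))"
 by (induction P xs rule: successively.induct) (auto simp: nth_Cons' less_Suc_eq_0_disj)

lemma cyc_append_commute: "cyc f (xs @ ys) ==> cyc f (ys @ xs)"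
 by (cases "xs = []"; cases "ys = []") (auto simp: cyc_def successively_append_iff)

text \<open>A cycle is the list of iterates of its head. If one of two cycles with the same head
  were longer, it would meet the head again at the length of the other, against
  distinctness.\<close>

lemma cyc_unique:
 assumes "cyc f xs" "cyc f ys" "hd xs = hd ys"
 shows "xs = ys"
proof -
 have *: "length ys \<le> length xs" if "cyc f xs" "cyc f ys" "hd xs = hd ys" for xs ys
 proof (rule ccontr)
  assume "\<not> length ys \<le> length xs"
  then have less: "length xs < length ys" by simp
  have "ys ! length xs = (f ^^ length xs) (hd ys)"
   using that less by (intro successively_nth_funpow) (auto simp: cyc_def)
  also have "\<dots> = f ((f ^^ (length xs - 1)) (hd xs))"
   using that by (cases xs) (auto simp: cyc_def)
  also have "(f ^^ (length xs - 1)) (hd xs) = xs ! (length xs - 1)"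
   using that by (subst successively_nth_funpow) (auto simp: cyc_def)
  also have "f \<dots> = hd xs"
   using that by (simp add: cyc_def last_conv_nth)
  also have "\<dots> = ys ! 0"
   using that by (simp add: cyc_def hd_conv_nth)
  finally show False
   using that less by (auto simp: cyc_def nth_eq_iff_index_eq)
 qed
 have "length xs = length ys"
  using *[OF assms] *[OF assms(2,1)] assms(3) by simp
 then show ?thesis
  using assms by (intro nth_equalityI) (auto simp: cyc_def successively_nth_funpow)
qed

lemma cyc_set_unique:
 assumes "cyc f xs" "cyc f ys" "x \<in> set xs" "x \<in> set ys"
 shows "set xs = set ys"
proof -
 obtain a b where xs: "xs = a @ x # b" using assms(3) by (auto simp: in_set_conv_decomp)
 obtain c d where ys: "ys = c @ x # d" using assms(4) by (auto simp: in_set_conv_decomp)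
 have "x # b @ a = x # d @ c"
  using cyc_unique[of f "x # b @ a" "x # d @ c"] cyc_append_commute[of f a "x # b"]
   cyc_append_commute[of f c "x # d"] assms xs ys by simp
 then show ?thesis
  unfolding xs ys by (metis Un_commute append_Cons list.inject list.set(2) set_append)
qed

lemma cyc_rotate_to_hd:
 assumes "cyc f xs" "x \<in> set xs"
 obtains ys where "cyc f ys" "hd ys = x" "set ys = set xs"
proof -
 obtain a b where "xs = a @ x # b" using assms(2) by (auto simp: in_set_conv_decomp)
 then show thesis
  using assms cyc_append_commute[of f a "x # b"] by (intro that[of "x # b @ a"]) auto
qed

text \<open>By finiteness two iterates of the start agree, and injectivity cancels their common
  part, so the start recurs. The iterates below the least positive period form the cycle.\<close>

lemma cyc_exists:
 assumes "finite D" "inj_on f D" "f ` D \<subseteq> D" "x \<in> D"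
 obtains xs where "cyc f xs" "hd xs = x" "set xs \<subseteq> D"
proof -
 have in_D: "(f ^^ n) x \<in> D" for n
  using assms by (induction n) auto
 have "finite (range (\<lambda>n. (f ^^ n) x))"
  using in_D by (intro finite_subset[OF _ assms(1)]) auto
 then have "\<not> inj (\<lambda>n. (f ^^ n) x)"
  using finite_imageD infinite_UNIV_nat by blast
 then obtain a b where ab: "a ~= b" "(f ^^ a) x = (f ^^ b) x"
  unfolding inj_def by blast
 obtain i j where ij: "i < j" "(f ^^ i) x = (f ^^ j) x"
  using ab by (metis linorder_neqE_nat)
 have per: "(f ^^ (j - i)) x = x" if "i < j" "(f ^^ i) x = (f ^^ j) x" for i j
  using that
 proof (induction i arbitrary: j)
  case (Suc i)
  then obtain j' where j: "j = Suc j'" by (cases j) auto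
  have "(f ^^ i) x = (f ^^ j') x"
   using Suc.prems(2) inj_onD[OF assms(2) _ in_D in_D] by (simp add: j)
  with Suc.IH[of j'] Suc.prems(1) show ?case by (simp add: j)
 qed (metis diff_zero funpow_0)
 define n where "n = (LEAST n. n > 0 \<and> (f ^^ n) x = x)"
 have n: "n > 0 \<and> (f ^^ n) x = x"
  unfolding n_def by (rule LeastI[of _ "j - i"]) (use per[OF ij] ij(1) in simp)
 have least: "n \<le> m" if "m > 0" "(f ^^ m) x = x" for m
  unfolding n_def by (rule Least_le) (use that in simp)
 define xs where "xs = map (\<lambda>k. (f ^^ k) x) [0..<n]"
 have "inj_on (\<lambda>k. (f ^^ k) x) {0..<n}"
 proof (rule linorder_inj_onI)
  fix a b assume *: "a < b" "a \<in> {0..<n}" "b \<in> {0..<n}"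
  have "(f ^^ (b - a)) x ~= x"
   using least[of "b - a"] * by force
  then show "(f ^^ a) x ~= (f ^^ b) x"
   using per[OF *(1)] by blast
 qed auto
 then have dist: "distinct xs"
  by (simp add: xs_def distinct_map)
 have succ: "successively (\<lambda>x y. y = f x) xs"
  unfolding xs_def successively_map
  by (auto simp: successively_conv_nth)
 have hd: "hd xs = x"
  using n by (simp add: xs_def hd_map)
 have "f (last xs) = (f ^^ n) x"
  using n by (cases n) (simp_all add: xs_def last_map)
 then show thesis
  using n in_D hd dist succ by (intro that[of xs]) (auto simp: cyc_def xs_def)
qed

lemma cyc_cong:
 assumes "cyc f xs" "\<And>x. x \<in> set xs ==> f x = g x"
 shows "cyc g xs"
proof -
 have *: "xs ~= []" "distinct xs" "successively (\<lambda>x y. y = f x) xs" "hd xs = f (last xs)"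
  using assms(1) unfolding cyc_def by blast+
 have "successively (\<lambda>x y. y = g x) xs"
  using *(3)
 proof (rule successively_mono_tl)
  fix x y assume "y = f x" "x \<in> set xs"
  then show "y = g x" using assms(2)[of x] by metis
 qed
 moreover have "hd xs = g (last xs)"
  using * assms(2)[of "last xs"] last_in_set[of xs] by metis
 ultimately show ?thesis using * unfolding cyc_def by blast
qed

lemma cyc_map:
 assumes "cyc f xs" "inj \<rho>" "\<And>x. x \<in> set xs ==> g (\<rho> x) = \<rho> (f x)"
 shows "cyc g (map \<rho> xs)"
proof -
 have *: "xs ~= []" "distinct xs" "successively (\<lambda>x y. y = f x) xs" "hd xs = f (last xs)"
  using assms(1) unfolding cyc_def by blast+
 have "successively (\<lambda>x y. \<rho> y = g (\<rho> x)) xs"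
  using *(3)
 proof (rule successively_mono_tl)
  fix x y assume "y = f x" "x \<in> set xs"
  then show "\<rho> y = g (\<rho> x)" using assms(3)[of x] by metis
 qed
 moreover have "\<rho> (hd xs) = g (\<rho> (last xs))"
  using * assms(3)[of "last xs"] last_in_set[of xs] by metis
 ultimately show ?thesis
  using *(1,2) assms(2) unfolding cyc_def
  by (auto simp: successively_map distinct_map hd_map last_map inj_on_def inj_def)
qed

lemma successively_transpose:
 assumes "successively (\<lambda>x y. y = f x) xs" "\<And>y. y \<in> set (tl xs) ==> y ~= a \<and> y ~= b"
 shows "successively (\<lambda>x y. y = (transpose a b \<circ> f) x) xs"
 using assms(1)
proof (rule successively_mono_tl)
 fix x y assume "y = f x" "y \<in> set (tl xs)"
 then show "y = (transpose a b \<circ> f) x" using assms(2)[of y] by (simp add: transpose_def)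
qed

text \<open>The last entry of each piece is mapped by \<open>f\<close> to the head of the other
  piece, and the transposition exchanges these two images. No other entry has a head as its image,
  so both pieces close up.\<close>

lemma cyc_split:
 assumes "cyc f (xs @ ys)" "xs ~= []" "ys ~= []"
 shows "cyc (transpose (hd xs) (hd ys) \<circ> f) xs" "cyc (transpose (hd xs) (hd ys) \<circ> f) ys"
proof -
 have d: "distinct (xs @ ys)" and s: "successively (\<lambda>x y. y = f x) xs" "successively (\<lambda>x y. y = f x) ys"
  and l: "hd ys = f (last xs)" "hd xs = f (last ys)"
  using assms by (auto simp: cyc_def successively_append_iff)
 have ne: "y ~= hd xs \<and> y ~= hd ys" if "y \<in> set (tl xs) \<or> y \<in> set (tl ys)" for y
  using that d assms(2,3) by (cases xs; cases ys) auto
 have "successively (\<lambda>x y. y = (transpose (hd xs) (hd ys) \<circ> f) x) xs"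
  "successively (\<lambda>x y. y = (transpose (hd xs) (hd ys) \<circ> f) x) ys"
  by (rule successively_transpose; use s ne in blast)+
 then show "cyc (transpose (hd xs) (hd ys) \<circ> f) xs" "cyc (transpose (hd xs) (hd ys) \<circ> f) ys"
  using d l assms(2,3) by (auto simp: cyc_def transpose_def)
qed

lemma cyc_join:
 assumes "cyc f xs" "cyc f ys" "set xs \<inter> set ys = {}"
 shows "cyc (transpose (hd xs) (hd ys) \<circ> f) (xs @ ys)"
proof -
 have ne: "y ~= hd xs \<and> y ~= hd ys" if "y \<in> set (tl xs) \<or> y \<in> set (tl ys)" for y
  using that assms by (cases xs; cases ys) (auto simp: cyc_def)
 have s: "successively (\<lambda>x y. y = f x) xs" "successively (\<lambda>x y. y = f x) ys"
  using assms by (auto simp: cyc_def)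
 have "successively (\<lambda>x y. y = (transpose (hd xs) (hd ys) \<circ> f) x) xs"
  "successively (\<lambda>x y. y = (transpose (hd xs) (hd ys) \<circ> f) x) ys"
  by (rule successively_transpose; use s ne in blast)+
 moreover have "hd ys = (transpose (hd xs) (hd ys) \<circ> f) (last xs)" "hd xs = (transpose (hd xs) (hd ys) \<circ> f) (last ys)"
  using assms(1,2) by (simp_all add: cyc_def)
 ultimately show ?thesis
  using assms unfolding cyc_def by (simp del: o_apply comp_apply add: successively_append_iff)
qed

lemma cyc_transpose_other:
 assumes "cyc f zs" "a \<notin> set zs" "b \<notin> set zs"
 shows "cyc (transpose a b \<circ> f) zs"
proof -
 have "f x \<in> set zs" if "x \<in> set zs" for x
 proof -
  obtain ys where ys: "cyc f ys" "hd ys = x" "set ys = set zs"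
   using cyc_rotate_to_hd[OF assms(1) \<open>x \<in> set zs\<close>] .
  obtain y ys' where ys': "ys = y # ys'" using ys by (cases ys) (auto simp: cyc_def)
  then have "f x \<in> set ys"
   using ys by (cases ys') (auto simp: cyc_def)
  then show ?thesis using ys by simp
 qed
 then have "f x = (transpose a b \<circ> f) x" if "x \<in> set zs" for x
  using that assms(2,3) by (metis comp_apply transpose_apply_other)
 then show ?thesis
  using assms(1) cyc_cong by metis
qed

section \<open>Faces as supports of cycles, and their change under a transposition\<close>

definition faces :: "('a => 'a) => 'a set => 'a set set" where
 "faces f D = {set xs | xs. cyc f xs \<and> set xs \<subseteq> D}"

lemma facesI: "cyc f xs ==> set xs \<subseteq> D ==> set xs \<in> faces f D"
 by (auto simp: faces_def)

lemma facesE: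
 assumes "X \<in> faces f D" "x \<in> X"
 obtains xs where "cyc f xs" "hd xs = x" "set xs = X" "X \<subseteq> D"
proof -
 obtain zs where "X = set zs" "cyc f zs" "X \<subseteq> D" using assms(1) by (auto simp: faces_def)
 with assms(2) show thesis using cyc_rotate_to_hd[of f zs x] that by blast
qed

lemma finite_faces: "finite D ==> finite (faces f D)"
 by (rule finite_subset[of _ "Pow D"]) (auto simp: faces_def)

lemma faces_disjoint: "X \<in> faces f D ==> Y \<in> faces f D' ==> x \<in> X ==> x \<in> Y ==> X = Y"
 by (auto simp: faces_def dest: cyc_set_unique)

lemma faces_nonempty: "X \<in> faces f D ==> X ~= {}"
 by (auto simp: faces_def cyc_def)

lemma faces_cover:
 assumes "finite D" "inj_on f D" "f ` D \<subseteq> D" "x \<in> D"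
 obtains X where "X \<in> faces f D" "x \<in> X"
proof -
 obtain xs where "cyc f xs" "hd xs = x" "set xs \<subseteq> D" using cyc_exists[OF assms] .
 then have "set xs \<in> faces f D" "x \<in> set xs" using hd_in_set[of xs] facesI by (auto simp: cyc_def)
 then show thesis by (rule that)
qed

text \<open>A new cycle through one of the two heads is one of the two pieces, because cycles with a
  common point have the same support. A cycle that avoids both heads is not affected by the
  transposition, in either direction.\<close>

lemma faces_transpose_split:
 assumes "cyc f (xs @ ys)" "xs ~= []" "ys ~= []" "set (xs @ ys) \<subseteq> D"
 defines "g \<equiv> transpose (hd xs) (hd ys) \<circ> f"
 shows "faces g D = insert (set xs) (insert (set ys) (faces f D - {set (xs @ ys)}))"
proof (intro equalityI subsetI)
 note split = cyc_split[OF assms(1-3), folded g_def]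
 have f: "f = transpose (hd xs) (hd ys) \<circ> g"
  by (auto simp: g_def fun_eq_iff)
 {
  fix X assume "X \<in> faces g D"
  then obtain zs where zs: "X = set zs" "cyc g zs" "set zs \<subseteq> D" by (auto simp: faces_def)
  consider "hd xs \<in> set zs" | "hd ys \<in> set zs" | "hd xs \<notin> set zs" "hd ys \<notin> set zs" by blast
  then show "X \<in> insert (set xs) (insert (set ys) (faces f D - {set (xs @ ys)}))"
  proof cases
   case 1
   then show ?thesis using cyc_set_unique[OF zs(2) split(1) 1] assms zs by auto
  next
   case 2
   then show ?thesis using cyc_set_unique[OF zs(2) split(2) 2] assms zs by auto
  next
   case 3
   then have "cyc f zs" using cyc_transpose_other[OF zs(2)] f by metis
   moreover have "hd xs \<in> set (xs @ ys)" using assms by simp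
   ultimately show ?thesis using zs 3 by (auto simp: faces_def)
  qed
 next
  fix X assume X: "X \<in> insert (set xs) (insert (set ys) (faces f D - {set (xs @ ys)}))"
  show "X \<in> faces g D"
  proof (cases "X = set xs \<or> X = set ys")
   case True
   then show ?thesis using split assms by (auto simp: faces_def)
  next
   case False
   then obtain zs where zs: "X = set zs" "cyc f zs" "set zs \<subseteq> D" "X ~= set (xs @ ys)"
    using X by (auto simp: faces_def)
   have "z \<notin> set zs" if "z \<in> set (xs @ ys)" for z
    using cyc_set_unique[OF zs(2) assms(1)] that zs by auto
   then have "cyc g zs" unfolding g_def
    using assms(2,3) by (intro cyc_transpose_other[OF zs(2)]) auto
   then show ?thesis using zs by (auto simp: faces_def)
  qed
 }
qed

lemma card_faces_transpose_split:
 assumes "cyc f (xs @ ys)" "xs ~= []" "ys ~= []" "set (xs @ ys) \<subseteq> D" "finite D"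
 shows "card (faces (transpose (hd xs) (hd ys) \<circ> f) D) = card (faces f D) + 1"
proof -
 let ?F = "faces f D - {set (xs @ ys)}"
 have fin: "finite (faces f D)" using assms by (simp add: finite_faces)
 have in_F: "set (xs @ ys) \<in> faces f D" using assms facesI by blast
 have d: "set xs \<inter> set ys = {}" using assms(1) by (auto simp: cyc_def)
 have "set zs \<notin> ?F" if "set zs \<subseteq> set (xs @ ys)" "zs ~= []" for zs
 proof
  assume zs: "set zs \<in> ?F"
  then have "set zs \<in> faces f D" by blast
  moreover have "hd zs \<in> set zs" using that by simp
  moreover from this have "hd zs \<in> set (xs @ ys)" using that by blast
  ultimately have "set zs = set (xs @ ys)"
   by (rule faces_disjoint[OF _ in_F])
  with zs show False by blast
 qed
 then have "set xs \<notin> ?F" "set ys \<notin> ?F" using assms by auto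
 moreover have "set xs ~= set ys" using d assms by auto
 ultimately have "card (insert (set xs) (insert (set ys) ?F)) = card ?F + 2"
  using fin by simp
 then show ?thesis
  using faces_transpose_split[OF assms(1-4)] card_Suc_Diff1[OF fin in_F] by simp
qed

lemma faces_disjoint_Un:
 assumes "finite D1" "finite D2" "inj_on f D1" "inj_on f D2" "f ` D1 \<subseteq> D1" "f ` D2 \<subseteq> D2"
 shows "faces f (D1 \<union> D2) = faces f D1 \<union> faces f D2"
proof (intro equalityI subsetI)
 fix X assume X: "X \<in> faces f (D1 \<union> D2)"
 then have "X \<subseteq> D1 \<union> D2" by (auto simp: faces_def)
 then obtain x where x: "x \<in> X" "x \<in> D1 \<union> D2"
  using faces_nonempty[OF X] by blast
 obtain Y where "Y \<in> faces f D1 \<union> faces f D2" "x \<in> Y"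
  using faces_cover[OF assms(1,3,5)] faces_cover[OF assms(2,4,6)] x(2) by blast
 then show "X \<in> faces f D1 \<union> faces f D2"
  using faces_disjoint[OF X] x by blast
qed (auto simp: faces_def)

lemma faces_cong:
 assumes "\<And>x. x \<in> D ==> f x = g x"
 shows "faces f D = faces g D"
 using assms cyc_cong[of f _ g] cyc_cong[of g _ f] unfolding faces_def
 by (metis (no_types, opaque_lifting) subsetD)

lemma faces_image:
 assumes "bij \<rho>" "\<And>x. g (\<rho> x) = \<rho> (f x)"
 shows "faces g (\<rho> ` D) = (`) \<rho> ` faces f D"
proof (intro equalityI subsetI)
 fix X assume "X \<in> faces g (\<rho> ` D)"
 then obtain xs where xs: "X = set xs" "cyc g xs" "set xs \<subseteq> \<rho> ` D" by (auto simp: faces_def)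
 have "f (inv \<rho> y) = inv \<rho> (g y)" for y
  using assms by (metis bij_inv_eq_iff)
 then have "cyc f (map (inv \<rho>) xs)"
  using xs assms(1) by (intro cyc_map[of g]) (auto simp: bij_imp_bij_inv bij_is_inj)
 moreover have "set (map (inv \<rho>) xs) \<subseteq> D"
  using xs assms(1) by (auto simp: bij_is_inj)
 moreover have "X = \<rho> ` set (map (inv \<rho>) xs)"
  using xs assms(1) by (simp add: image_image bij_is_surj surj_f_inv_f)
 ultimately show "X \<in> (`) \<rho> ` faces f D" by (auto simp: faces_def simp del: set_map)
next
 fix X assume "X \<in> (`) \<rho> ` faces f D"
 then obtain xs where "X = set (map \<rho> xs)" "cyc f xs" "set xs \<subseteq> D" by (auto simp: faces_def)
 then show "X \<in> faces g (\<rho> ` D)"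
  using cyc_map[of f xs \<rho> g] assms facesI[of g "map \<rho> xs" "\<rho> ` D"] by (auto simp: bij_is_inj)
qed

section \<open>Graphs as involutions on edge-ends\<close>

primrec vert :: "edge_end => nat" where
 "vert (In v i) = v"
| "vert (Out v i) = v"

text \<open>\<open>(False, i)\<close> is the corner label \<open>U\<^sub>i\<close> and
  \<open>(True, i)\<close> is \<open>s\<^sub>i\<close>. An edge-end is given the label of the corner
  that follows it clockwise.\<close>

type_synonym letter = "bool \<times> nat"

primrec ety :: "edge_end => letter" where
 "ety (In v i) = (False, i)"
| "ety (Out v i) = (True, i)"

fun flip :: "letter => letter" where
 "flip (k, i) = (\<not> k, i)"

fun nxt :: "nat => letter => letter" where
 "nxt N (k, i) = (if k then (False, cyc_suc N i) else (True, i))"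

text \<open>The next edge-end clockwise around the same vertex. Together with the involution that
  describes the arcs it encodes the embedding of the graph.\<close>

definition sg :: "nat => edge_end => edge_end" where
 "sg N e = next_end N (next_corner e)"

definition ends :: "nat => nat set => edge_end set" where
 "ends N S = {e. vert e \<in> S \<and> snd (ety e) \<in> {1..N}}"

text \<open>The involution is a total function that fixes everything not glued, including ends
  outside \<open>ends N S\<close>, so that equal graphs are equal functions. The condition on
  \<open>ety\<close> lets an arc join only an \<open>In\<close> and an \<open>Out\<close> end of the
  same color.\<close>

definition gmap :: "nat => nat set => (edge_end => edge_end) => bool" where
 "gmap N S t \<longleftrightarrow> (\<forall>e. t (t e) = e) \<and> (\<forall>e. t e ~= e \<longrightarrow> e \<in> ends N S \<and> ety (t e) = flip (ety e))"

text \<open>The face permutation: pass a corner, then cross the arc. At an end fixed by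
  \<open>t\<close> there is no arc and the orbit goes on with the next region, so the regions along
  a boundary circle belong to a single orbit.\<close>

definition fp :: "nat => (edge_end => edge_end) => edge_end => edge_end" where
 "fp N t = t \<circ> sg N"

definition bnd :: "nat => nat set => (edge_end => edge_end) => edge_end set" where
 "bnd N S t = {e \<in> ends N S. t e = e}"

text \<open>Every arc is represented once, by its \<open>Out\<close> end.\<close>

definition arcs_of :: "(edge_end => edge_end) => edge_end set" where
 "arcs_of t = {e. t e ~= e \<and> fst (ety e)}"

definition adj :: "(edge_end => edge_end) => (nat \<times> nat) set" where
 "adj t = range (\<lambda>e. (vert e, vert (t e)))"

definition conn :: "nat set => (edge_end => edge_end) => bool" where
 "conn S t \<longleftrightarrow> (\<forall>u\<in>S. \<forall>v\<in>S. (u, v) \<in> (adj t)\<^sup>*)"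

definition restr :: "nat set => (edge_end => edge_end) => edge_end => edge_end" where
 "restr S t = (\<lambda>e. if vert e \<in> S then t e else e)"

definition joinm :: "nat set => (edge_end => edge_end) => (edge_end => edge_end) => edge_end => edge_end" where
 "joinm S t1 t2 = (\<lambda>e. if vert e \<in> S then t1 e else t2 e)"

lemma sg_simps [simp]: "sg N (In v i) = Out v i" "sg N (Out v i) = In v (cyc_suc N i)"
 by (simp_all add: sg_def)

lemma vert_sg [simp]: "vert (sg N e) = vert e"
 by (cases e) auto

lemma ety_sg [simp]: "ety (sg N e) = nxt N (ety e)"
 by (cases e) auto

lemma flip_flip [simp]: "flip (flip l) = l"
 by (cases l) auto

lemma snd_flip [simp]: "snd (flip l) = snd l"
 by (cases l) auto

lemma fst_flip [simp]: "fst (flip l) = (\<not> fst l)"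
 by (cases l) auto

lemma flip_neq [simp]: "flip l ~= l" "l ~= flip l"
 by (cases l, simp)+

lemma edge_end_eqI: "vert e = vert e' ==> ety e = ety e' ==> e = e'"
 by (cases e; cases e') auto

lemma cyc_suc_range: "N \<ge> 1 ==> cyc_suc N i \<in> {1..N}"
 by (simp add: cyc_suc_def Suc_leI)

lemma cyc_suc_eq: "i \<in> {1..N} ==> cyc_suc N i = (if i = N then 1 else i + 1)"
 by (auto simp: cyc_suc_def)

lemma cyc_suc_inj:
 assumes "i \<in> {1..N}" "j \<in> {1..N}" "cyc_suc N i = cyc_suc N j"
 shows "i = j"
proof -
 have "(if i = N then 1 else i + 1) = (if j = N then 1 else j + 1)"
  using assms(3) unfolding cyc_suc_eq[OF assms(1)] cyc_suc_eq[OF assms(2)] .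
 moreover have "i \<ge> 1" "j \<ge> 1" using assms(1,2) by simp_all
 ultimately show ?thesis
  by (cases "i = N"; cases "j = N"; simp only: if_True if_False simp_thms; linarith)
qed

lemma nxt_inj:
 assumes "snd l \<in> {1..N}" "snd l' \<in> {1..N}" "nxt N l = nxt N l'"
 shows "l = l'"
proof -
 obtain k i where l: "l = (k, i)" by (cases l)
 obtain k' i' where l': "l' = (k', i')" by (cases l')
 show ?thesis
 proof (cases "k = k'")
  case True
  then show ?thesis using assms cyc_suc_inj[of i N i'] unfolding l l' by (cases k') simp_all
 next
  case False
  then show ?thesis using assms(3) unfolding l l' by (cases k; cases k') simp_all
 qed
qed

lemma fst_nxt [simp]: "fst (nxt N l) = (\<not> fst l)"
 by (cases l) simp

lemma finite_ends [simp]: "finite S ==> finite (ends N S)"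
proof -
 assume "finite S"
 then have "finite ((\<lambda>(v, i). In v i) ` (S \<times> {1..N}) \<union> (\<lambda>(v, i). Out v i) ` (S \<times> {1..N}))" by auto
 moreover have "ends N S \<subseteq> (\<lambda>(v, i). In v i) ` (S \<times> {1..N}) \<union> (\<lambda>(v, i). Out v i) ` (S \<times> {1..N})"
 proof
  fix e assume "e \<in> ends N S"
  then show "e \<in> (\<lambda>(v, i). In v i) ` (S \<times> {1..N}) \<union> (\<lambda>(v, i). Out v i) ` (S \<times> {1..N})"
   by (cases e) (auto simp: ends_def image_iff)
 qed
 ultimately show ?thesis by (rule finite_subset[rotated])
qed

lemma gmap_involution [simp]: "gmap N S t ==> t (t e) = e"
 by (simp add: gmap_def)

lemma gmap_inj: "gmap N S t ==> inj t"
 by (metis gmap_involution injI)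

lemma gmap_moved: "gmap N S t ==> t e ~= e ==> e \<in> ends N S \<and> ety (t e) = flip (ety e)"
 by (simp add: gmap_def)

lemma gmap_ends: "gmap N S t ==> t e \<in> ends N S \<longleftrightarrow> e \<in> ends N S"
 by (metis gmap_def)

lemma sg_ends: "N \<ge> 1 ==> e \<in> ends N S ==> sg N e \<in> ends N S"
 using cyc_suc_range[of N] by (cases e) (auto simp: ends_def)

text \<open>Injectivity is confined to \<open>ends N S\<close>, because \<open>cyc_suc\<close> sends
  all numbers that agree modulo \<open>N\<close> to the same color.\<close>

lemma sg_inj_on: "inj_on (sg N) (ends N S)"
proof (rule inj_onI)
 fix x y assume *: "x \<in> ends N S" "y \<in> ends N S" "sg N x = sg N y"
 then have "vert x = vert y" "nxt N (ety x) = nxt N (ety y)" by (metis vert_sg, metis ety_sg)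
 then show "x = y" using * nxt_inj[of "ety x" N "ety y"] by (intro edge_end_eqI) (auto simp: ends_def)
qed

lemma fp_inj_on: "gmap N S t ==> inj_on (fp N t) (ends N S)"
 unfolding fp_def using gmap_inj[of N S t] sg_inj_on
 by (metis comp_inj_on inj_on_subset subset_UNIV)

lemma fp_ends: "N \<ge> 1 ==> gmap N S t ==> e \<in> ends N S ==> fp N t e \<in> ends N S"
 by (simp add: fp_def sg_ends gmap_ends)

lemma fp_ends_image: "N \<ge> 1 ==> gmap N S t ==> fp N t ` ends N S \<subseteq> ends N S"
 using fp_ends by blast

lemma fp_transpose: "transpose a b \<circ> fp N t = fp N (transpose a b \<circ> t)"
 by (simp add: fp_def comp_assoc)

lemma finite_arcs_of: "gmap N S t ==> finite S ==> finite (arcs_of t)"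
 by (rule finite_subset[of _ "ends N S"]) (auto simp: arcs_of_def dest: gmap_moved)

lemma face_closed:
 assumes "X \<in> faces f D" "x \<in> X"
 shows "f x \<in> X"
proof -
 obtain xs where xs: "cyc f xs" "hd xs = x" "set xs = X" using facesE[OF assms] .
 then obtain ys where "xs = x # ys" by (cases xs) (auto simp: cyc_def)
 with xs show ?thesis by (cases ys) (auto simp: cyc_def)
qed

subsection \<open>Removing and adding an arc\<close>

text \<open>One operation both removes and adds arcs: composition with the transposition of two ends
  frees them if they are joined, and joins them if both are free. By \<open>fp_transpose\<close> the
  face permutation is composed with the same transposition.\<close>

lemma cut_apply:
 assumes "gmap N S t" "t h1 = h2" "h1 ~= h2"
 shows "(transpose h1 h2 \<circ> t) e = (if e = h1 \<or> e = h2 then e else t e)"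
proof -
 have "t h2 = h1" using assms gmap_involution by metis
 moreover have "t e ~= h1" "t e ~= h2" if "e ~= h1" "e ~= h2"
  using that calculation assms by (metis gmap_involution)+
 ultimately show ?thesis using assms by (simp add: transpose_def)
qed

lemma glue_apply:
 assumes "gmap N S t" "t h1 = h1" "t h2 = h2"
 shows "(transpose h1 h2 \<circ> t) e = (if e = h1 then h2 else if e = h2 then h1 else t e)"
proof -
 have "t e ~= h1" "t e ~= h2" if "e ~= h1" "e ~= h2"
  using that assms by (metis gmap_involution)+
 then show ?thesis using assms by (simp add: transpose_def)
qed

lemma gmap_cut:
 assumes "gmap N S t" "t h1 = h2" "h1 ~= h2"
 shows "gmap N S (transpose h1 h2 \<circ> t)"
proof -
 have "t h2 = h1" using assms gmap_involution by metis
 moreover have "t e ~= h1" "t e ~= h2" if "e ~= h1" "e ~= h2" for e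
  using that calculation assms(1,2) by (metis gmap_involution)+
 ultimately show ?thesis
  unfolding gmap_def cut_apply[OF assms] using assms(1) gmap_moved[OF assms(1)] by auto
qed

lemma gmap_glue:
 assumes "gmap N S t" "h1 \<in> bnd N S t" "h2 \<in> bnd N S t" "ety h1 = flip (ety h2)"
 shows "gmap N S (transpose h1 h2 \<circ> t)"
proof -
 have "t h1 = h1" "t h2 = h2" "h1 \<in> ends N S" "h2 \<in> ends N S" using assms by (auto simp: bnd_def)
 moreover have "t e ~= h1" "t e ~= h2" if "e ~= h1" "e ~= h2" for e
  using that calculation assms(1) by (metis gmap_involution)+
 moreover have "ety h2 = flip (ety h1)" using assms(4) by simp
 ultimately show ?thesis
  unfolding gmap_def glue_apply[OF assms(1) \<open>t h1 = h1\<close> \<open>t h2 = h2\<close>]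
  using assms(1,4) gmap_moved[OF assms(1)] by auto
qed

lemma bnd_cut:
 assumes "gmap N S t" "t h1 = h2" "h1 ~= h2"
 shows "bnd N S (transpose h1 h2 \<circ> t) = insert h1 (insert h2 (bnd N S t))"
proof -
 have "h1 \<in> ends N S" "h2 \<in> ends N S"
  using assms gmap_moved[OF assms(1), of h1] gmap_ends[OF assms(1)] by auto
 then show ?thesis
  unfolding bnd_def cut_apply[OF assms] by auto
qed

lemma card_arcs_cut:
 assumes "gmap N S t" "t h1 = h2" "h1 ~= h2" "finite S"
 shows "card (arcs_of t) = card (arcs_of (transpose h1 h2 \<circ> t)) + 1"
proof -
 have t2: "t h2 = h1" using assms gmap_involution by metis
 have ety: "fst (ety h2) = (\<not> fst (ety h1))"
  using gmap_moved[OF assms(1), of h1] assms by simp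
 \<comment> \<open>The \<open>Out\<close> end of the arc, which is the one that represents
   it.\<close>
 define h where "h = (if fst (ety h1) then h1 else h2)"
 have "arcs_of t = insert h (arcs_of (transpose h1 h2 \<circ> t))" "h \<notin> arcs_of (transpose h1 h2 \<circ> t)"
  unfolding arcs_of_def cut_apply[OF assms(1-3)] h_def using assms t2 ety by auto
 moreover have "finite (arcs_of (transpose h1 h2 \<circ> t))"
  using finite_arcs_of[OF gmap_cut[OF assms(1-3)] assms(4)] .
 ultimately show ?thesis by simp
qed

text \<open>The joining case is the splitting case read backwards: composing twice with the same
  transposition gives back \<open>f\<close>, so the cycle formed from both faces is split
  again.\<close>

lemma card_faces_transpose:
 assumes "finite D" "inj_on f D" "f ` D \<subseteq> D" "a \<in> D" "b \<in> D" "a ~= b"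
 shows "if \<exists>X\<in>faces f D. a \<in> X \<and> b \<in> X
  then card (faces (transpose a b \<circ> f) D) = card (faces f D) + 1
  else card (faces f D) = card (faces (transpose a b \<circ> f) D) + 1"
proof (cases "\<exists>X\<in>faces f D. a \<in> X \<and> b \<in> X")
 case True
 then obtain X where X: "X \<in> faces f D" "a \<in> X" "b \<in> X" by blast
 then obtain zs where zs: "cyc f zs" "hd zs = a" "set zs = X" "X \<subseteq> D" using facesE by metis
 obtain zs' where zs': "zs = a # zs'" using zs by (cases zs) (auto simp: cyc_def)
 then obtain xs ys where "zs' = xs @ b # ys"
  using X zs assms(6) by (auto simp: in_set_conv_decomp)
 then have "zs = (a # xs) @ (b # ys)" using zs' by simp
 then have "card (faces (transpose a b \<circ> f) D) = card (faces f D) + 1"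
  using card_faces_transpose_split[of f "a # xs" "b # ys" D] zs(1,3,4) assms(1) by auto
 then show ?thesis using True by simp
next
 case False
 obtain xs where xs: "cyc f xs" "hd xs = a" "set xs \<subseteq> D" using cyc_exists[OF assms(1-4)] .
 obtain ys where ys: "cyc f ys" "hd ys = b" "set ys \<subseteq> D" using cyc_exists[OF assms(1-3,5)] .
 have ne: "xs ~= []" "ys ~= []" using xs ys by (auto simp: cyc_def)
 have "set xs \<inter> set ys = {}"
 proof (rule ccontr)
  assume "set xs \<inter> set ys ~= {}"
  then have "set xs = set ys" using cyc_set_unique[OF xs(1) ys(1)] by blast
  then show False using False xs ys ne facesI[OF xs(1,3)] by (metis hd_in_set)
 qed
 then have "cyc (transpose a b \<circ> f) (xs @ ys)" using cyc_join[OF xs(1) ys(1)] xs ys by simp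
 moreover have "f = transpose a b \<circ> (transpose a b \<circ> f)" by (auto simp: fun_eq_iff)
 ultimately have "card (faces f D) = card (faces (transpose a b \<circ> f) D) + 1"
  using card_faces_transpose_split[of "transpose a b \<circ> f" xs ys D] ne xs ys assms(1) by simp
 then show ?thesis using False by simp
qed

subsection \<open>Connectedness\<close>

lemma adjI: "(vert e, vert (t e)) \<in> adj t"
 by (auto simp: adj_def)

lemma sym_adj: "gmap N S t ==> sym (adj t)"
proof (rule symI)
 fix x y assume g: "gmap N S t" and "(x, y) \<in> adj t"
 then obtain e where "x = vert e" "y = vert (t e)" by (auto simp: adj_def)
 then show "(y, x) \<in> adj t" using adjI[of "t e" t] gmap_involution[OF g, of e] by simp
qed

text \<open>Turning around a vertex does not leave it and applying \<open>t\<close> follows an arc,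
  so an orbit of the face permutation stays in one component.\<close>

lemma face_connected:
 assumes "cyc (fp N t) xs" "x \<in> set xs" "y \<in> set xs"
 shows "(vert x, vert y) \<in> (adj t)\<^sup>*"
proof -
 obtain zs where zs: "cyc (fp N t) zs" "hd zs = x" "set zs = set xs"
  using cyc_rotate_to_hd[OF assms(1,2)] .
 have step: "(vert x, vert ((fp N t ^^ k) x)) \<in> (adj t)\<^sup>*" for k
 proof (induction k)
  case (Suc k)
  have "(vert ((fp N t ^^ k) x), vert ((fp N t ^^ Suc k) x)) \<in> adj t"
   using adjI[of "sg N ((fp N t ^^ k) x)" t] by (simp add: fp_def)
  with Suc show ?case by simp
 qed simp
 obtain k where "k < length zs" "y = zs ! k" using assms(3) zs(3) by (metis in_set_conv_nth)
 then have "y = (fp N t ^^ k) x" using zs successively_nth_funpow by (metis cyc_def)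
 then show ?thesis using step by simp
qed

text \<open>A walk that uses the added edge can be restarted at the end of its last use of
  it.\<close>

lemma rtrancl_insert_symmetric_edge:
 assumes "(u, v) \<in> (R \<union> {(a, b), (b, a)})\<^sup>*"
 shows "(u, v) \<in> R\<^sup>* \<or> (a, v) \<in> R\<^sup>* \<or> (b, v) \<in> R\<^sup>*"
 using assms by induction (auto intro: rtrancl_into_rtrancl)

lemma adj_cut:
 assumes "gmap N S t" "t h1 = h2" "h1 ~= h2"
 shows "adj t \<subseteq> adj (transpose h1 h2 \<circ> t) \<union> {(vert h1, vert h2), (vert h2, vert h1)}"
  "adj (transpose h1 h2 \<circ> t) \<subseteq> adj t \<union> Id"
proof -
 have t2: "t h2 = h1" using assms gmap_involution by metis
 show "adj t \<subseteq> adj (transpose h1 h2 \<circ> t) \<union> {(vert h1, vert h2), (vert h2, vert h1)}"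
 proof
  fix p assume "p \<in> adj t"
  then obtain e where e: "p = (vert e, vert (t e))" by (auto simp: adj_def)
  show "p \<in> adj (transpose h1 h2 \<circ> t) \<union> {(vert h1, vert h2), (vert h2, vert h1)}"
  proof (cases "e = h1 \<or> e = h2")
   case False
   then show ?thesis using e adjI[of e "transpose h1 h2 \<circ> t"] by (simp add: cut_apply[OF assms, of e] del: o_apply comp_apply)
  qed (use e assms t2 in auto)
 qed
 show "adj (transpose h1 h2 \<circ> t) \<subseteq> adj t \<union> Id"
 proof
  fix p assume "p \<in> adj (transpose h1 h2 \<circ> t)"
  then obtain e where "p = (vert e, vert ((transpose h1 h2 \<circ> t) e))" unfolding adj_def by blast
  then have "p = (vert e, vert (if e = h1 \<or> e = h2 then e else t e))"
   by (simp only: cut_apply[OF assms])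
  then show "p \<in> adj t \<union> Id"
   using adjI[of e t] by (cases "e = h1 \<or> e = h2") simp_all
 qed
qed

text \<open>Only the endpoints of the removed arc lose an adjacency. If they are still connected,
  every use of the arc in a walk has a detour.\<close>

lemma conn_cut_iff:
 assumes "gmap N S t" "t h1 = h2" "h1 ~= h2" "conn S t"
 shows "conn S (transpose h1 h2 \<circ> t) \<longleftrightarrow> (vert h1, vert h2) \<in> (adj (transpose h1 h2 \<circ> t))\<^sup>*"
proof
 let ?t' = "transpose h1 h2 \<circ> t"
 have "vert h1 \<in> S" "vert h2 \<in> S"
  using assms gmap_moved[OF assms(1), of h1] gmap_ends[OF assms(1), of h1] by (auto simp: ends_def)
 then show "(vert h1, vert h2) \<in> (adj ?t')\<^sup>*" if "conn S ?t'"
  using that by (auto simp: conn_def)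
 assume *: "(vert h1, vert h2) \<in> (adj ?t')\<^sup>*"
 have "sym ((adj ?t')\<^sup>*)" using sym_adj[OF gmap_cut[OF assms(1-3)]] sym_rtrancl by blast
 then have "(vert h2, vert h1) \<in> (adj ?t')\<^sup>*" using * by (meson symD)
 with * adj_cut(1)[OF assms(1-3)] have "adj t \<subseteq> (adj ?t')\<^sup>*" by blast
 then have "(adj t)\<^sup>* \<subseteq> (adj ?t')\<^sup>*" by (rule rtrancl_subset_rtrancl)
 then show "conn S ?t'" using assms(4) unfolding conn_def by (meson subsetD)
qed

lemma conn_glue:
 assumes "gmap N S t" "t h1 = h2" "h1 ~= h2" "conn S (transpose h1 h2 \<circ> t)"
 shows "conn S t"
proof -
 have "(adj (transpose h1 h2 \<circ> t))\<^sup>* \<subseteq> (adj t)\<^sup>*"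
  by (rule rtrancl_subset_rtrancl) (use adj_cut(2)[OF assms(1-3)] in auto)
 then show ?thesis using assms(4) unfolding conn_def by (meson subsetD)
qed

subsection \<open>Disjoint unions\<close>

lemma gmap_restr:
 assumes "gmap N S t" "\<And>e. vert (t e) \<in> S1 \<longleftrightarrow> vert e \<in> S1"
 shows "gmap N (S \<inter> S1) (restr S1 t)"
 using assms unfolding gmap_def restr_def ends_def by auto

lemma restr_connected:
 assumes "\<And>e. vert (t e) \<in> S1 \<longleftrightarrow> vert e \<in> S1" "(a, v) \<in> (adj t)\<^sup>*" "a \<in> S1"
 shows "v \<in> S1 \<and> (a, v) \<in> (adj (restr S1 t))\<^sup>*"
 using assms(2)
proof induction
 case (step y z)
 then obtain e where e: "y = vert e" "z = vert (t e)" by (auto simp: adj_def)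
 then have "z = vert (restr S1 t e)" "z \<in> S1" using step assms(1) by (auto simp: restr_def)
 then show ?case using step e adjI[of e "restr S1 t"] by (metis rtrancl_into_rtrancl)
qed (use assms(3) in simp)

lemma ends_Un: "ends N (S1 \<union> S2) = ends N S1 \<union> ends N S2"
 by (auto simp: ends_def)

text \<open>A vertex set that no arc leaves splits the map into two independent ones. The numbers of
  arcs and faces are additive over the parts, which is what Euler's formula needs.\<close>

context
 fixes N S1 S2 t
 assumes N: "N \<ge> 1" and fin: "finite S1" "finite S2" and disj: "S1 \<inter> S2 = {}"
  and g: "gmap N (S1 \<union> S2) t" and closed: "\<And>e. vert (t e) \<in> S1 \<longleftrightarrow> vert e \<in> S1"
begin

lemma closed2: "vert (t e) \<in> S2 \<longleftrightarrow> vert e \<in> S2"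
proof (cases "t e = e")
 case False
 then have "t e \<in> ends N (S1 \<union> S2)" "e \<in> ends N (S1 \<union> S2)"
  using gmap_moved[OF g False] gmap_ends[OF g] by auto
 then show ?thesis using closed[of e] disj by (auto simp: ends_def)
qed simp

lemma gmap_parts: "gmap N S1 (restr S1 t)" "gmap N S2 (restr S2 t)"
 using gmap_restr[OF g closed] gmap_restr[OF g closed2] by (simp_all add: Int_absorb1 Int_commute)

lemma faces_parts:
 "faces (fp N t) (ends N (S1 \<union> S2)) =
 faces (fp N (restr S1 t)) (ends N S1) \<union> faces (fp N (restr S2 t)) (ends N S2)"
proof -
 have eq: "fp N t e = fp N (restr S1 t) e" if "e \<in> ends N S1" for e
  using that by (simp add: fp_def restr_def ends_def)
 have eq2: "fp N t e = fp N (restr S2 t) e" if "e \<in> ends N S2" for e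
  using that by (simp add: fp_def restr_def ends_def)
 have inj: "inj_on (fp N t) (ends N S1)" "inj_on (fp N t) (ends N S2)"
  using fp_inj_on[OF g] by (auto simp: ends_Un intro: inj_on_subset)
 have img: "fp N t ` ends N S1 \<subseteq> ends N S1" "fp N t ` ends N S2 \<subseteq> ends N S2"
  using fp_ends_image[OF N gmap_parts(1)] fp_ends_image[OF N gmap_parts(2)] eq eq2 by force+
 show ?thesis
  unfolding ends_Un
  using faces_disjoint_Un[OF finite_ends[OF fin(1)] finite_ends[OF fin(2)] inj img]
   faces_cong[OF eq, of "ends N S1"] faces_cong[OF eq2, of "ends N S2"] by simp
qed

lemma faces_parts_disjoint:
 "faces (fp N (restr S1 t)) (ends N S1) \<inter> faces (fp N (restr S2 t)) (ends N S2) = {}"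
proof -
 have d: "ends N S1 \<inter> ends N S2 = {}" using disj by (auto simp: ends_def)
 have False if X: "X \<in> faces (fp N (restr S1 t)) (ends N S1)" "X \<in> faces (fp N (restr S2 t)) (ends N S2)" for X
 proof -
  have "X \<subseteq> ends N S1" "X \<subseteq> ends N S2" using X by (auto simp: faces_def)
  then show False using d faces_nonempty[OF X(1)] by blast
 qed
 then show ?thesis by blast
qed

lemma card_faces_parts:
 "card (faces (fp N t) (ends N (S1 \<union> S2))) =
 card (faces (fp N (restr S1 t)) (ends N S1)) + card (faces (fp N (restr S2 t)) (ends N S2))"
 unfolding faces_parts using faces_parts_disjoint fin by (simp add: card_Un_disjoint finite_faces)

lemma card_arcs_parts: "card (arcs_of t) = card (arcs_of (restr S1 t)) + card (arcs_of (restr S2 t))"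
proof -
 have "arcs_of t = arcs_of (restr S1 t) \<union> arcs_of (restr S2 t)"
  using gmap_moved[OF g] by (auto simp: arcs_of_def restr_def ends_def)
 moreover have "arcs_of (restr S1 t) \<inter> arcs_of (restr S2 t) = {}"
  using disj by (auto simp: arcs_of_def restr_def)
 ultimately show ?thesis
  using finite_arcs_of[OF gmap_parts(1)] finite_arcs_of[OF gmap_parts(2)] fin
  by (simp add: card_Un_disjoint)
qed

lemma bnd_parts: "bnd N (S1 \<union> S2) t = bnd N S1 (restr S1 t) \<union> bnd N S2 (restr S2 t)"
 by (auto simp: bnd_def ends_def restr_def)

lemma joinm_parts: "joinm S1 (restr S1 t) (restr S2 t) = t"
proof
 fix e
 show "joinm S1 (restr S1 t) (restr S2 t) e = t e"
  using gmap_moved[OF g, of e] by (cases "t e = e") (auto simp: joinm_def restr_def ends_def)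
qed

end

lemma joinm:
 assumes "gmap N S1 t1" "gmap N S2 t2" "S1 \<inter> S2 = {}"
 shows "gmap N (S1 \<union> S2) (joinm S1 t1 t2)"
  "vert (joinm S1 t1 t2 e) \<in> S1 \<longleftrightarrow> vert e \<in> S1"
  "restr S1 (joinm S1 t1 t2) = t1" "restr S2 (joinm S1 t1 t2) = t2"
proof -
 have 1: "vert (t1 e) \<in> S1 \<longleftrightarrow> vert e \<in> S1" for e
  using gmap_moved[OF assms(1), of e] gmap_ends[OF assms(1), of e]
  by (cases "t1 e = e") (auto simp: ends_def)
 have 2: "vert (t2 e) \<in> S1 \<longleftrightarrow> vert e \<in> S1" for e
  using gmap_moved[OF assms(2), of e] gmap_ends[OF assms(2), of e] assms(3)
  by (cases "t2 e = e") (auto simp: ends_def)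
 show "vert (joinm S1 t1 t2 e) \<in> S1 \<longleftrightarrow> vert e \<in> S1"
  using 1 2 by (simp add: joinm_def)
 show "gmap N (S1 \<union> S2) (joinm S1 t1 t2)"
  unfolding gmap_def joinm_def ends_Un
  using 1 2 gmap_moved[OF assms(1)] gmap_moved[OF assms(2)] assms(1,2) by simp
 show "restr S1 (joinm S1 t1 t2) = t1"
  using gmap_moved[OF assms(1)] by (force simp: fun_eq_iff restr_def joinm_def ends_def)
 show "restr S2 (joinm S1 t1 t2) = t2"
  using gmap_moved[OF assms(2)] assms(3) by (force simp: fun_eq_iff restr_def joinm_def ends_def)
qed

lemma conn_Un_glue:
 assumes "gmap N S t" "t h1 = h2" "h1 ~= h2" "S = S1 \<union> S2" "vert h1 \<in> S1" "vert h2 \<in> S2"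
  "conn S1 (restr S1 (transpose h1 h2 \<circ> t))" "conn S2 (restr S2 (transpose h1 h2 \<circ> t))"
 shows "conn S t"
proof -
 let ?t' = "transpose h1 h2 \<circ> t"
 have "adj (restr A ?t') \<subseteq> adj ?t' \<union> Id" for A
  unfolding adj_def restr_def by auto
 then have "adj (restr A ?t') \<subseteq> (adj t)\<^sup>*" for A
  using adj_cut(2)[OF assms(1-3)] by fastforce
 then have sub: "(adj (restr A ?t'))\<^sup>* \<subseteq> (adj t)\<^sup>*" for A
  by (rule rtrancl_subset_rtrancl)
 have e: "(vert h1, vert h2) \<in> (adj t)\<^sup>*" using adjI[of h1 t] assms(2) by auto
 have s: "sym ((adj t)\<^sup>*)" using sym_adj[OF assms(1)] sym_rtrancl by blast
 have "(v, vert h1) \<in> (adj t)\<^sup>*" if v: "v \<in> S" for v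
 proof -
  consider "v \<in> S1" | "v \<in> S2" using v assms(4) by blast
  then show ?thesis
  proof cases
   case 1 then show ?thesis using assms(5,7) sub[of S1] unfolding conn_def by (meson subsetD)
  next
   case 2 then have "(v, vert h2) \<in> (adj t)\<^sup>*" using assms(6,8) sub[of S2] unfolding conn_def by (meson subsetD)
   then show ?thesis using e s by (meson rtrancl_trans symD)
  qed
 qed
 then show ?thesis using s unfolding conn_def by (meson rtrancl_trans symD)
qed

text \<open>One side is what \<open>h1\<close> still reaches. A walk of the old graph from
  \<open>h1\<close> to a vertex beyond that side must use the arc, and after its last use it starts
  from \<open>h2\<close>; hence the other side is connected as well.\<close>

lemma cut_components:
 assumes "gmap N S t" "t h1 = h2" "h1 ~= h2" "conn S t" "\<not> conn S (transpose h1 h2 \<circ> t)"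
 defines "t' \<equiv> transpose h1 h2 \<circ> t"
 defines "S1 \<equiv> {v \<in> S. (vert h1, v) \<in> (adj t')\<^sup>*}"
 shows "vert h1 \<in> S1" "vert h2 \<in> S - S1" "\<And>e. vert (t' e) \<in> S1 \<longleftrightarrow> vert e \<in> S1"
  "conn S1 (restr S1 t')" "conn (S - S1) (restr (S - S1) t')"
proof -
 have g': "gmap N S t'" unfolding t'_def by (rule gmap_cut[OF assms(1-3)])
 have hS: "vert h1 \<in> S" "vert h2 \<in> S"
  using assms(2,3) gmap_moved[OF assms(1), of h1] gmap_ends[OF assms(1), of h1] by (auto simp: ends_def)
 have s: "sym ((adj t')\<^sup>*)" using sym_adj[OF g'] sym_rtrancl by blast
 have no: "(vert h1, vert h2) \<notin> (adj t')\<^sup>*"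
  using conn_cut_iff[OF assms(1-4)] assms(5) by (simp add: t'_def)
 show h1: "vert h1 \<in> S1" using hS by (simp add: S1_def)
 show h2: "vert h2 \<in> S - S1" using hS no by (simp add: S1_def)
 have inS: "vert (t' e) \<in> S \<longleftrightarrow> vert e \<in> S" for e
  using gmap_moved[OF g', of e] gmap_ends[OF g', of e] by (cases "t' e = e") (auto simp: ends_def)
 show closed: "vert (t' e) \<in> S1 \<longleftrightarrow> vert e \<in> S1" for e
 proof -
  have 1: "(vert e, vert (t' e)) \<in> (adj t')\<^sup>*" using adjI[of e t'] by blast
  then have 2: "(vert (t' e), vert e) \<in> (adj t')\<^sup>*" using s by (meson symD)
  show ?thesis
   unfolding S1_def using inS[of e] rtrancl_trans[OF _ 1] rtrancl_trans[OF _ 2] by blast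
 qed
 have closed2: "vert (t' e) \<in> S - S1 \<longleftrightarrow> vert e \<in> S - S1" for e
  using closed inS by blast
 have conn_from: "conn A (restr A t')"
  if "gmap N A (restr A t')" "a \<in> A" "\<And>v. v \<in> A ==> (a, v) \<in> (adj t')\<^sup>*"
   "\<And>e. vert (t' e) \<in> A \<longleftrightarrow> vert e \<in> A" for A a
 proof -
  have "(a, v) \<in> (adj (restr A t'))\<^sup>*" if "v \<in> A" for v
   using restr_connected[OF \<open>\<And>e. vert (t' e) \<in> A \<longleftrightarrow> vert e \<in> A\<close>] that \<open>a \<in> A\<close> \<open>\<And>v. v \<in> A ==> (a, v) \<in> (adj t')\<^sup>*\<close> by blast
  moreover have "sym ((adj (restr A t'))\<^sup>*)" using sym_adj[OF that(1)] sym_rtrancl by blast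
  ultimately show ?thesis unfolding conn_def by (meson rtrancl_trans symD)
 qed
 have "S \<inter> S1 = S1" "S \<inter> (S - S1) = S - S1" by (auto simp: S1_def)
 then have gm: "gmap N S1 (restr S1 t')" "gmap N (S - S1) (restr (S - S1) t')"
  using gmap_restr[OF g' closed] gmap_restr[OF g' closed2] by simp_all
 show "conn S1 (restr S1 t')"
  by (rule conn_from[OF gm(1) h1 _ closed]) (simp add: S1_def)
 have "(vert h2, v) \<in> (adj t')\<^sup>*" if "v \<in> S - S1" for v
 proof -
  have "(vert h1, v) \<in> (adj t)\<^sup>*" using assms(4) hS that by (simp add: conn_def)
  then have "(vert h1, v) \<in> (adj t' \<union> {(vert h1, vert h2), (vert h2, vert h1)})\<^sup>*"
   using rtrancl_mono[OF adj_cut(1)[OF assms(1-3)]] unfolding t'_def by blast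
  then show ?thesis
   using rtrancl_insert_symmetric_edge[of "vert h1" v "adj t'"] that by (auto simp: S1_def)
 qed
 then show "conn (S - S1) (restr (S - S1) t')"
  by (rule conn_from[OF gm(2) h2 _ closed2])
qed

section \<open>The genus inequality\<close>

lemma adj_Id_imp:
 assumes "adj t \<subseteq> Id" "(u, v) \<in> (adj t)\<^sup>*"
 shows "u = v"
 using assms(2) by induction (use assms(1) in auto)

text \<open>Without arcs the face permutation only turns around a vertex and runs through all
  colors, so each face contains an end \<open>In v 1\<close>, and there is at most one candidate for
  \<open>v\<close>.\<close>

lemma single_vertex_faces:
 assumes "N \<ge> 1" "finite S" "\<And>e. t e = e" "\<And>u v. u \<in> S ==> v \<in> S ==> u = v"
 shows "card (faces (fp N t) (ends N S)) \<le> 1"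
proof -
 have step: "sg N e \<in> X" if "X \<in> faces (fp N t) (ends N S)" "e \<in> X" for e X
  using face_closed[OF that] assms(3) by (simp add: fp_def)
 have base: "In v 1 \<in> X" if X: "X \<in> faces (fp N t) (ends N S)" and i: "In v i \<in> X" "i \<in> {1..N}" for v i X
 proof -
  have "In v N \<in> X"
   using i
  proof (induction "N - i" arbitrary: i)
   case (Suc d)
   then have "cyc_suc N i = i + 1" using cyc_suc_eq[of i N] by auto
   then have "In v (i + 1) \<in> X"
    using step[OF X step[OF X Suc.prems(1)]] by simp
   then show ?case using Suc.hyps(1)[of "i + 1"] Suc.hyps(2) Suc.prems(2) by simp
  qed simp
  moreover have "cyc_suc N N = 1" using cyc_suc_eq[of N N] assms(1) by simp
  ultimately show ?thesis using step[OF X step[OF X, of "In v N"]] by simp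
 qed
 have ex: "\<exists>v\<in>S. In v 1 \<in> X" if X: "X \<in> faces (fp N t) (ends N S)" for X
 proof -
  have "X \<subseteq> ends N S" using X by (auto simp: faces_def)
  then obtain e where e: "e \<in> X" "e \<in> ends N S" using faces_nonempty[OF X] by blast
  show ?thesis
  proof (cases e)
   case (In v i)
   then show ?thesis using base[OF X, of v i] e by (auto simp: ends_def)
  next
   case (Out v i)
   have "In v (cyc_suc N i) \<in> X" using step[OF X e(1)] Out by simp
   then show ?thesis using base[OF X] cyc_suc_range[OF assms(1)] e Out by (auto simp: ends_def)
  qed
 qed
 have eq: "X = Y" if XY: "X \<in> faces (fp N t) (ends N S)" "Y \<in> faces (fp N t) (ends N S)" for X Y
 proof -
  obtain u v where uv: "u \<in> S" "v \<in> S" "In u 1 \<in> X" "In v 1 \<in> Y" using ex[OF XY(1)] ex[OF XY(2)] by blast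
  then have "In u 1 \<in> Y" using assms(4)[of u v] by simp
  then show ?thesis using faces_disjoint[OF XY uv(3)] by blast
 qed
 have "finite (faces (fp N t) (ends N S))" using assms(2) by (simp add: finite_faces)
 then show ?thesis using card_le_Suc0_iff_eq eq by (metis One_nat_def)
qed

text \<open>Induction over the removal of an arc. If the graph stays connected, restoring the arc
  adds at most one face, which the arc pays for. If it falls apart, the two ends lie in different
  faces afterwards, since faces are connected; so the original graph has one face less and one arc
  more, which turns the constant 4 of the two parts into 2.\<close>

theorem genus_inequality:
 assumes "N \<ge> 1" "finite S" "S ~= {}" "gmap N S t" "conn S t"
 shows "card S + card (faces (fp N t) (ends N S)) \<le> card (arcs_of t) + 2"
 using assms(2-)
proof (induction "card (arcs_of t)" arbitrary: S t rule: less_induct)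
 case less
 note finS = less.prems(1) and g = less.prems(3) and c = less.prems(4)
 show ?case
 proof (cases "arcs_of t = {}")
  case True
  have t: "t e = e" for e
  proof (rule ccontr)
   assume ne: "t e ~= e"
   then have "fst (ety (t e)) = (\<not> fst (ety e))" using gmap_moved[OF g ne] by simp
   moreover have "t (t e) ~= t e" using ne gmap_involution[OF g, of e] by simp
   ultimately show False using True ne by (auto simp: arcs_of_def)
  qed
  then have "adj t \<subseteq> Id" by (auto simp: adj_def)
  then have uv: "u = v" if "u \<in> S" "v \<in> S" for u v
   using c that adj_Id_imp[of t u v] by (simp add: conn_def)
  then have "card S \<le> 1" using finS card_le_Suc0_iff_eq by (metis One_nat_def)
  then show ?thesis using single_vertex_faces[OF assms(1) finS t uv] by simp
 next
  case False
  then obtain h1 where h1: "t h1 ~= h1" by (auto simp: arcs_of_def)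
  define h2 where "h2 = t h1"
  define t' where "t' = transpose h1 h2 \<circ> t"
  have h: "t h1 = h2" "h1 ~= h2" using h1 by (simp_all add: h2_def)
  have g': "gmap N S t'" unfolding t'_def by (rule gmap_cut[OF g h])
  have arcs: "card (arcs_of t) = card (arcs_of t') + 1"
   unfolding t'_def by (rule card_arcs_cut[OF g h finS])
  have hE: "h1 \<in> ends N S" "h2 \<in> ends N S"
   using gmap_moved[OF g h1] gmap_ends[OF g, of h1] h by simp_all
  note perm = finite_ends[OF finS] fp_inj_on[OF g'] fp_ends_image[OF assms(1) g'] hE h(2)
  have undo: "transpose h1 h2 \<circ> fp N t' = fp N t"
   unfolding fp_transpose t'_def by (auto simp: fp_def fun_eq_iff)
  have dich: "card (faces (fp N t) (ends N S)) \<le> card (faces (fp N t') (ends N S)) + 1"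
   using card_faces_transpose[OF perm] unfolding undo by (simp split: if_splits)
  show ?thesis
  proof (cases "conn S t'")
   case True
   then have "card S + card (faces (fp N t') (ends N S)) \<le> card (arcs_of t') + 2"
    using less.hyps[OF _ finS less.prems(2) g'] arcs by simp
   then show ?thesis using dich arcs by simp
  next
   case False
   define S1 where "S1 = {v \<in> S. (vert h1, v) \<in> (adj t')\<^sup>*}"
   define S2 where "S2 = S - S1"
   note comp = cut_components[OF g h c False[unfolded t'_def], folded t'_def, folded S1_def, folded S2_def]
   have S: "S = S1 \<union> S2" "S1 \<inter> S2 = {}" by (auto simp: S1_def S2_def)
   have fin: "finite S1" "finite S2" using finS S by auto
   note parts = assms(1) fin S(2) g'[unfolded S(1)] comp(3)
   note gp = gmap_parts[OF parts]
   have ne: "S1 ~= {}" "S2 ~= {}" using comp(1,2) by auto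
   have arcs2: "card (arcs_of t') = card (arcs_of (restr S1 t')) + card (arcs_of (restr S2 t'))"
    by (rule card_arcs_parts[OF parts])
   have i1: "card S1 + card (faces (fp N (restr S1 t')) (ends N S1)) \<le> card (arcs_of (restr S1 t')) + 2"
    using less.hyps[OF _ fin(1) ne(1) gp(1) comp(4)] arcs arcs2 by simp
   have i2: "card S2 + card (faces (fp N (restr S2 t')) (ends N S2)) \<le> card (arcs_of (restr S2 t')) + 2"
    using less.hyps[OF _ fin(2) ne(2) gp(2) comp(5)] arcs arcs2 by simp
   have f: "card (faces (fp N t') (ends N S)) =
    card (faces (fp N (restr S1 t')) (ends N S1)) + card (faces (fp N (restr S2 t')) (ends N S2))"
    unfolding S(1) by (rule card_faces_parts[OF parts])
   have cS: "card S = card S1 + card S2" using S fin by (simp add: card_Un_disjoint)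
   have "\<not> (\<exists>X\<in>faces (fp N t') (ends N S). h1 \<in> X \<and> h2 \<in> X)"
   proof
    assume "\<exists>X\<in>faces (fp N t') (ends N S). h1 \<in> X \<and> h2 \<in> X"
    then obtain xs where "cyc (fp N t') xs" "h1 \<in> set xs" "h2 \<in> set xs" by (auto simp: faces_def)
    then have "(vert h1, vert h2) \<in> (adj t')\<^sup>*" by (rule face_connected)
    then show False using comp(2) by (auto simp: S1_def S2_def)
   qed
   then have "card (faces (fp N t') (ends N S)) = card (faces (fp N t) (ends N S)) + 1"
    using card_faces_transpose[OF perm] unfolding undo by simp
   then show ?thesis using i1 i2 f cS arcs arcs2 by linarith
  qed
 qed
qed

section \<open>Weights of inner faces\<close>

text \<open>A face is the set of ends that precede its corners: a single \<open>In\<close> end for a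
  petal, and one \<open>Out\<close> end of every color for an internal cycle.\<close>

definition face_wt :: "nat => edge_end set => nat => bool" where
 "face_wt N X k \<longleftrightarrow> k \<in> {1..N} \<and> (\<exists>v. X = {In v k}) \<or>
  k = N + 1 \<and> (\<exists>f. X = (\<lambda>i. Out (f i) i) ` {1..N})"

text \<open>A witness assigns an index to each face, instead of counting the faces index by index.
  The condition then includes that every face is admissible, and it is additive over disjoint sets
  of faces.\<close>

definition weighted :: "nat => nat multiset => edge_end set set => bool" where
 "weighted N w F \<longleftrightarrow> (\<exists>g. (\<forall>X\<in>F. face_wt N X (g X)) \<and> w = image_mset g (mset_set F))"

lemma face_wt_unique:
 assumes "N \<ge> 1" "face_wt N X k" "face_wt N X k'"
 shows "k = k'"
proof -
 have "k = (if \<exists>v i. Out v i \<in> X then N + 1 else k) \<and> (k \<le> N \<longrightarrow> (\<exists>v. X = {In v k}))"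
  if "face_wt N X k" for k
  using that assms(1) unfolding face_wt_def by fastforce
 from this[OF assms(2)] this[OF assms(3)] show ?thesis
  using assms(2,3) unfolding face_wt_def by (auto split: if_splits)
qed

lemma weighted_unique:
 assumes "N \<ge> 1" "finite F" "weighted N w F" "weighted N w' F"
 shows "w = w'"
proof -
 obtain g g' where g: "\<forall>X\<in>F. face_wt N X (g X)" "w = image_mset g (mset_set F)"
  "\<forall>X\<in>F. face_wt N X (g' X)" "w' = image_mset g' (mset_set F)"
  using assms(3,4) unfolding weighted_def by blast
 then have "\<forall>X\<in>F. g X = g' X" using face_wt_unique[OF assms(1)] by blast
 then show ?thesis using g assms(2) by (auto intro!: image_mset_cong)
qed

lemma weighted_Un:
 assumes "finite F1" "finite F2" "F1 \<inter> F2 = {}"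
 shows "weighted N w (F1 \<union> F2) \<longleftrightarrow> (\<exists>w1 w2. w = w1 + w2 \<and> weighted N w1 F1 \<and> weighted N w2 F2)"
proof
 assume "weighted N w (F1 \<union> F2)"
 then obtain g where "\<forall>X\<in>F1 \<union> F2. face_wt N X (g X)" "w = image_mset g (mset_set (F1 \<union> F2))"
  unfolding weighted_def by blast
 moreover from this have "w = image_mset g (mset_set F1) + image_mset g (mset_set F2)"
  using assms by (simp add: mset_set_Union)
 ultimately show "\<exists>w1 w2. w = w1 + w2 \<and> weighted N w1 F1 \<and> weighted N w2 F2"
  unfolding weighted_def by blast
next
 assume "\<exists>w1 w2. w = w1 + w2 \<and> weighted N w1 F1 \<and> weighted N w2 F2"
 then obtain g1 g2 where g: "\<forall>X\<in>F1. face_wt N X (g1 X)" "\<forall>X\<in>F2. face_wt N X (g2 X)"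
  "w = image_mset g1 (mset_set F1) + image_mset g2 (mset_set F2)"
  unfolding weighted_def by blast
 let ?g = "\<lambda>X. if X \<in> F1 then g1 X else g2 X"
 have "image_mset g1 (mset_set F1) = image_mset ?g (mset_set F1)"
  using assms by (auto intro!: image_mset_cong)
 moreover have "image_mset g2 (mset_set F2) = image_mset ?g (mset_set F2)"
  using assms by (auto intro!: image_mset_cong)
 ultimately have "w = image_mset ?g (mset_set (F1 \<union> F2))"
  using g(3) assms by (simp add: mset_set_Union)
 moreover have "\<forall>X\<in>F1 \<union> F2. face_wt N X (?g X)" using g by auto
 ultimately show "weighted N w (F1 \<union> F2)" unfolding weighted_def by (intro exI[of _ ?g] conjI)
qed

lemma weighted_single: "weighted N w {X} \<longleftrightarrow> (\<exists>k. w = {#k#} \<and> face_wt N X k)"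
 unfolding weighted_def by auto

lemma weighted_insert:
 assumes "finite F" "X \<notin> F"
 shows "weighted N w (insert X F) \<longleftrightarrow> (\<exists>k w'. face_wt N X k \<and> w = add_mset k w' \<and> weighted N w' F)"
proof -
 have "weighted N w (insert X F) \<longleftrightarrow> (\<exists>w1 w2. w = w1 + w2 \<and> (\<exists>k. w1 = {#k#} \<and> face_wt N X k) \<and> weighted N w2 F)"
  using weighted_Un[of "{X}" F N w] assms by (simp add: weighted_single)
 also have "\<dots> \<longleftrightarrow> (\<exists>k w'. face_wt N X k \<and> w = {#k#} + w' \<and> weighted N w' F)" by blast
 finally show ?thesis by simp
qed

section \<open>Reading the boundary\<close>

text \<open>The letter that continues a word: turn to the next end and pass to the end glued to it,
  whose type is opposite. Hence \<open>U\<^sub>i\<close> is followed by \<open>U\<^sub>i\<close> and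
  \<open>s\<^sub>i\<close> by \<open>s\<^sub>i\<^sub>+\<^sub>1\<close>, as in the nonzero products.
  A \<open>chain\<close> is a word built in this way.\<close>

definition lk :: "nat => letter => letter" where
 "lk N l = flip (nxt N l)"

definition chain :: "nat => letter list => bool" where
 "chain N ls \<longleftrightarrow> successively (\<lambda>x y. y = lk N x) ls"

definition spath :: "nat => nat => nat => letter list" where
 "spath N i m = map (\<lambda>j. (True, (cyc_suc N ^^ j) i)) [0..<m]"

text \<open>The words of the terms of \<open>\<mu>\<^sub>0\<close> of weight
  \<open>\<epsilon>\<^sub>k\<close>: the letter \<open>U\<^sub>k\<close>, or the closed paths
  \<open>s\<^sub>i\<^sub>i\<close> for all starting points.\<close>

definition kap :: "nat => nat => letter list set" where
 "kap N k = (if k \<in> {1..N} then {[(False, k)]} else if k = N + 1 then (\<lambda>i. spath N i N) ` {1..N} else {})"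

text \<open>One orbit passes through all boundary ends, which expresses that there is a single
  boundary circle. It is cut in front of each of these ends, and a block lists the corners of one
  region by the ends that precede them.\<close>

definition reading :: "nat => nat set => (edge_end => edge_end) => edge_end list list => bool" where
 "reading N S t dss \<longleftrightarrow> dss ~= [] \<and> (\<forall>ds\<in>set dss. ds ~= []) \<and> cyc (fp N t) (concat dss) \<and>
  set (map hd dss) = bnd N S t"

lemma lk_simps [simp]: "lk N (False, i) = (False, i)" "lk N (True, i) = (True, cyc_suc N i)"
 by (simp_all add: lk_def)

lemma fst_lk [simp]: "fst (lk N l) = fst l"
 by (simp add: lk_def)

lemma lk_nth: "chain N ls ==> k < length ls ==> ls ! k = (lk N ^^ k) (hd ls)"
 unfolding chain_def by (rule successively_nth_funpow)

lemma chain_unique: "chain N ls ==> chain N ls' ==> hd ls = hd ls' ==> length ls = length ls' ==> ls = ls'"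
 by (rule nth_equalityI) (simp_all add: lk_nth)

lemma fst_lk_funpow [simp]: "fst ((lk N ^^ k) l) = fst l"
 by (induction k) auto

lemma lk_funpow_False [simp]: "(lk N ^^ k) (False, i) = (False, i)"
 by (induction k) auto

lemma chain_fst: "chain N ls ==> l \<in> set ls ==> fst l = fst (hd ls)"
 by (auto simp: in_set_conv_nth lk_nth)

lemma length_spath [simp]: "length (spath N i m) = m"
 by (simp add: spath_def)

lemma chain_spath: "chain N (spath N i m)"
 unfolding chain_def spath_def successively_conv_nth by (simp del: upt_Suc)

lemma hd_spath: "m \<ge> 1 ==> hd (spath N i m) = (True, i)"
 by (simp add: spath_def hd_map)

lemma cyc_suc_funpow: "i \<in> {1..N} ==> (cyc_suc N ^^ j) i = (i - 1 + j) mod N + 1"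
proof (induction j)
 case 0
 then have "(i - 1) mod N = i - 1" by (intro mod_less) auto
 with 0 show ?case by simp
next
 case (Suc j)
 then show ?case by (simp add: cyc_suc_def mod_Suc_eq)
qed

lemma bij_cyc_suc_funpow:
 assumes "i \<in> {1..N}"
 shows "bij_betw (\<lambda>j. (cyc_suc N ^^ j) i) {..<N} {1..N}"
proof -
 have N: "N \<ge> 1" using assms by simp
 have inj: "inj_on (\<lambda>j. (cyc_suc N ^^ j) i) {..<N}"
 proof (rule linorder_inj_onI)
  fix a b assume *: "a < b" "a \<in> {..<N}" "b \<in> {..<N}"
  have "((i - 1) + a) mod N ~= ((i - 1) + b) mod N"
  proof
   assume "((i - 1) + a) mod N = ((i - 1) + b) mod N"
   then have "N dvd b - a" using * mod_eq_dvd_iff_nat[of "i - 1 + a" "i - 1 + b" N] by simp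
   then show False using * dvd_imp_le[of N "b - a"] by auto
  qed
  then show "(cyc_suc N ^^ a) i ~= (cyc_suc N ^^ b) i" by (simp add: cyc_suc_funpow[OF assms])
 qed auto
 have "(\<lambda>j. (cyc_suc N ^^ j) i) ` {..<N} \<subseteq> {1..N}"
  using N by (auto simp: cyc_suc_funpow[OF assms] Suc_leI)
 then have "(\<lambda>j. (cyc_suc N ^^ j) i) ` {..<N} = {1..N}"
  by (rule card_subset_eq[rotated]) (simp_all add: card_image[OF inj])
 then show ?thesis using inj by (simp add: bij_betw_def)
qed

lemma kap_face_wt:
 assumes "map ety zs \<in> kap N k"
 shows "face_wt N (set zs) k"
proof (cases "k \<in> {1..N}")
 case True
 then have "map ety zs = [(False, k)]" using assms by (simp add: kap_def)
 then obtain e where "zs = [e]" "ety e = (False, k)" by auto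
 then show ?thesis using True by (cases e) (auto simp: face_wt_def)
next
 case False
 then obtain i where k: "k = N + 1" and i: "i \<in> {1..N}" and z: "map ety zs = spath N i N"
  using assms by (auto simp: kap_def split: if_splits)
 have len: "length zs = N" using z by (metis length_map length_spath)
 have nth: "ety (zs ! j) = (True, (cyc_suc N ^^ j) i)" if "j < N" for j
  using arg_cong[OF z, of "\<lambda>l. l ! j"] that len by (simp add: spath_def)
 note bij = bij_cyc_suc_funpow[OF i]
 \<comment> \<open>\<open>J\<close> returns the position of a color on the path, so that the set of
   ends can be indexed by colors.\<close>
 define J where "J = the_inv_into {..<N} (\<lambda>j. (cyc_suc N ^^ j) i)"
 have J: "J ((cyc_suc N ^^ j) i) = j" if "j < N" for j
  unfolding J_def using that bij by (intro the_inv_into_f_f) (auto simp: bij_betw_def)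
 have out: "zs ! j = Out (vert (zs ! j)) ((cyc_suc N ^^ j) i)" if "j < N" for j
  using nth[OF that] by (cases "zs ! j") auto
 have "set zs = (\<lambda>j. zs ! j) ` {..<N}" using len by (auto simp: set_conv_nth)
 also have "\<dots> = (\<lambda>j. Out (vert (zs ! J ((cyc_suc N ^^ j) i))) ((cyc_suc N ^^ j) i)) ` {..<N}"
  using out J by (intro image_cong) auto
 also have "\<dots> = (\<lambda>c. Out (vert (zs ! J c)) c) ` ((\<lambda>j. (cyc_suc N ^^ j) i) ` {..<N})"
  by (simp add: image_image)
 also have "(\<lambda>j. (cyc_suc N ^^ j) i) ` {..<N} = {1..N}" using bij by (simp add: bij_betw_def)
 finally show ?thesis using k unfolding face_wt_def by (auto intro!: exI[of _ "\<lambda>c. vert (zs ! J c)"])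
qed

text \<open>The face is given as a set only, but its word is a chain, and a chain is determined by
  its first letter and its length. The set gives the length and the kind of the first
  letter.\<close>

lemma face_wt_kap:
 assumes "face_wt N (set zs) k" "distinct zs" "chain N (map ety zs)" "N \<ge> 1"
 shows "map ety zs \<in> kap N k"
proof -
 consider v where "k \<in> {1..N}" "set zs = {In v k}" | f where "k = N + 1" "set zs = (\<lambda>i. Out (f i) i) ` {1..N}"
  using assms(1) unfolding face_wt_def by blast
 then show ?thesis
 proof cases
  case 1
  then have "length zs = 1" using distinct_card[OF assms(2)] by simp
  then obtain e where "zs = [e]" by (cases zs) auto
  then show ?thesis using 1 by (simp add: kap_def)
 next
  case 2
  have "inj_on (\<lambda>i. Out (f i) i) {1..N}" by (auto simp: inj_on_def)
  then have len: "length zs = N" using distinct_card[OF assms(2)] 2 by (simp add: card_image)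
  then have "hd zs \<in> set zs" using assms(4) by (cases zs) auto
  then obtain i where i: "i \<in> {1..N}" "hd zs = Out (f i) i" using 2(2) by auto
  have "map ety zs = spath N i N"
  proof (rule chain_unique[OF assms(3) chain_spath])
   have "zs ~= []" using len assms(4) by auto
   then show "hd (map ety zs) = hd (spath N i N)" using i assms(4) by (simp add: hd_spath hd_map)
  qed (simp add: len)
  then show ?thesis using 2 i by (auto simp: kap_def)
 qed
qed

text \<open>The last property allows a region with the word \<kappa> to be closed to an inner face:
  its first letter continues its last one.\<close>

lemma kap_closed:
 assumes "\<kappa> \<in> kap N k"
 shows "\<kappa> ~= []" "chain N \<kappa>" "lk N (last \<kappa>) = hd \<kappa>"
proof -
 consider "\<kappa> = [(False, k)]" | i where "i \<in> {1..N}" "\<kappa> = spath N i N"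
  using assms by (auto simp: kap_def split: if_splits)
 then have "\<kappa> ~= [] \<and> chain N \<kappa> \<and> lk N (last \<kappa>) = hd \<kappa>"
 proof cases
  case 2
  then have N: "N \<ge> 1" by simp
  then have ne: "\<kappa> ~= []" using 2 by (metis length_spath list.size(3) not_one_le_zero)
  have "last \<kappa> = (True, (cyc_suc N ^^ (N - 1)) i)"
   using 2 N ne by (simp add: last_conv_nth spath_def)
  then have "lk N (last \<kappa>) = (True, (cyc_suc N ^^ N) i)"
   using N by (cases N) simp_all
  also have "(cyc_suc N ^^ N) i = i" using cyc_suc_funpow[OF 2(1), of N] cyc_suc_funpow[OF 2(1), of 0] by simp
  finally show ?thesis using ne 2 N by (simp add: hd_spath chain_spath)
 qed (simp add: chain_def)
 then show "\<kappa> ~= []" "chain N \<kappa>" "lk N (last \<kappa>) = hd \<kappa>" by auto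
qed

lemma kap_index:
 assumes "\<kappa> \<in> kap N k"
 shows "k = (if fst (hd \<kappa>) then N + 1 else snd (hd \<kappa>))"
proof -
 consider "\<kappa> = [(False, k)]" | i where "i \<in> {1..N}" "\<kappa> = spath N i N" "k = N + 1"
  using assms by (auto simp: kap_def split: if_splits)
 then show ?thesis
 proof cases
  case 2
  then have "hd \<kappa> = (True, i)" by (simp add: hd_spath)
  then show ?thesis using 2 by simp
 qed simp
qed

context
 fixes N S t dss
 assumes N: "N \<ge> 1" and fin: "finite S" and g: "gmap N S t" and rd: "reading N S t dss"
begin

text \<open>The orbit starts at a boundary end, hence in \<open>ends N S\<close>, and the face
  permutation preserves this set.\<close>

lemma reading_subset: "set (concat dss) \<subseteq> ends N S"
proof -
 obtain ds dss' where dss: "dss = ds # dss'" using rd by (cases dss) (auto simp: reading_def)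
 have ne: "ds ~= []" using rd dss by (auto simp: reading_def)
 have "hd ds \<in> bnd N S t" using rd dss by (auto simp: reading_def)
 then have "hd ds \<in> ends N S" by (simp add: bnd_def)
 then obtain xs where xs: "cyc (fp N t) xs" "hd xs = hd ds" "set xs \<subseteq> ends N S"
  using cyc_exists[OF finite_ends[OF fin] fp_inj_on[OF g] fp_ends_image[OF N g]] by blast
 have "xs = concat dss" using cyc_unique[OF xs(1)] rd xs(2) dss ne by (simp add: reading_def)
 then show ?thesis using xs by simp
qed

lemma reading_facesI: "set (concat dss) \<in> faces (fp N t) (ends N S)"
 using reading_subset rd facesI unfolding reading_def by metis

text \<open>Every boundary end is the head of some block, and the entries of all blocks are
  distinct, so none can occur further inside.\<close>

lemma reading_not_head:
 assumes "ds \<in> set dss" "y \<in> set (tl ds)"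
 shows "y \<notin> bnd N S t"
proof
 assume "y \<in> bnd N S t"
 then obtain ds' where ds': "ds' \<in> set dss" "y = hd ds'" using rd unfolding reading_def by auto
 have d: "distinct (concat dss)" using rd by (auto simp: reading_def cyc_def)
 have ne: "ds' ~= []" "ds ~= []" using rd ds' assms by (auto simp: reading_def)
 have y: "y \<in> set ds'" "y \<in> set ds" using ds' ne assms by (auto dest: list.set_sel(2))
 have "ds' = ds" using d y ds'(1) assms(1) unfolding distinct_concat_iff by blast
 moreover have "distinct ds" using d assms(1) unfolding distinct_concat_iff by blast
 ultimately show False using ds' assms(2) ne by (cases ds) auto
qed

lemma step_inner:
 assumes "y = fp N t x" "y \<in> ends N S" "y \<notin> bnd N S t"
 shows "ety y = lk N (ety x)"
proof -
 have "t y ~= y" using assms by (simp add: bnd_def)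
 then have "t (sg N x) ~= sg N x" using assms(1) g by (metis comp_apply fp_def gmap_involution)
 from gmap_moved[OF g this] show ?thesis using assms(1) by (simp add: fp_def lk_def)
qed

text \<open>A boundary end is fixed by the involution, so the step only turns around the vertex and
  the type of the letter changes. Inside a block the step also crosses an arc, which restores the
  type. Thus successive blocks alternate between powers of \<open>U\<^sub>i\<close> and
  paths.\<close>

lemma step_head:
 assumes "y = fp N t x" "y \<in> bnd N S t"
 shows "ety y = nxt N (ety x)"
proof -
 have "y = sg N x" using assms g by (metis (mono_tags, lifting) bnd_def comp_apply fp_def gmap_involution mem_Collect_eq)
 then show ?thesis by simp
qed

lemma inner_chain:
 assumes "successively (\<lambda>x y. y = fp N t x) zs" "set zs \<subseteq> ends N S" "set (tl zs) \<inter> bnd N S t = {}"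
 shows "chain N (map ety zs)"
 unfolding chain_def successively_map using assms(1)
proof (rule successively_mono_tl)
 fix x y assume "y = fp N t x" "x \<in> set zs" "y \<in> set (tl zs)"
 then show "ety y = lk N (ety x)" using step_inner[of y x] assms by (metis disjoint_iff list.set_sel(2) list.sel(2) subsetD)
qed

lemma reading_chain:
 assumes "ds \<in> set dss"
 shows "chain N (map ety ds)"
proof (rule inner_chain)
 obtain us vs where "dss = us @ ds # vs" using assms by (auto simp: in_set_conv_decomp)
 then show "successively (\<lambda>x y. y = fp N t x) ds"
  using rd by (simp add: reading_def cyc_def successively_append_iff)
 show "set ds \<subseteq> ends N S" using reading_subset assms by auto
 show "set (tl ds) \<inter> bnd N S t = {}" using reading_not_head[OF assms] by blast
qed

lemma reading_adjacent:
 assumes "dss = us @ d1 # d2 # vs"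
 shows "ety (hd d2) = nxt N (ety (last d1))"
proof (rule step_head)
 have "d1 ~= []" "d2 ~= []" using rd assms by (auto simp: reading_def)
 then show "hd d2 = fp N t (last d1)"
  using rd by (simp add: assms reading_def cyc_def successively_append_iff)
 show "hd d2 \<in> bnd N S t" using rd assms by (auto simp: reading_def)
qed

lemma reading_closing: "ety (hd (hd dss)) = nxt N (ety (last (last dss)))"
proof (rule step_head)
 have ne: "dss ~= []" "hd dss ~= []" "last dss ~= []" using rd by (auto simp: reading_def)
 have "hd (concat dss) = hd (hd dss)" using ne by (cases dss) auto
 moreover have "last (concat dss) = last (last dss)"
  using ne by (cases dss rule: rev_cases) auto
 ultimately show "hd (hd dss) = fp N t (last (last dss))" using rd by (simp add: reading_def cyc_def)
 show "hd (hd dss) \<in> bnd N S t" using rd ne by (auto simp: reading_def)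
qed

end

section \<open>Cutting an edge\<close>

text \<open>Equality in \<open>genus_inequality\<close> is planarity. The boundary orbit is one of
  the faces in this count, but it carries no weight.\<close>

definition good :: "nat => nat set => nat multiset => (edge_end => edge_end) => edge_end list list => bool" where
 "good N S w t dss \<longleftrightarrow> gmap N S t \<and> conn S t \<and>
  card S + card (faces (fp N t) (ends N S)) = card (arcs_of t) + 2 \<and> reading N S t dss \<and>
  weighted N w (faces (fp N t) (ends N S) - {set (concat dss)})"

lemma goodD:
 assumes "good N S w t dss"
 shows "gmap N S t" "conn S t" "card S + card (faces (fp N t) (ends N S)) = card (arcs_of t) + 2"
  "reading N S t dss" "weighted N w (faces (fp N t) (ends N S) - {set (concat dss)})"
  "cyc (fp N t) (concat dss)" "distinct (concat dss)" "dss ~= []" "\<And>ds. ds \<in> set dss ==> ds ~= []"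
  "set (map hd dss) = bnd N S t"
 using assms unfolding good_def reading_def cyc_def by blast+

lemma insert2_cancel:
 assumes "\<And>x. x \<in> A ==> x ~= a \<and> x ~= b" "insert a (insert b A) = insert a (insert b B)" "a \<notin> B" "b \<notin> B"
 shows "A = B"
proof -
 have "A = insert a (insert b A) - {a, b}" using assms(1) by auto
 also have "\<dots> = B" unfolding assms(2) using assms(3,4) by auto
 finally show ?thesis .
qed

lemma heads_subset_concat:
 assumes "\<And>d. d \<in> set dss ==> d ~= []"
 shows "set (map hd dss) \<subseteq> set (concat dss)"
proof
 fix x assume "x \<in> set (map hd dss)"
 then obtain d where d: "d \<in> set dss" "x = hd d" by auto
 then have "x \<in> set d" using assms[of d] by simp
 with d(1) show "x \<in> set (concat dss)" by auto
qed

lemma reading_rotate: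
 assumes "reading N S t (us @ vs)"
 shows "reading N S t (vs @ us)"
 using assms cyc_append_commute[of "fp N t" "concat us" "concat vs"] unfolding reading_def by auto

lemma good_rotate: "good N S w t (us @ vs) ==> good N S w t (vs @ us)"
 using reading_rotate[of N S t us vs] unfolding good_def by (simp add: Un_commute)

lemma block_mem_unique:
 assumes "distinct (concat dss)" "d1 \<in> set dss" "d2 \<in> set dss" "x \<in> set d1" "x \<in> set d2"
 shows "d1 = d2"
 using assms unfolding distinct_concat_iff by blast

context
 fixes N S t h1 h2 t'
 assumes N: "N \<ge> 1" and fin: "finite S" and g: "gmap N S t" and h: "t h1 = h2" "h1 ~= h2"
  and t': "t' = transpose h1 h2 \<circ> t"
begin

lemma cut_gmap: "gmap N S t'"
 unfolding t' by (rule gmap_cut[OF g h])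

lemma cut_arcs: "card (arcs_of t) = card (arcs_of t') + 1"
 unfolding t' by (rule card_arcs_cut[OF g h fin])

lemma cut_bnd: "bnd N S t' = insert h1 (insert h2 (bnd N S t))" "h1 \<notin> bnd N S t" "h2 \<notin> bnd N S t"
 unfolding t' using bnd_cut[OF g h] h gmap_involution[OF g, of h1] by (auto simp: bnd_def)

lemma cut_fp: "fp N t' = transpose h1 h2 \<circ> fp N t" "fp N t = transpose h1 h2 \<circ> fp N t'"
 unfolding t' fp_transpose by (auto simp: fp_def fun_eq_iff)

lemma cut_ends: "h1 \<in> ends N S" "h2 \<in> ends N S"
 using gmap_moved[OF g, of h1] gmap_ends[OF g, of h1] h by auto

text \<open>Composing with the transposition merges the two faces along the arc, or splits their union.\<close>

lemma cut_merge:
 assumes "cyc (fp N t) X" "cyc (fp N t) Z" "set X \<inter> set Z = {}" "hd X = h2" "hd Z = h1"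
 shows "cyc (fp N t') (X @ Z)"
 using cyc_join[OF assms(1-3)] assms(4,5) cut_fp(1) by (simp add: transpose_commute)

lemma cut_merge_faces:
 assumes "cyc (fp N t') (X @ Z)" "X ~= []" "Z ~= []" "hd X = h2" "hd Z = h1" "set (X @ Z) \<subseteq> ends N S"
 shows "cyc (fp N t) X" "cyc (fp N t) Z"
  "faces (fp N t) (ends N S) - {set X} = insert (set Z) (faces (fp N t') (ends N S) - {set (X @ Z)})"
  "set Z \<notin> faces (fp N t') (ends N S) - {set (X @ Z)}"
  "card (faces (fp N t) (ends N S)) = card (faces (fp N t') (ends N S)) + 1"
proof -
 have eq: "transpose (hd X) (hd Z) \<circ> fp N t' = fp N t"
  unfolding assms(4,5) using cut_fp(2) by (simp add: transpose_commute)
 show "cyc (fp N t) X" "cyc (fp N t) Z" using cyc_split[OF assms(1-3)] eq by simp_all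
 have XZ: "set (X @ Z) \<in> faces (fp N t') (ends N S)" using assms(1,6) by (rule facesI)
 have d: "set X \<inter> set Z = {}" using assms(1) by (simp add: cyc_def)
 have no: "set Y \<notin> faces (fp N t') (ends N S) - {set (X @ Z)}" if "Y = X \<or> Y = Z" for Y
 proof
  assume Y: "set Y \<in> faces (fp N t') (ends N S) - {set (X @ Z)}"
  have "Y ~= []" using that assms(2,3) by auto
  then have "hd Y \<in> set Y" "hd Y \<in> set (X @ Z)" using that by auto
  then show False using faces_disjoint[of "set Y" _ _ "set (X @ Z)" _ "hd Y"] Y XZ by blast
 qed
 then show "set Z \<notin> faces (fp N t') (ends N S) - {set (X @ Z)}" by blast
 have "set X ~= set Z" using d assms(2) by auto
 then show "faces (fp N t) (ends N S) - {set X} = insert (set Z) (faces (fp N t') (ends N S) - {set (X @ Z)})"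
  using faces_transpose_split[OF assms(1-3,6)] no[of X] unfolding eq by blast
 show "card (faces (fp N t) (ends N S)) = card (faces (fp N t') (ends N S)) + 1"
  using card_faces_transpose_split[OF assms(1-3,6) finite_ends[OF fin]] unfolding eq .
qed

lemma cut_split:
 assumes "cyc (fp N t) (P @ Q)" "P ~= []" "Q ~= []" "hd P = h2" "hd Q = h1" "set (P @ Q) \<subseteq> ends N S"
 shows "cyc (fp N t') P" "cyc (fp N t') Q"
  "faces (fp N t) (ends N S) - {set (P @ Q)} = faces (fp N t') (ends N S) - {set P, set Q}"
  "card (faces (fp N t') (ends N S)) = card (faces (fp N t) (ends N S)) + 1"
proof -
 have eq: "transpose (hd P) (hd Q) \<circ> fp N t = fp N t'"
  unfolding assms(4,5) using cut_fp(1) by (simp add: transpose_commute)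
 show "cyc (fp N t') P" "cyc (fp N t') Q" using cyc_split[OF assms(1-3)] eq by simp_all
 have PQ: "set (P @ Q) \<in> faces (fp N t) (ends N S)" using assms(1,6) by (rule facesI)
 have no: "set Y \<notin> faces (fp N t) (ends N S) - {set (P @ Q)}" if "Y = P \<or> Y = Q" for Y
 proof
  assume Y: "set Y \<in> faces (fp N t) (ends N S) - {set (P @ Q)}"
  have "Y ~= []" using that assms(2,3) by auto
  then have "hd Y \<in> set Y" "hd Y \<in> set (P @ Q)" using that by auto
  then show False using faces_disjoint[of "set Y" _ _ "set (P @ Q)" _ "hd Y"] Y PQ by blast
 qed
 then show "faces (fp N t) (ends N S) - {set (P @ Q)} = faces (fp N t') (ends N S) - {set P, set Q}"
  using faces_transpose_split[OF assms(1-3,6)] unfolding eq by blast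
 show "card (faces (fp N t') (ends N S)) = card (faces (fp N t) (ends N S)) + 1"
  using card_faces_transpose_split[OF assms(1-3,6) finite_ends[OF fin]] unfolding eq .
qed

end

section \<open>Surgery on planar graphs: arcs beside an inner face and arcs that disconnect\<close>

text \<open>After \<open>dk\<close> the orbit turns to \<open>hd da\<close>, which is now exchanged
  for \<open>hd dk\<close>, so \<open>dk\<close> closes to an inner face of index \<open>k\<close>.
  After \<open>db\<close> it turns to \<open>hd dk\<close>, now exchanged for \<open>hd da\<close>,
  so \<open>db\<close> and \<open>da\<close> become one block.\<close>

lemma glue_inner_face:
 assumes N: "N \<ge> 1" and fin: "finite S"
  and good: "good N S w t' (da # dys @ [db, dk])" and kap: "map ety dk \<in> kap N k"
  and hs: "h2 = hd da" "h1 = hd dk" and t: "t = transpose h1 h2 \<circ> t'"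
 shows "good N S (add_mset k w) t ((db @ da) # dys)" "t h2 = h1" "h1 \<notin> set (concat ((db @ da) # dys))"
  "transpose h1 h2 \<circ> t = t'"
proof -
 note gd = goodD[OF good]
 define X where "X = da @ concat dys @ db"
 have ne: "da ~= []" "db ~= []" "dk ~= []" "\<And>d. d \<in> set dys ==> d ~= []" using gd(9) by auto
 have cXZ: "cyc (fp N t') (X @ dk)" using gd(6) by (simp add: X_def)
 have sub: "set (X @ dk) \<subseteq> ends N S"
  using reading_subset[OF N fin gd(1,4)] by (simp add: X_def)
 have hb: "h1 \<in> bnd N S t'" "h2 \<in> bnd N S t'" using gd(10) hs by auto
 have d: "distinct (X @ dk)" using cXZ by (simp add: cyc_def)
 have hX: "hd X = h2" "X ~= []" using ne hs by (auto simp: X_def)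
 \<comment> \<open>The word \<kappa> closes up, so the letter that would continue \<open>dk\<close>
   is its own first letter. Hence the two ends have opposite types and may be joined.\<close>
 have "ety h2 = nxt N (ety (last dk))" using reading_closing[OF N fin gd(1,4)] hs by simp
 then have "flip (ety h2) = lk N (last (map ety dk))" using ne by (simp add: lk_def last_map)
 then have lab: "ety h1 = flip (ety h2)" using kap_closed(3)[OF kap] ne hs by (simp add: hd_map)
 have "h1 \<in> set dk" "h2 \<in> set X" using ne hs hX hd_in_set[OF hX(2)] by auto
 then have h12: "h1 ~= h2" using d by auto
 have tapp: "t e = (if e = h1 then h2 else if e = h2 then h1 else t' e)" for e
  unfolding t using glue_apply[OF gd(1), of h1 h2 e] hb by (auto simp: bnd_def)
 have gm: "gmap N S t" unfolding t by (rule gmap_glue[OF gd(1) hb lab])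
 have th: "t h1 = h2" by (simp add: tapp)
 show "t h2 = h1" using h12 by (simp add: tapp)
 show t': "transpose h1 h2 \<circ> t = t'" by (auto simp: t fun_eq_iff)
 note cc = N fin gm th h12 t'[symmetric]
 note mf = cut_merge_faces[OF cc cXZ hX(2) ne(3) hX(1) hs(2)[symmetric] sub]
 have rot: "set (concat ((db @ da) # dys)) = set X" by (auto simp: X_def)
 show "h1 \<notin> set (concat ((db @ da) # dys))" unfolding rot using \<open>h1 \<in> set dk\<close> d by auto
 have "cyc (fp N t) (concat ((db @ da) # dys))"
  using cyc_append_commute[of "fp N t" "da @ concat dys" db] mf(1) by (simp add: X_def)
 moreover have "set (map hd ((db @ da) # dys)) = bnd N S t"
 proof -
  have "h ~= h1 \<and> h ~= h2" if "h \<in> insert (hd db) (hd ` set dys)" for h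
  proof -
   have "h \<in> set (concat dys @ db)" using that ne(2) heads_subset_concat[OF ne(4)] by auto
   moreover have "set da \<inter> set (concat dys @ db) = {}" "set dk \<inter> set (concat dys @ db) = {}"
    using d by (auto simp: X_def)
   moreover have "h2 \<in> set da" using hs ne(1) by simp
   ultimately show ?thesis using \<open>h1 \<in> set dk\<close> by blast
  qed
  moreover have "insert h1 (insert h2 (insert (hd db) (hd ` set dys))) = insert h1 (insert h2 (bnd N S t))"
  proof -
   have "insert h1 (insert h2 (insert (hd db) (hd ` set dys))) = set (map hd (da # dys @ [db, dk]))"
    using hs by auto
   then show ?thesis unfolding gd(10) cut_bnd(1)[OF cc] .
  qed
  ultimately have "insert (hd db) (hd ` set dys) = bnd N S t"
   using cut_bnd(2,3)[OF cc] by (rule insert2_cancel)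
  then show ?thesis using ne by simp
 qed
 ultimately have rd: "reading N S t ((db @ da) # dys)" using ne by (auto simp: reading_def)
 have "weighted N (add_mset k w) (insert (set dk) (faces (fp N t') (ends N S) - {set (X @ dk)}))"
 proof (subst weighted_insert)
  have "set (concat (da # dys @ [db, dk])) = set (X @ dk)" by (auto simp: X_def)
  then show "\<exists>j w'. face_wt N (set dk) j \<and> add_mset k w = add_mset j w' \<and>
    weighted N w' (faces (fp N t') (ends N S) - {set (X @ dk)})"
   using gd(5) kap_face_wt[OF kap] by metis
 next
  show "finite (faces (fp N t') (ends N S) - {set (X @ dk)})" using fin by (simp add: finite_faces)
 qed (fact mf(4))
 moreover have "conn S t" by (rule conn_glue[OF gm th h12]) (simp only: t' gd(2))
 ultimately show "good N S (add_mset k w) t ((db @ da) # dys)"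
  unfolding good_def rot mf(3) using gm rd gd(3) mf(5) cut_arcs[OF cc] by simp
qed

text \<open>The face beyond the arc is not the boundary orbit, so it is an inner face, and its word
  read from \<open>h1\<close> is some \<kappa>. The cut joins it to the boundary orbit; the result
  stays connected because this orbit passes through both ends of the arc.\<close>

lemma cut_inner_face:
 assumes N: "N \<ge> 1" and fin: "finite S"
  and good: "good N S w t ((db @ da) # dys)" and ne: "da ~= []" "db ~= []"
  and hs: "h2 = hd da" "h1 = t h2" and out: "h1 \<notin> set (concat ((db @ da) # dys))"
  and t': "t' = transpose h1 h2 \<circ> t"
 obtains k w' dk where "w = add_mset k w'" "map ety dk \<in> kap N k" "hd dk = h1"
  "good N S w' t' (da # dys @ [db, dk])"
proof -
 note gd = goodD[OF good]
 define X where "X = da @ concat dys @ db"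
 have rot: "set (concat ((db @ da) # dys)) = set X" by (auto simp: X_def)
 have hX: "hd X = h2" "X ~= []" "h2 \<in> set X" using ne hs by (auto simp: X_def)
 have h12: "h1 ~= h2" using out hX(3) rot by blast
 have th: "t h1 = h2" using hs gmap_involution[OF gd(1)] by simp
 note cc = N fin gd(1) th h12 t'
 have sub: "set X \<subseteq> ends N S" using reading_subset[OF N fin gd(1,4)] unfolding rot .
 obtain dk where dk: "cyc (fp N t) dk" "hd dk = h1" "set dk \<subseteq> ends N S"
  using cyc_exists[OF finite_ends[OF fin] fp_inj_on[OF gd(1)] fp_ends_image[OF N gd(1)] cut_ends(1)[OF cc]] .
 have nek: "dk ~= []" using dk by (simp add: cyc_def)
 have cX: "cyc (fp N t) X"
  using gd(6) cyc_append_commute[of "fp N t" db "da @ concat dys"] by (simp add: X_def)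
 have disj: "set X \<inter> set dk = {}"
 proof (rule ccontr)
  assume "set X \<inter> set dk ~= {}"
  then have "set X = set dk" using cyc_set_unique[OF cX dk(1)] by blast
  then show False using out rot nek dk(2) by (metis hd_in_set)
 qed
 have cXZ: "cyc (fp N t') (X @ dk)" by (rule cut_merge[OF cc cX dk(1) disj hX(1) dk(2)])
 have subXZ: "set (X @ dk) \<subseteq> ends N S" using sub dk(3) by simp
 note mf = cut_merge_faces[OF cc cXZ hX(2) nek hX(1) dk(2) subXZ]
 have "weighted N w (insert (set dk) (faces (fp N t') (ends N S) - {set (X @ dk)}))"
  using gd(5) unfolding rot mf(3) .
 then obtain k w' where kw: "face_wt N (set dk) k" "w = add_mset k w'"
  "weighted N w' (faces (fp N t') (ends N S) - {set (X @ dk)})"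
  using weighted_insert[OF finite_Diff[OF finite_faces[OF finite_ends[OF fin]]] mf(4)] by blast
 have bX: "bnd N S t \<subseteq> set X"
  using heads_subset_concat[of "(db @ da) # dys", OF gd(9)] unfolding gd(10) rot by simp
 have "chain N (map ety dk)"
  by (rule inner_chain[OF N fin gd(1) gd(4)])
   (use dk bX disj nek in \<open>auto simp: cyc_def dest: list.set_sel(2)\<close>)
 then have kap: "map ety dk \<in> kap N k"
  using face_wt_kap[OF kw(1)] dk(1) N by (simp add: cyc_def)
 have ne': "\<And>d. d \<in> set dys ==> d ~= []" using gd(9) by auto
 have "set (map hd (da # dys @ [db, dk])) = insert h1 (insert h2 (set (map hd ((db @ da) # dys))))"
  using ne hs(1) dk(2) by auto
 then have "set (map hd (da # dys @ [db, dk])) = bnd N S t'"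
  unfolding gd(10) cut_bnd(1)[OF cc] .
 then have rd: "reading N S t' (da # dys @ [db, dk])"
  using cXZ ne ne' nek by (auto simp: reading_def X_def)
 have "(vert h1, vert h2) \<in> (adj t')\<^sup>*"
  by (rule face_connected[OF cXZ]) (use dk(2) nek hX(3) in auto)
 then have "conn S t'" using conn_cut_iff[OF gd(1) th h12 gd(2)] t' by simp
 moreover have "set (concat (da # dys @ [db, dk])) = set (X @ dk)" by (auto simp: X_def)
 ultimately have "good N S w' t' (da # dys @ [db, dk])"
  unfolding good_def using cut_gmap[OF cc] rd kw(3) gd(3) mf(5) cut_arcs[OF cc] by simp
 with kw kap dk(2) show thesis by (intro that)
qed

text \<open>The new arc merges the boundary orbits of two components. The Euler equalities of the
  parts add up with constant 4; one arc more and one face less bring it back to 2.\<close>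

lemma glue_disjoint:
 assumes N: "N \<ge> 1" and fin: "finite S1" "finite S2" and disj: "S1 \<inter> S2 = {}"
  and good1: "good N S1 w1 t1 (da # dpre @ [dx])" and good2: "good N S2 w2 t2 (dl # dpost @ [db])"
  and hs: "h2 = hd da" "h1 = hd dl" and lab: "ety h1 = flip (ety h2)"
  and t0: "t0 = joinm S1 t1 t2" and t: "t = transpose h1 h2 \<circ> t0"
 shows "good N (S1 \<union> S2) (w1 + w2) t ((db @ da) # dpre @ (dx @ dl) # dpost)" "t h2 = h1"
  "transpose h1 h2 \<circ> t = t0" "restr S1 t0 = t1" "restr S2 t0 = t2" "\<And>e. vert (t0 e) \<in> S1 \<longleftrightarrow> vert e \<in> S1"
proof -
 let ?S = "S1 \<union> S2"
 note g1 = goodD[OF good1] and g2 = goodD[OF good2]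
 note jm = joinm[OF g1(1) g2(1) disj, folded t0]
 show r: "restr S1 t0 = t1" "restr S2 t0 = t2" by (fact jm(3), fact jm(4))
 show closed: "vert (t0 e) \<in> S1 \<longleftrightarrow> vert e \<in> S1" for e by (fact jm(2))
 note parts = N fin disj jm(1) closed
 define P where "P = da @ concat dpre @ dx"
 define Q where "Q = dl @ concat dpost @ db"
 have ne: "da ~= []" "dx ~= []" "dl ~= []" "db ~= []" "\<And>d. d \<in> set dpre ==> d ~= []" "\<And>d. d \<in> set dpost ==> d ~= []"
  using g1(9) g2(9) by auto
 have hPQ: "hd P = h2" "hd Q = h1" "P ~= []" "Q ~= []" using ne hs by (auto simp: P_def Q_def)
 have sP: "set P \<subseteq> ends N S1" using reading_subset[OF N fin(1) g1(1,4)] by (auto simp: P_def)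
 have sQ: "set Q \<subseteq> ends N S2" using reading_subset[OF N fin(2) g2(1,4)] by (auto simp: Q_def)
 have dE: "ends N S1 \<inter> ends N S2 = {}" using disj by (auto simp: ends_def)
 have b0: "bnd N ?S t0 = bnd N S1 t1 \<union> bnd N S2 t2" using bnd_parts[OF parts] r by simp
 have hb: "h1 \<in> bnd N ?S t0" "h2 \<in> bnd N ?S t0" using b0 g1(10) g2(10) hs by auto
 have hE: "h2 \<in> ends N S1" "h1 \<in> ends N S2" using sP sQ hPQ hd_in_set by auto
 then have h12: "h1 ~= h2" using dE by auto
 have tapp: "t e = (if e = h1 then h2 else if e = h2 then h1 else t0 e)" for e
  unfolding t using glue_apply[OF jm(1), of h1 h2 e] hb by (auto simp: bnd_def)
 have gm: "gmap N ?S t" unfolding t by (rule gmap_glue[OF jm(1) hb lab])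
 have th: "t h1 = h2" by (simp add: tapp)
 show th2: "t h2 = h1" using h12 by (simp add: tapp)
 show t': "transpose h1 h2 \<circ> t = t0" by (auto simp: t fun_eq_iff)
 have finS: "finite ?S" using fin by simp
 note cc = N finS gm th h12 t'[symmetric]
 have cP: "cyc (fp N t0) P"
 proof (rule cyc_cong)
  show "cyc (fp N t1) P" using g1(6) by (simp add: P_def)
  show "fp N t1 x = fp N t0 x" if "x \<in> set P" for x
   using that sP unfolding r(1)[symmetric] by (auto simp: fp_def restr_def ends_def)
 qed
 have cQ: "cyc (fp N t0) Q"
 proof (rule cyc_cong)
  show "cyc (fp N t2) Q" using g2(6) by (simp add: Q_def)
  show "fp N t2 x = fp N t0 x" if "x \<in> set Q" for x
   using that sQ unfolding r(2)[symmetric] by (auto simp: fp_def restr_def ends_def)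
 qed
 have dPQ: "set P \<inter> set Q = {}" using sP sQ dE by blast
 have cPQ: "cyc (fp N t) (P @ Q)"
  using cyc_join[OF cP cQ dPQ] cut_fp(2)[OF cc] hPQ by (simp add: transpose_commute)
 have subPQ: "set (P @ Q) \<subseteq> ends N ?S" using sP sQ by (auto simp: ends_Un)
 note cs = cut_split[OF cc cPQ hPQ(3,4) hPQ(1,2) subPQ]
 let ?dss = "(db @ da) # dpre @ (dx @ dl) # dpost"
 have rot: "set (concat ?dss) = set (P @ Q)" by (auto simp: P_def Q_def)
 have "cyc (fp N t) (concat ?dss)"
  using cyc_append_commute[of "fp N t" "P @ dl @ concat dpost" db] cPQ by (simp add: P_def Q_def)
 moreover have "set (map hd ?dss) = bnd N ?S t"
 proof -
  let ?H = "insert (hd db) (insert (hd dx) (hd ` set dpre \<union> hd ` set dpost))"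
  have "h ~= h1 \<and> h ~= h2" if "h \<in> ?H" for h
  proof -
   have "hd ` set dpre \<subseteq> set (concat dpre)" "hd ` set dpost \<subseteq> set (concat dpost)"
    using heads_subset_concat[OF ne(5)] heads_subset_concat[OF ne(6)] by simp_all
   then have "h \<in> set (concat dpre) \<union> set (concat dpost) \<union> set dx \<union> set db"
    using that ne(2,4) hd_in_set by blast
   then have "h \<in> set (tl P) \<union> set (tl Q)"
    using ne(1,3) unfolding P_def Q_def by (cases da; cases dl) auto
   moreover have "distinct (P @ Q)" using cPQ by (simp add: cyc_def)
   ultimately show ?thesis using hPQ by (cases P; cases Q) auto
  qed
  moreover have "insert h1 (insert h2 ?H) = insert h1 (insert h2 (bnd N ?S t))"
  proof -
   have "insert h1 (insert h2 ?H) = set (map hd (da # dpre @ [dx])) \<union> set (map hd (dl # dpost @ [db]))"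
    using hs by auto
   then show ?thesis unfolding g1(10) g2(10) b0[symmetric] cut_bnd(1)[OF cc] .
  qed
  ultimately have "?H = bnd N ?S t" using cut_bnd(2,3)[OF cc] by (rule insert2_cancel)
  then show ?thesis using ne by auto
 qed
 ultimately have rd: "reading N ?S t ?dss" using ne by (auto simp: reading_def)
 let ?F1 = "faces (fp N t1) (ends N S1)" and ?F2 = "faces (fp N t2) (ends N S2)"
 have f0: "faces (fp N t0) (ends N ?S) = ?F1 \<union> ?F2" using faces_parts[OF parts] r by simp
 have fd: "?F1 \<inter> ?F2 = {}" using faces_parts_disjoint[OF parts] r by simp
 have PF: "set P \<in> ?F1" "set Q \<in> ?F2"
  using reading_facesI[OF N fin(1) g1(1,4)] reading_facesI[OF N fin(2) g2(1,4)]
  by (simp_all add: P_def Q_def)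
 then have "faces (fp N t) (ends N ?S) - {set (P @ Q)} = (?F1 - {set P}) \<union> (?F2 - {set Q})"
  unfolding cs(3) f0 using fd by blast
 moreover have "weighted N (w1 + w2) ((?F1 - {set P}) \<union> (?F2 - {set Q}))"
 proof (subst weighted_Un)
  show "\<exists>w1' w2'. w1 + w2 = w1' + w2' \<and> weighted N w1' (?F1 - {set P}) \<and> weighted N w2' (?F2 - {set Q})"
   using g1(5) g2(5) by (intro exI[of _ w1] exI[of _ w2]) (simp add: P_def Q_def)
 next
  show "(?F1 - {set P}) \<inter> (?F2 - {set Q}) = {}" using fd by blast
 qed (use fin in \<open>simp_all add: finite_faces\<close>)
 moreover have "conn ?S t"
 proof (rule conn_Un_glue[OF gm th2 h12[symmetric]])
  have eq: "transpose h2 h1 \<circ> t = t0" using t' by (simp add: transpose_commute)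
  show "conn S1 (restr S1 (transpose h2 h1 \<circ> t))" "conn S2 (restr S2 (transpose h2 h1 \<circ> t))"
   unfolding eq r using g1(2) g2(2) by simp_all
 qed (use hE in \<open>auto simp: ends_def\<close>)
 moreover have "card ?S = card S1 + card S2" using fin disj by (simp add: card_Un_disjoint)
 moreover have "card (arcs_of t0) = card (arcs_of t1) + card (arcs_of t2)"
  using card_arcs_parts[OF parts] r by simp
 moreover have "card (faces (fp N t0) (ends N ?S)) = card ?F1 + card ?F2"
  using card_faces_parts[OF parts] r by simp
 ultimately show "good N ?S (w1 + w2) t ?dss"
  unfolding good_def rot using gm rd g1(3) g2(3) cs(4) cut_arcs[OF cc] by simp
qed

text \<open>Both sides of the arc belong to the boundary orbit, so the cut splits this orbit. With
  one face more and one arc less, a connected result would violate \<open>genus_inequality\<close>;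
  hence the arc is a bridge, and the two halves of the orbit are the boundaries of the
  components.\<close>

lemma cut_disjoint:
 assumes N: "N \<ge> 1" and fin: "finite S"
  and good: "good N S w t ((db @ da) # dpre @ (dx @ dl) # dpost)"
  and ne: "da ~= []" "db ~= []" "dx ~= []" "dl ~= []"
  and hs: "h2 = hd da" "h1 = t h2" "h1 = hd dl"
  and t': "t' = transpose h1 h2 \<circ> t"
 obtains S1 w1 w2 where "S1 \<subseteq> S" "w = w1 + w2"
  "good N S1 w1 (restr S1 t') (da # dpre @ [dx])"
  "good N (S - S1) w2 (restr (S - S1) t') (dl # dpost @ [db])"
  "joinm S1 (restr S1 t') (restr (S - S1) t') = t'" "ety h1 = flip (ety h2)"
proof -
 let ?dss = "(db @ da) # dpre @ (dx @ dl) # dpost"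
 note gd = goodD[OF good]
 define P where "P = da @ concat dpre @ dx"
 define Q where "Q = dl @ concat dpost @ db"
 have rot: "set (concat ?dss) = set (P @ Q)" by (auto simp: P_def Q_def)
 have hPQ: "hd P = h2" "hd Q = h1" "P ~= []" "Q ~= []" using ne hs by (auto simp: P_def Q_def)
 have cPQ: "cyc (fp N t) (P @ Q)"
  using gd(6) cyc_append_commute[of "fp N t" db "P @ dl @ concat dpost"] by (simp add: P_def Q_def)
 have dPQ: "distinct (P @ Q)" using cPQ by (simp add: cyc_def)
 have h12: "h1 ~= h2" using dPQ hPQ hd_in_set[of P] hd_in_set[of Q] by auto
 have th: "t h1 = h2" "t h2 = h1" using hs gmap_involution[OF gd(1)] by simp_all
 have t'2: "t' = transpose h2 h1 \<circ> t" using t' by (simp add: transpose_commute)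
 note cc = N fin gd(1) th(1) h12 t'
 have subPQ: "set (P @ Q) \<subseteq> ends N S" using reading_subset[OF N fin gd(1,4)] unfolding rot .
 note cs = cut_split[OF cc cPQ hPQ(3,4) hPQ(1,2) subPQ]
 have Sne: "S ~= {}" using cut_ends(1)[OF cc] by (auto simp: ends_def)
 have nc: "\<not> conn S t'"
 proof
  assume "conn S t'"
  from genus_inequality[OF N fin Sne cut_gmap[OF cc] this]
  show False using cs(4) cut_arcs[OF cc] gd(3) by simp
 qed
 define S1 where "S1 = {v \<in> S. (vert h2, v) \<in> (adj t')\<^sup>*}"
 define S2 where "S2 = S - S1"
 note comp = cut_components[OF gd(1) th(2) h12[symmetric] gd(2) nc[unfolded t'2], folded t'2, folded S1_def, folded S2_def]
 have S: "S = S1 \<union> S2" "S1 \<inter> S2 = {}" by (auto simp: S1_def S2_def)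
 have fins: "finite S1" "finite S2" using fin S by auto
 note parts = N fins S(2) cut_gmap[OF cc, unfolded S(1)] comp(3)
 note gp = gmap_parts[OF parts]
 let ?t1 = "restr S1 t'" and ?t2 = "restr S2 t'"
 let ?F1 = "faces (fp N ?t1) (ends N S1)" and ?F2 = "faces (fp N ?t2) (ends N S2)"
 have sP: "set P \<subseteq> ends N S1"
 proof
  fix x assume x: "x \<in> set P"
  have "(vert h2, vert x) \<in> (adj t')\<^sup>*" by (rule face_connected[OF cs(1) _ x]) (use hPQ hd_in_set in auto)
  then show "x \<in> ends N S1" using x subPQ by (auto simp: ends_def S1_def)
 qed
 have sQ: "set Q \<subseteq> ends N S2"
 proof
  fix x assume x: "x \<in> set Q"
  have p: "(vert x, vert h1) \<in> (adj t')\<^sup>*" by (rule face_connected[OF cs(2) x]) (use hPQ hd_in_set in auto)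
  have "vert x \<notin> S1"
  proof
   assume "vert x \<in> S1"
   then have "vert h1 \<in> S1" using restr_connected[OF comp(3) p] by blast
   then show False using comp(2) by (simp add: S2_def)
  qed
  then show "x \<in> ends N S2" using x subPQ by (auto simp: ends_def S2_def)
 qed
 have dE: "ends N S1 \<inter> ends N S2 = {}" using S(2) by (auto simp: ends_def)
 have c1: "cyc (fp N ?t1) P"
  by (rule cyc_cong[OF cs(1)]) (use sP in \<open>auto simp: fp_def restr_def ends_def\<close>)
 have c2: "cyc (fp N ?t2) Q"
  by (rule cyc_cong[OF cs(2)]) (use sQ in \<open>auto simp: fp_def restr_def ends_def\<close>)
 have f0: "faces (fp N t') (ends N S) = ?F1 \<union> ?F2" using faces_parts[OF parts] S(1) by simp
 have fd: "?F1 \<inter> ?F2 = {}" by (rule faces_parts_disjoint[OF parts])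
 have PF: "set P \<in> ?F1" "set Q \<in> ?F2" using c1 c2 sP sQ facesI by metis+
 have "faces (fp N t) (ends N S) - {set (P @ Q)} = (?F1 - {set P}) \<union> (?F2 - {set Q})"
  unfolding cs(3) f0 using fd PF by blast
 then have "weighted N w ((?F1 - {set P}) \<union> (?F2 - {set Q}))" using gd(5) unfolding rot by simp
 then obtain w1 w2 where w: "w = w1 + w2" "weighted N w1 (?F1 - {set P})" "weighted N w2 (?F2 - {set Q})"
  using weighted_Un[of "?F1 - {set P}" "?F2 - {set Q}" N w] fins fd by (auto simp: finite_faces)
 have ne': "\<And>d. d \<in> set dpre ==> d ~= []" "\<And>d. d \<in> set dpost ==> d ~= []" using gd(9) by auto
 have b': "bnd N S t' = set (map hd (da # dpre @ [dx])) \<union> set (map hd (dl # dpost @ [db]))"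
 proof -
  have "insert h1 (insert h2 (set (map hd ?dss))) =
    set (map hd (da # dpre @ [dx])) \<union> set (map hd (dl # dpost @ [db]))"
   using ne hs(1,3) by auto
  then show ?thesis unfolding gd(10) cut_bnd(1)[OF cc] .
 qed
 have b0: "bnd N S t' = bnd N S1 ?t1 \<union> bnd N S2 ?t2" using bnd_parts[OF parts] S(1) by simp
 have cp: "set (concat (da # dpre @ [dx])) = set P" "set (concat (dl # dpost @ [db])) = set Q"
  by (auto simp: P_def Q_def)
 have H1: "set (map hd (da # dpre @ [dx])) \<subseteq> ends N S1"
  using heads_subset_concat[of "da # dpre @ [dx]"] sP ne ne' unfolding cp by auto
 have H2: "set (map hd (dl # dpost @ [db])) \<subseteq> ends N S2"
  using heads_subset_concat[of "dl # dpost @ [db]"] sQ ne ne' unfolding cp by auto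
 have "bnd N S1 ?t1 \<subseteq> ends N S1" "bnd N S2 ?t2 \<subseteq> ends N S2" by (auto simp: bnd_def)
 then have B: "set (map hd (da # dpre @ [dx])) = bnd N S1 ?t1" "set (map hd (dl # dpost @ [db])) = bnd N S2 ?t2"
  using b' b0 H1 H2 dE by blast+
 have rd1: "reading N S1 ?t1 (da # dpre @ [dx])" unfolding reading_def B(1) using c1 ne ne' by (auto simp: P_def)
 have rd2: "reading N S2 ?t2 (dl # dpost @ [db])" unfolding reading_def B(2) using c2 ne ne' by (auto simp: Q_def)
 have Sn: "S1 ~= {}" "S2 ~= {}" using comp(1,2) by auto
 have arcs: "card (arcs_of t') = card (arcs_of ?t1) + card (arcs_of ?t2)" by (rule card_arcs_parts[OF parts])
 have fc: "card (faces (fp N t') (ends N S)) = card ?F1 + card ?F2" using card_faces_parts[OF parts] S(1) by simp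
 have cS: "card S = card S1 + card S2" using S fins by (simp add: card_Un_disjoint)
 \<comment> \<open>The two genus inequalities add up to an equality, so each of them is one: both
   components are planar.\<close>
 have e: "card S1 + card ?F1 = card (arcs_of ?t1) + 2" "card S2 + card ?F2 = card (arcs_of ?t2) + 2"
  using genus_inequality[OF N fins(1) Sn(1) gp(1) comp(4)] genus_inequality[OF N fins(2) Sn(2) gp(2) comp(5)]
   arcs fc cS gd(3) cs(4) cut_arcs[OF cc] by linarith+
 have good1: "good N S1 w1 ?t1 (da # dpre @ [dx])"
  unfolding good_def cp using gp(1) comp(4) e(1) rd1 w(2) by blast
 have good2: "good N S2 w2 ?t2 (dl # dpost @ [db])"
  unfolding good_def cp using gp(2) comp(5) e(2) rd2 w(3) by blast
 have jn: "joinm S1 ?t1 ?t2 = t'" by (rule joinm_parts[OF parts])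
 have lab: "ety h1 = flip (ety h2)" using gmap_moved[OF gd(1), of h2] th h12 by simp
 have sub: "S1 \<subseteq> S" by (auto simp: S1_def)
 show thesis by (rule that[OF sub w(1) good1 good2[unfolded S2_def] jn[unfolded S2_def] lab])
qed

text \<open>The two sides of an arc have corners of different kinds, so it is met twice only in different blocks.\<close>

lemma arc_return_block:
 assumes N: "N \<ge> 1" and fin: "finite S" and good: "good N S w t ((db @ da) # dys)" and ne: "da ~= []" "db ~= []"
  and hs: "h2 = hd da" "h1 = t h2" and mem: "h1 \<in> set (concat ((db @ da) # dys))"
 obtains dpre dx dl dpost where "dys = dpre @ (dx @ dl) # dpost" "dx ~= []" "dl ~= []" "hd dl = h1"
proof -
 note gd = goodD[OF good]
 have dc: "distinct (concat ((db @ da) # dys))" by (fact gd(7))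
 have "h2 \<in> set (tl (db @ da))" using ne hs by (cases db) auto
 then have h2b: "h2 \<notin> bnd N S t" using reading_not_head[OF N fin gd(1,4), of "db @ da" h2] by simp
 have h2e: "h2 \<in> ends N S" using reading_subset[OF N fin gd(1,4)] hs ne by auto
 have ne12: "h1 ~= h2" using h2b h2e hs by (auto simp: bnd_def)
 have th: "t h1 = h2" using hs gmap_involution[OF gd(1)] by simp
 have h1b: "h1 \<notin> bnd N S t" using th ne12 by (auto simp: bnd_def)
 have lab: "ety h1 = flip (ety h2)" using gmap_moved[OF gd(1), of h2] hs ne12 by simp
 have "h1 \<notin> set (db @ da)"
 proof
  assume h1: "h1 \<in> set (db @ da)"
  have ch: "chain N (map ety (db @ da))" by (rule reading_chain[OF N fin gd(1,4)]) simp
  have "fst (ety h) = fst (hd (map ety (db @ da)))" if "h \<in> set (db @ da)" for h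
   by (rule chain_fst[OF ch]) (use that in auto)
  from this[OF h1] this[of h2] have "fst (ety h1) = fst (ety h2)" using hs ne by simp
  then show False using lab by simp
 qed
 then obtain d where d: "d \<in> set dys" "h1 \<in> set d" using mem by auto
 then obtain dpre dpost where dys: "dys = dpre @ d # dpost" by (auto simp: in_set_conv_decomp)
 obtain dx dl' where d': "d = dx @ h1 # dl'" using d(2) by (auto simp: in_set_conv_decomp)
 have "dx ~= []"
 proof
  assume "dx = []"
  then have "h1 \<in> set (map hd ((db @ da) # dys))" using d(1) d' by force
  then show False using h1b unfolding gd(10) by blast
 qed
 then show thesis using that[of dpre dx "h1 # dl'" dpost] dys d' by simp
qed

section \<open>Counting labelled graphs\<close>

text \<open>Graphs on a fixed set of vertices, together with the root. The blocks need not be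
  recorded, as the root and the lengths of the words determine them.\<close>

definition Lab :: "nat => nat set => nat multiset => letter list list => ((edge_end => edge_end) \<times> edge_end) set" where
 "Lab N S w ls = {(t, hd (hd dss)) | t dss. good N S w t dss \<and> map (map ety) dss = ls}"

definition splits :: "letter list list => (letter list list \<times> letter list \<times> letter list \<times> letter list list) set" where
 "splits ys = {(pre, x, l, post). ys = pre @ (x @ l) # post \<and> x ~= [] \<and> l ~= []}"

lemma LabI: "good N S w t dss ==> map (map ety) dss = ls ==> r = hd (hd dss) ==> (t, r) \<in> Lab N S w ls"
 by (auto simp: Lab_def)

lemma LabE:
 assumes "(t, r) \<in> Lab N S w ls"
 obtains dss where "good N S w t dss" "map (map ety) dss = ls" "r = hd (hd dss)"
 using assms by (auto simp: Lab_def)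

lemma gmap_permutes: "gmap N S t ==> t permutes ends N S"
 unfolding permutes_def by (metis gmap_involution gmap_moved)

lemma finite_Lab:
 assumes "finite S"
 shows "finite (Lab N S w ls)"
proof (rule finite_subset)
 show "Lab N S w ls \<subseteq> {t. t permutes ends N S} \<times> ends N S"
 proof
  fix p assume "p \<in> Lab N S w ls"
  then obtain t dss where p: "p = (t, hd (hd dss))" "good N S w t dss" by (auto simp: Lab_def)
  note gd = goodD[OF p(2)]
  have "hd (hd dss) \<in> bnd N S t" using gd(8,10) by (metis hd_in_set image_eqI list.set_map)
  then show "p \<in> {t. t permutes ends N S} \<times> ends N S"
   using p gmap_permutes[OF gd(1)] by (auto simp: bnd_def)
 qed
 show "finite ({t. t permutes ends N S} \<times> ends N S)"
  using assms by (simp add: finite_permutations)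
qed

lemma concat_eq_lengths:
 "concat xss = concat yss ==> map length xss = map length yss ==> xss = yss"
proof (induction xss arbitrary: yss)
 case (Cons x xss)
 then show ?case by (cases yss) auto
qed simp

text \<open>The root determines the boundary orbit as a list, and the lengths of the words determine
  where it is cut.\<close>

lemma good_unique:
 assumes "good N S w t dss" "good N S' w' t dss'" "hd (hd dss) = hd (hd dss')" "map (map ety) dss = map (map ety) dss'"
 shows "dss = dss'"
proof (rule concat_eq_lengths)
 note g = goodD[OF assms(1)] and g' = goodD[OF assms(2)]
 have "hd (concat ds) = hd (hd ds)" if "ds ~= []" "hd ds ~= []" for ds :: "edge_end list list"
  using that by (cases ds) auto
 then have "hd (concat dss) = hd (concat dss')" using g(8,9) g'(8,9) assms(3) by simp
 then show "concat dss = concat dss'" by (rule cyc_unique[OF g(6) g'(6)])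
 have "map length (map (map ety) dss) = map length (map (map ety) dss')" using assms(4) by simp
 then show "map length dss = map length dss'" by (simp add: comp_def)
qed

lemma good_weight_unique:
 assumes "N \<ge> 1" "finite S" "good N S w t dss" "good N S w' t dss"
 shows "w = w'"
 using weighted_unique[OF assms(1) _ goodD(5)[OF assms(3)] goodD(5)[OF assms(4)]] assms(2)
 by (simp add: finite_faces)

lemma finite_splits [simp]: "finite (splits ys)"
proof (rule finite_subset)
 let ?n = "length ys"
 let ?f = "\<lambda>(k, i). (take k ys, take i (ys ! k), drop i (ys ! k), drop (Suc k) ys)"
 show "splits ys \<subseteq> ?f ` (SIGMA k:{..<?n}. {..length (ys ! k)})"
 proof
  fix s assume "s \<in> splits ys"
  then obtain pre x l post where s: "s = (pre, x, l, post)" "ys = pre @ (x @ l) # post" by (auto simp: splits_def)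
  then have "s = ?f (length pre, length x)" by simp
  moreover have "(length pre, length x) \<in> (SIGMA k:{..<?n}. {..length (ys ! k)})" using s by simp
  ultimately show "s \<in> ?f ` (SIGMA k:{..<?n}. {..length (ys ! k)})" by (rule image_eqI)
 qed
qed auto

lemma finite_submultisets: "finite {w1. w1 \<subseteq># (w :: 'a multiset)}"
proof (induction w)
 case (add k w)
 have "{w1. w1 \<subseteq># add_mset k w} \<subseteq> {w1. w1 \<subseteq># w} \<union> add_mset k ` {w1. w1 \<subseteq># w}"
 proof
  fix w1 assume w1: "w1 \<in> {w1. w1 \<subseteq># add_mset k w}"
  show "w1 \<in> {w1. w1 \<subseteq># w} \<union> add_mset k ` {w1. w1 \<subseteq># w}"
  proof (cases "k \<in># w1")
   case True
   then obtain u where "w1 = add_mset k u" by (metis insert_DiffM)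
   then show ?thesis using w1 by simp
  next
   case False
   have "w1 \<subseteq># w"
   proof (rule mset_subset_eqI)
    fix x
    show "count w1 x \<le> count w x"
     using mset_subset_eq_count[of w1 "add_mset k w" x] w1 False
     by (cases "x = k") (simp_all add: not_in_iff)
   qed
   then show ?thesis by simp
  qed
 qed
 then show ?case using add.IH by (meson finite_UnI finite_imageI finite_subset)
qed simp

lemma finite_kap [simp]: "finite (kap N k)"
 by (simp add: kap_def)

lemma cyc_funpow_block:
 assumes "cyc f (us @ vs)" "us ~= []" "vs ~= []"
 shows "(f ^^ length us) (hd us) = hd vs"
proof -
 have "(us @ vs) ! length us = (f ^^ length us) (hd (us @ vs))"
  using assms by (intro successively_nth_funpow) (auto simp: cyc_def)
 then show ?thesis using assms(2,3) by (simp add: nth_append hd_conv_nth)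
qed

lemma takeWhile_block:
 assumes "distinct (concat (dpre @ d # dpost))" "h \<in> set d"
 shows "takeWhile (\<lambda>b. h \<notin> set b) (dpre @ d # dpost) = dpre"
proof -
 have "h \<notin> set b" if "b \<in> set dpre" for b using assms that by auto
 then show ?thesis using assms(2) by (subst takeWhile_append2) auto
qed

lemma takeWhile_elem:
 assumes "distinct (dx @ dl)" "dl ~= []"
 shows "takeWhile (\<lambda>x. x ~= hd dl) (dx @ dl) = dx"
proof -
 have "hd dl \<notin> set dx" using assms hd_in_set[OF assms(2)] by auto
 then show ?thesis using assms(2) by (subst takeWhile_append2) (auto simp: neq_Nil_conv)
qed

lemma split_position_unique:
 assumes "distinct (concat dys)" "dys = dpre @ (dx @ dl) # dpost" "dys = dpre' @ (dx' @ dl') # dpost'"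
  "dl ~= []" "dl' ~= []" "hd dl = hd dl'"
 shows "dpre = dpre' \<and> dx = dx' \<and> dl = dl' \<and> dpost = dpost'"
proof -
 have "hd dl \<in> set (dx @ dl)" "hd dl \<in> set (dx' @ dl')"
  using assms(4,5) hd_in_set[OF assms(4)] hd_in_set[OF assms(5)] unfolding assms(6) by auto
 then have "dpre = dpre'" using takeWhile_block assms(1-3) by metis
 moreover from this have eq: "dx @ dl = dx' @ dl'" "dpost = dpost'" using assms(2,3) by auto
 moreover have "distinct (dx @ dl)" using assms(1,2) by auto
 then have "dx = dx'" using takeWhile_elem[of dx dl] takeWhile_elem[of dx' dl'] assms(4-6) eq by simp
 ultimately show ?thesis by simp
qed

section \<open>The bijection behind the cut identity\<close>

context
 fixes N :: nat and S :: "nat set" and w :: "nat multiset" and a b :: "letter list" and ys :: "letter list list"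
 assumes N: "N \<ge> 1" and fin: "finite S" and ne: "a ~= []" "b ~= []"
  and ch: "\<And>y. y \<in> set ys ==> chain N y"
begin

text \<open>The data of a cut beside an inner face: a term \<kappa> of \<open>\<mu>\<^sub>0\<close>
  whose index is taken from the weight, and a graph that has \<kappa> as its last block.\<close>

definition Y1 where
 "Y1 = (SIGMA (k, \<kappa>):(SIGMA k:set_mset w. kap N k). Lab N S (w - {#k#}) (a # ys @ [b, \<kappa>]))"

text \<open>The end that is joined to the root \<open>h2\<close>, and the new root, which begins the
  block \<open>b\<close>, are located by running along the boundary orbit for the length of the
  words in between.\<close>

definition G1 where
 "G1 = (\<lambda>(_ :: nat \<times> letter list, t', h2). (transpose ((fp N t' ^^ length (a @ concat ys @ b)) h2) h2 \<circ> t',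
  (fp N t' ^^ length (a @ concat ys)) h2))"

text \<open>The data of a cut that disconnects: the place in \<open>ys\<close> where the arc is met
  again, and the vertices \<open>S1\<close> and the weight \<open>w1\<close> of the component that
  contains the block \<open>a\<close>.\<close>

definition Y2 where
 "Y2 = (SIGMA ((pre, x, l, post), S1, w1):splits ys \<times> Pow S \<times> {w1. w1 \<subseteq># w}.
  Lab N S1 w1 (a # pre @ [x]) \<times> Lab N (S - S1) (w - w1) (l # post @ [b]))"

definition G2 where
 "G2 = (\<lambda>(((pre :: letter list list, x :: letter list, l, post), S1, w1 :: nat multiset), (t1, h2), (t2, h1)).
  (transpose h1 h2 \<circ> joinm S1 t1 t2, (fp N t2 ^^ length (l @ concat post)) h1))"

lemma map_block_split:
 assumes "map (map ety) dss = (b @ a) # ys"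
 obtains db da dys where "dss = (db @ da) # dys" "map ety db = b" "map ety da = a" "map (map ety) dys = ys"
  "db ~= []" "da ~= []"
proof -
 obtain d dys where d: "dss = d # dys" "map ety d = b @ a" "map (map ety) dys = ys" using assms by auto
 then obtain db da where "d = db @ da" "map ety db = b" "map ety da = a" by (metis map_eq_append_conv)
 then show thesis using d ne by (intro that[of db da dys]) auto
qed

lemma length_concat_ety: "map (map ety) dys = ls ==> length (concat ls) = length (concat dys)"
 by (metis length_map map_concat)

lemma Y1_cases:
 assumes "y \<in> Y1"
 obtains k \<kappa> t' da dys db dk where "y = ((k, \<kappa>), t', hd da)" "k \<in># w" "\<kappa> \<in> kap N k"
  "good N S (w - {#k#}) t' (da # dys @ [db, dk])" "map ety da = a" "map (map ety) dys = ys" "map ety db = b"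
  "map ety dk = \<kappa>" "G1 y = (transpose (hd dk) (hd da) \<circ> t', hd db)"
proof -
 obtain k \<kappa> t' h2 where y: "y = ((k, \<kappa>), t', h2)" "k \<in># w" "\<kappa> \<in> kap N k"
  and L: "(t', h2) \<in> Lab N S (w - {#k#}) (a # ys @ [b, \<kappa>])" using assms by (auto simp: Y1_def)
 obtain dss where dss: "good N S (w - {#k#}) t' dss" "map (map ety) dss = a # ys @ [b, \<kappa>]" "h2 = hd (hd dss)"
  using LabE[OF L] .
 obtain da dys db dk where d: "dss = da # dys @ [db, dk]" "map ety da = a" "map (map ety) dys = ys"
  "map ety db = b" "map ety dk = \<kappa>" using dss(2) by (auto simp: map_eq_Cons_conv map_eq_append_conv)
 note gd = goodD[OF dss(1)[unfolded d(1)]]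
 have nd: "da ~= []" "db ~= []" "dk ~= []" using gd(9) by auto
 have l: "length (a @ concat ys) = length (da @ concat dys)"
  "length (a @ concat ys @ b) = length (da @ concat dys @ db)"
  using d length_concat_ety[OF d(3)] by auto
 have c: "cyc (fp N t') ((da @ concat dys) @ db @ dk)" "cyc (fp N t') ((da @ concat dys @ db) @ dk)"
  using gd(6) by simp_all
 have "(fp N t' ^^ length (da @ concat dys)) (hd da) = hd db"
  using cyc_funpow_block[OF c(1)] nd by simp
 moreover have "(fp N t' ^^ length (da @ concat dys @ db)) (hd da) = hd dk"
  using cyc_funpow_block[OF c(2)] nd by simp
 ultimately have "G1 y = (transpose (hd dk) (hd da) \<circ> t', hd db)"
  unfolding y(1) G1_def dss(3) d(1) by (simp only: prod.case l list.sel)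
 then show thesis using that y d dss by simp
qed

lemma Y1_glue:
 assumes "y \<in> Y1" "y = ((k, \<kappa>), t', hd da)" "k \<in># w" "\<kappa> \<in> kap N k"
  "good N S (w - {#k#}) t' (da # dys @ [db, dk])" "map ety dk = \<kappa>"
  "G1 y = (t, r)" "G1 y = (transpose (hd dk) (hd da) \<circ> t', hd db)"
 shows "good N S w t ((db @ da) # dys)" "t (hd da) = hd dk" "hd dk \<notin> set (concat ((db @ da) # dys))"
  "transpose (hd dk) (hd da) \<circ> t = t'" "r = hd db"
proof -
 have t: "t = transpose (hd dk) (hd da) \<circ> t'" "r = hd db" using assms(7,8) by auto
 have kap: "map ety dk \<in> kap N k" using assms by simp
 note gl = glue_inner_face[OF N fin assms(5) kap refl refl t(1)]
 show "good N S w t ((db @ da) # dys)" using gl(1) assms(3) by simp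
 show "t (hd da) = hd dk" "hd dk \<notin> set (concat ((db @ da) # dys))" "transpose (hd dk) (hd da) \<circ> t = t'" "r = hd db"
  using gl(2-4) t(2) by blast+
qed

text \<open>The gluing can be undone: the root determines the blocks, the arc at the beginning of
  \<open>da\<close> is removed, the orbit of the result shows \<kappa>, and \<kappa> determines its
  index.\<close>

lemma G1_inj: "inj_on G1 Y1"
proof (rule inj_onI)
 fix y z assume y: "y \<in> Y1" and z: "z \<in> Y1" and eq: "G1 y = G1 z"
 obtain t r where tr: "G1 y = (t, r)" by (cases "G1 y")
 then have tr': "G1 z = (t, r)" using eq by simp
 obtain k \<kappa> t' da dys db dk where 1: "y = ((k, \<kappa>), t', hd da)" "k \<in># w" "\<kappa> \<in> kap N k"
  "good N S (w - {#k#}) t' (da # dys @ [db, dk])" "map ety da = a" "map (map ety) dys = ys" "map ety db = b"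
  "map ety dk = \<kappa>" "G1 y = (transpose (hd dk) (hd da) \<circ> t', hd db)" using Y1_cases[OF y] .
 obtain k2 \<kappa>2 t'2 da2 dys2 db2 dk2 where 2: "z = ((k2, \<kappa>2), t'2, hd da2)" "k2 \<in># w" "\<kappa>2 \<in> kap N k2"
  "good N S (w - {#k2#}) t'2 (da2 # dys2 @ [db2, dk2])" "map ety da2 = a" "map (map ety) dys2 = ys" "map ety db2 = b"
  "map ety dk2 = \<kappa>2" "G1 z = (transpose (hd dk2) (hd da2) \<circ> t'2, hd db2)" using Y1_cases[OF z] .
 note p1 = Y1_glue[OF y 1(1-4,8) tr 1(9)] and p2 = Y1_glue[OF z 2(1-4,8) tr' 2(9)]
 have nd: "db ~= []" "db2 ~= []" "da ~= []" "da2 ~= []" using 1 2 ne by auto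
 have "(db @ da) # dys = (db2 @ da2) # dys2"
  using good_unique[OF p1(1) p2(1)] p1(5) p2(5) 1 2 nd by simp
 moreover have "length db = length db2" using 1 2 by (metis length_map)
 ultimately have e: "db = db2" "da = da2" "dys = dys2" by auto
 then have h: "hd dk = hd dk2" using p1(2) p2(2) by simp
 then have t': "t' = t'2" using p1(4) p2(4) e by simp
 have "cyc (fp N t') (concat (da # dys @ [db, dk]))" "cyc (fp N t') (concat (da # dys @ [db, dk2]))"
  using goodD(6)[OF 1(4)] goodD(6)[OF 2(4)] e t' by simp_all
 then have "concat (da # dys @ [db, dk]) = concat (da # dys @ [db, dk2])"
  by (rule cyc_unique) (use nd in auto)
 then have "\<kappa> = \<kappa>2" using 1 2 by simp
 then have "k = k2" using kap_index 1(3) 2(3) by metis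
 then show "y = z" using 1(1) 2(1) e t' \<open>\<kappa> = \<kappa>2\<close> by simp
qed

lemma Y2_cases:
 assumes "y \<in> Y2"
 obtains S1 w1 t1 t2 da dpre dx dl dpost db where
  "y = (((map (map ety) dpre, map ety dx, map ety dl, map (map ety) dpost), S1, w1), (t1, hd da), (t2, hd dl))"
  "S1 \<subseteq> S" "w1 \<subseteq># w" "good N S1 w1 t1 (da # dpre @ [dx])" "good N (S - S1) (w - w1) t2 (dl # dpost @ [db])"
  "map ety da = a" "map ety db = b" "ys = map (map ety) dpre @ (map ety dx @ map ety dl) # map (map ety) dpost"
  "dx ~= []" "dl ~= []" "G2 y = (transpose (hd dl) (hd da) \<circ> joinm S1 t1 t2, hd db)"
proof -
 obtain pre x l post S1 w1 t1 h2 t2 h1 where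
  y: "y = (((pre, x, l, post), S1, w1), (t1, h2), (t2, h1))" "(pre, x, l, post) \<in> splits ys" "S1 \<subseteq> S" "w1 \<subseteq># w"
  "(t1, h2) \<in> Lab N S1 w1 (a # pre @ [x])" "(t2, h1) \<in> Lab N (S - S1) (w - w1) (l # post @ [b])"
  using assms unfolding Y2_def by auto
 obtain dss1 where d1: "good N S1 w1 t1 dss1" "map (map ety) dss1 = a # pre @ [x]" "h2 = hd (hd dss1)"
  using LabE[OF y(5)] .
 obtain dss2 where d2: "good N (S - S1) (w - w1) t2 dss2" "map (map ety) dss2 = l # post @ [b]" "h1 = hd (hd dss2)"
  using LabE[OF y(6)] .
 obtain da dpre dx where e1: "dss1 = da # dpre @ [dx]" "map ety da = a" "map (map ety) dpre = pre" "map ety dx = x"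
  using d1(2) by (auto simp: map_eq_Cons_conv map_eq_append_conv)
 obtain dl dpost db where e2: "dss2 = dl # dpost @ [db]" "map ety dl = l" "map (map ety) dpost = post" "map ety db = b"
  using d2(2) by (auto simp: map_eq_Cons_conv map_eq_append_conv)
 note g2 = goodD[OF d2(1)[unfolded e2(1)]]
 have nd: "dl ~= []" "db ~= []" using g2(9) by auto
 have "length (l @ concat post) = length (dl @ concat dpost)"
  using e2 length_concat_ety[OF e2(3)] by auto
 moreover have "(fp N t2 ^^ length (dl @ concat dpost)) (hd dl) = hd db"
  using cyc_funpow_block[of "fp N t2" "dl @ concat dpost" db] g2(6) nd by simp
 ultimately have G: "G2 y = (transpose (hd dl) (hd da) \<circ> joinm S1 t1 t2, hd db)"
  unfolding y(1) G2_def d1(3) d2(3) e1(1) e2(1) by (simp only: prod.case list.sel)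
 show thesis
 proof (rule that[of dpre dx dl dpost S1 w1 t1 da t2 db])
  show "y = (((map (map ety) dpre, map ety dx, map ety dl, map (map ety) dpost), S1, w1), (t1, hd da), (t2, hd dl))"
   using y(1) d1 d2 e1 e2 by simp
  show "ys = map (map ety) dpre @ (map ety dx @ map ety dl) # map (map ety) dpost" "dx ~= []"
   using y(2) e1 e2 by (auto simp: splits_def)
  show "good N S1 w1 t1 (da # dpre @ [dx])" "good N (S - S1) (w - w1) t2 (dl # dpost @ [db])"
   using d1 d2 e1 e2 by simp_all
 qed (use y e1 e2 nd G in auto)
qed

text \<open>The chain condition on \<open>ys\<close> makes the two ends compatible: the letter of
  \<open>hd dl\<close> continues that of \<open>last dx\<close>, while the letter of
  \<open>hd da\<close> follows it around the vertex, and these two differ by a flip.\<close>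

lemma Y2_glue:
 assumes S1: "S1 \<subseteq> S" and w1: "w1 \<subseteq># w" and g1: "good N S1 w1 t1 (da # dpre @ [dx])"
  and g2: "good N (S - S1) (w - w1) t2 (dl # dpost @ [db])" and nd: "dx ~= []" "dl ~= []"
  and mem: "map ety dx @ map ety dl \<in> set ys"
  and t: "t = transpose (hd dl) (hd da) \<circ> joinm S1 t1 t2"
 shows "good N S w t ((db @ da) # dpre @ (dx @ dl) # dpost)" "t (hd da) = hd dl"
  "transpose (hd dl) (hd da) \<circ> t = joinm S1 t1 t2"
  "restr S1 (joinm S1 t1 t2) = t1" "restr (S - S1) (joinm S1 t1 t2) = t2"
  "vert (joinm S1 t1 t2 e) \<in> S1 \<longleftrightarrow> vert e \<in> S1"
proof -
 have fS: "finite S1" "finite (S - S1)" "S1 \<inter> (S - S1) = {}" "S1 \<union> (S - S1) = S" using S1 fin finite_subset by auto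
 have "chain N (map ety dx @ map ety dl)" using ch mem by blast
 then have "ety (hd dl) = lk N (ety (last dx))"
  using nd by (simp add: chain_def successively_append_iff hd_map last_map)
 moreover have "ety (hd da) = nxt N (ety (last dx))"
  using reading_closing[OF N fS(1) goodD(1,4)[OF g1]] by simp
 ultimately have lab: "ety (hd dl) = flip (ety (hd da))" by (simp add: lk_def)
 note gl = glue_disjoint[OF N fS(1-3) g1 g2 refl refl lab refl t]
 show "good N S w t ((db @ da) # dpre @ (dx @ dl) # dpost)" using gl(1) w1 fS(4) by simp
 show "t (hd da) = hd dl" "transpose (hd dl) (hd da) \<circ> t = joinm S1 t1 t2"
  "restr S1 (joinm S1 t1 t2) = t1" "restr (S - S1) (joinm S1 t1 t2) = t2"
  "vert (joinm S1 t1 t2 e) \<in> S1 \<longleftrightarrow> vert e \<in> S1" using gl(2-6) by blast+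
qed

lemma G2_inj: "inj_on G2 Y2"
proof (rule inj_onI)
 fix y z assume y: "y \<in> Y2" and z: "z \<in> Y2" and eq: "G2 y = G2 z"
 obtain t r where tr: "G2 y = (t, r)" by (cases "G2 y")
 obtain S1 w1 t1 t2 da dpre dx dl dpost db where 1:
  "y = (((map (map ety) dpre, map ety dx, map ety dl, map (map ety) dpost), S1, w1), (t1, hd da), (t2, hd dl))"
  "S1 \<subseteq> S" "w1 \<subseteq># w" "good N S1 w1 t1 (da # dpre @ [dx])" "good N (S - S1) (w - w1) t2 (dl # dpost @ [db])"
  "map ety da = a" "map ety db = b" "ys = map (map ety) dpre @ (map ety dx @ map ety dl) # map (map ety) dpost"
  "dx ~= []" "dl ~= []" "G2 y = (transpose (hd dl) (hd da) \<circ> joinm S1 t1 t2, hd db)" using Y2_cases[OF y] .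
 obtain S1' w1' t1' t2' da' dpre' dx' dl' dpost' db' where 2:
  "z = (((map (map ety) dpre', map ety dx', map ety dl', map (map ety) dpost'), S1', w1'), (t1', hd da'), (t2', hd dl'))"
  "S1' \<subseteq> S" "w1' \<subseteq># w" "good N S1' w1' t1' (da' # dpre' @ [dx'])" "good N (S - S1') (w - w1') t2' (dl' # dpost' @ [db'])"
  "map ety da' = a" "map ety db' = b" "ys = map (map ety) dpre' @ (map ety dx' @ map ety dl') # map (map ety) dpost'"
  "dx' ~= []" "dl' ~= []" "G2 z = (transpose (hd dl') (hd da') \<circ> joinm S1' t1' t2', hd db')" using Y2_cases[OF z] .
 have t: "t = transpose (hd dl) (hd da) \<circ> joinm S1 t1 t2" "r = hd db" using tr 1(11) by auto
 have t2: "t = transpose (hd dl') (hd da') \<circ> joinm S1' t1' t2'" "r = hd db'" using tr 2(11) eq by auto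
 have m: "map ety dx @ map ety dl \<in> set ys" "map ety dx' @ map ety dl' \<in> set ys" using 1(8) 2(8) by (metis in_set_conv_decomp)+
 note p1 = Y2_glue[OF 1(2-5,9,10) m(1) t(1)] and p2 = Y2_glue[OF 2(2-5,9,10) m(2) t2(1)]
 have nd: "db ~= []" "db' ~= []" "da ~= []" "da' ~= []" using 1 2 ne by auto
 have ml: "map (map ety) (dpre @ (dx @ dl) # dpost) = ys" "map (map ety) (dpre' @ (dx' @ dl') # dpost') = ys"
  using 1(8) 2(8) by simp_all
 have "(db @ da) # dpre @ (dx @ dl) # dpost = (db' @ da') # dpre' @ (dx' @ dl') # dpost'"
  using good_unique[OF p1(1) p2(1)] t(2) t2(2) ml 1(6,7) 2(6,7) nd by simp
 moreover have "length db = length db'" using 1 2 by (metis length_map)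
 ultimately have e: "db = db'" "da = da'" "dpre @ (dx @ dl) # dpost = dpre' @ (dx' @ dl') # dpost'" by auto
 \<comment> \<open>The partner of \<open>hd da\<close> marks the place of the split, and an end
   occurs only once on the boundary orbit.\<close>
 have h: "hd dl = hd dl'" using p1(2) p2(2) e by simp
 have dist: "distinct (concat (dpre @ (dx @ dl) # dpost))" using goodD(7)[OF p1(1)] by simp
 have e2: "dpre = dpre'" "dx = dx'" "dl = dl'" "dpost = dpost'"
  using split_position_unique[OF dist refl e(3) 1(10) 2(10) h] by auto
 have J: "joinm S1 t1 t2 = joinm S1' t1' t2'" using p1(3) p2(3) h e by simp
 define t0 where "t0 = joinm S1 t1 t2"
 \<comment> \<open>The vertex set of the first part is recovered as the component of the end
   \<open>hd da\<close>; the inclusion is used in both directions.\<close>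
 have sub: "A \<subseteq> B" if A: "A \<subseteq> S" "good N A u (restr A t0) (da # ds)"
  and B: "good N B u' (restr B t0) (da # ds')" "\<And>e. vert (t0 e) \<in> B \<longleftrightarrow> vert e \<in> B" for A B u u' ds ds'
 proof
  fix v assume v: "v \<in> A"
  have "hd da \<in> bnd N A (restr A t0)" "hd da \<in> bnd N B (restr B t0)"
   using goodD(10)[OF A(2)] goodD(10)[OF B(1)] by auto
  then have hA: "vert (hd da) \<in> A" "vert (hd da) \<in> B" by (auto simp: bnd_def ends_def)
  have "adj (restr A t0) \<subseteq> adj t0 \<union> Id" unfolding adj_def restr_def by auto
  then have "adj (restr A t0) \<subseteq> (adj t0)\<^sup>*" by fastforce
  then have "(adj (restr A t0))\<^sup>* \<subseteq> (adj t0)\<^sup>*" by (rule rtrancl_subset_rtrancl)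
  moreover have "(vert (hd da), v) \<in> (adj (restr A t0))\<^sup>*"
   using goodD(2)[OF A(2)] hA v by (simp add: conn_def)
  ultimately have "(vert (hd da), v) \<in> (adj t0)\<^sup>*" by (rule subsetD)
  then show "v \<in> B" using restr_connected[OF B(2) _ hA(2)] by blast
 qed
 have r1: "restr S1 t0 = t1" "restr S1' t0 = t1'" using p1(4) p2(4) unfolding t0_def J by simp_all
 have "S1 \<subseteq> S1'"
  by (rule sub[OF 1(2) 1(4)[folded r1(1)] 2(4)[folded r1(2) e(2)]]) (unfold t0_def J, rule p2(6))
 moreover have "S1' \<subseteq> S1"
  by (rule sub[OF 2(2) 2(4)[folded r1(2) e(2)] 1(4)[folded r1(1)]]) (unfold t0_def, rule p1(6))
 ultimately have S: "S1 = S1'" by blast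
 then have tt: "t1 = t1'" "t2 = t2'" using r1 p1(5) p2(5) unfolding t0_def J by simp_all
 have fS1: "finite S1" using 1(2) fin by (rule finite_subset)
 have "w1 = w1'" using good_weight_unique[OF N fS1 1(4)] 2(4) e(2) e2 S tt by simp
 then show "y = z" using 1(1) 2(1) e(2) e2 S tt h by simp
qed

text \<open>The arc at the junction of \<open>b\<close> and \<open>a\<close> is cut. The two cases
  are whether or not its other end lies on the boundary orbit.\<close>

lemma Lab_cut: "Lab N S w ((b @ a) # ys) = G1 ` Y1 \<union> G2 ` Y2"
proof (intro equalityI subsetI)
 fix p assume "p \<in> Lab N S w ((b @ a) # ys)"
 then obtain t r where p: "p = (t, r)" and L: "(t, r) \<in> Lab N S w ((b @ a) # ys)" by (cases p) auto
 obtain dss where dss: "good N S w t dss" "map (map ety) dss = (b @ a) # ys" "r = hd (hd dss)" using LabE[OF L] .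
 obtain db da dys where d: "dss = (db @ da) # dys" "map ety db = b" "map ety da = a" "map (map ety) dys = ys"
  "db ~= []" "da ~= []" using map_block_split[OF dss(2)] .
 have good: "good N S w t ((db @ da) # dys)" using dss(1) d(1) by simp
 have r: "r = hd db" using dss(3) d by simp
 let ?h2 = "hd da" and ?h1 = "t (hd da)"
 let ?t' = "transpose ?h1 ?h2 \<circ> t"
 have undo: "transpose ?h1 ?h2 \<circ> ?t' = t" by (auto simp: fun_eq_iff)
 show "p \<in> G1 ` Y1 \<union> G2 ` Y2"
 proof (cases "?h1 \<in> set (concat ((db @ da) # dys))")
  case False
  obtain k w' dk where c: "w = add_mset k w'" "map ety dk \<in> kap N k" "hd dk = ?h1"
   "good N S w' ?t' (da # dys @ [db, dk])"
   using cut_inner_face[OF N fin good d(6,5) refl refl False refl] .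
  let ?y = "((k, map ety dk), ?t', ?h2)"
  have "(?t', ?h2) \<in> Lab N S (w - {#k#}) (a # ys @ [b, map ety dk])"
   by (rule LabI[of _ _ _ _ "da # dys @ [db, dk]"]) (use c d in auto)
  moreover have "k \<in># w" using c(1) by simp
  ultimately have y: "?y \<in> Y1" unfolding Y1_def using c(2) by simp
  obtain k2 \<kappa>2 t'2 da2 dys2 db2 dk2 where 2: "?y = ((k2, \<kappa>2), t'2, hd da2)" "k2 \<in># w" "\<kappa>2 \<in> kap N k2"
   "good N S (w - {#k2#}) t'2 (da2 # dys2 @ [db2, dk2])" "map ety da2 = a" "map (map ety) dys2 = ys" "map ety db2 = b"
   "map ety dk2 = \<kappa>2" "G1 ?y = (transpose (hd dk2) (hd da2) \<circ> t'2, hd db2)" using Y1_cases[OF y] .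
  have eqs: "t'2 = ?t'" "hd da2 = ?h2" "\<kappa>2 = map ety dk" using 2(1) unfolding prod.inject by metis+
  have "da # dys @ [db, dk] = da2 # dys2 @ [db2, dk2]"
   by (rule good_unique[OF c(4) 2(4)[unfolded eqs(1)]]) (use eqs 2(5-8) d in simp_all)
  then have "dk = dk2" "db = db2" by simp_all
  then have "G1 ?y = (t, r)" unfolding 2(9) eqs(1,2) using undo r c(3) by simp
  then show ?thesis using y p by (metis UnI1 image_eqI)
 next
  case True
  obtain dpre dx dl dpost where c: "dys = dpre @ (dx @ dl) # dpost" "dx ~= []" "dl ~= []" "hd dl = ?h1"
   using arc_return_block[OF N fin good d(6,5) refl refl True] .
  obtain S1 w1 w2 where k: "S1 \<subseteq> S" "w = w1 + w2"
   "good N S1 w1 (restr S1 ?t') (da # dpre @ [dx])" "good N (S - S1) w2 (restr (S - S1) ?t') (dl # dpost @ [db])"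
   "joinm S1 (restr S1 ?t') (restr (S - S1) ?t') = ?t'" "ety ?h1 = flip (ety ?h2)"
   using cut_disjoint[OF N fin good[unfolded c(1)] d(6,5) c(2,3) refl refl c(4)[symmetric] refl] .
  let ?s = "(map (map ety) dpre, map ety dx, map ety dl, map (map ety) dpost)"
  let ?y = "((?s, S1, w1), (restr S1 ?t', ?h2), (restr (S - S1) ?t', ?h1))"
  have s: "?s \<in> splits ys" using c d(4) by (auto simp: splits_def)
  have "(restr S1 ?t', ?h2) \<in> Lab N S1 w1 (a # map (map ety) dpre @ [map ety dx])"
   by (rule LabI[OF k(3)]) (use d in auto)
  moreover have "(restr (S - S1) ?t', ?h1) \<in> Lab N (S - S1) (w - w1) (map ety dl # map (map ety) dpost @ [b])"
   by (rule LabI[of _ _ _ _ "dl # dpost @ [db]"]) (use k d c in auto)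
  moreover have "w1 \<subseteq># w" using k(2) by simp
  ultimately have y: "?y \<in> Y2" unfolding Y2_def using s k(1) by simp
  have c2: "cyc (fp N (restr (S - S1) ?t')) ((dl @ concat dpost) @ db)" using goodD(6)[OF k(4)] by simp
  have "length (map ety dl @ concat (map (map ety) dpost)) = length (dl @ concat dpost)"
   using length_concat_ety[OF refl, of dpost] by simp
  then have "G2 ?y = (t, r)"
   unfolding G2_def using cyc_funpow_block[OF c2] c d(5) k(5) undo r by simp
  then show ?thesis using y p by (metis UnI2 image_eqI)
 qed
next
 fix p assume "p \<in> G1 ` Y1 \<union> G2 ` Y2"
 then consider y where "y \<in> Y1" "p = G1 y" | y where "y \<in> Y2" "p = G2 y" by blast
 then show "p \<in> Lab N S w ((b @ a) # ys)"
 proof cases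
  case 1
  obtain k \<kappa> t' da dys db dk where 2: "y = ((k, \<kappa>), t', hd da)" "k \<in># w" "\<kappa> \<in> kap N k"
   "good N S (w - {#k#}) t' (da # dys @ [db, dk])" "map ety da = a" "map (map ety) dys = ys" "map ety db = b"
   "map ety dk = \<kappa>" "G1 y = (transpose (hd dk) (hd da) \<circ> t', hd db)" using Y1_cases[OF 1(1)] .
  have "db ~= []" using 2 ne by auto
  then show ?thesis
   unfolding 1(2) 2(9) using Y1_glue(1)[OF 1(1) 2(1-4,8) 2(9) 2(9)] 2 by (intro LabI) auto
 next
  case 2
  obtain S1 w1 t1 t2 da dpre dx dl dpost db where 1:
   "y = (((map (map ety) dpre, map ety dx, map ety dl, map (map ety) dpost), S1, w1), (t1, hd da), (t2, hd dl))"
   "S1 \<subseteq> S" "w1 \<subseteq># w" "good N S1 w1 t1 (da # dpre @ [dx])" "good N (S - S1) (w - w1) t2 (dl # dpost @ [db])"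
   "map ety da = a" "map ety db = b" "ys = map (map ety) dpre @ (map ety dx @ map ety dl) # map (map ety) dpost"
   "dx ~= []" "dl ~= []" "G2 y = (transpose (hd dl) (hd da) \<circ> joinm S1 t1 t2, hd db)" using Y2_cases[OF 2(1)] .
  have m: "map ety dx @ map ety dl \<in> set ys" using 1(8) by (metis in_set_conv_decomp)
  have "db ~= []" using 1 ne by auto
  then show ?thesis
   unfolding 2(2) 1(11) using Y2_glue(1)[OF 1(2-5,9,10) m refl] 1(6-8) by (intro LabI) auto
 qed
qed

text \<open>The partner of \<open>hd da\<close> is off the boundary orbit for a graph in the first
  image and on it for one in the second.\<close>

lemma Lab_cut_disjoint: "G1 ` Y1 \<inter> G2 ` Y2 = {}"
proof (rule ccontr)
 assume "G1 ` Y1 \<inter> G2 ` Y2 ~= {}"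
 then obtain y z where y: "y \<in> Y1" and z: "z \<in> Y2" and eq: "G1 y = G2 z" by blast
 obtain t r where tr: "G1 y = (t, r)" by (cases "G1 y")
 obtain k \<kappa> t' da dys db dk where 2: "y = ((k, \<kappa>), t', hd da)" "k \<in># w" "\<kappa> \<in> kap N k"
  "good N S (w - {#k#}) t' (da # dys @ [db, dk])" "map ety da = a" "map (map ety) dys = ys" "map ety db = b"
  "map ety dk = \<kappa>" "G1 y = (transpose (hd dk) (hd da) \<circ> t', hd db)" using Y1_cases[OF y] .
 obtain S1 w1 t1 t2 da' dpre dx dl dpost db' where 1:
  "z = (((map (map ety) dpre, map ety dx, map ety dl, map (map ety) dpost), S1, w1), (t1, hd da'), (t2, hd dl))"
  "S1 \<subseteq> S" "w1 \<subseteq># w" "good N S1 w1 t1 (da' # dpre @ [dx])" "good N (S - S1) (w - w1) t2 (dl # dpost @ [db'])"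
  "map ety da' = a" "map ety db' = b" "ys = map (map ety) dpre @ (map ety dx @ map ety dl) # map (map ety) dpost"
  "dx ~= []" "dl ~= []" "G2 z = (transpose (hd dl) (hd da') \<circ> joinm S1 t1 t2, hd db')" using Y2_cases[OF z] .
 have m: "map ety dx @ map ety dl \<in> set ys" using 1(8) by (metis in_set_conv_decomp)
 have t: "t = transpose (hd dl) (hd da') \<circ> joinm S1 t1 t2" "r = hd db'" using tr 1(11) eq by auto
 note p1 = Y1_glue[OF y 2(1-4,8) tr 2(9)] and p2 = Y2_glue[OF 1(2-5,9,10) m t(1)]
 have nd: "db ~= []" "db' ~= []" using 1 2 ne by auto
 have "map (map ety) (dpre @ (dx @ dl) # dpost) = ys" using 1(8) by simp
 then have e: "(db @ da) # dys = (db' @ da') # dpre @ (dx @ dl) # dpost"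
  using good_unique[OF p1(1) p2(1)] p1(5) t(2) 1(6,7) 2(5-7) nd by simp
 moreover have "length db = length db'" using 1 2 by (metis length_map)
 ultimately have "da = da'" by auto
 then have "hd dk = hd dl" using p1(2) p2(2) by simp
 moreover have "hd dl \<in> set (concat ((db' @ da') # dpre @ (dx @ dl) # dpost))" using 1(10) by simp
 ultimately show False using p1(3) unfolding e by simp
qed

theorem labelled_cut:
 "card (Lab N S w ((b @ a) # ys)) =
  (\<Sum>(k, \<kappa>)\<in>(SIGMA k:set_mset w. kap N k). card (Lab N S (w - {#k#}) (a # ys @ [b, \<kappa>]))) +
  (\<Sum>((pre, x, l, post), S1, w1)\<in>splits ys \<times> Pow S \<times> {w1. w1 \<subseteq># w}.
   card (Lab N S1 w1 (a # pre @ [x])) * card (Lab N (S - S1) (w - w1) (l # post @ [b])))"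
proof -
 have finL: "finite (Lab N A u ls)" if "A \<subseteq> S" for A u ls
  using that fin by (intro finite_Lab) (rule finite_subset)
 have f1: "finite (SIGMA k:set_mset w. kap N k)" by simp
 have "finite {w1. w1 \<subseteq># w}" by (rule finite_submultisets)
 then have f2: "finite (splits ys \<times> Pow S \<times> {w1. w1 \<subseteq># w})" using fin by simp
 have Y1: "card Y1 = (\<Sum>(k, \<kappa>)\<in>(SIGMA k:set_mset w. kap N k). card (Lab N S (w - {#k#}) (a # ys @ [b, \<kappa>])))"
  unfolding Y1_def using f1 finL by (subst card_SigmaI) (auto intro!: sum.cong)
 have Y2: "card Y2 = (\<Sum>((pre, x, l, post), S1, w1)\<in>splits ys \<times> Pow S \<times> {w1. w1 \<subseteq># w}.
   card (Lab N S1 w1 (a # pre @ [x])) * card (Lab N (S - S1) (w - w1) (l # post @ [b])))"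
  unfolding Y2_def using f2 finL by (subst card_SigmaI) (auto intro!: sum.cong simp: card_cartesian_product)
 have fY: "finite Y1" "finite Y2"
  unfolding Y1_def Y2_def using f1 f2 finL by (auto intro!: finite_SigmaI)
 show ?thesis
  unfolding Lab_cut Y1[symmetric] Y2[symmetric]
  using fY Lab_cut_disjoint by (simp add: card_Un_disjoint card_image G1_inj G2_inj)
qed

end

section \<open>Renaming vertices\<close>

definition relab :: "(nat => nat) => (edge_end => edge_end) \<times> edge_end => (edge_end => edge_end) \<times> edge_end" where
 "relab \<pi> p = (rename_end \<pi> \<circ> fst p \<circ> inv (rename_end \<pi>), rename_end \<pi> (snd p))"

lemma vert_rename [simp]: "vert (rename_end \<pi> e) = \<pi> (vert e)"
 by (cases e) auto

lemma ety_rename [simp]: "ety (rename_end \<pi> e) = ety e"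
 by (cases e) auto

lemma sg_rename: "sg N (rename_end \<pi> e) = rename_end \<pi> (sg N e)"
 by (cases e) auto

lemma rename_comp: "rename_end (\<pi> \<circ> \<pi>') = rename_end \<pi> \<circ> rename_end \<pi>'"
proof
 fix e show "rename_end (\<pi> \<circ> \<pi>') e = (rename_end \<pi> \<circ> rename_end \<pi>') e" by (cases e) auto
qed

lemma rename_id: "rename_end id = id"
proof
 fix e show "rename_end id e = id e" by (cases e) auto
qed

lemma bij_rename: "bij \<pi> ==> bij (rename_end \<pi>)"
 by (rule o_bij[of "rename_end (inv \<pi>)"])
  (simp_all add: rename_comp[symmetric] bij_is_inj bij_is_surj surj_iff[THEN iffD1] rename_id)

lemma rename_ends:
 assumes "bij \<pi>"
 shows "rename_end \<pi> ` ends N S = ends N (\<pi> ` S)"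
proof (intro equalityI subsetI)
 fix e assume "e \<in> ends N (\<pi> ` S)"
 moreover obtain e' where "e = rename_end \<pi> e'" using bij_rename[OF assms] by (metis bij_pointE)
 ultimately have "e' \<in> ends N S" using assms by (auto simp: ends_def bij_is_inj inj_image_mem_iff)
 then show "e \<in> rename_end \<pi> ` ends N S" using \<open>e = rename_end \<pi> e'\<close> by blast
qed (auto simp: ends_def)

lemma relab_comp:
 assumes "bij \<pi>" "bij \<pi>'"
 shows "relab \<pi> (relab \<pi>' p) = relab (\<pi> \<circ> \<pi>') p"
 using assms by (simp add: relab_def rename_comp o_inv_distrib bij_rename comp_assoc)

lemma relab_id: "relab id p = p"
 by (simp add: relab_def rename_id)

lemma face_wt_rename:
 assumes "face_wt N X k"
 shows "face_wt N (rename_end \<pi> ` X) k"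
proof -
 consider v where "k \<in> {1..N}" "X = {In v k}" | f where "k = N + 1" "X = (\<lambda>i. Out (f i) i) ` {1..N}"
  using assms unfolding face_wt_def by blast
 then show ?thesis
 proof cases
  case 2
  then have "rename_end \<pi> ` X = (\<lambda>i. Out ((\<pi> \<circ> f) i) i) ` {1..N}" by (simp add: image_image)
  then show ?thesis unfolding face_wt_def using 2(1) by blast
 qed (simp add: face_wt_def)
qed

lemma weighted_rename:
 assumes "inj (rename_end \<pi>)" "weighted N w F"
 shows "weighted N w ((`) (rename_end \<pi>) ` F)"
proof -
 let ?\<rho> = "rename_end \<pi>"
 obtain g where g: "\<forall>X\<in>F. face_wt N X (g X)" "w = image_mset g (mset_set F)"
  using assms(2) unfolding weighted_def by blast
 let ?g = "\<lambda>Y. g (?\<rho> -` Y)"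
 have v: "?\<rho> -` (?\<rho> ` X) = X" for X using assms(1) by (simp add: inj_vimage_image_eq)
 have "inj_on ((`) ?\<rho>) F" by (rule inj_onI) (metis v)
 then have "image_mset ?g (mset_set ((`) ?\<rho> ` F)) = image_mset ?g (image_mset ((`) ?\<rho>) (mset_set F))"
  by (simp add: image_mset_mset_set)
 also have "\<dots> = w" using g(2) by (simp add: v comp_def image_mset.compositionality)
 finally have "w = image_mset ?g (mset_set ((`) ?\<rho> ` F))" by simp
 moreover have "\<forall>Y\<in>(`) ?\<rho> ` F. face_wt N Y (?g Y)" using g(1) v face_wt_rename by auto
 ultimately show ?thesis unfolding weighted_def by (intro exI[of _ ?g] conjI)
qed

lemma good_rename:
 assumes "bij \<pi>" "good N S w t dss"
 defines "\<rho> \<equiv> rename_end \<pi>"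
 shows "good N (\<pi> ` S) w (\<rho> \<circ> t \<circ> inv \<rho>) (map (map \<rho>) dss)"
proof -
 note gd = goodD[OF assms(2)]
 have b: "bij \<rho>" unfolding \<rho>_def by (rule bij_rename[OF assms(1)])
 have inj: "inj \<rho>" using b by (rule bij_is_inj)
 have surj: "\<exists>e'. e = \<rho> e'" for e using b by (metis bij_pointE)
 define t' where "t' = \<rho> \<circ> t \<circ> inv \<rho>"
 have t': "t' (\<rho> e) = \<rho> (t e)" for e by (simp add: t'_def inj)
 have E: "ends N (\<pi> ` S) = \<rho> ` ends N S" unfolding \<rho>_def by (rule rename_ends[OF assms(1), symmetric])
 have memE: "\<rho> e \<in> ends N (\<pi> ` S) \<longleftrightarrow> e \<in> ends N S" for e unfolding E using inj by (rule inj_image_mem_iff)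
 have ety: "ety (\<rho> e) = ety e" and vert: "vert (\<rho> e) = \<pi> (vert e)" for e by (simp_all add: \<rho>_def)
 have eq: "\<rho> x = \<rho> y \<longleftrightarrow> x = y" for x y using inj by (simp add: inj_eq)
 have gm: "gmap N (\<pi> ` S) t'"
  unfolding gmap_def
 proof (intro conjI allI impI)
  fix e
  obtain e' where e: "e = \<rho> e'" using surj by blast
  show "t' (t' e) = e" unfolding e t' using gmap_involution[OF gd(1)] by simp
  assume "t' e ~= e"
  then have "t e' ~= e'" unfolding e t' eq .
  from gmap_moved[OF gd(1) this] show "e \<in> ends N (\<pi> ` S)" "ety (t' e) = flip (ety e)"
   unfolding e t' memE ety by blast+
 qed
 have fp: "fp N t' (\<rho> e) = \<rho> (fp N t e)" for e
  using t' sg_rename[of N \<pi>] by (simp add: fp_def \<rho>_def)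
 have F: "faces (fp N t') (ends N (\<pi> ` S)) = (`) \<rho> ` faces (fp N t) (ends N S)"
  unfolding E by (rule faces_image[where f = "fp N t", OF b fp])
 have inj2: "inj_on ((`) \<rho>) A" for A using inj by (simp add: inj_on_def inj_image_eq_iff)
 have cn: "conn (\<pi> ` S) t'"
 proof -
  have "(\<pi> u, \<pi> v) \<in> (adj t')\<^sup>*" if "(u, v) \<in> (adj t)\<^sup>*" for u v
   using that
  proof induction
   case (step y z)
   then obtain e where "y = vert e" "z = vert (t e)" by (auto simp: adj_def)
   then have "(\<pi> y, \<pi> z) \<in> adj t'" using adjI[of "\<rho> e" t'] by (simp add: t' vert)
   with step.IH show ?case by (rule rtrancl_into_rtrancl)
  qed simp
  then show ?thesis using gd(2) by (auto simp: conn_def)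
 qed
 have A: "arcs_of t' = \<rho> ` arcs_of t"
 proof (intro equalityI subsetI)
  fix e assume e: "e \<in> arcs_of t'"
  obtain e' where e': "e = \<rho> e'" using surj by blast
  then have "e' \<in> arcs_of t" using e unfolding arcs_of_def mem_Collect_eq e' t' eq ety by blast
  then show "e \<in> \<rho> ` arcs_of t" using e' by blast
 qed (auto simp: arcs_of_def t' eq ety)
 have B: "bnd N (\<pi> ` S) t' = \<rho> ` bnd N S t"
 proof (intro equalityI subsetI)
  fix e assume e: "e \<in> bnd N (\<pi> ` S) t'"
  obtain e' where e': "e = \<rho> e'" using surj by blast
  then have "e' \<in> bnd N S t" using e unfolding bnd_def mem_Collect_eq e' t' eq memE by blast
  then show "e \<in> \<rho> ` bnd N S t" using e' by blast
 qed (auto simp: bnd_def t' memE)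
 have C: "cyc (fp N t') (map \<rho> (concat dss))" using gd(6) inj fp by (rule cyc_map)
 have "map hd (map (map \<rho>) dss) = map \<rho> (map hd dss)" using gd(9) by (simp add: hd_map)
 then have "set (map hd (map (map \<rho>) dss)) = \<rho> ` set (map hd dss)" by (metis set_map)
 then have R: "reading N (\<pi> ` S) t' (map (map \<rho>) dss)"
  unfolding reading_def B using gd(8,9,10) C by (simp add: map_concat)
 have "set (concat (map (map \<rho>) dss)) = \<rho> ` set (concat dss)" by (simp add: map_concat[symmetric])
 then have W: "faces (fp N t') (ends N (\<pi> ` S)) - {set (concat (map (map \<rho>) dss))} =
   (`) \<rho> ` (faces (fp N t) (ends N S) - {set (concat dss)})"
  unfolding F using inj2[of UNIV] by (simp add: image_set_diff)
 have "weighted N w (faces (fp N t') (ends N (\<pi> ` S)) - {set (concat (map (map \<rho>) dss))})"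
  unfolding W by (rule weighted_rename[of \<pi>, folded \<rho>_def, OF inj gd(5)])
 moreover have "card (\<pi> ` S) = card S" using assms(1) by (simp add: card_image bij_is_inj inj_on_subset[OF _ subset_UNIV])
 moreover have "card (faces (fp N t') (ends N (\<pi> ` S))) = card (faces (fp N t) (ends N S))"
  unfolding F by (rule card_image[OF inj2])
 moreover have "card (arcs_of t') = card (arcs_of t)"
  unfolding A using inj by (simp add: card_image inj_on_subset[OF _ subset_UNIV])
 ultimately show ?thesis
  unfolding good_def t'_def[symmetric] using gm cn gd(3) R by simp
qed

lemma relab_Lab:
 assumes "bij \<pi>" "p \<in> Lab N S w ls"
 shows "relab \<pi> p \<in> Lab N (\<pi> ` S) w ls"
proof -
 obtain t dss where p: "p = (t, hd (hd dss))" and g: "good N S w t dss" and l: "map (map ety) dss = ls"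
  using assms(2) by (auto simp: Lab_def)
 have "map (map ety) (map (map (rename_end \<pi>)) dss) = ls" using l by (simp add: comp_def)
 moreover have "hd (hd (map (map (rename_end \<pi>)) dss)) = rename_end \<pi> (hd (hd dss))"
  using goodD(8,9)[OF g] by (simp add: hd_map)
 ultimately show ?thesis unfolding p relab_def fst_conv snd_conv
  by (intro LabI[OF good_rename[OF assms(1) g]]) simp_all
qed

lemma inj_relab: "bij \<pi> ==> inj (relab \<pi>)"
proof (rule injI)
 fix p q assume b: "bij \<pi>" and eq: "relab \<pi> p = relab \<pi> q"
 have "relab (inv \<pi>) (relab \<pi> r) = r" for r
  using b by (simp add: relab_comp bij_imp_bij_inv bij_is_inj relab_id)
 then show "p = q" using eq by metis
qed

text \<open>Relabelling conjugates by a bijection of all vertex names, so a bijection between two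
  vertex sets has to be extended: the rest of their union is matched as well, and everything else is
  fixed.\<close>

lemma exists_bij_image:
 assumes "finite S" "finite S'" "card S = card S'"
 obtains \<pi> :: "'a => 'a" where "bij \<pi>" "\<pi> ` S = S'"
proof -
 let ?T = "S \<union> S'"
 have fT: "finite ?T" using assms by simp
 have "card (?T - S) = card (?T - S')" using assms by (simp add: card_Diff_subset)
 then obtain h' where h': "bij_betw h' (?T - S) (?T - S')"
  using finite_same_card_bij[OF finite_Diff[OF fT] finite_Diff[OF fT]] by metis
 obtain h where h: "bij_betw h S S'" using finite_same_card_bij[OF assms] by metis
 define f where "f = (\<lambda>x. if x \<in> S then h x else if x \<in> ?T then h' x else x)"
 have 1: "bij_betw f S S'" using h bij_betw_cong[of S f h S'] by (simp add: f_def)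
 have 2: "bij_betw f (?T - S) (?T - S')" 
 proof -
  have "f x = h' x" if "x \<in> ?T - S" for x using that by (auto simp: f_def)
  then show ?thesis using bij_betw_cong[of "?T - S" f h' "?T - S'"] h' by blast
 qed
 have "bij_betw f (S \<union> (?T - S)) (S' \<union> (?T - S'))" by (rule bij_betw_combine[OF 1 2]) auto
 moreover have "S \<union> (?T - S) = ?T" "S' \<union> (?T - S') = ?T" by auto
 ultimately have "bij_betw f ?T ?T" by simp
 then have "f permutes ?T" by (rule bij_imp_permutes) (simp add: f_def)
 then have "bij f" by (rule permutes_bij)
 moreover have "f ` S = S'" using 1 by (simp add: bij_betw_def)
 ultimately show thesis by (rule that)
qed

lemma card_Lab_cong:
 assumes "finite S" "finite S'" "card S = card S'"
 shows "card (Lab N S w ls) = card (Lab N S' w ls)"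
proof -
 have le: "card (Lab N S w ls) \<le> card (Lab N S' w ls)" if fS: "finite S" "finite S'" "card S = card S'" for S S'
 proof -
  obtain \<pi> :: "nat => nat" where \<pi>: "bij \<pi>" "\<pi> ` S = S'" using exists_bij_image[OF fS] .
  have "relab \<pi> ` Lab N S w ls \<subseteq> Lab N S' w ls" using relab_Lab[OF \<pi>(1)] \<pi>(2) by blast
  moreover have "inj_on (relab \<pi>) (Lab N S w ls)" using inj_relab[OF \<pi>(1)] by (rule inj_on_subset) simp
  ultimately show ?thesis using finite_Lab[OF fS(2)] by (meson card_inj_on_le)
 qed
 show ?thesis using le[OF assms] le[OF assms(2,1) assms(3)[symmetric]] by simp
qed

section \<open>Isotopy classes\<close>

definition orb :: "nat set => (edge_end => edge_end) \<times> edge_end => ((edge_end => edge_end) \<times> edge_end) set" where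
 "orb S p = (\<lambda>\<pi>. relab \<pi> p) ` {\<pi>. \<pi> permutes S}"

definition orbs :: "nat => nat set => nat multiset => letter list list => ((edge_end => edge_end) \<times> edge_end) set set" where
 "orbs N S w ls = orb S ` Lab N S w ls"

text \<open>A renaming that fixes the root of a connected graph fixes everything reachable from it.\<close>

lemma relab_free:
 assumes "p \<in> Lab N S w ls" "\<pi> permutes S" "\<pi>' permutes S" "relab \<pi> p = relab \<pi>' p"
 shows "\<pi> = \<pi>'"
proof
 fix v
 obtain t dss where p: "p = (t, hd (hd dss))" and g: "good N S w t dss" using assms(1) by (auto simp: Lab_def)
 let ?\<rho> = "rename_end \<pi>" and ?\<rho>' = "rename_end \<pi>'" and ?r = "hd (hd dss)"
 have inj: "inj ?\<rho>" "inj ?\<rho>'" using assms(2,3) by (simp_all add: bij_rename permutes_bij bij_is_inj)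
 have e1: "?\<rho> \<circ> t \<circ> inv ?\<rho> = ?\<rho>' \<circ> t \<circ> inv ?\<rho>'" and e2: "?\<rho> ?r = ?\<rho>' ?r"
  using assms(4) by (simp_all add: relab_def p)
 have "?r \<in> bnd N S t" using goodD(8,10)[OF g] by (metis hd_in_set image_eqI list.set_map)
 then have rS: "vert ?r \<in> S" by (simp add: bnd_def ends_def)
 have "\<pi> u = \<pi>' u" if "(vert ?r, u) \<in> (adj t)\<^sup>*" for u
  using that
 proof induction
  case base
  then show ?case using arg_cong[OF e2, of vert] by simp
 next
  case (step y z)
  then obtain e where e: "y = vert e" "z = vert (t e)" by (auto simp: adj_def)
  have "?\<rho> e = ?\<rho>' e" by (rule edge_end_eqI) (use step.IH e in simp_all)
  moreover have "?\<rho> (t e) = (?\<rho> \<circ> t \<circ> inv ?\<rho>) (?\<rho> e)" using inj(1) by simp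
  moreover have "?\<rho>' (t e) = (?\<rho>' \<circ> t \<circ> inv ?\<rho>') (?\<rho>' e)" using inj(2) by simp
  ultimately have "?\<rho> (t e) = ?\<rho>' (t e)" unfolding e1 by simp
  then have "vert (?\<rho> (t e)) = vert (?\<rho>' (t e))" by (rule arg_cong)
  then show ?case using e by simp
 qed
 then show "\<pi> v = \<pi>' v"
  using goodD(2)[OF g] rS assms(2,3) by (cases "v \<in> S") (simp_all add: conn_def permutes_not_in)
qed

lemma orb_eq:
 assumes "\<pi> permutes S"
 shows "orb S (relab \<pi> p) = orb S p"
proof -
 have sub: "orb S (relab \<pi> p) \<subseteq> orb S p" if "\<pi> permutes S" for \<pi> p
 proof
  fix q assume "q \<in> orb S (relab \<pi> p)"
  then obtain \<sigma> where "\<sigma> permutes S" "q = relab \<sigma> (relab \<pi> p)" by (auto simp: orb_def)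
  then have "q = relab (\<sigma> \<circ> \<pi>) p" "\<sigma> \<circ> \<pi> permutes S"
   using that by (simp_all add: relab_comp permutes_bij permutes_compose)
  then show "q \<in> orb S p" by (auto simp: orb_def)
 qed
 have "relab (inv \<pi>) (relab \<pi> p) = p"
  using assms by (simp add: relab_comp permutes_bij bij_imp_bij_inv permutes_inv_o relab_id)
 then show ?thesis using sub[OF assms, of p] sub[OF permutes_inv[OF assms], of "relab \<pi> p"] by simp
qed

lemma orb_self: "p \<in> orb S p"
 unfolding orb_def by (rule image_eqI[of _ _ id]) (simp_all add: relab_id permutes_id)

lemma orb_subset: "p \<in> Lab N S w ls ==> orb S p \<subseteq> Lab N S w ls"
proof
 fix q assume p: "p \<in> Lab N S w ls" and "q \<in> orb S p"
 then obtain \<pi> where "\<pi> permutes S" "q = relab \<pi> p" by (auto simp: orb_def)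
 then show "q \<in> Lab N S w ls" using relab_Lab[OF permutes_bij p, of \<pi>] by (simp add: permutes_image)
qed

text \<open>The permutations of the vertices act freely, so every orbit has as many elements as
  there are permutations. The orbits represent the isotopy classes.\<close>

lemma card_Lab_orbs:
 assumes "finite S"
 shows "card (Lab N S w ls) = fact (card S) * card (orbs N S w ls)"
proof -
 have un: "\<Union> (orbs N S w ls) = Lab N S w ls"
 proof (intro equalityI subsetI)
  fix q assume "q \<in> \<Union> (orbs N S w ls)"
  then obtain p where "p \<in> Lab N S w ls" "q \<in> orb S p" unfolding orbs_def by blast
  then show "q \<in> Lab N S w ls" using orb_subset[of p N S w ls] by blast
 next
  fix q assume "q \<in> Lab N S w ls"
  then show "q \<in> \<Union> (orbs N S w ls)" using orb_self[of q S] unfolding orbs_def by blast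
 qed
 have "fact (card S) * card (orbs N S w ls) = card (\<Union> (orbs N S w ls))"
 proof (rule card_partition)
  show "finite (orbs N S w ls)" by (simp add: orbs_def finite_Lab assms)
  show "finite (\<Union> (orbs N S w ls))" unfolding un by (rule finite_Lab[OF assms])
  show "card c = fact (card S)" if c: "c \<in> orbs N S w ls" for c
  proof -
   obtain p where p: "p \<in> Lab N S w ls" "c = orb S p" using c unfolding orbs_def by blast
   have "inj_on (\<lambda>\<pi>. relab \<pi> p) {\<pi>. \<pi> permutes S}"
    by (rule inj_onI) (use relab_free[OF p(1)] in blast)
   then show ?thesis unfolding p(2) orb_def
    using card_permutations[OF refl assms] by (simp add: card_image)
  qed
  show "c1 \<inter> c2 = {}" if c: "c1 \<in> orbs N S w ls" "c2 \<in> orbs N S w ls" "c1 ~= c2" for c1 c2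
  proof (rule ccontr)
   assume "c1 \<inter> c2 ~= {}"
   then obtain q where q: "q \<in> c1" "q \<in> c2" by blast
   have orbq: "orb S q = orb S p" if "q \<in> orb S p" for p
    using that orb_eq[of _ S p] unfolding orb_def[of S p] by auto
   obtain p1 p2 where "c1 = orb S p1" "c2 = orb S p2" using c(1,2) unfolding orbs_def by blast
   then show False using orbq[of p1] orbq[of p2] q c(3) by metis
  qed
 qed
 then show ?thesis unfolding un by simp
qed

section \<open>The number of vertices\<close>

text \<open>The number of vertices: each vertex has exactly one corner \<open>U\<^sub>1\<close>,
  which lies either in a petal of weight \<open>\<epsilon>\<^sub>1\<close> or in a boundary region.
  Any other color would serve as well.\<close>

definition nv :: "nat multiset => letter list list => nat" where
 "nv w ls = count w 1 + count_list (concat ls) (False, 1)"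

lemma count_list_map_distinct:
 "distinct xs ==> count_list (map f xs) y = card {x \<in> set xs. f x = y}"
proof (induction xs)
 case (Cons a xs)
 have "{x \<in> set (a # xs). f x = y} = (if f a = y then insert a {x \<in> set xs. f x = y} else {x \<in> set xs. f x = y})"
  by auto
 then show ?case using Cons by simp
qed simp

lemma count_image_mset_set:
 assumes "finite F"
 shows "count (image_mset g (mset_set F)) k = card {X \<in> F. g X = k}"
 using assms
proof (induction F)
 case (insert X F)
 have "{Y \<in> insert X F. g Y = k} = (if g X = k then insert X {Y \<in> F. g Y = k} else {Y \<in> F. g Y = k})" by auto
 then show ?case using insert by simp
qed simp

lemma face_wt_In: "face_wt N X k ==> In v i \<in> X ==> X = {In v i}"
 unfolding face_wt_def by blast

lemma Lab_card:
 assumes N: "N \<ge> 1" and fin: "finite S" and p: "p \<in> Lab N S w ls"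
 shows "card S = nv w ls"
proof -
 obtain t dss where g: "good N S w t dss" and l: "map (map ety) dss = ls" using p by (auto simp: Lab_def)
 note gd = goodD[OF g]
 let ?X = "set (concat dss)" and ?F = "faces (fp N t) (ends N S)"
 obtain h where h: "\<forall>X\<in>?F - {?X}. face_wt N X (h X)" "w = image_mset h (mset_set (?F - {?X}))"
  using gd(5) unfolding weighted_def by blast
 have XF: "?X \<in> ?F" by (rule reading_facesI[OF N fin gd(1,4)])
 let ?A = "{v \<in> S. In v 1 \<in> ?X}" and ?B = "{v \<in> S. {In v 1} \<in> ?F - {?X}}"
 have "S = ?A \<union> ?B"
 proof (intro equalityI subsetI)
  fix v assume v: "v \<in> S"
  then have "In v 1 \<in> ends N S" using N by (simp add: ends_def)
  then obtain X where X: "X \<in> ?F" "In v 1 \<in> X"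
   using faces_cover[OF finite_ends[OF fin] fp_inj_on[OF gd(1)] fp_ends_image[OF N gd(1)]] by blast
  show "v \<in> ?A \<union> ?B"
  proof (cases "X = ?X")
   case False
   then have "X \<in> ?F - {?X}" using X(1) by simp
   then have "face_wt N X (h X)" by (rule bspec[OF h(1)])
   then have "X = {In v 1}" using X(2) by (rule face_wt_In)
   then show ?thesis using v X False by simp
  qed (use v X in simp)
 qed auto
 moreover have "?A \<inter> ?B = {}"
 proof (rule equals0I)
  fix v assume v: "v \<in> ?A \<inter> ?B"
  then have "{In v 1} \<in> ?F" "In v 1 \<in> ?X" by simp_all
  then have "?X = {In v 1}" using faces_disjoint[OF XF, of "{In v 1}" _ "In v 1"] by blast
  then show False using v by simp
 qed
 moreover have "finite ?A" "finite ?B" using fin by simp_all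
 ultimately have S: "card S = card ?A + card ?B"
  using card_Un_disjoint[of ?A ?B] by presburger
 have sub: "?X \<subseteq> ends N S" by (rule reading_subset[OF N fin gd(1,4)])
 have "{e \<in> ?X. ety e = (False, 1)} = (\<lambda>v. In v 1) ` ?A"
 proof (intro equalityI subsetI)
  fix e assume e: "e \<in> {e \<in> ?X. ety e = (False, 1)}"
  then have "e = In (vert e) 1" by (cases e) auto
  moreover have "vert e \<in> S" using e sub by (auto simp: ends_def)
  ultimately show "e \<in> (\<lambda>v. In v 1) ` ?A" using e by (intro image_eqI[of _ _ "vert e"]) auto
 qed auto
 then have "card ?A = card {e \<in> ?X. ety e = (False, 1)}" by (simp add: card_image inj_on_def)
 also have "\<dots> = count_list (map ety (concat dss)) (False, 1)"
  by (rule count_list_map_distinct[OF gd(7), symmetric])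
 also have "map ety (concat dss) = concat ls" using l by (simp add: map_concat)
 finally have A: "card ?A = count_list (concat ls) (False, 1)" .
 have "{X \<in> ?F - {?X}. h X = 1} = (\<lambda>v. {In v 1}) ` ?B"
 proof (intro equalityI subsetI)
  fix X assume X: "X \<in> {X \<in> ?F - {?X}. h X = 1}"
  then have XF': "X \<in> ?F - {?X}" "h X = 1" by simp_all
  then have "face_wt N X 1" using bspec[OF h(1) XF'(1)] by simp
  then obtain v where v: "X = {In v 1}" using N unfolding face_wt_def by fastforce
  have "X \<subseteq> ends N S" using X by (auto simp: faces_def)
  then have "v \<in> S" using v by (simp add: ends_def)
  then show "X \<in> (\<lambda>v. {In v 1}) ` ?B" using v XF'(1) by (intro image_eqI[of _ _ v]) simp_all
 next
  fix X assume "X \<in> (\<lambda>v. {In v 1}) ` ?B"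
  then obtain v where v: "X = {In v 1}" "X \<in> ?F - {?X}" by (elim imageE CollectE conjE) metis
  have "face_wt N X 1" using v N by (simp add: face_wt_def)
  then have "h X = 1" using face_wt_unique[OF N bspec[OF h(1) v(2)]] by simp
  then show "X \<in> {X \<in> ?F - {?X}. h X = 1}" using v(2) by simp
 qed
 then have "card ?B = card {X \<in> ?F - {?X}. h X = 1}" by (simp add: card_image inj_on_def)
 also have "\<dots> = count w 1" unfolding h(2) using fin by (subst count_image_mset_set) (simp_all add: finite_faces)
 finally show ?thesis using S A by (simp add: nv_def)
qed

section \<open>The coefficients\<close>

text \<open>The number of isotopy classes. By \<open>Lab_card\<close> only graphs with
  \<open>nv w ls\<close> vertices exist, so no other vertex set has to be considered, and
  \<open>cf\<close> contains a single power of \<open>V\<^sub>0\<close>.\<close>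

definition mm :: "nat => nat multiset => letter list list => nat" where
 "mm N w ls = card (orbs N {..<nv w ls} w ls)"

definition cf :: "nat => nat multiset => letter list list => scalar" where
 "cf N w ls = of_nat (mm N w ls) * Vvar 0 ^ nv w ls"

lemma card_Lab:
 assumes "N \<ge> 1" "finite S"
 shows "card (Lab N S w ls) = (if card S = nv w ls then fact (nv w ls) * mm N w ls else 0)"
proof (cases "card S = nv w ls")
 case True
 then have "card (Lab N S w ls) = card (Lab N {..<nv w ls} w ls)"
  using assms(2) by (intro card_Lab_cong) simp_all
 then show ?thesis using True by (simp add: mm_def card_Lab_orbs)
next
 case False
 then have "Lab N S w ls = {}" using Lab_card[OF assms] by blast
 then show ?thesis using False by simp
qed

text \<open>For \<open>k = 1\<close> the petal that disappears from the weight comes back as the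
  letter \<open>U\<^sub>1\<close> of \<kappa>. For other indices neither count changes.\<close>

lemma nv_kap:
 assumes "N \<ge> 1" "k \<in># w" "\<kappa> \<in> kap N k"
 shows "nv (w - {#k#}) (a # ys @ [b, \<kappa>]) = nv w ((b @ a) # ys)"
proof -
 have "count_list \<kappa> (False, 1) = (if k = 1 then 1 else 0)"
 proof -
  consider "k \<in> {1..N}" "\<kappa> = [(False, k)]" | i where "\<kappa> = spath N i N" "k = N + 1"
   using assms(3) by (auto simp: kap_def split: if_splits)
  then show ?thesis
  proof cases
   case 2
   then have "(False, 1) \<notin> set \<kappa>" by (auto simp: spath_def)
   then show ?thesis using 2 assms(1) by (simp add: count_list_0_iff)
  qed simp
 qed
 moreover have "count w k > 0" using assms(2) by simp
 ultimately show ?thesis unfolding nv_def by (cases "k = 1") (simp_all add: nv_def)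
qed

lemma nv_split:
 assumes "w1 \<subseteq># w" "ys = pre @ (x @ l) # post"
 shows "nv w1 (a # pre @ [x]) + nv (w - w1) (l # post @ [b]) = nv w ((b @ a) # ys)"
proof -
 have "count w1 1 + count (w - w1) 1 = count w 1"
  using mset_subset_eq_count[OF assms(1), of 1] by simp
 then show ?thesis using assms(2) by (simp add: nv_def)
qed

text \<open>The labelled identity divided by a factorial. For a disconnecting cut, the vertex sets
  of the right size are counted by a binomial coefficient, which combines the factorials of the two
  parts into that of the whole. The division has to precede the passage to characteristic 2.\<close>

theorem mm_cut:
 assumes N: "N \<ge> 1" and ne: "a ~= []" "b ~= []" and ch: "\<And>y. y \<in> set ys ==> chain N y"
 shows "mm N w ((b @ a) # ys) =
  (\<Sum>(k, \<kappa>)\<in>(SIGMA k:set_mset w. kap N k). mm N (w - {#k#}) (a # ys @ [b, \<kappa>])) +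
  (\<Sum>((pre, x, l, post), w1)\<in>splits ys \<times> {w1. w1 \<subseteq># w}.
   mm N w1 (a # pre @ [x]) * mm N (w - w1) (l # post @ [b]))"
proof -
 define J where "J = nv w ((b @ a) # ys)"
 let ?S = "{..<J}"
 have "card (Lab N ?S w ((b @ a) # ys)) = fact J * mm N w ((b @ a) # ys)"
  using card_Lab[OF N, of ?S] by (simp add: J_def)
 moreover have "card (Lab N ?S (w - {#k#}) (a # ys @ [b, \<kappa>])) = fact J * mm N (w - {#k#}) (a # ys @ [b, \<kappa>])"
  if "(k, \<kappa>) \<in> (SIGMA k:set_mset w. kap N k)" for k \<kappa>
  using card_Lab[OF N, of ?S] nv_kap[OF N, of k w \<kappa> a ys b] that by (simp add: J_def)
 moreover have "(\<Sum>S1\<in>Pow ?S. card (Lab N S1 w1 (a # pre @ [x])) * card (Lab N (?S - S1) (w - w1) (l # post @ [b])))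
   = fact J * (mm N w1 (a # pre @ [x]) * mm N (w - w1) (l # post @ [b]))"
  if s: "(pre, x, l, post) \<in> splits ys" "w1 \<subseteq># w" for pre x l post w1
 proof -
  define j1 where "j1 = nv w1 (a # pre @ [x])"
  define j2 where "j2 = nv (w - w1) (l # post @ [b])"
  have j: "j1 + j2 = J" unfolding j1_def j2_def J_def using s by (intro nv_split) (auto simp: splits_def)
  let ?m1 = "mm N w1 (a # pre @ [x])" and ?m2 = "mm N (w - w1) (l # post @ [b])"
  \<comment> \<open>The words and the weights prescribe the sizes of both vertex sets, and the two
    prescriptions add up to \<open>J\<close>; other subsets contribute nothing.\<close>
  have "card (Lab N S1 w1 (a # pre @ [x])) * card (Lab N (?S - S1) (w - w1) (l # post @ [b])) =
    (if card S1 = j1 then fact j1 * ?m1 * (fact j2 * ?m2) else 0)" if "S1 \<in> Pow ?S" for S1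
  proof -
   have f: "finite S1" "finite (?S - S1)" using that finite_subset by auto
   have "card (?S - S1) = J - card S1" using that f by (simp add: card_Diff_subset)
   moreover have "card S1 \<le> J" using that card_mono[of ?S S1] by simp
   ultimately have "card S1 = j1 \<longleftrightarrow> card (?S - S1) = j2" using j by auto
   moreover have "card (Lab N S1 w1 (a # pre @ [x])) = (if card S1 = j1 then fact j1 * ?m1 else 0)"
    unfolding j1_def by (rule card_Lab[OF N f(1)])
   moreover have "card (Lab N (?S - S1) (w - w1) (l # post @ [b])) = (if card (?S - S1) = j2 then fact j2 * ?m2 else 0)"
    unfolding j2_def by (rule card_Lab[OF N f(2)])
   ultimately show ?thesis by simp
  qed
  then have "(\<Sum>S1\<in>Pow ?S. card (Lab N S1 w1 (a # pre @ [x])) * card (Lab N (?S - S1) (w - w1) (l # post @ [b]))) =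
    (\<Sum>S1\<in>Pow ?S. if card S1 = j1 then fact j1 * ?m1 * (fact j2 * ?m2) else 0)" by (rule sum.cong[OF refl])
  also have "\<dots> = (\<Sum>S1\<in>{S1. S1 \<subseteq> ?S \<and> card S1 = j1}. fact j1 * ?m1 * (fact j2 * ?m2))"
   by (subst sum.inter_filter[symmetric]) (auto intro!: sum.cong)
  also have "\<dots> = (J choose j1) * (fact j1 * ?m1 * (fact j2 * ?m2))" by (simp add: n_subsets)
  also have "\<dots> = (fact j1 * fact (J - j1) * (J choose j1)) * (?m1 * ?m2)" using j by (auto simp: algebra_simps)
  also have "\<dots> = fact J * (?m1 * ?m2)" using j by (subst binomial_fact_lemma) auto
  finally show ?thesis .
 qed
 then have "(\<Sum>((pre, x, l, post), S1, w1)\<in>splits ys \<times> Pow ?S \<times> {w1. w1 \<subseteq># w}.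
   card (Lab N S1 w1 (a # pre @ [x])) * card (Lab N (?S - S1) (w - w1) (l # post @ [b]))) =
  fact J * (\<Sum>((pre, x, l, post), w1)\<in>splits ys \<times> {w1. w1 \<subseteq># w}.
   mm N w1 (a # pre @ [x]) * mm N (w - w1) (l # post @ [b]))"
  (is "?lhs = ?rhs")
 proof -
  assume *: "\<And>pre x l post w1. (pre, x, l, post) \<in> splits ys ==> w1 \<subseteq># w ==>
   (\<Sum>S1\<in>Pow ?S. card (Lab N S1 w1 (a # pre @ [x])) * card (Lab N (?S - S1) (w - w1) (l # post @ [b])))
   = fact J * (mm N w1 (a # pre @ [x]) * mm N (w - w1) (l # post @ [b]))"
  have inner: "(\<Sum>(S1, w1)\<in>Pow ?S \<times> {w1. w1 \<subseteq># w}.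
    card (Lab N S1 w1 (a # pre @ [x])) * card (Lab N (?S - S1) (w - w1) (l # post @ [b]))) =
   (\<Sum>w1\<in>{w1. w1 \<subseteq># w}. fact J * (mm N w1 (a # pre @ [x]) * mm N (w - w1) (l # post @ [b])))"
   if s: "(pre, x, l, post) \<in> splits ys" for pre x l post
  proof -
   have "(\<Sum>(S1, w1)\<in>Pow ?S \<times> {w1. w1 \<subseteq># w}.
     card (Lab N S1 w1 (a # pre @ [x])) * card (Lab N (?S - S1) (w - w1) (l # post @ [b]))) =
    (\<Sum>S1\<in>Pow ?S. \<Sum>w1\<in>{w1. w1 \<subseteq># w}.
     card (Lab N S1 w1 (a # pre @ [x])) * card (Lab N (?S - S1) (w - w1) (l # post @ [b])))"
    by (rule sum.cartesian_product[symmetric])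
   also have "\<dots> = (\<Sum>w1\<in>{w1. w1 \<subseteq># w}. \<Sum>S1\<in>Pow ?S.
     card (Lab N S1 w1 (a # pre @ [x])) * card (Lab N (?S - S1) (w - w1) (l # post @ [b])))"
    by (rule sum.swap)
   also have "\<dots> = (\<Sum>w1\<in>{w1. w1 \<subseteq># w}. fact J * (mm N w1 (a # pre @ [x]) * mm N (w - w1) (l # post @ [b])))"
    by (rule sum.cong[OF refl]) (simp only: *[OF s] mem_Collect_eq)
   finally show ?thesis .
  qed
  show "?lhs = ?rhs"
   unfolding sum.cartesian_product[symmetric, where A = "splits ys"] sum_distrib_left
  proof (rule sum.cong[OF refl])
   fix s assume s: "s \<in> splits ys"
   obtain pre x l post where e: "s = (pre, x, l, post)" by (cases s) auto
   show "sum (case s of (pre, x, l, post) => \<lambda>(S1, w1).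
      card (Lab N S1 w1 (a # pre @ [x])) * card (Lab N ({..<J} - S1) (w - w1) (l # post @ [b])))
     (Pow {..<J} \<times> {w1. w1 \<subseteq># w}) =
    (\<Sum>w1\<in>{w1. w1 \<subseteq># w}. fact J * (case s of (pre, x, l, post) =>
      \<lambda>w1. mm N w1 (a # pre @ [x]) * mm N (w - w1) (l # post @ [b])) w1)"
    using inner[OF s[unfolded e]] unfolding e prod.case .
  qed
 qed
 ultimately have "fact J * mm N w ((b @ a) # ys) = fact J * (
  (\<Sum>(k, \<kappa>)\<in>(SIGMA k:set_mset w. kap N k). mm N (w - {#k#}) (a # ys @ [b, \<kappa>])) +
  (\<Sum>((pre, x, l, post), w1)\<in>splits ys \<times> {w1. w1 \<subseteq># w}.
   mm N w1 (a # pre @ [x]) * mm N (w - w1) (l # post @ [b])))"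
 proof -
  assume 1: "card (Lab N ?S w ((b @ a) # ys)) = fact J * mm N w ((b @ a) # ys)"
   and 2: "\<And>k \<kappa>. (k, \<kappa>) \<in> (SIGMA k:set_mset w. kap N k) ==>
    card (Lab N ?S (w - {#k#}) (a # ys @ [b, \<kappa>])) = fact J * mm N (w - {#k#}) (a # ys @ [b, \<kappa>])"
   and 3: "(\<Sum>((pre, x, l, post), S1, w1)\<in>splits ys \<times> Pow ?S \<times> {w1. w1 \<subseteq># w}.
     card (Lab N S1 w1 (a # pre @ [x])) * card (Lab N (?S - S1) (w - w1) (l # post @ [b]))) =
    fact J * (\<Sum>((pre, x, l, post), w1)\<in>splits ys \<times> {w1. w1 \<subseteq># w}.
     mm N w1 (a # pre @ [x]) * mm N (w - w1) (l # post @ [b]))"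
  have "card (Lab N ?S w ((b @ a) # ys)) =
   (\<Sum>(k, \<kappa>)\<in>(SIGMA k:set_mset w. kap N k). card (Lab N ?S (w - {#k#}) (a # ys @ [b, \<kappa>]))) +
   (\<Sum>((pre, x, l, post), S1, w1)\<in>splits ys \<times> Pow ?S \<times> {w1. w1 \<subseteq># w}.
    card (Lab N S1 w1 (a # pre @ [x])) * card (Lab N (?S - S1) (w - w1) (l # post @ [b])))"
   by (rule labelled_cut[OF N _ ne ch]) simp_all
  moreover have "(\<Sum>(k, \<kappa>)\<in>(SIGMA k:set_mset w. kap N k). card (Lab N ?S (w - {#k#}) (a # ys @ [b, \<kappa>]))) =
   (\<Sum>(k, \<kappa>)\<in>(SIGMA k:set_mset w. kap N k). fact J * mm N (w - {#k#}) (a # ys @ [b, \<kappa>]))"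
   by (rule sum.cong[OF refl]) (use 2 in force)
  ultimately show ?thesis
   unfolding 1 3 by (simp only: distrib_left sum_distrib_left case_prod_unfold)
 qed
 then show ?thesis by (simp only: mult_cancel1 fact_nonzero simp_thms)
qed

text \<open>The powers of \<open>V\<^sub>0\<close> on both sides agree because the numbers of
  vertices do, by \<open>nv_kap\<close> and \<open>nv_split\<close>.\<close>

theorem cf_cut:
 assumes N: "N \<ge> 1" and ne: "a ~= []" "b ~= []" and ch: "\<And>y. y \<in> set ys ==> chain N y"
 shows "cf N w ((b @ a) # ys) =
  (\<Sum>(k, \<kappa>)\<in>(SIGMA k:set_mset w. kap N k). cf N (w - {#k#}) (a # ys @ [b, \<kappa>])) +
  (\<Sum>((pre, x, l, post), w1)\<in>splits ys \<times> {w1. w1 \<subseteq># w}.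
   cf N w1 (a # pre @ [x]) * cf N (w - w1) (l # post @ [b]))"
proof -
 define J where "J = nv w ((b @ a) # ys)"
 have 1: "cf N (w - {#k#}) (a # ys @ [b, \<kappa>]) = of_nat (mm N (w - {#k#}) (a # ys @ [b, \<kappa>])) * Vvar 0 ^ J"
  if "(k, \<kappa>) \<in> (SIGMA k:set_mset w. kap N k)" for k \<kappa>
  using nv_kap[OF N, of k w \<kappa> a ys b] that by (simp add: cf_def J_def)
 have 2: "cf N w1 (a # pre @ [x]) * cf N (w - w1) (l # post @ [b]) =
   of_nat (mm N w1 (a # pre @ [x]) * mm N (w - w1) (l # post @ [b])) * Vvar 0 ^ J"
  if "((pre, x, l, post), w1) \<in> splits ys \<times> {w1. w1 \<subseteq># w}" for pre x l post w1
 proof -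
  have "nv w1 (a # pre @ [x]) + nv (w - w1) (l # post @ [b]) = J"
   unfolding J_def using that by (intro nv_split) (auto simp: splits_def)
  then have "Vvar 0 ^ J = Vvar 0 ^ nv w1 (a # pre @ [x]) * Vvar 0 ^ nv (w - w1) (l # post @ [b])"
   by (simp only: power_add[symmetric])
  then show ?thesis unfolding cf_def of_nat_mult by (simp only: mult_ac)
 qed
 have "cf N w ((b @ a) # ys) = of_nat (mm N w ((b @ a) # ys)) * Vvar 0 ^ J" by (simp add: cf_def J_def)
 also have "\<dots> = (\<Sum>(k, \<kappa>)\<in>(SIGMA k:set_mset w. kap N k). of_nat (mm N (w - {#k#}) (a # ys @ [b, \<kappa>])) * Vvar 0 ^ J) +
  (\<Sum>((pre, x, l, post), w1)\<in>splits ys \<times> {w1. w1 \<subseteq># w}.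
   of_nat (mm N w1 (a # pre @ [x]) * mm N (w - w1) (l # post @ [b])) * Vvar 0 ^ J)"
 proof -
  have "mm N w ((b @ a) # ys) =
   (\<Sum>(k, \<kappa>)\<in>(SIGMA k:set_mset w. kap N k). mm N (w - {#k#}) (a # ys @ [b, \<kappa>])) +
   (\<Sum>((pre, x, l, post), w1)\<in>splits ys \<times> {w1. w1 \<subseteq># w}.
    mm N w1 (a # pre @ [x]) * mm N (w - w1) (l # post @ [b]))"
   by (rule mm_cut[OF N ne ch])
  then show ?thesis
   by (simp only: of_nat_add of_nat_sum distrib_right sum_distrib_right case_prod_unfold)
 qed
 also have "(\<Sum>(k, \<kappa>)\<in>(SIGMA k:set_mset w. kap N k). of_nat (mm N (w - {#k#}) (a # ys @ [b, \<kappa>])) * Vvar 0 ^ J) =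
   (\<Sum>(k, \<kappa>)\<in>(SIGMA k:set_mset w. kap N k). cf N (w - {#k#}) (a # ys @ [b, \<kappa>]))"
  using 1 by (intro sum.cong) auto
 also have "(\<Sum>((pre, x, l, post), w1)\<in>splits ys \<times> {w1. w1 \<subseteq># w}.
   of_nat (mm N w1 (a # pre @ [x]) * mm N (w - w1) (l # post @ [b])) * Vvar 0 ^ J) =
   (\<Sum>((pre, x, l, post), w1)\<in>splits ys \<times> {w1. w1 \<subseteq># w}.
   cf N w1 (a # pre @ [x]) * cf N (w - w1) (l # post @ [b]))"
  using 2 by (intro sum.cong) auto
 finally show ?thesis .
qed

text \<open>Moving the root along the boundary orbit to the first end of \<open>vs\<close> is
  injective, as the rotated blocks determine the old root. The inequality in both directions gives
  the rotation invariance.\<close>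

lemma card_Lab_rotate_le:
 assumes "finite S" "us ~= []" "vs ~= []"
 shows "card (Lab N S w (us @ vs)) \<le> card (Lab N S w (vs @ us))"
proof -
 let ?f = "\<lambda>(t, r). (t, (fp N t ^^ length (concat us)) r)"
 have ex: "\<exists>dus dvs. good N S w t (dus @ dvs) \<and> map (map ety) dus = us \<and> map (map ety) dvs = vs \<and>
   r = hd (hd dus) \<and> ?f (t, r) = (t, hd (hd dvs))" if tr: "(t, r) \<in> Lab N S w (us @ vs)" for t r
 proof -
  obtain dss where dss: "good N S w t dss" "map (map ety) dss = us @ vs" "r = hd (hd dss)" using LabE[OF tr] .
  obtain dus dvs where d: "dss = dus @ dvs" "map (map ety) dus = us" "map (map ety) dvs = vs"
   using dss(2) by (metis map_eq_append_conv)
  note gd = goodD[OF dss(1)[unfolded d(1)]]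
  have ne: "dus ~= []" "dvs ~= []" using d assms by auto
  then have ne2: "hd dus ~= []" "hd dvs ~= []" using gd(9) by auto
  have hc: "concat ds ~= [] \<and> hd (concat ds) = hd (hd ds)" if "ds ~= []" "hd ds ~= []" for ds :: "edge_end list list"
   using that by (cases ds) auto
  have "(fp N t ^^ length (concat dus)) (hd (concat dus)) = hd (concat dvs)"
   using cyc_funpow_block[of "fp N t" "concat dus" "concat dvs"] gd(6) hc[OF ne(1) ne2(1)] hc[OF ne(2) ne2(2)] by simp
  moreover have "length (concat us) = length (concat dus)" using d(2) by (metis length_map map_concat)
  ultimately show ?thesis
   using dss d ne hc[OF ne(1) ne2(1)] hc[OF ne(2) ne2(2)] by (intro exI[of _ dus] exI[of _ dvs]) simp
 qed
 have "inj_on ?f (Lab N S w (us @ vs))"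
 proof (rule inj_onI)
  fix p q assume p: "p \<in> Lab N S w (us @ vs)" and q: "q \<in> Lab N S w (us @ vs)" and eq: "?f p = ?f q"
  obtain t r where pt: "p = (t, r)" by (cases p)
  obtain t' r' where qt: "q = (t', r')" by (cases q)
  obtain dus dvs where 1: "good N S w t (dus @ dvs)" "map (map ety) dus = us" "map (map ety) dvs = vs"
   "r = hd (hd dus)" "?f (t, r) = (t, hd (hd dvs))" using ex p pt by blast
  obtain dus' dvs' where 2: "good N S w t' (dus' @ dvs')" "map (map ety) dus' = us" "map (map ety) dvs' = vs"
   "r' = hd (hd dus')" "?f (t', r') = (t', hd (hd dvs'))" using ex q qt by blast
  have e: "t = t'" "hd (hd dvs) = hd (hd dvs')" using eq 1(5) 2(5) pt qt by auto
  have "dvs ~= []" "dvs' ~= []" using 1 2 assms by auto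
  then have "dvs @ dus = dvs' @ dus'"
   using good_unique[OF good_rotate[OF 1(1)] good_rotate[OF 2(1)[folded e(1)]]] e 1 2 by simp
  moreover have "length dvs = length dvs'" using 1(3) 2(3) by (metis length_map)
  ultimately show "p = q" using 1(4) 2(4) pt qt e by simp
 qed
 moreover have "?f ` Lab N S w (us @ vs) \<subseteq> Lab N S w (vs @ us)"
 proof
  fix p assume "p \<in> ?f ` Lab N S w (us @ vs)"
  then obtain t r where tr: "(t, r) \<in> Lab N S w (us @ vs)" "p = ?f (t, r)" by auto
  obtain dus dvs where 1: "good N S w t (dus @ dvs)" "map (map ety) dus = us" "map (map ety) dvs = vs"
   "?f (t, r) = (t, hd (hd dvs))" using ex[OF tr(1)] by blast
  have "dvs ~= []" using 1 assms by auto
  then have "(t, hd (hd dvs)) \<in> Lab N S w (vs @ us)"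
   by (intro LabI[OF good_rotate[OF 1(1)]]) (use 1 in auto)
  then show "p \<in> Lab N S w (vs @ us)" using tr(2) 1(4) by simp
 qed
 ultimately show ?thesis using finite_Lab[OF assms(1)] card_inj_on_le by blast
qed

lemma cf_rotate: "cf N w (us @ vs) = cf N w (vs @ us)"
proof (cases "us = [] \<or> vs = []")
 case False
 have nv: "nv w (us @ vs) = nv w (vs @ us)" by (simp add: nv_def)
 let ?S = "{..<nv w (us @ vs)}"
 have "card (Lab N ?S w (us @ vs)) = card (Lab N ?S w (vs @ us))"
  using False card_Lab_rotate_le[of ?S us vs N w] card_Lab_rotate_le[of ?S vs us N w] by simp
 then have "mm N w (us @ vs) = mm N w (vs @ us)"
  unfolding mm_def nv[symmetric] by (simp add: card_Lab_orbs)
 then show ?thesis by (simp add: cf_def nv)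
qed auto

text \<open>Together with \<open>cf_cut\<close> and \<open>cf_rotate\<close> this is all that the
  algebraic part uses about the coefficients.\<close>

lemma cf_nonzero:
 assumes "N \<ge> 1" "cf N w ls ~= 0"
 obtains "ls ~= []" "\<And>l. l \<in> set ls ==> l ~= []" "\<And>l. l \<in> set ls ==> chain N l"
  "\<And>l x. l \<in> set ls ==> x \<in> set l ==> snd x \<in> {1..N}"
  "\<And>us l1 l2 vs. ls = us @ l1 # l2 # vs ==> hd l2 = nxt N (last l1)"
  "hd (hd ls) = nxt N (last (last ls))"
proof -
 let ?S = "{..<nv w ls}"
 have "mm N w ls ~= 0" using assms(2) by (metis cf_def mult_zero_left of_nat_0)
 then have "Lab N ?S w ls ~= {}" unfolding mm_def orbs_def by auto
 then obtain t r where "(t, r) \<in> Lab N ?S w ls" by auto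
 then obtain dss where g: "good N ?S w t dss" and l: "map (map ety) dss = ls" by (rule LabE)
 note gd = goodD[OF g]
 have fin: "finite ?S" by simp
 note rd = assms(1) fin gd(1,4)
 show thesis
 proof (rule that)
  show "ls ~= []" using gd(8) l by auto
  show "m ~= []" "chain N m" "x \<in> set m ==> snd x \<in> {1..N}" if m: "m \<in> set ls" for m x
  proof -
   obtain d where d: "d \<in> set dss" "m = map ety d" using m l by auto
   show "m ~= []" using gd(9)[OF d(1)] d(2) by simp
   show "chain N m" using reading_chain[OF rd d(1)] d(2) by simp
   show "snd x \<in> {1..N}" if "x \<in> set m"
   proof -
    obtain e where "e \<in> set d" "x = ety e" using \<open>x \<in> set m\<close> d by auto
    then show ?thesis using reading_subset[OF rd] d(1) by (auto simp: ends_def)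
   qed
  qed
  show "hd l2 = nxt N (last l1)" if eq: "ls = us @ l1 # l2 # vs" for us l1 l2 vs
  proof -
   obtain dus d1 d2 dvs where d: "dss = dus @ d1 # d2 # dvs" "map ety d1 = l1" "map ety d2 = l2"
    using l unfolding eq by (auto simp: map_eq_append_conv map_eq_Cons_conv)
   have "d1 ~= []" "d2 ~= []" using gd(9) d by auto
   then show ?thesis using reading_adjacent[OF rd d(1)] d by (auto simp: hd_map last_map)
  qed
  have "hd dss ~= []" "last dss ~= []" using gd(8,9) by auto
  then show "hd (hd ls) = nxt N (last (last ls))"
   using reading_closing[OF rd] gd(8) l by (auto simp: hd_map last_map)
 qed
qed

section \<open>Combinatorial maps as involutions\<close>

definition toG :: "nat => (edge_end => edge_end) \<times> edge_end => star_graph" where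
 "toG j p = \<lparr>nverts = j, arcs = {(v, i, u). fst p (Out v i) = In u i}, root_end = snd p\<rparr>"

primrec letters :: "nat => basis_elt => letter list" where
 "letters N (Idem i) = []"
| "letters N (Upow i p) = replicate p (False, i)"
| "letters N (Path i m) = spath N i m"

text \<open>The inverse of \<open>letters\<close> on nonempty chains. The first letter and the
  length suffice to name the product.\<close>

definition of_letters :: "letter list => basis_elt" where
 "of_letters ls = (if fst (hd ls) then Path (snd (hd ls)) (length ls) else Upow (snd (hd ls)) (length ls))"

definition gen :: "letter => basis_elt" where
 "gen l = (if fst l then Path (snd l) 1 else Upow (snd l) 1)"

lemma nontrivial_cases:
 assumes "x \<in> nontrivial N"
 obtains i p where "x = Upow i p" "i \<in> {1..N}" "p \<ge> 1" | i m where "x = Path i m" "i \<in> {1..N}" "m \<ge> 1"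
 using assms unfolding nontrivial_def basis_def by blast

lemma chain_replicate: "chain N (replicate p (False, i))"
 unfolding chain_def successively_conv_nth by simp

lemma letters_nontrivial:
 assumes "x \<in> nontrivial N"
 shows "letters N x ~= []" "chain N (letters N x)" "of_letters (letters N x) = x" "snd (hd (letters N x)) \<in> {1..N}"
proof -
 have "letters N x ~= [] \<and> chain N (letters N x) \<and> of_letters (letters N x) = x \<and> snd (hd (letters N x)) \<in> {1..N}"
  using assms
 proof (cases rule: nontrivial_cases)
  case (1 i p)
  then have "p ~= 0" "letters N x = replicate p (False, i)" by simp_all
  then show ?thesis using 1 by (simp add: of_letters_def chain_replicate hd_replicate)
 next
  case (2 i m)
  then have "spath N i m ~= []" by (metis length_spath list.size(3) not_one_le_zero)
  then show ?thesis using 2 by (simp add: of_letters_def hd_spath chain_spath)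
 qed
 then show "letters N x ~= []" "chain N (letters N x)" "of_letters (letters N x) = x" "snd (hd (letters N x)) \<in> {1..N}" by auto
qed

lemma of_letters_nontrivial:
 "ls ~= [] ==> snd (hd ls) \<in> {1..N} ==> of_letters ls \<in> nontrivial N"
 by (cases ls) (auto simp: of_letters_def nontrivial_def basis_def)

lemma letters_of_letters:
 assumes "ls ~= []" "chain N ls"
 shows "letters N (of_letters ls) = ls"
proof -
 obtain k i where h: "hd ls = (k, i)" by (cases "hd ls")
 have m: "length ls \<ge> 1" using assms(1) by (cases ls) auto
 show ?thesis
 proof (cases k)
  case True
  then have "letters N (of_letters ls) = spath N i (length ls)" by (simp add: of_letters_def h)
  also have "\<dots> = ls"
   using chain_unique[OF chain_spath assms(2)] m h True by (simp add: hd_spath)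
  finally show ?thesis .
 next
  case False
  then have "letters N (of_letters ls) = replicate (length ls) (False, i)" by (simp add: of_letters_def h)
  also have "\<dots> = ls"
   using chain_unique[OF chain_replicate assms(2)] assms(1) h False by (simp add: hd_replicate)
  finally show ?thesis .
 qed
qed

lemma basis_prod_gen:
 "ls ~= [] ==> chain N ls ==> basis_prod N (map gen ls) = Some (of_letters ls)"
proof (induction ls rule: induct_list012)
 case (2 x)
 then show ?case by (simp add: gen_def of_letters_def)
next
 case (3 x y zs)
 have c: "chain N (y # zs)" "y = lk N x" using 3(4) unfolding chain_def successively.simps by blast+
 obtain k i where x: "x = (k, i)" by (cases x)
 have "basis_prod N (map gen (x # y # zs)) = basis_mult N (gen x) (of_letters (y # zs))"
  using 3(2) c(1) by simp
 also have "\<dots> = Some (of_letters (x # y # zs))"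
  using c(2) x by (cases k) (simp_all add: gen_def of_letters_def basis_mult_def)
 finally show ?case .
qed simp

lemma successively_concat_step:
 "successively P (concat (us @ d1 # d2 # vs)) ==> d1 ~= [] ==> d2 ~= [] ==> P (last d1) (hd d2)"
 by (simp add: successively_append_iff)

lemma successively_concat_block: "successively P (concat (us @ d # vs)) ==> successively P d"
 by (simp add: successively_append_iff)

lemma inj_next_corner: "inj next_corner"
proof (rule injI)
 fix x y assume "next_corner x = next_corner y"
 then show "x = y" by (cases x; cases y) auto
qed

lemma corner_label_next_corner: "corner_label (next_corner e) = gen (ety e)"
 by (cases e) (auto simp: gen_def)

section \<open>The dictionary between graphs and involutions\<close>

context
 fixes N j t r G
 assumes N: "N \<ge> 1" and g: "gmap N {..<j} t" and G: "G = toG j (t, r)"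
begin

lemma nverts_G [simp]: "nverts G = j" and root_G [simp]: "root_end G = r"
 by (simp_all add: G toG_def)

lemma arcs_G: "(v, i, u) \<in> arcs G \<longleftrightarrow> t (Out v i) = In u i"
 by (simp add: G toG_def)

lemma joined_iff: "joined G e e' \<longleftrightarrow> t e = e' \<and> e' ~= e"
proof
 assume "joined G e e'"
 then show "t e = e' \<and> e' ~= e"
 proof cases
  case (1 v i w)
  then show ?thesis using arcs_G by simp
 next
  case (2 v i w)
  then have "t (Out v i) = In w i" using arcs_G by simp
  then have "t (In w i) = Out v i" using gmap_involution[OF g] by metis
  then show ?thesis using 2 by simp
 qed
next
 assume a: "t e = e' \<and> e' ~= e"
 then have ety: "ety e' = flip (ety e)" using gmap_moved[OF g, of e] by simp
 show "joined G e e'"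
 proof (cases e)
  case (Out v i)
  then obtain u where "e' = In u i" using ety by (cases e') auto
  then show ?thesis using a Out arcs_G joined.intros(1) by metis
 next
  case (In u i)
  then obtain v where e': "e' = Out v i" using ety by (cases e') auto
  then have "t (Out v i) = In u i" using a In gmap_involution[OF g] by metis
  then show ?thesis using e' In arcs_G joined.intros(2) by metis
 qed
qed

lemma edge_ends_G: "edge_ends N G = ends N {..<j}"
proof (rule set_eqI)
 fix e show "e \<in> edge_ends N G \<longleftrightarrow> e \<in> ends N {..<j}"
  by (cases e) (auto simp: edge_ends_def ends_def)
qed

lemma boundary_ends_G: "boundary_ends N G = bnd N {..<j} t"
 unfolding boundary_ends_def edge_ends_G bnd_def joined_iff by auto

lemma corners_G: "corners N G = next_corner ` ends N {..<j}"
proof (rule set_eqI)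
 fix c show "c \<in> corners N G \<longleftrightarrow> c \<in> next_corner ` ends N {..<j}"
 proof (cases c)
  case (UCorner v i)
  have "c \<in> next_corner ` ends N {..<j} \<longleftrightarrow> In v i \<in> ends N {..<j}"
   using inj_image_mem_iff[OF inj_next_corner, of "In v i"] UCorner by simp
  then show ?thesis using UCorner by (simp add: corners_def ends_def)
 next
  case (SCorner v i)
  have "c \<in> next_corner ` ends N {..<j} \<longleftrightarrow> Out v i \<in> ends N {..<j}"
   using inj_image_mem_iff[OF inj_next_corner, of "Out v i"] SCorner by simp
  then show ?thesis using SCorner by (simp add: corners_def ends_def)
 qed
qed

text \<open>The face permutation and the corner steps agree except where the former arrives at a
  boundary end: there the region ends, while the orbit goes on.\<close>

lemma step_iff:
 assumes "e \<in> ends N {..<j}"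
 shows "(next_corner e, c) \<in> corner_step N G \<longleftrightarrow> fp N t e \<notin> bnd N {..<j} t \<and> c = next_corner (fp N t e)"
  "sg N e \<in> bnd N {..<j} t \<longleftrightarrow> fp N t e \<in> bnd N {..<j} t"
proof -
 have s: "sg N e \<in> ends N {..<j}" by (rule sg_ends[OF N assms])
 have f: "fp N t e = t (sg N e)" "fp N t e \<in> ends N {..<j}" using fp_ends[OF N g assms] by (simp_all add: fp_def)
 have b: "fp N t e \<in> bnd N {..<j} t \<longleftrightarrow> t (sg N e) = sg N e"
  using f gmap_involution[OF g, of "sg N e"] by (auto simp: bnd_def)
 show "sg N e \<in> bnd N {..<j} t \<longleftrightarrow> fp N t e \<in> bnd N {..<j} t"
  unfolding b using s by (simp add: bnd_def)
 have "(next_corner e, c) \<in> corner_step N G \<longleftrightarrow> (\<exists>e'. t (sg N e) = e' \<and> e' ~= sg N e \<and> c = next_corner e')"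
  unfolding corner_step_def corners_G using assms by (simp add: sg_def[symmetric] joined_iff)
 then show "(next_corner e, c) \<in> corner_step N G \<longleftrightarrow> fp N t e \<notin> bnd N {..<j} t \<and> c = next_corner (fp N t e)"
  unfolding b using f(1) by auto
qed

lemma step_dom: "(c, c') \<in> corner_step N G ==> \<exists>e\<in>ends N {..<j}. c = next_corner e"
 unfolding corner_step_def corners_G by auto

lemma connected_G: "connected_graph G \<longleftrightarrow> conn {..<j} t"
proof -
 let ?R = "{(x, y). \<exists>i. (x, i, y) \<in> arcs G \<or> (y, i, x) \<in> arcs G}"
 have "?R \<subseteq> adj t"
 proof
  fix p assume "p \<in> ?R"
  then obtain x y i where p: "p = (x, y)" "t (Out x i) = In y i \<or> t (Out y i) = In x i" unfolding arcs_G by auto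
  from p(2) show "p \<in> adj t"
  proof
   assume "t (Out x i) = In y i"
   then show ?thesis using adjI[of "Out x i" t] p(1) by simp
  next
   assume "t (Out y i) = In x i"
   then have "t (In x i) = Out y i" using gmap_involution[OF g] by metis
   then show ?thesis using adjI[of "In x i" t] p(1) by simp
  qed
 qed
 moreover have "adj t \<subseteq> ?R\<^sup>*"
 proof
  fix p assume "p \<in> adj t"
  then obtain e where p: "p = (vert e, vert (t e))" by (auto simp: adj_def)
  show "p \<in> ?R\<^sup>*"
  proof (cases "t e = e")
   case False
   then have "joined G e (t e)" using joined_iff by simp
   then have "p \<in> ?R" unfolding p by cases auto
   then show ?thesis by (rule r_into_rtrancl)
  qed (simp add: p)
 qed
 ultimately have "?R\<^sup>* = (adj t)\<^sup>*" by (rule rtrancl_subset[symmetric])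
 then show ?thesis unfolding connected_graph_def conn_def by (simp add: Ball_def)
qed

lemma arcs_G_range: "(v, i, u) \<in> arcs G ==> v < j \<and> i \<in> {1..N} \<and> u < j"
 using gmap_moved[OF g, of "Out v i"] gmap_ends[OF g, of "Out v i"] unfolding arcs_G by (auto simp: ends_def)

lemma card_arcs_G: "card (arcs G) = card (arcs_of t)"
proof -
 have "inj_on (\<lambda>(v, i, u). Out v i) (arcs G)"
  by (rule inj_onI) (auto simp: arcs_G)
 moreover have "(\<lambda>(v, i, u). Out v i) ` arcs G = arcs_of t"
 proof (intro equalityI subsetI)
  fix e assume e: "e \<in> arcs_of t"
  then obtain v i where "e = Out v i" by (cases e) (auto simp: arcs_of_def)
  moreover have "joined G e (t e)" using e by (simp add: joined_iff arcs_of_def)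
  ultimately obtain u where "(v, i, u) \<in> arcs G" by (auto elim: joined.cases)
  then show "e \<in> (\<lambda>(v, i, u). Out v i) ` arcs G" using \<open>e = Out v i\<close> by force
 qed (auto simp: arcs_G arcs_of_def)
 ultimately show ?thesis by (metis card_image)
qed

lemma wf_G: "j \<ge> 1 ==> wf_star_graph N G"
 unfolding wf_star_graph_def
proof (intro conjI allI impI)
 show "arcs G \<subseteq> {..<nverts G} \<times> {1..N} \<times> {..<nverts G}" using arcs_G_range by auto
 show "w = w'" if "(v, i, w) \<in> arcs G \<and> (v, i, w') \<in> arcs G" for v i w w'
  using that unfolding arcs_G by auto
 show "v = v'" if "(v, i, w) \<in> arcs G \<and> (v', i, w) \<in> arcs G" for v v' i w
 proof -
  have "t (Out v i) = t (Out v' i)" using that by (simp add: arcs_G)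
  then have "Out v i = Out v' i" using gmap_inj[OF g] by (simp add: inj_eq)
  then show ?thesis by simp
 qed
qed simp

lemma boundary_region_iff:
 assumes "set ds \<subseteq> ends N {..<j}" "ds ~= []"
 shows "boundary_region N G b (map next_corner ds) b' \<longleftrightarrow> b \<in> bnd N {..<j} t \<and> hd ds = b \<and>
  successively (\<lambda>x y. y = fp N t x) ds \<and> set (tl ds) \<inter> bnd N {..<j} t = {} \<and> sg N (last ds) = b' \<and> b' \<in> bnd N {..<j} t"
proof -
 have "successively (\<lambda>x y. (next_corner x, next_corner y) \<in> corner_step N G) ds \<longleftrightarrow>
   successively (\<lambda>x y. y = fp N t x) ds \<and> set (tl ds) \<inter> bnd N {..<j} t = {}"
  using assms
 proof (induction ds)
  case (Cons x ds)
  show ?case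
  proof (cases ds)
   case (Cons y zs)
   have x: "x \<in> ends N {..<j}" using Cons.prems by simp
   have "(next_corner x, next_corner y) \<in> corner_step N G \<longleftrightarrow> y = fp N t x \<and> y \<notin> bnd N {..<j} t"
    using step_iff(1)[OF x] inj_next_corner by (auto simp: inj_eq)
   then show ?thesis using Cons.IH Cons.prems Cons by auto
  qed simp
 qed simp
 moreover have "hd (map next_corner ds) = next_corner b \<longleftrightarrow> hd ds = b"
  using assms(2) inj_next_corner by (simp add: hd_map inj_eq)
 moreover have "next_end N (last (map next_corner ds)) = sg N (last ds)"
  using assms(2) by (simp add: last_map sg_def)
 ultimately show ?thesis
  unfolding boundary_region_def boundary_ends_G successively_map using assms(2) by auto
qed

lemma reading_imp_boundary:
 assumes rd: "reading N {..<j} t dss" and r: "hd (hd dss) = r"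
 shows "boundary_reading N G (map hd dss) (map (map next_corner) dss)"
proof -
 have c: "cyc (fp N t) (concat dss)" and ne: "dss ~= []" "\<And>d. d \<in> set dss ==> d ~= []"
  and B: "set (map hd dss) = bnd N {..<j} t"
  using rd unfolding reading_def by blast+
 have fin: "finite {..<j}" by simp
 note sub = reading_subset[OF N fin g rd]
 have d: "distinct (map hd dss)"
 proof (rule distinct_conv_nth[THEN iffD2], intro allI impI)
  fix a b assume ab: "a < length (map hd dss)" "b < length (map hd dss)" "a ~= b"
  have "dss ! a ~= dss ! b \<and> distinct (concat dss)"
  proof
   show "distinct (concat dss)" using c by (simp add: cyc_def)
   then have "distinct (removeAll [] dss)" unfolding distinct_concat_iff by blast
   moreover have "removeAll [] dss = dss" using ne(2) by (metis removeAll_id)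
   ultimately show "dss ! a ~= dss ! b" using ab by (simp add: nth_eq_iff_index_eq)
  qed
  moreover have "hd (dss ! a) \<in> set (dss ! a)" "hd (dss ! b) \<in> set (dss ! b)" using ab ne(2) by simp_all
  ultimately show "map hd dss ! a ~= map hd dss ! b"
   using ab block_mem_unique[of dss "dss ! a" "dss ! b" "hd (dss ! a)"] by force
 qed
 have head: "sg N x = y" if "y = fp N t x" "y \<in> bnd N {..<j} t" for x y
  using that gmap_involution[OF g, of "sg N x"] by (simp add: fp_def bnd_def)
 have reg: "boundary_region N G (map hd dss ! k) (map (map next_corner) dss ! k) (map hd dss ! (Suc k mod length (map hd dss)))"
  if k: "k < length (map hd dss)" for k
 proof -
  let ?ds = "dss ! k" and ?k' = "Suc k mod length dss"
  have kl: "k < length dss" using k by simp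
  have k': "?k' < length dss" using kl by (cases dss) simp_all
  have mem: "?ds \<in> set dss" "dss ! ?k' \<in> set dss" using kl k' by simp_all
  have f: "hd (dss ! ?k') = fp N t (last ?ds)"
  proof (cases "Suc k < length dss")
   case True
   then have "dss = take k dss @ ?ds # dss ! Suc k # drop (Suc (Suc k)) dss"
    by (metis Cons_nth_drop_Suc Suc_lessD id_take_nth_drop)
   moreover have "?ds ~= []" "dss ! Suc k ~= []" using ne(2) True kl by simp_all
   moreover have "?k' = Suc k" using True by simp
   moreover have "successively (\<lambda>x y. y = fp N t x) (concat dss)" using c by (simp add: cyc_def)
   ultimately show ?thesis using successively_concat_step[of "\<lambda>x y. y = fp N t x" "take k dss" ?ds "dss ! Suc k"] by metis
  next
   case False
   then have sk: "length dss = Suc k" using kl by simp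
   then have "?k' = 0" "?ds = last dss" using last_conv_nth[OF ne(1)] by simp_all
   moreover have "hd (concat dss) = hd (dss ! 0)" using ne by (cases dss) auto
   moreover have "last (concat dss) = last (last dss)" using ne by (cases dss rule: rev_cases) auto
   ultimately show ?thesis using c by (simp add: cyc_def)
  qed
  have hb: "hd (dss ! ?k') \<in> bnd N {..<j} t" "hd ?ds \<in> bnd N {..<j} t" using B mem by auto
  obtain us vs where "dss = us @ ?ds # vs" using mem(1) by (metis in_set_conv_decomp)
  moreover have "successively (\<lambda>x y. y = fp N t x) (concat dss)" using c by (simp add: cyc_def)
  ultimately have s: "successively (\<lambda>x y. y = fp N t x) ?ds"
   using successively_concat_block by metis
  have tl: "set (tl ?ds) \<inter> bnd N {..<j} t = {}" using reading_not_head[OF N fin g rd mem(1)] by blast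
  have e: "set ?ds \<subseteq> ends N {..<j}" using sub mem(1) by auto
  have "boundary_region N G (hd ?ds) (map next_corner ?ds) (hd (dss ! ?k'))"
   unfolding boundary_region_iff[OF e ne(2)[OF mem(1)]] using s tl hb head[OF f hb(1)] by simp
  then show ?thesis using kl k' by simp
 qed
 have "hd (map hd dss) = r" using ne r by (simp add: hd_map)
 then show ?thesis unfolding boundary_reading_def using ne d B boundary_ends_G reg by simp
qed

text \<open>The regions follow each other from endpoint to endpoint, so the concatenated blocks run
  along the orbit of the root. What needs an argument is that they run through it only once.\<close>

lemma boundary_imp_reading:
 assumes br: "boundary_reading N G bs css"
 obtains dss where "reading N {..<j} t dss" "hd (hd dss) = r" "css = map (map next_corner) dss" "bs = map hd dss"
proof -
 have b: "bs ~= []" "length css = length bs" "distinct bs" "set bs = bnd N {..<j} t" "hd bs = r"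
  and reg: "\<And>k. k < length bs ==> boundary_region N G (bs ! k) (css ! k) (bs ! (Suc k mod length bs))"
  using br unfolding boundary_reading_def boundary_ends_G by auto
 have ex: "\<exists>ds. css ! k = map next_corner ds \<and> set ds \<subseteq> ends N {..<j} \<and> ds ~= []" if k: "k < length bs" for k
 proof -
  have r: "css ! k ~= []" "hd (css ! k) = next_corner (bs ! k)"
   "successively (\<lambda>c c'. (c, c') \<in> corner_step N G) (css ! k)" "bs ! k \<in> bnd N {..<j} t"
   using reg[OF k] unfolding boundary_region_def boundary_ends_G by auto
  have h: "hd (css ! k) \<in> next_corner ` ends N {..<j}" using r by (auto simp: bnd_def)
  have "set cs \<subseteq> next_corner ` ends N {..<j}"
   if "successively (\<lambda>c c'. (c, c') \<in> corner_step N G) cs" "cs ~= []" "hd cs \<in> next_corner ` ends N {..<j}" for cs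
   using that
  proof (induction cs)
   case (Cons c cs)
   show ?case
   proof (cases cs)
    case (Cons c' cs')
    obtain e where e: "e \<in> ends N {..<j}" "c = next_corner e" using Cons.prems(3) by auto
    have "(next_corner e, c') \<in> corner_step N G" using Cons.prems(1) Cons e by simp
    then have "c' = next_corner (fp N t e)" using step_iff(1)[OF e(1)] by simp
    then have "c' \<in> next_corner ` ends N {..<j}" using fp_ends[OF N g e(1)] by simp
    then show ?thesis using Cons.IH Cons.prems Cons by simp
   qed (use Cons.prems in simp)
  qed simp
  from this[OF r(3,1) h] have "set (css ! k) \<subseteq> next_corner ` ends N {..<j}" .
  then have "css ! k \<in> lists (next_corner ` ends N {..<j})" by (simp add: lists_eq_set)
  then have "css ! k \<in> map next_corner ` lists (ends N {..<j})" by (simp only: lists_image)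
  then obtain ds where "set ds \<subseteq> ends N {..<j}" "css ! k = map next_corner ds"
   unfolding lists_eq_set by blast
  then show ?thesis using r(1) by auto
 qed
 define dss where "dss = map (map (inv next_corner)) css"
 have len: "length dss = length bs" by (simp add: dss_def b(2))
 have D: "css ! k = map next_corner (dss ! k)" "set (dss ! k) \<subseteq> ends N {..<j}" "dss ! k ~= []" if k: "k < length bs" for k
 proof -
  obtain ds where ds: "css ! k = map next_corner ds" "set ds \<subseteq> ends N {..<j}" "ds ~= []" using ex[OF k] by blast
  have "dss ! k = ds" using k b(2) ds(1) by (simp add: dss_def comp_def inj_next_corner)
  then show "css ! k = map next_corner (dss ! k)" "set (dss ! k) \<subseteq> ends N {..<j}" "dss ! k ~= []" using ds by simp_all
 qed
 have R: "bs ! k \<in> bnd N {..<j} t \<and> hd (dss ! k) = bs ! k \<and> successively (\<lambda>x y. y = fp N t x) (dss ! k) \<and>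
   set (tl (dss ! k)) \<inter> bnd N {..<j} t = {} \<and> sg N (last (dss ! k)) = bs ! (Suc k mod length bs) \<and>
   bs ! (Suc k mod length bs) \<in> bnd N {..<j} t" if k: "k < length bs" for k
  using reg[OF k] unfolding D(1)[OF k] boundary_region_iff[OF D(2,3)[OF k]] by blast
 have cssd: "css = map (map next_corner) dss"
  by (rule nth_equalityI) (use len b(2) D(1) in auto)
 have bsd: "bs = map hd dss" by (rule nth_equalityI) (use len R in auto)
 have nxt: "fp N t (last (dss ! k)) = hd (dss ! (Suc k mod length bs))" if k: "k < length bs" for k
 proof -
  have "Suc k mod length bs < length bs" using b(1) by simp
  then show ?thesis using R[OF k] R[of "Suc k mod length bs"] by (simp add: fp_def bnd_def)
 qed
 have ne: "d ~= []" if "d \<in> set dss" for d using that D(3) len by (metis in_set_conv_nth)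
 have dne: "dss ~= []" using b(1) bsd by auto
 have succ: "successively (\<lambda>x y. y = fp N t x) (concat (take n dss))" if "n \<le> length dss" for n
  using that
 proof (induction n)
  case (Suc n)
  then have n: "n < length dss" "n < length bs" using len by simp_all
  have eq: "concat (take (Suc n) dss) = concat (take n dss) @ dss ! n"
   using n by (simp add: take_Suc_conv_app_nth)
  show ?case
  proof (cases n)
   case 0
   then show ?thesis unfolding eq using R[OF n(2)] by simp
  next
   case (Suc m)
   have "take n dss = take m dss @ [dss ! m]" using n Suc by (simp add: take_Suc_conv_app_nth)
   then have l: "concat (take n dss) ~= []" "last (concat (take n dss)) = last (dss ! m)"
    using ne[of "dss ! m"] n Suc by simp_all
   have "fp N t (last (dss ! m)) = hd (dss ! n)" using nxt[of m] n Suc by simp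
   then show ?thesis
    unfolding eq successively_append_iff using Suc.IH n R[OF n(2)] l by simp
  qed
 qed simp
 have hl: "hd (concat dss) = hd (dss ! 0)" "concat dss ~= []"
  using dne ne by (cases dss; simp)+
 have ll: "last (concat dss) = last (last dss)" using dne ne by (cases dss rule: rev_cases) auto
 have close: "hd (concat dss) = fp N t (last (concat dss))"
 proof -
  have "length dss > 0" using dne by simp
  then have k1: "Suc (length dss - 1) = length bs" using len by linarith
  have k: "length dss - 1 < length bs" using k1 by linarith
  have k2: "Suc (length dss - 1) mod length bs = 0" unfolding k1 by simp
  have "last dss = dss ! (length dss - 1)" using dne by (simp add: last_conv_nth)
  then show ?thesis unfolding hl(1) ll using nxt[OF k] unfolding k2 by metis
 qed
 have S: "successively (\<lambda>x y. y = fp N t x) (concat dss)" using succ[of "length dss"] by simp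
 let ?b = "hd (concat dss)"
 have b0: "?b = bs ! 0" using R[of 0] b(1) hl by simp
 have "?b \<in> ends N {..<j}" using R[of 0] b(1) b0 by (simp add: bnd_def)
 then obtain xs where xs: "cyc (fp N t) xs" "hd xs = ?b"
  using cyc_exists[OF finite_ends[OF finite_lessThan] fp_inj_on[OF g] fp_ends_image[OF N g]] by metis
 have xne: "xs ~= []" using xs(1) by (simp add: cyc_def)
 have nth: "xs ! n = concat dss ! n" if "n < length xs" "n < length (concat dss)" for n
  using successively_nth_funpow[OF _ that(1), of "fp N t"] successively_nth_funpow[OF S that(2)] xs by (simp add: cyc_def)
 \<comment> \<open>Otherwise the root would be passed a second time. It would then lie inside a
   block, where no boundary end occurs, or begin another block, although the endpoints are
   distinct.\<close>
 have le: "length (concat dss) \<le> length xs"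
 proof (rule ccontr)
  assume "\<not> length (concat dss) \<le> length xs"
  then have l: "length xs < length (concat dss)" by simp
  have "concat dss ! length xs = (fp N t ^^ length xs) ?b" by (rule successively_nth_funpow[OF S l])
  also have "\<dots> = fp N t ((fp N t ^^ (length xs - 1)) (hd xs))" using xne xs(2) by (cases xs) simp_all
  also have "(fp N t ^^ (length xs - 1)) (hd xs) = last xs"
   using successively_nth_funpow[of "fp N t" xs "length xs - 1"] xs(1) xne by (simp add: cyc_def last_conv_nth)
  also have "fp N t (last xs) = ?b" using xs by (simp add: cyc_def)
  finally have nb: "concat dss ! length xs = ?b" .
  obtain m where m: "length xs = Suc m" using xne by (cases xs) auto
  obtain c cs where cc: "concat dss = c # cs" using hl(2) by (cases "concat dss") auto
  have "?b = cs ! m" using nb m unfolding cc by simp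
  moreover have "cs ! m \<in> set cs" using l m cc by simp
  ultimately have "?b \<in> set (tl (concat dss))" unfolding cc by simp
  moreover obtain d ds' where d: "dss = d # ds'" using dne by (cases dss) auto
  moreover have "d ~= []" using ne d by simp
  ultimately have "?b \<in> set (tl d) \<or> ?b \<in> set (concat ds')" by (cases d) auto
  moreover have "?b \<in> bnd N {..<j} t" using R[of 0] b(1) b0 by simp
  moreover have tl: "set (tl x) \<inter> bnd N {..<j} t = {}" if "x \<in> set dss" for x
   using that R len by (metis in_set_conv_nth)
  ultimately obtain x where x: "x \<in> set ds'" "?b \<in> set x" using d by auto
  then have "?b \<notin> set (tl x)" using tl[of x] d \<open>?b \<in> bnd N {..<j} t\<close> by auto
  then have "?b = hd x" using x(2) by (cases x) auto
  then have "?b \<in> set (map hd ds')" using x(1) by auto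
  moreover have "?b = hd d" using d ne by simp
  ultimately show False using b(3) unfolding bsd d by simp
 qed
 have "concat dss = take (length (concat dss)) xs"
  by (rule nth_equalityI) (use le nth in auto)
 moreover have "distinct xs" using xs(1) by (simp add: cyc_def)
 ultimately have "distinct (concat dss)" by (metis distinct_take)
 then have "cyc (fp N t) (concat dss)" using S close hl(2) by (simp add: cyc_def)
 then have "reading N {..<j} t dss" unfolding reading_def using dne ne b(4) bsd by metis
 moreover have "hd (hd dss) = r" using b(5) bsd dne by (simp add: hd_map)
 ultimately show thesis using cssd bsd by (rule that)
qed

text \<open>On a face without boundary ends every application of the face permutation is a corner
  step, and a corner step that arrives in the face also starts in it. So the equivalence class
  generated by the steps is one orbit.\<close>

lemma region_of_face:
 assumes X: "X \<in> faces (fp N t) (ends N {..<j})" "X \<inter> bnd N {..<j} t = {}" "x \<in> X"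
 shows "(corner_step N G \<union> (corner_step N G)\<inverse>)\<^sup>* `` {next_corner x} = next_corner ` X"
proof (intro equalityI subsetI)
 have XE: "X \<subseteq> ends N {..<j}" using X(1) by (auto simp: faces_def)
 fix c
 {
  assume "c \<in> (corner_step N G \<union> (corner_step N G)\<inverse>)\<^sup>* `` {next_corner x}"
  then have "(next_corner x, c) \<in> (corner_step N G \<union> (corner_step N G)\<inverse>)\<^sup>*" by simp
  then show "c \<in> next_corner ` X"
  proof induction
   case base
   then show ?case using X(3) by simp
  next
   case (step y z)
   then obtain e where e: "e \<in> X" "y = next_corner e" by auto
   from step.hyps(2) consider "(y, z) \<in> corner_step N G" | "(z, y) \<in> corner_step N G" by blast
   then show ?case
   proof cases
    case 1
    then have "z = next_corner (fp N t e)" using step_iff(1)[of e z] e XE by auto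
    then show ?thesis using face_closed[OF X(1) e(1)] by simp
   next
    case 2
    then obtain e' where e': "e' \<in> ends N {..<j}" "z = next_corner e'" using step_dom by blast
    have "y = next_corner (fp N t e')" using 2 step_iff(1)[OF e'(1)] e'(2) by simp
    then have f: "fp N t e' = e" using e(2) inj_next_corner by (simp add: inj_eq)
    obtain X' where X': "X' \<in> faces (fp N t) (ends N {..<j})" "e' \<in> X'"
     using faces_cover[OF finite_ends[OF finite_lessThan] fp_inj_on[OF g] fp_ends_image[OF N g] e'(1)] .
    have "e \<in> X'" using face_closed[OF X'] f by simp
    then have "X' = X" using faces_disjoint[OF X'(1) X(1)] e(1) by blast
    then show ?thesis using X'(2) e'(2) by simp
   qed
  qed
 next
  assume "c \<in> next_corner ` X"
  then obtain y where y: "y \<in> X" "c = next_corner y" by auto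
  obtain xs where xs: "cyc (fp N t) xs" "hd xs = x" "set xs = X" "X \<subseteq> ends N {..<j}" using facesE[OF X(1,3)] .
  have mem: "(fp N t ^^ k) x \<in> X" for k by (induction k) (use X(3) face_closed[OF X(1)] in auto)
  have "(next_corner x, next_corner ((fp N t ^^ k) x)) \<in> (corner_step N G \<union> (corner_step N G)\<inverse>)\<^sup>*" for k
  proof (induction k)
   case (Suc k)
   have "(next_corner ((fp N t ^^ k) x), next_corner (fp N t ((fp N t ^^ k) x))) \<in> corner_step N G"
    using step_iff(1)[of "(fp N t ^^ k) x"] mem[of k] mem[of "Suc k"] XE X(2) by auto
   then show ?case using Suc.IH by (simp add: rtrancl_into_rtrancl)
  qed simp
  moreover obtain k where "k < length xs" "y = xs ! k" using y(1) xs(3) by (metis in_set_conv_nth)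
  then have "y = (fp N t ^^ k) x" using successively_nth_funpow[of "fp N t" xs k] xs by (simp add: cyc_def)
  ultimately show "c \<in> (corner_step N G \<union> (corner_step N G)\<inverse>)\<^sup>* `` {next_corner x}" using y(2) by simp
 }
qed

lemma inner_regions_G:
 "inner_regions N G = (`) next_corner ` {X \<in> faces (fp N t) (ends N {..<j}). X \<inter> bnd N {..<j} t = {}}"
proof (intro equalityI subsetI)
 let ?R = "(corner_step N G \<union> (corner_step N G)\<inverse>)\<^sup>*"
 let ?B = "bnd N {..<j} t"
 fix Y assume "Y \<in> inner_regions N G"
 then obtain e where e: "e \<in> ends N {..<j}" "Y = ?R `` {next_corner e}" and Y: "\<And>c. c \<in> Y ==> next_end N c \<notin> ?B"
  unfolding inner_regions_def regions_def boundary_ends_G corners_G by (auto elim!: quotientE)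
 obtain X where X: "X \<in> faces (fp N t) (ends N {..<j})" "e \<in> X"
  using faces_cover[OF finite_ends[OF finite_lessThan] fp_inj_on[OF g] fp_ends_image[OF N g] e(1)] .
 obtain xs where xs: "cyc (fp N t) xs" "hd xs = e" "set xs = X" "X \<subseteq> ends N {..<j}" using facesE[OF X] .
 \<comment> \<open>No corner of the region leads to a boundary endpoint, so the corner steps never
   stop and follow the whole face.\<close>
 have in_Y: "next_corner ((fp N t ^^ k) e) \<in> Y \<and> (fp N t ^^ k) e \<in> X" for k
 proof (induction k)
  case 0
  then show ?case using e X by simp
 next
  case (Suc k)
  let ?e = "(fp N t ^^ k) e"
  have E: "?e \<in> ends N {..<j}" using Suc xs by auto
  have "sg N ?e \<notin> ?B" using Y[of "next_corner ?e"] Suc by (simp add: sg_def)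
  then have "(next_corner ?e, next_corner (fp N t ?e)) \<in> corner_step N G" using step_iff[OF E] by simp
  moreover have "(next_corner e, next_corner ?e) \<in> ?R" using Suc e(2) by simp
  ultimately have "(next_corner e, next_corner (fp N t ?e)) \<in> ?R"
   by (meson UnI1 rtrancl.rtrancl_into_rtrancl)
  then show ?case using e(2) face_closed[OF X(1)] Suc by simp
 qed
 have "x \<notin> ?B" if x: "x \<in> X" for x
 proof -
  obtain ys where ys: "cyc (fp N t) ys" "hd ys = x" "set ys = X" "X \<subseteq> ends N {..<j}" using facesE[OF X(1) x] .
  then have l: "last ys \<in> X" "fp N t (last ys) = x" by (auto simp: cyc_def)
  obtain k where "k < length xs" "last ys = xs ! k" using l(1) xs(3) by (metis in_set_conv_nth)
  then have k: "last ys = (fp N t ^^ k) e" using successively_nth_funpow[of "fp N t" xs k] xs by (simp add: cyc_def)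
  have "sg N (last ys) \<notin> ?B" using Y[of "next_corner (last ys)"] in_Y[of k] k by (simp add: sg_def)
  then show ?thesis using step_iff(2)[of "last ys"] l ys(4) by auto
 qed
 then have XB: "X \<inter> ?B = {}" by blast
 then have "Y = next_corner ` X" using region_of_face[OF X(1) XB X(2)] e(2) by simp
 then show "Y \<in> (`) next_corner ` {X \<in> faces (fp N t) (ends N {..<j}). X \<inter> ?B = {}}" using X(1) XB by blast
next
 fix Y assume "Y \<in> (`) next_corner ` {X \<in> faces (fp N t) (ends N {..<j}). X \<inter> bnd N {..<j} t = {}}"
 then obtain X where X: "Y = next_corner ` X" "X \<in> faces (fp N t) (ends N {..<j})" "X \<inter> bnd N {..<j} t = {}" by auto
 obtain x where x: "x \<in> X" using faces_nonempty[OF X(2)] by blast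
 have XE: "X \<subseteq> ends N {..<j}" using X(2) by (auto simp: faces_def)
 have "Y = (corner_step N G \<union> (corner_step N G)\<inverse>)\<^sup>* `` {next_corner x}"
  using region_of_face[OF X(2,3) x] X(1) by simp
 moreover have "next_corner x \<in> corners N G" using x XE corners_G by blast
 ultimately have "Y \<in> regions N G" unfolding regions_def by (metis quotientI)
 moreover have "next_end N c \<notin> boundary_ends N G" if c: "c \<in> Y" for c
 proof -
  obtain y where y: "y \<in> X" "c = next_corner y" using c X(1) by auto
  have "fp N t y \<notin> bnd N {..<j} t" using face_closed[OF X(2) y(1)] X(3) by blast
  then show ?thesis using step_iff(2)[of y] y XE boundary_ends_G by (auto simp: sg_def)
 qed
 ultimately show "Y \<in> inner_regions N G" unfolding inner_regions_def by blast
qed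

text \<open>All boundary ends lie on the boundary orbit, so every other face is free of
  them.\<close>

lemma inner_faces_reading:
 assumes rd: "reading N {..<j} t dss"
 shows "{X \<in> faces (fp N t) (ends N {..<j}). X \<inter> bnd N {..<j} t = {}} =
  faces (fp N t) (ends N {..<j}) - {set (concat dss)}"
proof -
 have fin: "finite {..<j}" by simp
 note XF = reading_facesI[OF N fin g rd]
 have ne: "dss ~= []" "\<And>d. d \<in> set dss ==> d ~= []" and B: "set (map hd dss) = bnd N {..<j} t"
  using rd unfolding reading_def by blast+
 have sub: "bnd N {..<j} t \<subseteq> set (concat dss)" using heads_subset_concat[OF ne(2)] B by metis
 have "hd (hd dss) \<in> bnd N {..<j} t" using B ne(1) by (metis hd_in_set image_eqI list.set_map)
 then have "set (concat dss) \<inter> bnd N {..<j} t ~= {}" using sub by blast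
 moreover have "X \<inter> bnd N {..<j} t = {}" if "X \<in> faces (fp N t) (ends N {..<j})" "X ~= set (concat dss)" for X
  using faces_disjoint[OF that(1) XF] that(2) sub by blast
 ultimately show ?thesis by blast
qed

lemma petal_image: "petal_cycle i (next_corner ` X) \<longleftrightarrow> (\<exists>v. X = {In v i})"
proof -
 have "next_corner ` X = {UCorner v i} \<longleftrightarrow> X = {In v i}" for v
  using inj_image_eq_iff[OF inj_next_corner, of X "{In v i}"] by simp
 then show ?thesis by (simp add: petal_cycle_def)
qed

lemma internal_image: "internal_cycle N (next_corner ` X) \<longleftrightarrow> (\<exists>f. X = (\<lambda>i. Out (f i) i) ` {1..N})"
proof -
 have "next_corner ` X = (\<lambda>i. SCorner (f i) i) ` {1..N} \<longleftrightarrow> X = (\<lambda>i. Out (f i) i) ` {1..N}" for f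
  using inj_image_eq_iff[OF inj_next_corner, of X "(\<lambda>i. Out (f i) i) ` {1..N}"] by (simp add: image_image)
 then show ?thesis by (simp add: internal_cycle_def)
qed

lemma face_wt_ex:
 "(\<exists>k. face_wt N X k) \<longleftrightarrow> (\<exists>i \<in> {1..N}. petal_cycle i (next_corner ` X)) \<or> internal_cycle N (next_corner ` X)"
 unfolding petal_image internal_image face_wt_def by blast

lemma image_Collect_filter: "{Y \<in> f ` A. P Y} = f ` {X \<in> A. P (f X)}"
 by auto

text \<open>\<open>graph_weight\<close> counts regions for each index, whereas
  \<open>weighted\<close> chooses an index for each face. The multiplicities agree because a face
  determines its index.\<close>

lemma weighted_iff_G:
 "weighted N w {X \<in> faces (fp N t) (ends N {..<j}). X \<inter> bnd N {..<j} t = {}} \<longleftrightarrow>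
 (\<forall>X \<in> inner_regions N G. (\<exists>i \<in> {1..N}. petal_cycle i X) \<or> internal_cycle N X) \<and> graph_weight N G = w"
proof -
 let ?F = "{X \<in> faces (fp N t) (ends N {..<j}). X \<inter> bnd N {..<j} t = {}}"
 have fin: "finite ?F" by (simp add: finite_faces)
 have inj: "inj_on ((`) next_corner) A" for A using inj_next_corner by (simp add: inj_on_def inj_image_eq_iff)
 have allowed: "(\<forall>X \<in> inner_regions N G. (\<exists>i \<in> {1..N}. petal_cycle i X) \<or> internal_cycle N X) \<longleftrightarrow>
   (\<forall>X\<in>?F. \<exists>k. face_wt N X k)"
  (is "?L \<longleftrightarrow> ?R")
 proof
  assume l: ?L
  show ?R
  proof
   fix X assume "X \<in> ?F"
   then have "next_corner ` X \<in> inner_regions N G" unfolding inner_regions_G by (rule imageI)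
   from bspec[OF l this] show "\<exists>k. face_wt N X k" unfolding face_wt_ex .
  qed
 next
  assume r: ?R
  show ?L
  proof
   fix Y assume "Y \<in> inner_regions N G"
   then obtain X where "Y = next_corner ` X" "X \<in> ?F" unfolding inner_regions_G by (rule imageE)
   then show "(\<exists>i \<in> {1..N}. petal_cycle i Y) \<or> internal_cycle N Y"
    using bspec[OF r, of X] unfolding face_wt_ex by simp
  qed
 qed
 have card_im: "card {Y \<in> inner_regions N G. P Y} = card {X \<in> ?F. P (next_corner ` X)}" for P
 proof -
  have "{Y \<in> inner_regions N G. P Y} = (`) next_corner ` {X \<in> ?F. P (next_corner ` X)}"
   unfolding inner_regions_G by (rule image_Collect_filter)
  then show ?thesis by (simp only: card_image[OF inj])
 qed
 have gw: "graph_weight N G = image_mset h (mset_set ?F)" if h: "\<forall>X\<in>?F. face_wt N X (h X)" for h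
 proof (rule multiset_eqI)
  fix k
  have c: "count (image_mset h (mset_set ?F)) k = card {X \<in> ?F. h X = k}" by (rule count_image_mset_set[OF fin])
  have hk: "h X = k \<longleftrightarrow> face_wt N X k" if X: "X \<in> ?F" for X
   using bspec[OF h X] face_wt_unique[OF N, of X "h X" k] by blast
  have eq: "{X \<in> ?F. h X = k} = {X \<in> ?F. face_wt N X k}" by (rule Collect_cong) (use hk in blast)
  have "count (graph_weight N G) k =
    (\<Sum>i\<in>{1..N}. if i = k then card {X \<in> inner_regions N G. petal_cycle i X} else 0) +
    (if N + 1 = k then card {X \<in> inner_regions N G. internal_cycle N X} else 0)"
   unfolding graph_weight_def by (simp add: count_sum)
  also have "\<dots> = (if k \<in> {1..N} then card {X \<in> inner_regions N G. petal_cycle k X} else 0) +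
    (if N + 1 = k then card {X \<in> inner_regions N G. internal_cycle N X} else 0)"
   by (simp add: sum.delta)
  also have "\<dots> = card {X \<in> ?F. face_wt N X k}"
  proof -
   consider "k \<in> {1..N}" | "k = N + 1" | "k \<notin> {1..N}" "k ~= N + 1" by blast
   then show ?thesis
   proof cases
    case 1
    then have "N + 1 ~= k" by simp
    then have "face_wt N X k \<longleftrightarrow> petal_cycle k (next_corner ` X)" for X
     using 1 unfolding petal_image face_wt_def by metis
    then show ?thesis using 1 \<open>N + 1 ~= k\<close> card_im[of "petal_cycle k"] by simp
   next
    case 2
    then have "k \<notin> {1..N}" by simp
    moreover from this have "face_wt N X k \<longleftrightarrow> internal_cycle N (next_corner ` X)" for X
     using 2 unfolding internal_image face_wt_def by metis
    ultimately show ?thesis using 2 card_im[of "internal_cycle N"] by simp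
   next
    case 3
    then have "\<not> face_wt N X k" for X unfolding face_wt_def by blast
    then have e: "{X \<in> ?F. face_wt N X k} = {}" by simp
    have "N + 1 ~= k" using 3 by simp
    then show ?thesis
     by (simp only: e if_not_P[OF 3(1)] if_not_P[OF \<open>N + 1 ~= k\<close>] if_False card.empty add_0)
   qed
  qed
  finally show "count (graph_weight N G) k = count (image_mset h (mset_set ?F)) k" unfolding c eq .
 qed
 show ?thesis
 proof
  assume "weighted N w ?F"
  then obtain h where h: "\<forall>X\<in>?F. face_wt N X (h X)" "w = image_mset h (mset_set ?F)" unfolding weighted_def by blast
  then show "(\<forall>X \<in> inner_regions N G. (\<exists>i \<in> {1..N}. petal_cycle i X) \<or> internal_cycle N X) \<and> graph_weight N G = w"
   using allowed gw[OF h(1)] by blast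
 next
  assume a: "(\<forall>X \<in> inner_regions N G. (\<exists>i \<in> {1..N}. petal_cycle i X) \<or> internal_cycle N X) \<and> graph_weight N G = w"
  then have "\<forall>X\<in>?F. \<exists>k. face_wt N X k" using allowed by blast
  then obtain h where h: "\<forall>X\<in>?F. face_wt N X (h X)" by (rule bchoice[THEN exE])
  then have "w = image_mset h (mset_set ?F)" using gw[OF h] a by simp
  then show "weighted N w ?F" unfolding weighted_def using h by blast
 qed
qed

lemma card_inner_G: "card (inner_regions N G) = card {X \<in> faces (fp N t) (ends N {..<j}). X \<inter> bnd N {..<j} t = {}}"
 unfolding inner_regions_G using inj_next_corner by (intro card_image) (simp add: inj_on_def inj_image_eq_iff)

lemma card_inner_reading:
 assumes "reading N {..<j} t dss"
 shows "card (inner_regions N G) + 1 = card (faces (fp N t) (ends N {..<j}))"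
proof -
 have fin: "finite {..<j}" by simp
 note XF = reading_facesI[OF N fin g assms]
 have "finite (faces (fp N t) (ends N {..<j}))" by (simp add: finite_faces)
 then show ?thesis unfolding card_inner_G inner_faces_reading[OF assms] using card_Suc_Diff1[OF _ XF] by simp
qed

lemma labels_reading:
 assumes rd: "reading N {..<j} t dss"
 shows "map (\<lambda>cs. basis_prod N (map corner_label cs)) (map (map next_corner) dss) =
   map Some (map of_letters (map (map ety) dss))"
  "\<And>l. l \<in> set (map (map ety) dss) ==> l ~= [] \<and> chain N l \<and> snd (hd l) \<in> {1..N}"
proof -
 have fin: "finite {..<j}" by simp
 show L: "l ~= [] \<and> chain N l \<and> snd (hd l) \<in> {1..N}" if l: "l \<in> set (map (map ety) dss)" for l
 proof -
  obtain d where d: "d \<in> set dss" "l = map ety d" using l by auto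
  have "d ~= []" using rd d(1) by (auto simp: reading_def)
  moreover from this have "hd d \<in> ends N {..<j}" using reading_subset[OF N fin g rd] d(1) by (auto intro: hd_in_set)
  ultimately show ?thesis using reading_chain[OF N fin g rd d(1)] d(2) by (simp add: hd_map ends_def)
 qed
 show "map (\<lambda>cs. basis_prod N (map corner_label cs)) (map (map next_corner) dss) =
   map Some (map of_letters (map (map ety) dss))"
 proof -
  have "basis_prod N (map corner_label (map next_corner d)) = Some (of_letters (map ety d))" if "d \<in> set dss" for d
  proof -
   have "map corner_label (map next_corner d) = map gen (map ety d)" by (simp add: corner_label_next_corner)
   moreover have "map ety d \<in> set (map (map ety) dss)" using that by simp
   ultimately show ?thesis using basis_prod_gen[of "map ety d" N] L[of "map ety d"] by metis
  qed
  then show ?thesis by simp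
 qed
qed

lemma centered_iff_Lab:
 "G \<in> centered_graphs N j w as \<longleftrightarrow>
 set as \<subseteq> nontrivial N \<and> (t, r) \<in> Lab N {..<j} w (map (letters N) as)"
proof
 assume "G \<in> centered_graphs N j w as"
 then have d: "disk_graph N G" and al: "\<forall>X \<in> inner_regions N G. (\<exists>i \<in> {1..N}. petal_cycle i X) \<or> internal_cycle N X"
  and w: "graph_weight N G = w" and "reads_sequence N G as"
  by (simp_all add: centered_graphs_def centered_allowable_def)
 then obtain bs css where br: "boundary_reading N G bs css"
  and lab: "map (\<lambda>cs. basis_prod N (map corner_label cs)) css = map Some as" unfolding reads_sequence_def by blast
 obtain dss where dss: "reading N {..<j} t dss" "hd (hd dss) = r" "css = map (map next_corner) dss" "bs = map hd dss"
  using boundary_imp_reading[OF br] .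
 note L = labels_reading[OF dss(1)]
 have "map Some (map of_letters (map (map ety) dss)) = map Some as" 
  unfolding L(1)[symmetric] dss(3)[symmetric] by (rule lab)
 then have as: "as = map of_letters (map (map ety) dss)" by (simp only: inj_map_eq_map[OF inj_Some])
 have "set as \<subseteq> nontrivial N" unfolding as set_map[of of_letters] using L(2) of_letters_nontrivial by blast
 moreover have "map (letters N) as = map (map ety) dss"
  unfolding as map_map[of "letters N" of_letters] comp_def[of "letters N"]
  by (rule map_idI) (use L(2) letters_of_letters in blast)
 moreover have "good N {..<j} w t dss"
  unfolding good_def
 proof (intro conjI)
  show "conn {..<j} t" using d connected_G by (simp add: disk_graph_def)
  show "card {..<j} + card (faces (fp N t) (ends N {..<j})) = card (arcs_of t) + 2"
   using d card_inner_reading[OF dss(1)] card_arcs_G by (simp add: disk_graph_def)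
  show "weighted N w (faces (fp N t) (ends N {..<j}) - {set (concat dss)})"
   using weighted_iff_G[of w] al w inner_faces_reading[OF dss(1)] by simp
 qed (use g dss in auto)
 ultimately show "set as \<subseteq> nontrivial N \<and> (t, r) \<in> Lab N {..<j} w (map (letters N) as)"
  using dss(2) LabI[of N "{..<j}" w t dss _ r] by metis
next
 assume a: "set as \<subseteq> nontrivial N \<and> (t, r) \<in> Lab N {..<j} w (map (letters N) as)"
 then obtain dss where dss: "good N {..<j} w t dss" "map (map ety) dss = map (letters N) as" "r = hd (hd dss)"
  using LabE by metis
 note gd = goodD[OF dss(1)]
 have br: "boundary_reading N G (map hd dss) (map (map next_corner) dss)"
  by (rule reading_imp_boundary[OF gd(4) dss(3)[symmetric]])
 have "map of_letters (map (letters N) as) = as"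
  using a letters_nontrivial(3) by (simp add: map_idI subset_iff)
 then have rs: "reads_sequence N G as"
  unfolding reads_sequence_def using br labels_reading(1)[OF gd(4)] dss(2) by metis
 have "r \<in> bnd N {..<j} t" using gd(8,10) dss(3) by (metis hd_in_set image_eqI list.set_map)
 then have "j \<ge> 1" by (cases j) (auto simp: bnd_def ends_def)
 then have "disk_graph N G"
  unfolding disk_graph_def using wf_G connected_G gd(2,3) br card_inner_reading[OF gd(4)] card_arcs_G by auto
 moreover have "(\<forall>X \<in> inner_regions N G. (\<exists>i \<in> {1..N}. petal_cycle i X) \<or> internal_cycle N X) \<and> graph_weight N G = w"
  using weighted_iff_G[of w] gd(5) inner_faces_reading[OF gd(4)] by simp
 ultimately show "G \<in> centered_graphs N j w as"
  using rs by (simp add: centered_graphs_def centered_allowable_def)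
qed

end

section \<open>The structure constants\<close>

text \<open>In each color the arcs form the graph of a partial injection, so every end has at most
  one partner and the descriptions by \<open>THE\<close> are justified.\<close>

lemma star_graph_is_toG:
 assumes "wf_star_graph N G"
 obtains t where "gmap N {..<nverts G} t" "G = toG (nverts G) (t, root_end G)"
proof -
 have A: "v < nverts G \<and> i \<in> {1..N} \<and> u < nverts G" if "(v, i, u) \<in> arcs G" for v i u
  using assms that unfolding wf_star_graph_def by auto
 have out: "u = u'" if "(v, i, u) \<in> arcs G" "(v, i, u') \<in> arcs G" for v i u u'
  using assms that unfolding wf_star_graph_def by blast
 have inn: "v = v'" if "(v, i, u) \<in> arcs G" "(v', i, u) \<in> arcs G" for v v' i u
  using assms that unfolding wf_star_graph_def by blast
 define t where "t = (\<lambda>e. case e of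
   Out v i => (if \<exists>u. (v, i, u) \<in> arcs G then In (THE u. (v, i, u) \<in> arcs G) i else e)
  | In u i => (if \<exists>v. (v, i, u) \<in> arcs G then Out (THE v. (v, i, u) \<in> arcs G) i else e))"
 have tO: "t (Out v i) = In u i" and tI: "t (In u i) = Out v i" if a: "(v, i, u) \<in> arcs G" for v i u
 proof -
  have "(THE u. (v, i, u) \<in> arcs G) = u" using a out by (intro the_equality) auto
  then show "t (Out v i) = In u i" using a by (auto simp: t_def)
  have "(THE v. (v, i, u) \<in> arcs G) = v" using a inn by (intro the_equality) auto
  then show "t (In u i) = Out v i" using a by (auto simp: t_def)
 qed
 have cases: "t e = e \<or> (\<exists>v i u. (v, i, u) \<in> arcs G \<and> (e = Out v i \<and> t e = In u i \<or> e = In u i \<and> t e = Out v i))" for e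
 proof (cases e)
  case (Out v i)
  show ?thesis
  proof (cases "\<exists>u. (v, i, u) \<in> arcs G")
   case True
   then show ?thesis using tO Out by blast
  qed (simp add: t_def Out)
 next
  case (In u i)
  show ?thesis
  proof (cases "\<exists>v. (v, i, u) \<in> arcs G")
   case True
   then show ?thesis using tI In by blast
  qed (simp add: t_def In)
 qed
 have g: "gmap N {..<nverts G} t"
  unfolding gmap_def
 proof (intro conjI allI impI)
  show "t (t e) = e" for e using cases[of e] tO tI by metis
  show "e \<in> ends N {..<nverts G}" "ety (t e) = flip (ety e)" if "t e ~= e" for e
  proof -
   obtain v i u where "(v, i, u) \<in> arcs G" "e = Out v i \<and> t e = In u i \<or> e = In u i \<and> t e = Out v i"
    using cases[of e] \<open>t e ~= e\<close> by blast
   then show "e \<in> ends N {..<nverts G}" "ety (t e) = flip (ety e)" using A[of v i u] by (auto simp: ends_def)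
  qed
 qed
 have "arcs G = {(v, i, u). t (Out v i) = In u i}"
 proof (rule set_eqI)
  fix p :: "nat \<times> nat \<times> nat"
  obtain v i u where p: "p = (v, i, u)" by (cases p)
  have "(v, i, u) \<in> arcs G" if "t (Out v i) = In u i" using cases[of "Out v i"] that by auto
  then show "p \<in> arcs G \<longleftrightarrow> p \<in> {(v, i, u). t (Out v i) = In u i}" using p tO by auto
 qed
 then have "G = toG (nverts G) (t, root_end G)" by (simp add: toG_def)
 with g show thesis by (rule that)
qed

lemma centered_graphs_toG:
 assumes "N \<ge> 1"
 shows "centered_graphs N j w as = (if set as \<subseteq> nontrivial N then toG j ` Lab N {..<j} w (map (letters N) as) else {})"
proof -
 have 1: "G \<in> toG j ` Lab N {..<j} w (map (letters N) as) \<and> set as \<subseteq> nontrivial N" if G: "G \<in> centered_graphs N j w as" for G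
 proof -
  have n: "nverts G = j" and "wf_star_graph N G"
   using G by (simp_all add: centered_graphs_def centered_allowable_def disk_graph_def)
  then obtain t where t: "gmap N {..<j} t" "G = toG j (t, root_end G)" using star_graph_is_toG by metis
  show ?thesis using centered_iff_Lab[OF assms t, of w as] G t(2) by blast
 qed
 have 2: "toG j p \<in> centered_graphs N j w as"
  if p: "p \<in> Lab N {..<j} w (map (letters N) as)" "set as \<subseteq> nontrivial N" for p
 proof -
  obtain t r where tr: "p = (t, r)" by (cases p)
  have "gmap N {..<j} t" using p(1) unfolding tr by (elim LabE) (rule goodD(1))
  then show ?thesis using centered_iff_Lab[OF assms _ refl, of j t r w as] p unfolding tr by blast
 qed
 show ?thesis using 1 2 by (auto split: if_splits)
qed

lemma toG_relab:
 assumes "bij \<pi>"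
 shows "nverts (toG j (relab \<pi> p)) = j" "root_end (toG j (relab \<pi> p)) = rename_end \<pi> (snd p)"
  "arcs (toG j (relab \<pi> p)) = (\<lambda>(v, i, u). (\<pi> v, i, \<pi> u)) ` arcs (toG j p)"
proof -
 let ?\<rho> = "rename_end \<pi>"
 have inj: "inj ?\<rho>" by (rule bij_is_inj[OF bij_rename[OF assms]])
 have eq: "(?\<rho> \<circ> fst p \<circ> inv ?\<rho>) (Out (\<pi> v) i) = In (\<pi> u) i \<longleftrightarrow> fst p (Out v i) = In u i" for v i u
 proof -
  have "inv ?\<rho> (Out (\<pi> v) i) = Out v i" using inv_f_f[OF inj, of "Out v i"] by simp
  moreover have "?\<rho> x = In (\<pi> u) i \<longleftrightarrow> x = In u i" for x
   using inj_eq[OF inj, of x "In u i"] by simp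
  ultimately show ?thesis by simp
 qed
 show "arcs (toG j (relab \<pi> p)) = (\<lambda>(v, i, u). (\<pi> v, i, \<pi> u)) ` arcs (toG j p)"
 proof (intro equalityI subsetI)
  fix q assume q: "q \<in> arcs (toG j (relab \<pi> p))"
  obtain v i u where q': "q = (\<pi> v, i, \<pi> u)" using assms by (metis bij_pointE surj_pair)
  then have "(v, i, u) \<in> arcs (toG j p)" using q eq by (simp add: toG_def relab_def)
  then show "q \<in> (\<lambda>(v, i, u). (\<pi> v, i, \<pi> u)) ` arcs (toG j p)" using q' by force
 next
  fix q assume "q \<in> (\<lambda>(v, i, u). (\<pi> v, i, \<pi> u)) ` arcs (toG j p)"
  then obtain v i u where "(v, i, u) \<in> arcs (toG j p)" "q = (\<pi> v, i, \<pi> u)" by auto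
  then show "q \<in> arcs (toG j (relab \<pi> p))" using eq by (simp add: toG_def relab_def)
 qed
qed (simp_all add: toG_def relab_def)

lemma isotopic_class:
 assumes N: "N \<ge> 1" and p: "p \<in> Lab N {..<j} w ls"
 shows "isotopic `` {toG j p} = toG j ` orb {..<j} p"
proof (intro equalityI subsetI)
 obtain t dss where tp: "p = (t, hd (hd dss))" and good: "good N {..<j} w t dss" using p by (auto simp: Lab_def)
 note gd = goodD[OF good]
 have rb: "snd p \<in> bnd N {..<j} t" using gd(8,10) tp by (metis hd_in_set image_eqI list.set_map snd_conv)
 fix H
 {
  assume "H \<in> isotopic `` {toG j p}"
  then obtain \<pi> where H: "nverts H = j" "bij_betw \<pi> {..<j} {..<j}"
   "arcs H = (\<lambda>(v, i, u). (\<pi> v, i, \<pi> u)) ` arcs (toG j p)" "root_end H = rename_end \<pi> (snd p)"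
   by (auto simp: isotopic_def toG_def)
  \<comment> \<open>An isotopy provides a bijection of the vertices only. Continued by the identity
    it becomes a permutation of all vertex names, as relabelling requires.\<close>
  define \<pi>' where "\<pi>' = (\<lambda>v. if v < j then \<pi> v else v)"
  have eq: "\<pi>' v = \<pi> v" if "v < j" for v using that by (simp add: \<pi>'_def)
  have "bij_betw \<pi>' {..<j} {..<j}" using H(2) bij_betw_cong[of "{..<j}" \<pi>' \<pi>] eq by simp
  then have perm: "\<pi>' permutes {..<j}" by (rule bij_imp_permutes) (simp add: \<pi>'_def)
  note rl = toG_relab[OF permutes_bij[OF perm], of j p]
  have "arcs H = (\<lambda>(v, i, u). (\<pi>' v, i, \<pi>' u)) ` arcs (toG j p)"
   unfolding H(3)
  proof (rule image_cong[OF refl])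
   fix q assume q: "q \<in> arcs (toG j p)"
   obtain v i u where q': "q = (v, i, u)" by (cases q)
   have "v < j" "u < j" using arcs_G_range[OF N gd(1) refl, of v i u] q unfolding q' tp by auto
   then show "(case q of (v, i, u) => (\<pi> v, i, \<pi> u)) = (case q of (v, i, u) => (\<pi>' v, i, \<pi>' u))"
    unfolding q' by (simp add: eq)
  qed
  moreover have "rename_end \<pi> (snd p) = rename_end \<pi>' (snd p)"
   using rb eq[of "vert (snd p)"] by (intro edge_end_eqI) (auto simp: bnd_def ends_def)
  ultimately have "H = toG j (relab \<pi>' p)" using rl H by (intro star_graph.equality) simp_all
  then show "H \<in> toG j ` orb {..<j} p" using perm by (auto simp: orb_def)
 next
  assume "H \<in> toG j ` orb {..<j} p"
  then obtain \<pi> where \<pi>: "\<pi> permutes {..<j}" "H = toG j (relab \<pi> p)" by (auto simp: orb_def)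
  note rl = toG_relab[OF permutes_bij[OF \<pi>(1)], of j p]
  have "root_end (toG j p) = snd p" "nverts (toG j p) = j" by (simp_all add: toG_def)
  then show "H \<in> isotopic `` {toG j p}"
   unfolding isotopic_def \<pi>(2) using rl permutes_imp_bij[OF \<pi>(1)] by auto
 }
qed

lemma inj_toG: "inj_on (toG j) (Lab N {..<j} w ls)"
proof (rule inj_onI)
 fix p q assume p: "p \<in> Lab N {..<j} w ls" and q: "q \<in> Lab N {..<j} w ls" and eq: "toG j p = toG j q"
 obtain t r t' r' where pq: "p = (t, r)" "q = (t', r')" by (cases p; cases q)
 have g: "gmap N {..<j} t" "gmap N {..<j} t'" using p q unfolding pq by (elim LabE; blast dest: goodD(1))+
 have r: "r = r'" and a: "{(v, i, u). t (Out v i) = In u i} = {(v, i, u). t' (Out v i) = In u i}"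
  using eq by (simp_all add: toG_def pq)
 have O: "t (Out v i) = In u i \<longleftrightarrow> t' (Out v i) = In u i" for v i u
  using eqset_imp_iff[OF a, of "(v, i, u)"] by simp
 have sub: "t' e = t e" if gt: "gmap N {..<j} t" "gmap N {..<j} t'" "t e ~= e"
  and O: "\<And>v i u. t (Out v i) = In u i \<longleftrightarrow> t' (Out v i) = In u i" for t t' e
 proof -
  have "ety (t e) = flip (ety e)" using gmap_moved[OF gt(1,3)] by blast
  then consider v i u where "e = Out v i" "t e = In u i" | v i u where "e = In u i" "t e = Out v i"
   by (cases e; cases "t e") auto
  then show ?thesis
  proof cases
   case 1
   then show ?thesis using O by metis
  next
   case 2
   then have "t (Out v i) = In u i" using gmap_involution[OF gt(1)] by metis
   then have "t' (Out v i) = In u i" using O by simp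
   then show ?thesis using 2 gmap_involution[OF gt(2)] by metis
  qed
 qed
 have "t = t'"
 proof
  fix e
  consider "t e ~= e" | "t' e ~= e" | "t e = e" "t' e = e" by blast
  then show "t e = t' e"
  proof cases
   case 1
   show ?thesis by (rule sub[OF g 1 O, symmetric])
  next
   case 2
   show ?thesis by (rule sub[OF g(2,1) 2 O[symmetric]])
  next
   case 3
   then show ?thesis by metis
  qed
 qed
 then show "p = q" using r pq by simp
qed

lemma card_isotopy_classes:
 assumes "N \<ge> 1" "set as \<subseteq> nontrivial N"
 shows "card (centered_graphs N j w as // isotopic) = card (orbs N {..<j} w (map (letters N) as))"
proof -
 let ?L = "Lab N {..<j} w (map (letters N) as)"
 have "centered_graphs N j w as // isotopic = (\<lambda>p. isotopic `` {toG j p}) ` ?L"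
  using assms by (auto simp: quotient_def centered_graphs_toG)
 also have "\<dots> = (\<lambda>p. toG j ` orb {..<j} p) ` ?L"
  by (rule image_cong[OF refl]) (rule isotopic_class[OF assms(1)])
 also have "\<dots> = (`) (toG j) ` orbs N {..<j} w (map (letters N) as)" by (simp add: orbs_def image_image)
 finally have eq: "centered_graphs N j w as // isotopic = (`) (toG j) ` orbs N {..<j} w (map (letters N) as)" .
 have "\<Union> (orbs N {..<j} w (map (letters N) as)) \<subseteq> ?L" unfolding orbs_def using orb_subset by fast
 then have "inj_on (toG j) (\<Union> (orbs N {..<j} w (map (letters N) as)))" by (rule inj_on_subset[OF inj_toG])
 then have "inj_on ((`) (toG j)) (orbs N {..<j} w (map (letters N) as))" by (rule inj_on_image)
 then show ?thesis unfolding eq by (rule card_image)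
qed

text \<open>The sum over the number of vertices has at most one nonzero term, since the weight and
  the word fix this number.\<close>

theorem centered_coeff_cf:
 assumes N: "N \<ge> 1"
 shows "centered_coeff N w as = (if set as \<subseteq> nontrivial N then cf N w (map (letters N) as) else 0)"
proof (cases "set as \<subseteq> nontrivial N")
 case True
 let ?ls = "map (letters N) as" and ?J = "{j. centered_graphs N j w as ~= {}}"
 let ?f = "\<lambda>j. of_nat (card (centered_graphs N j w as // isotopic)) * Vvar 0 ^ j :: scalar"
 have J: "?J = {j. Lab N {..<j} w ?ls ~= {}}" using True by (simp add: centered_graphs_toG[OF N])
 have sub: "?J \<subseteq> {nv w ?ls}"
 proof
  fix j assume "j \<in> ?J"
  then obtain p where "p \<in> Lab N {..<j} w ?ls" unfolding J by auto
  then have "card {..<j} = nv w ?ls" by (rule Lab_card[OF N finite_lessThan])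
  then show "j \<in> {nv w ?ls}" by simp
 qed
 have "centered_coeff N w as = sum ?f ?J" by (simp add: centered_coeff_def)
 also have "\<dots> = sum ?f {nv w ?ls}"
 proof (rule sum.mono_neutral_left[OF _ sub])
  show "\<forall>j\<in>{nv w ?ls} - ?J. ?f j = 0"
  proof
   fix j assume "j \<in> {nv w ?ls} - ?J"
   then have "Lab N {..<j} w ?ls = {}" unfolding J by blast
   then show "?f j = 0" using card_isotopy_classes[OF N True, of j w] by (simp add: orbs_def)
  qed
 qed simp
 also have "\<dots> = cf N w ?ls" using card_isotopy_classes[OF N True] by (simp add: cf_def mm_def)
 finally show ?thesis using True by simp
next
 case False
 then show ?thesis using centered_graphs_toG[OF N, of _ w as] by (simp add: centered_coeff_def)
qed

section \<open>Sums over decompositions of lists\<close>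

definition cuts :: "'a list => ('a list \<times> 'a list) set" where
 "cuts as = {(p, q). as = p @ q}"

definition bsplit :: "'a list => ('a list \<times> 'a list) set" where
 "bsplit a = {(x, l). a = x @ l \<and> x ~= [] \<and> l ~= []}"

lemma finite_cuts [simp]: "finite (cuts as)"
proof -
 have "cuts as \<subseteq> (\<lambda>k. (take k as, drop k as)) ` {..length as}"
 proof
  fix p assume "p \<in> cuts as"
  then obtain x y where "p = (x, y)" "as = x @ y" by (auto simp: cuts_def)
  then show "p \<in> (\<lambda>k. (take k as, drop k as)) ` {..length as}"
   by (intro image_eqI[of _ _ "length x"]) auto
 qed
 then show ?thesis by (rule finite_subset) simp
qed

lemma finite_bsplit [simp]: "finite (bsplit a)"
 by (rule finite_subset[OF _ finite_cuts[of a]]) (auto simp: bsplit_def cuts_def)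

lemma sum_cuts_Nil [simp]:
 fixes f :: "'a list => 'a list => 'b::comm_monoid_add"
 shows "(\<Sum>(p, q)\<in>cuts []. f p q) = f [] []"
proof -
 have "(cuts [] :: ('a list \<times> 'a list) set) = {([], [])}" by (auto simp: cuts_def)
 then show ?thesis by simp
qed

lemma sum_cuts_Cons:
 fixes f :: "'a list => 'a list => 'b::comm_monoid_add"
 shows "(\<Sum>(p, q)\<in>cuts (a # as). f p q) = f [] (a # as) + (\<Sum>(p, q)\<in>cuts as. f (a # p) q)"
proof -
 let ?h = "\<lambda>(p, q). (a # p, q)"
 have "cuts (a # as) = insert ([], a # as) (?h ` cuts as)"
  by (auto simp: cuts_def Cons_eq_append_conv)
 moreover have "([], a # as) \<notin> ?h ` cuts as" by auto
 moreover have "inj_on ?h (cuts as)" by (auto simp: inj_on_def)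
 ultimately show ?thesis by (simp add: sum.reindex case_prod_unfold)
qed

lemma sum_cuts_snoc:
 fixes f :: "'a list => 'a list => 'b::comm_monoid_add"
 shows "(\<Sum>(p, q)\<in>cuts (as @ [a]). f p q) = f (as @ [a]) [] + (\<Sum>(p, q)\<in>cuts as. f p (q @ [a]))"
proof -
 let ?h = "\<lambda>(p, q). (p, q @ [a])"
 have "cuts (as @ [a]) = insert (as @ [a], []) (?h ` cuts as)"
 proof (rule set_eqI)
  fix z :: "'a list \<times> 'a list"
  obtain p q where z: "z = (p, q)" by (cases z)
  show "z \<in> cuts (as @ [a]) \<longleftrightarrow> z \<in> insert (as @ [a], []) (?h ` cuts as)"
   unfolding z by (cases q rule: rev_cases) (auto simp: cuts_def image_iff)
 qed
 moreover have "(as @ [a], []) \<notin> ?h ` cuts as" by auto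
 moreover have "inj_on ?h (cuts as)" by (auto simp: inj_on_def)
 ultimately show ?thesis by (simp add: sum.reindex case_prod_unfold)
qed

lemma sum_splits_Nil [simp]: "(\<Sum>(p, x, l, q)\<in>splits []. f p x l q) = 0"
proof -
 have "splits [] = {}" by (auto simp: splits_def)
 then show ?thesis by simp
qed

lemma sum_splits_Cons:
 fixes f :: "letter list list => letter list => letter list => letter list list => 'b::comm_monoid_add"
 shows "(\<Sum>(p, x, l, q)\<in>splits (a # as). f p x l q) =
  (\<Sum>(x, l)\<in>bsplit a. f [] x l as) + (\<Sum>(p, x, l, q)\<in>splits as. f (a # p) x l q)"
proof -
 let ?h = "\<lambda>(p, x, l, q). (a # p, x, l, q)" and ?g = "\<lambda>(x, l). ([], x, l, as)"
 have eq: "splits (a # as) = ?g ` bsplit a \<union> ?h ` splits as"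
  by (auto simp: splits_def bsplit_def Cons_eq_append_conv)
 have d: "?g ` bsplit a \<inter> ?h ` splits as = {}" by auto
 have i: "inj_on ?h (splits as)" "inj_on ?g (bsplit a)" by (auto simp: inj_on_def)
 have f: "finite (?g ` bsplit a)" "finite (?h ` splits as)" by simp_all
 show ?thesis
  unfolding eq sum.union_disjoint[OF f d] sum.reindex[OF i(1)] sum.reindex[OF i(2)]
  by (simp add: comp_def case_prod_unfold)
qed

lemma sum_splits_snoc:
 fixes f :: "letter list list => letter list => letter list => letter list list => 'b::comm_monoid_add"
 shows "(\<Sum>(p, x, l, q)\<in>splits (as @ [a]). f p x l q) =
  (\<Sum>(p, x, l, q)\<in>splits as. f p x l (q @ [a])) + (\<Sum>(x, l)\<in>bsplit a. f as x l [])"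
proof (induction as arbitrary: f)
 case Nil
 show ?case using sum_splits_Cons[of f a "[]"] by simp
next
 case (Cons b as)
 have "(\<Sum>(p, x, l, q)\<in>splits ((b # as) @ [a]). f p x l q) =
   (\<Sum>(x, l)\<in>bsplit b. f [] x l (as @ [a])) + (\<Sum>(p, x, l, q)\<in>splits (as @ [a]). f (b # p) x l q)"
  using sum_splits_Cons[of f b "as @ [a]"] by simp
 also have "\<dots> = (\<Sum>(x, l)\<in>bsplit b. f [] x l (as @ [a])) +
   ((\<Sum>(p, x, l, q)\<in>splits as. f (b # p) x l (q @ [a])) + (\<Sum>(x, l)\<in>bsplit a. f (b # as) x l []))"
  unfolding Cons.IH[of "\<lambda>p. f (b # p)"] ..
 also have "\<dots> = (\<Sum>(p, x, l, q)\<in>splits (b # as). f p x l (q @ [a])) + (\<Sum>(x, l)\<in>bsplit a. f (b # as) x l [])"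
  unfolding sum_splits_Cons by (simp add: add.assoc)
 finally show ?case .
qed

lemma sum_splits_append:
 fixes f :: "letter list list => letter list => letter list => letter list list => 'b::comm_monoid_add"
 shows "(\<Sum>(p, x, l, q)\<in>splits (as @ bs). f p x l q) =
  (\<Sum>(p, x, l, q)\<in>splits as. f p x l (q @ bs)) + (\<Sum>(p, x, l, q)\<in>splits bs. f (as @ p) x l q)"
proof (induction as arbitrary: f)
 case (Cons a as)
 show ?case
  unfolding append_Cons sum_splits_Cons Cons.IH[of "\<lambda>p. f (a # p)"] by (simp only: add.assoc)
qed simp

text \<open>Cutting the list and splitting the last block before the cut amounts to choosing a block
  and splitting it.\<close>

lemma sum_cuts_last_split:
 fixes f :: "letter list list => letter list => letter list => letter list list => 'b::comm_monoid_add"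
 assumes "\<And>q. g [] q = 0" "\<And>p z q. g (p @ [z]) q = (\<Sum>(x, l)\<in>bsplit z. f p x l q)"
 shows "(\<Sum>(p, q)\<in>cuts as. g p q) = (\<Sum>(p, x, l, q)\<in>splits as. f p x l q)"
 using assms
proof (induction as arbitrary: f g)
 case (Cons a as)
 define g' where "g' = (\<lambda>p q. if p = [] then 0 else g (a # p) q)"
 have split: "(\<Sum>(p, q)\<in>cuts as. g (a # p) q) = g [a] as + (\<Sum>(p, q)\<in>cuts as. g' p q)"
 proof (cases as)
  case (Cons b bs)
  then show ?thesis by (simp add: sum_cuts_Cons g'_def)
 qed (simp add: g'_def)
 have IH: "(\<Sum>(p, q)\<in>cuts as. g' p q) = (\<Sum>(p, x, l, q)\<in>splits as. f (a # p) x l q)"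
  by (rule Cons.IH) (use Cons.prems(2)[of "a # p" for p] in \<open>simp_all add: g'_def\<close>)
 have "g [a] as = (\<Sum>(x, l)\<in>bsplit a. f [] x l as)" using Cons.prems(2)[of "[]" a as] by simp
 then show ?case unfolding sum_cuts_Cons sum_splits_Cons split IH using Cons.prems(1) by simp
qed simp

section \<open>The quadratic relations\<close>

lemma scalar_add_self [simp]: "(x :: scalar) + x = 0"
proof (rule poly_mapping_eqI)
 fix m show "Poly_Mapping.lookup (x + x) m = Poly_Mapping.lookup 0 m"
  unfolding lookup_add lookup_zero by (cases "Poly_Mapping.lookup x m") simp_all
qed

lemma scalar_add_self_left [simp]: "(x :: scalar) + (x + y) = y"
 by (simp add: add.assoc[symmetric])

lemma scalar_add_eq_0_iff: "(x :: scalar) + y = 0 \<longleftrightarrow> x = y"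
 by (metis add.right_neutral scalar_add_self scalar_add_self_left)

text \<open>The sum over all decompositions into three consecutive pieces, as
  \<open>trip_sum\<close> confirms. The recursion over the first piece is the form in which the
  relations telescope.\<close>

fun trip :: "('a list => 'a list => 'a list => 'b::comm_monoid_add) => 'a list => 'b" where
 "trip G [] = G [] [] []"
| "trip G (a # as) = (\<Sum>(mid, post)\<in>cuts (a # as). G [] mid post) + trip (\<lambda>pre. G (a # pre)) as"

lemma cf_not_chain: "N \<ge> 1 ==> \<not> chain N a ==> cf N w (p @ a # q) = 0"
 by (metis cf_nonzero in_set_conv_decomp)

text \<open>A block keeps the type of its letters, while passing a boundary end changes it. So the
  boundary circle carries at least two blocks.\<close>

lemma cf_single: "N \<ge> 1 ==> cf N w [a] = 0"
proof (rule ccontr)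
 assume N: "N \<ge> 1" and nz: "cf N w [a] ~= 0"
 from N nz have "a ~= []" "chain N a" "hd a = nxt N (last a)" by (rule cf_nonzero; simp)+
 moreover from this have "fst (last a) = fst (hd a)" by (intro chain_fst) simp_all
 ultimately show False by (metis fst_nxt)
qed

lemma cf_Nil: "N \<ge> 1 ==> cf N w [] = 0"
 by (metis cf_nonzero)

context
 fixes N :: nat and w :: "nat multiset"
 assumes N: "N \<ge> 1"
begin

text \<open>An outer operation \<Phi> on \<open>l1\<close> times a graph coefficient on
  \<open>l2\<close>, summed over the distributions of the weight. \<Phi> stays a parameter, so that
  the same sums serve for centered and extended outputs and for fixed neighbouring inputs.\<close>

definition CC where
 "CC \<Phi> l1 l2 = (\<Sum>w1\<in>{w1. w1 \<subseteq># w}. \<Phi> w1 l1 * cf N (w - w1) l2)"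

definition KK :: "(nat multiset => letter list list => scalar) => letter list list => letter list list => scalar" where
 "KK \<Phi> pre post = (\<Sum>(k, \<kappa>)\<in>(SIGMA k:set_mset w. kap N k). \<Phi> (w - {#k#}) (pre @ \<kappa> # post))"

definition inn :: "(nat multiset => letter list list => scalar) =>
  letter list list => letter list list => letter list list => scalar" where
 "inn \<Phi> pre mid post = (case mid of [] => KK \<Phi> pre post | a # ms =>
  (case ms of [b] => if chain N (a @ b) then \<Phi> w (pre @ (a @ b) # post) else 0 | _ => 0) +
  ((\<Sum>(x, l)\<in>bsplit a. CC \<Phi> (pre @ x # post) (l # ms)) +
   (\<Sum>(x, l)\<in>bsplit (last mid). CC \<Phi> (pre @ l # post) (butlast mid @ [x]))))"

text \<open>The terms of the relation with outer operation \<Phi>. Terms whose outer operation is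
  the product are kept apart.\<close>

definition TT :: "(nat multiset => letter list list => scalar) => letter list list => scalar" where
 "TT \<Phi> as = trip (inn \<Phi>) as"

definition pr where
 "pr \<Phi> a rest = (case rest of [] => 0 | b # r => if chain N (a @ b) then \<Phi> w ((a @ b) # r) else (0::scalar))"

text \<open>The terms of \<open>TT\<close> whose inner operation begins with the first input
  \<open>a\<close>, or is \<open>\<mu>\<^sub>0\<close> inserted before it: curvature, product, left
  extended and right extended operations, in this order. \<open>T0r\<close> is its mirror image at
  the last input.\<close>

definition T0 :: "(nat multiset => letter list list => scalar) => letter list => letter list list => scalar" where
 "T0 \<Phi> a rest = KK \<Phi> [] (a # rest) + pr \<Phi> a rest +
  (\<Sum>(x, l)\<in>bsplit a. \<Sum>(ms, post)\<in>cuts rest. CC \<Phi> (x # post) (l # ms)) +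
  (\<Sum>(q, x, l, post)\<in>splits rest. CC \<Phi> (l # post) (a # q @ [x]))"

definition pr_r where
 "pr_r \<Phi> as a = (if as = [] then 0 else if chain N (last as @ a) then \<Phi> w (butlast as @ [last as @ a]) else (0::scalar))"

definition T0r :: "(nat multiset => letter list list => scalar) => letter list list => letter list => scalar" where
 "T0r \<Phi> as a = KK \<Phi> (as @ [a]) [] + pr_r \<Phi> as a +
  (\<Sum>(x, l)\<in>bsplit a. \<Sum>(pre, ms)\<in>cuts as. CC \<Phi> (pre @ [l]) (ms @ [x])) +
  (\<Sum>(pre, x, l, q)\<in>splits as. CC \<Phi> (pre @ [x]) (l # q @ [a]))"

lemma CC_single: "CC \<Phi> l1 [x] = 0"
 by (simp add: CC_def cf_single[OF N])

lemma CC_Cons: "CC (\<lambda>w l. \<Phi> w (a # l)) l1 l2 = CC \<Phi> (a # l1) l2"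
 by (simp add: CC_def)

lemma KK_Cons: "KK (\<lambda>w l. \<Phi> w (a # l)) pre post = KK \<Phi> (a # pre) post"
 by (simp add: KK_def)

lemma inn_Cons: "inn \<Phi> (a # pre) mid post = inn (\<lambda>w l. \<Phi> w (a # l)) pre mid post"
proof (cases mid)
 case (Cons b ms)
 show ?thesis unfolding Cons inn_def CC_Cons by (cases ms; cases "tl ms") simp_all
qed (simp add: inn_def KK_Cons)

lemma TT_Nil: "TT \<Phi> [] = KK \<Phi> [] []"
 by (simp add: TT_def inn_def)

lemma TT_Cons: "TT \<Phi> (a # rest) = T0 \<Phi> a rest + TT (\<lambda>w l. \<Phi> w (a # l)) rest"
proof -
 let ?P = "\<lambda>ms post. case ms of [b] => if chain N (a @ b) then \<Phi> w ((a @ b) # post) else 0 | _ => (0::scalar)"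
 have P: "(\<Sum>(ms, post)\<in>cuts rest. ?P ms post) = pr \<Phi> a rest"
 proof (cases rest)
  case (Cons b r)
  have "(\<Sum>(ms, post)\<in>cuts r. ?P (b # ms) post) = ?P [b] r"
  proof (cases r)
   case (Cons b' r')
   have "(\<Sum>(ms, post)\<in>cuts r'. ?P (b # b' # ms) post) = 0" by (simp add: case_prod_unfold)
   then show ?thesis unfolding Cons sum_cuts_Cons by simp
  qed simp
  then show ?thesis unfolding Cons sum_cuts_Cons by (simp add: pr_def)
 qed (simp add: pr_def)
 have R: "(\<Sum>(ms, post)\<in>cuts rest. \<Sum>(x, l)\<in>bsplit (last (a # ms)). CC \<Phi> (l # post) (butlast (a # ms) @ [x])) =
   (\<Sum>(q, x, l, post)\<in>splits rest. CC \<Phi> (l # post) (a # q @ [x]))"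
 proof (rule sum_cuts_last_split)
  show "(\<Sum>(x, l)\<in>bsplit (last [a]). CC \<Phi> (l # q) (butlast [a] @ [x])) = 0" for q
   by (simp add: CC_single case_prod_unfold)
  show "(\<Sum>(x, l)\<in>bsplit (last (a # p @ [z])). CC \<Phi> (l # q) (butlast (a # p @ [z]) @ [x])) =
    (\<Sum>(x, l)\<in>bsplit z. CC \<Phi> (l # q) (a # p @ [x]))" for p z q
   by (simp add: butlast_append)
 qed
 have "(\<Sum>(mid, post)\<in>cuts (a # rest). inn \<Phi> [] mid post) =
   KK \<Phi> [] (a # rest) + (\<Sum>(ms, post)\<in>cuts rest. inn \<Phi> [] (a # ms) post)"
 proof -
  have "inn \<Phi> [] [] (a # rest) = KK \<Phi> [] (a # rest)" by (simp add: inn_def)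
  then show ?thesis by (simp only: sum_cuts_Cons)
 qed
 also have "(\<Sum>(ms, post)\<in>cuts rest. inn \<Phi> [] (a # ms) post) =
   (\<Sum>(ms, post)\<in>cuts rest. ?P ms post) +
   ((\<Sum>(ms, post)\<in>cuts rest. \<Sum>(x, l)\<in>bsplit a. CC \<Phi> (x # post) (l # ms)) +
   (\<Sum>(ms, post)\<in>cuts rest. \<Sum>(x, l)\<in>bsplit (last (a # ms)). CC \<Phi> (l # post) (butlast (a # ms) @ [x])))"
  unfolding sum.distrib[symmetric] by (rule sum.cong[OF refl]) (simp add: inn_def case_prod_unfold split: list.split)
 also have "(\<Sum>(ms, post)\<in>cuts rest. \<Sum>(x, l)\<in>bsplit a. CC \<Phi> (x # post) (l # ms)) =
   (\<Sum>(x, l)\<in>bsplit a. \<Sum>(ms, post)\<in>cuts rest. CC \<Phi> (x # post) (l # ms))"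
  unfolding case_prod_unfold by (rule sum.swap)
 finally show ?thesis
  unfolding TT_def trip.simps P R inn_Cons T0_def by (simp only: add.assoc)
qed

text \<open>Peeling off the first or the last input must give the same total. The induction reduces
  this to the two orders of peeling off one input at either end.\<close>

lemma TT_snoc: "TT \<Phi> (as @ [a]) = TT (\<lambda>w l. \<Phi> w (l @ [a])) as + T0r \<Phi> as a"
proof (induction as arbitrary: \<Phi>)
 case Nil
 have z: "(\<Sum>(x, l)\<in>bsplit a. CC \<Phi> [x] [l]) = 0" "(\<Sum>(x, l)\<in>bsplit a. CC \<Phi> [l] [x]) = 0"
  by (simp_all add: CC_single case_prod_unfold)
 show ?case
  by (simp add: TT_Cons TT_Nil T0_def T0r_def pr_def pr_r_def z) (simp add: KK_def)
next
 case (Cons b bs)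
 let ?\<Phi>b = "\<lambda>w l. \<Phi> w (b # l)" and ?\<Phi>a = "\<lambda>w l. \<Phi> w (l @ [a])"
 have "T0 \<Phi> b (bs @ [a]) + T0r ?\<Phi>b bs a = T0 ?\<Phi>a b bs + T0r \<Phi> (b # bs) a"
 proof -
  have p: "pr \<Phi> b (bs @ [a]) + pr_r ?\<Phi>b bs a = pr ?\<Phi>a b bs + pr_r \<Phi> (b # bs) a"
   by (cases bs) (simp_all add: pr_def pr_r_def)
  have c1: "CC ?\<Phi>a l1 l2 = CC \<Phi> (l1 @ [a]) l2" and c2: "CC ?\<Phi>b l1 l2 = CC \<Phi> (b # l1) l2" for l1 l2
   by (simp_all add: CC_def)
  have k: "KK ?\<Phi>a [] (b # bs) = KK \<Phi> [] (b # bs @ [a])" "KK ?\<Phi>b (bs @ [a]) [] = KK \<Phi> (b # bs @ [a]) []"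
   by (simp_all add: KK_def)
  have s: "(\<Sum>(x, l)\<in>bsplit b. \<Sum>(ms, post)\<in>cuts (bs @ [a]). CC \<Phi> (x # post) (l # ms)) =
    (\<Sum>(x, l)\<in>bsplit b. CC \<Phi> [x] (l # bs @ [a])) +
    (\<Sum>(x, l)\<in>bsplit b. \<Sum>(ms, post)\<in>cuts bs. CC \<Phi> (x # post @ [a]) (l # ms))"
   unfolding sum_cuts_snoc by (simp add: sum.distrib case_prod_unfold)
  have s2: "(\<Sum>(x, l)\<in>bsplit a. \<Sum>(pre, ms)\<in>cuts (b # bs). CC \<Phi> (pre @ [l]) (ms @ [x])) =
    (\<Sum>(x, l)\<in>bsplit a. CC \<Phi> [l] (b # bs @ [x])) +
    (\<Sum>(x, l)\<in>bsplit a. \<Sum>(pre, ms)\<in>cuts bs. CC \<Phi> (b # pre @ [l]) (ms @ [x]))"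
   unfolding sum_cuts_Cons by (simp add: sum.distrib case_prod_unfold)
  show ?thesis
   unfolding T0_def T0r_def c1 c2 s s2 sum_splits_snoc sum_splits_Cons k append_Cons append_Nil using p by (simp add: ac_simps) 
 qed
 then show ?case
  unfolding append_Cons TT_Cons Cons.IH by (simp add: ac_simps)
qed

abbreviation "C \<equiv> cf N"

lemma CC_commute: "CC C l1 l2 = CC C l2 l1"
 unfolding CC_def
 by (rule sum.reindex_bij_witness[of _ "\<lambda>v. w - v" "\<lambda>v. w - v"])
  (auto simp: mult.commute subset_mset.diff_diff_right)

lemma CC_rotate: "CC C (us @ vs) l = CC C (vs @ us) l" "CC C l (us @ vs) = CC C l (vs @ us)"
 by (simp_all add: CC_def cf_rotate[of N _ us vs])

lemma cut_K:
 assumes "a ~= []" "b ~= []" "\<And>y. y \<in> set ys ==> chain N y"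
 shows "C w ((b @ a) # ys) = KK C (a # ys @ [b]) [] +
  (\<Sum>(pre, x, l, post)\<in>splits ys. CC C (a # pre @ [x]) (l # post @ [b]))"
proof -
 have "C w ((b @ a) # ys) =
  (\<Sum>(k, \<kappa>)\<in>(SIGMA k:set_mset w. kap N k). cf N (w - {#k#}) (a # ys @ [b, \<kappa>])) +
  (\<Sum>((pre, x, l, post), w1)\<in>splits ys \<times> {w1. w1 \<subseteq># w}.
   cf N w1 (a # pre @ [x]) * cf N (w - w1) (l # post @ [b]))"
  by (rule cf_cut[OF N assms])
 also have "(\<Sum>((pre, x, l, post), w1)\<in>splits ys \<times> {w1. w1 \<subseteq># w}.
   cf N w1 (a # pre @ [x]) * cf N (w - w1) (l # post @ [b])) =
  (\<Sum>(pre, x, l, post)\<in>splits ys. CC C (a # pre @ [x]) (l # post @ [b]))"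
  unfolding CC_def sum.cartesian_product[symmetric] by (rule sum.cong[OF refl]) auto
 finally show ?thesis by (simp add: KK_def)
qed

text \<open>The pairs in which a left extended inner operation begins inside a block of
  \<open>pre\<close>, leaving its first part \<open>x\<close> to the outer one, and ends somewhere
  in \<open>as\<close>.\<close>

definition QQ where
 "QQ pre as = (\<Sum>(y1, x, l, y2)\<in>splits pre. \<Sum>(s1, s2)\<in>cuts as. CC C (y1 @ x # s2) (l # y2 @ s1))"

definition mrg where
 "mrg pre as = (if pre = [] \<or> as = [] then 0 else C w (butlast pre @ (last pre @ hd as) # tl as))"

text \<open>One step of a telescoping sum: the products and the left extended inner operations cancel.\<close>

lemma T0_step:
 assumes ne: "pre ~= []" "\<And>y. y \<in> set (pre @ a # rest) ==> chain N y \<and> y ~= []"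
 shows "T0 (\<lambda>w l. C w (pre @ l)) a rest =
  mrg pre (a # rest) + mrg (pre @ [a]) rest + QQ pre (a # rest) + QQ (pre @ [a]) rest"
proof -
 let ?\<Phi> = "\<lambda>w l. C w (pre @ l)"
 obtain p b where pre: "pre = p @ [b]" using ne(1) by (cases pre rule: rev_cases) auto
 have CCP: "CC ?\<Phi> l1 l2 = CC C (pre @ l1) l2" for l1 l2 by (simp add: CC_def)
 \<comment> \<open>The cut identity for the merged block \<open>b @ a\<close>, rotated to the front
   and back. It contains the curvature term and the right extended terms of \<open>T0\<close>; the
   remaining terms belong to \<open>QQ\<close>.\<close>
 have K: "C w (p @ (b @ a) # rest) = KK C pre (a # rest) +
  ((\<Sum>(q, x, l, post)\<in>splits rest. CC C (pre @ l # post) (a # q @ [x])) +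
  (\<Sum>(y1, x, l, y2)\<in>splits p. CC C (y1 @ x # a # rest) (l # y2 @ [b])))"
 proof -
  have "C w (p @ (b @ a) # rest) = C w ((b @ a) # rest @ p)"
   using cf_rotate[of N w p "(b @ a) # rest"] by simp
  also have "\<dots> = KK C (a # (rest @ p) @ [b]) [] +
   (\<Sum>(pre, x, l, post)\<in>splits (rest @ p). CC C (a # pre @ [x]) (l # post @ [b]))"
   by (rule cut_K) (use ne pre in auto)
  also have "KK C (a # (rest @ p) @ [b]) [] = KK C pre (a # rest)"
   unfolding KK_def pre using cf_rotate[of N _ "a # rest" "p @ [b, \<kappa>]" for \<kappa>] by simp
  also have "(\<Sum>(pre, x, l, post)\<in>splits (rest @ p). CC C (a # pre @ [x]) (l # post @ [b])) =
   (\<Sum>(q, x, l, post)\<in>splits rest. CC C (a # q @ [x]) (l # post @ p @ [b])) +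
   (\<Sum>(y1, x, l, y2)\<in>splits p. CC C (a # rest @ y1 @ [x]) (l # y2 @ [b]))"
   unfolding sum_splits_append by simp
  also have "(\<Sum>(q, x, l, post)\<in>splits rest. CC C (a # q @ [x]) (l # post @ p @ [b])) =
   (\<Sum>(q, x, l, post)\<in>splits rest. CC C (pre @ l # post) (a # q @ [x]))"
  proof -
   have "CC C (a # q @ [x]) (l # post @ p @ [b]) = CC C (pre @ l # post) (a # q @ [x])" for q x l post
    using CC_commute[of "a # q @ [x]"] CC_rotate(1)[of "l # post" "p @ [b]"] by (simp add: pre)
   then show ?thesis by simp
  qed
  also have "(\<Sum>(y1, x, l, y2)\<in>splits p. CC C (a # rest @ y1 @ [x]) (l # y2 @ [b])) =
   (\<Sum>(y1, x, l, y2)\<in>splits p. CC C (y1 @ x # a # rest) (l # y2 @ [b]))"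
   using CC_rotate(1)[of "a # rest"] by (intro sum.cong refl) auto
  finally show ?thesis .
 qed
 have Q1: "QQ pre (a # rest) =
  (\<Sum>(y1, x, l, y2)\<in>splits p. CC C (y1 @ x # a # rest) (l # y2 @ [b])) +
  (\<Sum>(y1, x, l, y2)\<in>splits pre. \<Sum>(s1, s2)\<in>cuts rest. CC C (y1 @ x # s2) (l # y2 @ a # s1))"
 proof -
  have "(\<Sum>(y1, x, l, y2)\<in>splits pre. CC C (y1 @ x # a # rest) (l # y2)) =
   (\<Sum>(y1, x, l, y2)\<in>splits p. CC C (y1 @ x # a # rest) (l # y2 @ [b]))"
   unfolding pre sum_splits_snoc by (simp add: CC_single case_prod_unfold)
  then show ?thesis unfolding QQ_def sum_cuts_Cons by (simp add: sum.distrib case_prod_unfold)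
 qed
 have Q2: "QQ (pre @ [a]) rest =
  (\<Sum>(y1, x, l, y2)\<in>splits pre. \<Sum>(s1, s2)\<in>cuts rest. CC C (y1 @ x # s2) (l # y2 @ a # s1)) +
  (\<Sum>(x, l)\<in>bsplit a. \<Sum>(s1, s2)\<in>cuts rest. CC C (pre @ x # s2) (l # s1))"
  unfolding QQ_def sum_splits_snoc by (simp add: append_assoc)
 have P: "pr ?\<Phi> a rest = mrg (pre @ [a]) rest"
  using cf_not_chain[OF N] by (cases rest) (auto simp: pr_def mrg_def)
 have M: "mrg pre (a # rest) = C w (p @ (b @ a) # rest)" by (simp add: mrg_def pre)
 have KP: "KK ?\<Phi> [] (a # rest) = KK C pre (a # rest)" by (simp add: KK_def)
 show ?thesis
  unfolding T0_def CCP KP P M Q1 Q2 K by (simp add: ac_simps)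
qed

text \<open>The quantities \<open>mrg\<close> and \<open>QQ\<close> at each intermediate place occur
  in two neighbouring steps and cancel. The contributions of the two ends remain, together with the
  curvature after the last input.\<close>

lemma TT_tail:
 assumes "pre ~= []" "\<And>y. y \<in> set (pre @ as) ==> chain N y \<and> y ~= []"
 shows "TT (\<lambda>w l. C w (pre @ l)) as = mrg pre as + QQ pre as + QQ (pre @ as) [] + KK C (pre @ as) []"
 using assms
proof (induction as arbitrary: pre)
 case Nil
 then show ?case by (simp add: TT_Nil KK_def mrg_def)
next
 case (Cons a as)
 have "TT (\<lambda>w l. C w (pre @ l)) (a # as) = T0 (\<lambda>w l. C w (pre @ l)) a as + TT (\<lambda>w l. C w ((pre @ [a]) @ l)) as"
  unfolding TT_Cons by simp
 also have "TT (\<lambda>w l. C w ((pre @ [a]) @ l)) as =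
   mrg (pre @ [a]) as + QQ (pre @ [a]) as + QQ (pre @ a # as) [] + KK C (pre @ a # as) []"
  using Cons.IH[of "pre @ [a]"] Cons.prems by simp
 also have "T0 (\<lambda>w l. C w (pre @ l)) a as =
   mrg pre (a # as) + mrg (pre @ [a]) as + QQ pre (a # as) + QQ (pre @ [a]) as"
  by (rule T0_step) (use Cons.prems in auto)
 finally show ?case by (simp add: ac_simps)
qed

text \<open>The first input has no predecessor, so it is treated apart. Its terms are the end
  contributions of the telescoping sum for the other inputs; in particular, rotation identifies
  curvature before the first input with curvature after the last.\<close>

theorem TT_centered:
 assumes "as ~= []" "\<And>y. y \<in> set as ==> chain N y \<and> y ~= []"
 shows "TT C as = 0"
proof -
 obtain a rest where as: "as = a # rest" using assms(1) by (cases as) auto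
 have t: "TT (\<lambda>w l. C w (a # l)) rest = mrg [a] rest + QQ [a] rest + QQ (a # rest) [] + KK C (a # rest) []"
  using TT_tail[of "[a]" rest] assms(2) by (simp add: as)
 have "QQ (a # rest) [] = (\<Sum>(q, x, l, post)\<in>splits rest. CC C (l # post) (a # q @ [x]))"
  unfolding QQ_def sum_cuts_Nil sum_splits_Cons using CC_commute
  by (simp add: CC_single case_prod_unfold)
 moreover have "QQ [a] rest = (\<Sum>(x, l)\<in>bsplit a. \<Sum>(ms, post)\<in>cuts rest. CC C (x # post) (l # ms))"
  unfolding QQ_def sum_splits_Cons by simp
 moreover have "pr C a rest = mrg [a] rest"
  using cf_not_chain[OF N, where p = "[]"] by (cases rest) (auto simp: pr_def mrg_def)
 moreover have "KK C (a # rest) [] = KK C [] (a # rest)"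
  unfolding KK_def using cf_rotate[of N _ "a # rest" "[\<kappa>]" for \<kappa>] by simp
 ultimately show ?thesis unfolding as TT_Cons T0_def t by (simp add: ac_simps)
qed

end

section \<open>Extended outputs\<close>

text \<open>\<open>cl\<close> and \<open>cr\<close> give the coefficient of the output word \<gamma>
  in the left and right extended operations: \<gamma> is taken off the beginning of the first or the
  end of the last block, and a nonempty rest must remain.\<close>

definition cl :: "nat => letter list => nat multiset => letter list list => scalar" where
 "cl N \<gamma> w as = (case as of [] => 0 | a # r =>
  if \<exists>x. a = \<gamma> @ x \<and> x ~= [] then cf N w (drop (length \<gamma>) a # r) else 0)"

definition cr :: "nat => letter list => nat multiset => letter list list => scalar" where
 "cr N \<gamma> w as = (if as ~= [] \<and> (\<exists>x. last as = x @ \<gamma> \<and> x ~= [])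
  then cf N w (butlast as @ [take (length (last as) - length \<gamma>) (last as)]) else 0)"

lemma cl_prefix [simp]: "x ~= [] ==> cl N \<gamma> w ((\<gamma> @ x) # r) = cf N w (x # r)"
 by (auto simp: cl_def)

lemma cl_other: "\<nexists>x. a = \<gamma> @ x \<and> x ~= [] ==> cl N \<gamma> w (a # r) = 0"
 by (auto simp: cl_def)

lemma cr_suffix [simp]: "x ~= [] ==> cr N \<gamma> w (r @ [x @ \<gamma>]) = cf N w (r @ [x])"
 by (auto simp: cr_def)

lemma cr_other: "\<nexists>x. a = x @ \<gamma> \<and> x ~= [] ==> cr N \<gamma> w (r @ [a]) = 0"
 by (auto simp: cr_def)

lemma sum_if_const:
 "(\<Sum>(a, b)\<in>A. if P then f a b else (0::'b::comm_monoid_add)) = (if P then \<Sum>(a, b)\<in>A. f a b else 0)"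
 by (cases P) (simp_all add: case_prod_unfold)

lemma sum_bsplit_prefix:
 "(\<Sum>(x, l)\<in>bsplit a. if \<exists>y. x = \<gamma> @ y \<and> y ~= [] then f (drop (length \<gamma>) x) l else (0::'b::comm_monoid_add)) =
 (if \<exists>y. a = \<gamma> @ y \<and> y ~= [] then \<Sum>(x, l)\<in>bsplit (drop (length \<gamma>) a). f x l else 0)"
proof (cases "\<exists>y. a = \<gamma> @ y \<and> y ~= []")
 case True
 then obtain y where a: "a = \<gamma> @ y" by blast
 have "(\<Sum>(x, l)\<in>bsplit a. if \<exists>y. x = \<gamma> @ y \<and> y ~= [] then f (drop (length \<gamma>) x) l else 0) =
   (\<Sum>(x, l)\<in>{(x, l) \<in> bsplit a. \<exists>y. x = \<gamma> @ y \<and> y ~= []}. f (drop (length \<gamma>) x) l)"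
  by (rule sum.mono_neutral_cong_right) (auto split: if_splits)
 also have "\<dots> = (\<Sum>(x, l)\<in>bsplit y. f x l)"
  by (rule sum.reindex_bij_witness[of _ "\<lambda>(x, l). (\<gamma> @ x, l)" "\<lambda>(x, l). (drop (length \<gamma>) x, l)"])
   (auto simp: bsplit_def a)
 finally show ?thesis using True by (simp add: a)
next
 case False
 then have "(\<Sum>(x, l)\<in>bsplit a. if \<exists>y. x = \<gamma> @ y \<and> y ~= [] then f (drop (length \<gamma>) x) l else 0) = 0"
  by (intro sum.neutral) (auto simp: bsplit_def)
 then show ?thesis by (simp only: if_not_P[OF False])
qed

lemma sum_bsplit_suffix:
 "(\<Sum>(x, l)\<in>bsplit a. if \<exists>y. l = y @ \<gamma> \<and> y ~= [] then f x (take (length l - length \<gamma>) l) else (0::'b::comm_monoid_add)) =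
 (if \<exists>y. a = y @ \<gamma> \<and> y ~= [] then \<Sum>(x, l)\<in>bsplit (take (length a - length \<gamma>) a). f x l else 0)"
proof (cases "\<exists>y. a = y @ \<gamma> \<and> y ~= []")
 case True
 then obtain y where a: "a = y @ \<gamma>" by blast
 have "(\<Sum>(x, l)\<in>bsplit a. if \<exists>y. l = y @ \<gamma> \<and> y ~= [] then f x (take (length l - length \<gamma>) l) else 0) =
   (\<Sum>(x, l)\<in>{(x, l) \<in> bsplit a. \<exists>y. l = y @ \<gamma> \<and> y ~= []}. f x (take (length l - length \<gamma>) l))"
  by (rule sum.mono_neutral_cong_right) (auto split: if_splits)
 also have "\<dots> = (\<Sum>(x, l)\<in>bsplit y. f x l)"
  by (rule sum.reindex_bij_witness[of _ "\<lambda>(x, l). (x, l @ \<gamma>)" "\<lambda>(x, l). (x, take (length l - length \<gamma>) l)"])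
   (auto simp: bsplit_def a)
 finally show ?thesis using True by (simp add: a)
next
 case False
 then have "(\<Sum>(x, l)\<in>bsplit a. if \<exists>y. l = y @ \<gamma> \<and> y ~= [] then f x (take (length l - length \<gamma>) l) else 0) = 0"
  by (intro sum.neutral) (auto simp: bsplit_def)
 then show ?thesis by (simp only: if_not_P[OF False])
qed

text \<open>Both sums run over the factorizations of \<open>a\<close> into three nonempty words with
  \<gamma> in the middle; \<gamma> is attached to the right part or to the left one.\<close>

lemma sum_bsplit_infix:
 assumes "\<gamma> ~= []"
 shows "(\<Sum>(x, l)\<in>bsplit a. if \<exists>y. l = \<gamma> @ y \<and> y ~= [] then f x (drop (length \<gamma>) l) else (0::'b::comm_monoid_add)) =
  (\<Sum>(x, l)\<in>bsplit a. if \<exists>y. x = y @ \<gamma> \<and> y ~= [] then f (take (length x - length \<gamma>) x) l else 0)"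
proof -
 have "(\<Sum>(x, l)\<in>bsplit a. if \<exists>y. l = \<gamma> @ y \<and> y ~= [] then f x (drop (length \<gamma>) l) else 0) =
   (\<Sum>(x, l)\<in>{(x, l) \<in> bsplit a. \<exists>y. l = \<gamma> @ y \<and> y ~= []}. f x (drop (length \<gamma>) l))"
  by (rule sum.mono_neutral_cong_right) (auto split: if_splits)
 also have "\<dots> = (\<Sum>(x, l)\<in>{(x, l) \<in> bsplit a. \<exists>y. x = y @ \<gamma> \<and> y ~= []}. f (take (length x - length \<gamma>) x) l)"
  by (rule sum.reindex_bij_witness[of _ "\<lambda>(x, l). (take (length x - length \<gamma>) x, \<gamma> @ l)"
    "\<lambda>(x, l). (x @ \<gamma>, drop (length \<gamma>) l)"]) (use assms in \<open>auto simp: bsplit_def\<close>)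
 also have "\<dots> = (\<Sum>(x, l)\<in>bsplit a. if \<exists>y. x = y @ \<gamma> \<and> y ~= [] then f (take (length x - length \<gamma>) x) l else 0)"
  by (rule sum.mono_neutral_cong_left) (auto split: if_splits)
 finally show ?thesis .
qed

lemma sum_splits_infix:
 fixes F :: "letter list list => letter list => letter list => letter list list => 'b::comm_monoid_add"
 assumes "\<gamma> ~= []"
 shows "(\<Sum>(p, x, l, q)\<in>splits bs. if \<exists>y. l = \<gamma> @ y \<and> y ~= [] then F p x (drop (length \<gamma>) l) q else 0) =
  (\<Sum>(p, x, l, q)\<in>splits bs. if \<exists>y. x = y @ \<gamma> \<and> y ~= [] then F p (take (length x - length \<gamma>) x) l q else 0)"
proof (induction bs arbitrary: F)
 case (Cons b bs)
 show ?case unfolding sum_splits_Cons Cons.IH[of "\<lambda>p. F (b # p)"] sum_bsplit_infix[OF assms, where f = "\<lambda>x l. F [] x l bs"] ..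
qed simp

text \<open>A word of \<open>kap\<close> with at least two letters is a closed path through all
  colors, and its rotations are the closed paths with other starting points.\<close>

lemma kap_rotate:
 assumes "u @ v \<in> kap N k" "u ~= []" "v ~= []"
 shows "v @ u \<in> kap N k"
proof -
 obtain i where k: "k = N + 1" and i: "i \<in> {1..N}" "u @ v = spath N i N"
  using assms by (auto simp: kap_def append_eq_Cons_conv split: if_splits)
 note cl = kap_closed[OF assms(1)]
 have c: "chain N (v @ u)"
  using cl(2,3) assms(2,3) unfolding chain_def successively_append_iff by (metis hd_append2 last_appendR)
 have len: "length (v @ u) = N" using arg_cong[OF i(2), of length] by simp
 have colors: "\<forall>x\<in>set (u @ v). \<exists>i'\<in>{1..N}. x = (True, i')"
  unfolding i(2) spath_def using i(1) by (auto simp: cyc_suc_funpow Suc_leI)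
 then obtain i' where i': "i' \<in> {1..N}" "hd v = (True, i')" using assms(3) by (metis UnCI hd_in_set set_append)
 have "v @ u = spath N i' N"
  by (rule chain_unique[OF c chain_spath]) (use len i' assms(3) hd_spath[of N N i'] in auto)
 then show ?thesis using i' k by (simp add: kap_def)
qed

lemma chain_append:
 "u ~= [] ==> v ~= [] ==> chain N (u @ v) \<longleftrightarrow> chain N u \<and> chain N v \<and> hd v = lk N (last u)"
 by (simp add: chain_def successively_append_iff)

lemma chain_prefix:
 assumes "chain N u" "chain N v" "hd u = hd v" "length u \<le> length v"
 shows "\<exists>x. v = u @ x"
proof -
 have "chain N (take (length u) v)"
  using assms(2) unfolding chain_def by (metis append_take_drop_id successively_append_iff)
 moreover have "hd (take (length u) v) = hd v" if "u ~= []" using that by (cases u; cases v) auto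
 ultimately have "u = take (length u) v"
  using assms chain_unique[of N u "take (length u) v"] by (cases "u = []") auto
 then show ?thesis by (metis append_take_drop_id)
qed

lemma lk_inj: "snd l \<in> {1..N} ==> snd l' \<in> {1..N} ==> lk N l = lk N l' ==> l = l'"
 unfolding lk_def by (metis flip_flip nxt_inj)

definition colored :: "nat => letter list => bool" where
 "colored N ls \<longleftrightarrow> (\<forall>l\<in>set ls. snd l \<in> {1..N})"

text \<open>Read backwards, a chain is determined by its last letter only where \<open>lk\<close> is
  injective, hence the condition on the colors. Read forwards, as in \<open>chain_prefix\<close>,
  the letters are iterates of the first one.\<close>

lemma chain_suffix:
 "chain N u ==> chain N v ==> colored N u ==> colored N v ==> u ~= [] ==> v ~= [] ==> last u = last v ==>
 length u \<le> length v ==> \<exists>x. v = x @ u"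
proof (induction u arbitrary: v rule: rev_induct)
 case (snoc a u)
 obtain v' where v: "v = v' @ [a]" using snoc.prems by (cases v rule: rev_cases) auto
 show ?case
 proof (cases "u = []")
  case False
  then have ne: "v' ~= []" using snoc.prems v by auto
  have c: "chain N u" "a = lk N (last u)" using snoc.prems(1) False by (simp_all add: chain_append)
  have c': "chain N v'" "a = lk N (last v')" using snoc.prems(2) ne v by (simp_all add: chain_append)
  have col: "colored N u" "colored N v'" using snoc.prems(3,4) v by (simp_all add: colored_def)
  have "last u = last v'" using lk_inj[of "last u" N "last v'"] c(2) c'(2) col False ne by (simp add: colored_def)
  then obtain x where "v' = x @ u"
   using snoc.IH[OF c(1) c'(1) col False ne] snoc.prems(8) v by auto
  then show ?thesis using v by simp
 qed (use v in simp)
qed simp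

context
 fixes N :: nat and w :: "nat multiset"
 assumes N: "N \<ge> 1"
begin

abbreviation "T \<equiv> TT N w"
abbreviation "CS \<equiv> CC N w"
abbreviation "KS \<equiv> KK N w"

lemma CC_cl: "CS (cl N \<gamma>) (x # post) l2 =
 (if \<exists>y. x = \<gamma> @ y \<and> y ~= [] then CS (cf N) (drop (length \<gamma>) x # post) l2 else 0)"
proof (cases "\<exists>y. x = \<gamma> @ y \<and> y ~= []")
 case True
 then show ?thesis by (auto simp: CC_def[OF N])
next
 case False
 then show ?thesis unfolding if_not_P[OF False] CC_def[OF N] by (simp add: cl_other)
qed

lemma CC_cr: "CS (cr N \<gamma>) (pre @ [l]) l2 =
 (if \<exists>y. l = y @ \<gamma> \<and> y ~= [] then CS (cf N) (pre @ [take (length l - length \<gamma>) l]) l2 else 0)"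
proof (cases "\<exists>y. l = y @ \<gamma> \<and> y ~= []")
 case True
 then show ?thesis by (auto simp: CC_def[OF N])
next
 case False
 then show ?thesis unfolding if_not_P[OF False] CC_def[OF N] by (simp add: cr_other)
qed

text \<open>In the vanishing sum for centered outputs, the terms that begin with the first input and
  those that leave it untouched have equal totals, by characteristic 2.\<close>

lemma T_head:
 assumes "\<And>y. y \<in> set (a # rest) ==> chain N y \<and> y ~= []"
 shows "T (\<lambda>w l. cf N w (a # l)) rest = T0 N w (cf N) a rest"
proof -
 have "T (cf N) (a # rest) = 0" by (rule TT_centered[OF N]) (use assms in auto)
 then show ?thesis using TT_Cons[OF N, of w "cf N" a rest] scalar_add_eq_0_iff by metis
qed

lemma T_last:
 assumes "\<And>y. y \<in> set (as @ [a]) ==> chain N y \<and> y ~= []"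
 shows "T (\<lambda>w l. cf N w (l @ [a])) as = T0r N w (cf N) as a"
proof -
 have "T (cf N) (as @ [a]) = 0" by (rule TT_centered[OF N]) (use assms in auto)
 then show ?thesis using TT_snoc[OF N, of w "cf N" as a] scalar_add_eq_0_iff by metis
qed

lemma T_zero: "T (\<lambda>_ _. 0) as = 0"
proof (induction as)
 case Nil
 then show ?case by (simp add: TT_Nil[OF N] KK_def[OF N] case_prod_unfold)
next
 case (Cons b as)
 have c: "CS (\<lambda>_ _. 0) l1 l2 = 0" for l1 :: "letter list list" and l2 by (simp add: CC_def[OF N])
 have "T0 N w (\<lambda>_ _. 0) b as = 0"
  unfolding T0_def[OF N] pr_def[OF N] KK_def[OF N] c by (simp add: case_prod_unfold split: list.split)
 then show ?case using Cons unfolding TT_Cons[OF N] by simp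
qed

text \<open>The terms in which \<gamma> lies in the middle of a block: one operation uses what
  precedes it, the other what follows. They are common to the left and the right extended
  outputs.\<close>

definition Qq where
 "Qq \<gamma> as = (\<Sum>(p, x, l, q)\<in>splits as. if \<exists>y. l = \<gamma> @ y \<and> y ~= [] then CS (cf N) (p @ [x]) (drop (length \<gamma>) l # q) else 0)"

text \<open>If \<open>a\<close> is \<gamma> followed by \<open>x\<close>, the outer coefficient is
  the centered one with \<open>x\<close> in place of \<open>a\<close>. Then \<open>T_head\<close>
  for \<open>x\<close> turns the terms that leave the first input untouched into terms that begin
  with \<open>x\<close>, and among them the splittings of \<open>x\<close> cancel against the left
  extended inner operations on \<open>a\<close>.\<close>

lemma T_left:
 assumes ne: "\<gamma> ~= []" and ch: "\<And>y. y \<in> set (a # rest) ==> chain N y \<and> y ~= []"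
 shows "T (cl N \<gamma>) (a # rest) = KS (cl N \<gamma>) [] (a # rest) + Qq \<gamma> (a # rest) + pr N w (cl N \<gamma>) a rest +
  (if \<exists>x. a = \<gamma> @ x \<and> x ~= [] then pr N w (cf N) (drop (length \<gamma>) a) rest + KS (cf N) [] (drop (length \<gamma>) a # rest) +
   (\<Sum>(q, x, l, post)\<in>splits rest. CS (cf N) (l # post) (drop (length \<gamma>) a # q @ [x])) else 0)"
proof -
 let ?x = "drop (length \<gamma>) a"
 let ?P = "\<exists>x. a = \<gamma> @ x \<and> x ~= []"
 have tail: "T (\<lambda>w l. cl N \<gamma> w (a # l)) rest = (if ?P then T0 N w (cf N) ?x rest else 0)"
 proof (cases ?P)
  case True
  then obtain x where x: "a = \<gamma> @ x" "x ~= []" by blast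
  have "chain N x" using ch[of a] x ne by (simp add: chain_append)
  then have "T (\<lambda>w l. cf N w (x # l)) rest = T0 N w (cf N) x rest" by (intro T_head) (use ch x in auto)
  then show ?thesis using True x by simp
 next
  case False
  then have z: "(\<lambda>w l. cl N \<gamma> w (a # l)) = (\<lambda>w l. 0)" by (simp add: cl_other)
  show ?thesis unfolding z if_not_P[OF False] by (rule T_zero)
 qed
 have s1: "(\<Sum>(x, l)\<in>bsplit a. \<Sum>(ms, post)\<in>cuts rest. CS (cl N \<gamma>) (x # post) (l # ms)) =
   (if ?P then \<Sum>(x, l)\<in>bsplit ?x. \<Sum>(ms, post)\<in>cuts rest. CS (cf N) (x # post) (l # ms) else 0)"
  unfolding sum_bsplit_prefix[symmetric] CC_cl sum_if_const ..
 have s2: "(\<Sum>(q, x, l, post)\<in>splits rest. CS (cl N \<gamma>) (l # post) (a # q @ [x])) = Qq \<gamma> (a # rest)"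
 proof -
  have z: "(\<Sum>(x, l)\<in>bsplit a. if \<exists>y. l = \<gamma> @ y \<and> y ~= [] then CS (cf N) [x] (drop (length \<gamma>) l # rest) else 0) = 0"
   using CC_commute[OF N, of w "[x]" for x] CC_single[OF N] by (intro sum.neutral) auto
  have comm: "CS (cf N) (drop (length \<gamma>) l # q) (a # p @ [x]) = CS (cf N) (a # p @ [x]) (drop (length \<gamma>) l # q)"
   for l q p x by (rule CC_commute[OF N])
  show ?thesis
   unfolding Qq_def sum_splits_Cons CC_cl comm append_Nil append_Cons z add_0 ..
 qed
 note eq = TT_Cons[OF N] tail T0_def[OF N, of w "cl N \<gamma>"] s1 s2
 show ?thesis
 proof (cases ?P)
  case True
  show ?thesis unfolding eq if_P[OF True] T0_def[OF N] by (simp add: ac_simps)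
 next
  case False
  show ?thesis unfolding eq if_not_P[OF False] by (simp add: ac_simps)
 qed
qed

lemma T_right:
 assumes ne: "\<gamma> ~= []" and ch: "\<And>y. y \<in> set (as @ [a]) ==> chain N y \<and> y ~= []"
 shows "T (cr N \<gamma>) (as @ [a]) = KS (cr N \<gamma>) (as @ [a]) [] + Qq \<gamma> (as @ [a]) + pr_r N w (cr N \<gamma>) as a +
  (if \<exists>x. a = x @ \<gamma> \<and> x ~= [] then pr_r N w (cf N) as (take (length a - length \<gamma>) a) + KS (cf N) (as @ [take (length a - length \<gamma>) a]) [] +
   (\<Sum>(pre, x, l, q)\<in>splits as. CS (cf N) (pre @ [x]) (l # q @ [take (length a - length \<gamma>) a])) else 0)"
proof -
 let ?x = "take (length a - length \<gamma>) a"
 let ?P = "\<exists>x. a = x @ \<gamma> \<and> x ~= []"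
 have tail: "T (\<lambda>w l. cr N \<gamma> w (l @ [a])) as = (if ?P then T0r N w (cf N) as ?x else 0)"
 proof (cases ?P)
  case True
  then obtain x where x: "a = x @ \<gamma>" "x ~= []" by blast
  have "chain N x" using ch[of a] x ne by (simp add: chain_append)
  then have "T (\<lambda>w l. cf N w (l @ [x])) as = T0r N w (cf N) as x" by (intro T_last) (use ch x in auto)
  then show ?thesis using True x by simp
 next
  case False
  then have z: "(\<lambda>w l. cr N \<gamma> w (l @ [a])) = (\<lambda>w l. 0)" by (simp add: cr_other)
  show ?thesis unfolding z if_not_P[OF False] by (rule T_zero)
 qed
 have s1: "(\<Sum>(x, l)\<in>bsplit a. \<Sum>(pre, ms)\<in>cuts as. CS (cr N \<gamma>) (pre @ [l]) (ms @ [x])) =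
   (if ?P then \<Sum>(x, l)\<in>bsplit ?x. \<Sum>(pre, ms)\<in>cuts as. CS (cf N) (pre @ [l]) (ms @ [x]) else 0)"
  unfolding sum_bsplit_suffix[symmetric] CC_cr sum_if_const ..
 have s2: "(\<Sum>(pre, x, l, q)\<in>splits as. CS (cr N \<gamma>) (pre @ [x]) (l # q @ [a])) = Qq \<gamma> (as @ [a])"
 proof -
  have z: "(\<Sum>(x, l)\<in>bsplit a. if \<exists>y. x = y @ \<gamma> \<and> y ~= [] then CS (cf N) (as @ [take (length x - length \<gamma>) x]) [l] else 0) = 0"
   using CC_single[OF N] by (intro sum.neutral) auto
  show ?thesis
   unfolding Qq_def sum_splits_infix[OF ne, where F = "\<lambda>p x l q. CS (cf N) (p @ [x]) (l # q)"]
    sum_splits_snoc CC_cr z add_0_right ..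
 qed
 note eq = TT_snoc[OF N] tail T0r_def[OF N, of w "cr N \<gamma>"] s1 s2
 show ?thesis
 proof (cases ?P)
  case True
  show ?thesis unfolding eq if_P[OF True] T0r_def[OF N] by (simp add: ac_simps)
 next
  case False
  show ?thesis unfolding eq if_not_P[OF False] by (simp add: ac_simps)
 qed
qed

text \<open>If \<kappa> begins with \<gamma>, its rotation that ends with \<gamma> is a term of
  \<open>\<mu>\<^sub>0\<close> of the same weight. The remaining part of \<kappa> moves from the
  first to the last place by rotation of the blocks.\<close>

lemma KK_extended: "\<gamma> ~= [] ==> KS (cl N \<gamma>) [] as = KS (cr N \<gamma>) as []"
proof -
 assume ne: "\<gamma> ~= []"
 let ?J = "SIGMA k:set_mset w. kap N k"
 have J: "finite ?J" by simp
 have "KS (cl N \<gamma>) [] as = (\<Sum>(k, \<kappa>)\<in>{(k, \<kappa>) \<in> ?J. \<exists>x. \<kappa> = \<gamma> @ x \<and> x ~= []}. cf N (w - {#k#}) (drop (length \<gamma>) \<kappa> # as))"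
  unfolding KK_def[OF N] by (rule sum.mono_neutral_cong_right[OF J]) (auto simp: cl_def split: if_splits)
 also have "\<dots> = (\<Sum>(k, \<kappa>)\<in>{(k, \<kappa>) \<in> ?J. \<exists>x. \<kappa> = x @ \<gamma> \<and> x ~= []}. cf N (w - {#k#}) (as @ [take (length \<kappa> - length \<gamma>) \<kappa>]))"
 proof (rule sum.reindex_bij_witness[of _ "\<lambda>(k, \<kappa>). (k, \<gamma> @ take (length \<kappa> - length \<gamma>) \<kappa>)" "\<lambda>(k, \<kappa>). (k, drop (length \<gamma>) \<kappa> @ \<gamma>)"])
  fix p assume "p \<in> {(k, \<kappa>) \<in> ?J. \<exists>x. \<kappa> = \<gamma> @ x \<and> x ~= []}"
  then obtain k x where p: "p = (k, \<gamma> @ x)" "k \<in># w" "\<gamma> @ x \<in> kap N k" "x ~= []" by auto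
  then show "(case (case p of (k, \<kappa>) => (k, drop (length \<gamma>) \<kappa> @ \<gamma>)) of (k, \<kappa>) => (k, \<gamma> @ take (length \<kappa> - length \<gamma>) \<kappa>)) = p"
   "(case p of (k, \<kappa>) => (k, drop (length \<gamma>) \<kappa> @ \<gamma>)) \<in> {(k, \<kappa>) \<in> ?J. \<exists>x. \<kappa> = x @ \<gamma> \<and> x ~= []}"
   using kap_rotate[OF p(3) ne p(4)] by auto
  show "(case (case p of (k, \<kappa>) => (k, drop (length \<gamma>) \<kappa> @ \<gamma>)) of (k, \<kappa>) => cf N (w - {#k#}) (as @ [take (length \<kappa> - length \<gamma>) \<kappa>])) =
   (case p of (k, \<kappa>) => cf N (w - {#k#}) (drop (length \<gamma>) \<kappa> # as))"
   using cf_rotate[of N "w - {#k#}" as "[x]"] p by simp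
 next
  fix p assume "p \<in> {(k, \<kappa>) \<in> ?J. \<exists>x. \<kappa> = x @ \<gamma> \<and> x ~= []}"
  then obtain k x where p: "p = (k, x @ \<gamma>)" "k \<in># w" "x @ \<gamma> \<in> kap N k" "x ~= []" by auto
  then show "(case (case p of (k, \<kappa>) => (k, \<gamma> @ take (length \<kappa> - length \<gamma>) \<kappa>)) of (k, \<kappa>) => (k, drop (length \<gamma>) \<kappa> @ \<gamma>)) = p"
   "(case p of (k, \<kappa>) => (k, \<gamma> @ take (length \<kappa> - length \<gamma>) \<kappa>)) \<in> {(k, \<kappa>) \<in> ?J. \<exists>x. \<kappa> = \<gamma> @ x \<and> x ~= []}"
   using kap_rotate[OF p(3) p(4) ne] by auto
 qed
 also have "\<dots> = KS (cr N \<gamma>) as []"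
  unfolding KK_def[OF N] by (rule sum.mono_neutral_cong_left[OF J]) (auto simp: cr_def split: if_splits)
 finally show ?thesis .
qed

text \<open>The leftover terms are the cut identity for the block \<open>an @ x\<close>, in which
  the last input and the rest of the first one meet around the circle.\<close>

lemma merge_left:
 assumes "x ~= []" "an ~= []" "\<And>z. z \<in> set y ==> chain N z"
 shows "KS (cf N) [] (x # y @ [an]) + (\<Sum>(q, x', l, post)\<in>splits (y @ [an]). CS (cf N) (l # post) (x # q @ [x'])) =
  cf N w ((an @ x) # y)"
proof -
 have "KS (cf N) [] (x # y @ [an]) = KS (cf N) (x # y @ [an]) []"
  unfolding KK_def[OF N] using cf_rotate[of N _ "[\<kappa>]" "x # y @ [an]" for \<kappa>] by simp
 moreover have "(\<Sum>(q, x', l, post)\<in>splits (y @ [an]). CS (cf N) (l # post) (x # q @ [x'])) =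
  (\<Sum>(pre, x', l, post)\<in>splits y. CS (cf N) (x # pre @ [x']) (l # post @ [an]))"
 proof -
  have "(\<Sum>(x', l)\<in>bsplit an. CS (cf N) [l] (x # y @ [x'])) = 0"
   using CC_commute[OF N, of w "[l]" for l] CC_single[OF N] by (intro sum.neutral) auto
  then show ?thesis unfolding sum_splits_snoc using CC_commute[OF N, of w "x # p @ [x']" for p x'] by simp
 qed
 ultimately show ?thesis using cut_K[OF N, of x an y w] assms by simp
qed

lemma merge_right:
 assumes "x ~= []" "a ~= []" "\<And>z. z \<in> set y ==> chain N z"
 shows "KS (cf N) ((a # y) @ [x]) [] + (\<Sum>(pre, x', l, q)\<in>splits (a # y). CS (cf N) (pre @ [x']) (l # q @ [x])) =
  cf N w ((x @ a) # y)"
proof -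
 have "(\<Sum>(x', l)\<in>bsplit a. CS (cf N) [x'] (l # y @ [x])) = 0"
  using CC_commute[OF N, of w "[x']" for x'] CC_single[OF N] by (intro sum.neutral) auto
 then show ?thesis unfolding sum_splits_Cons using cut_K[OF N, of a x y w] assms by simp
qed

section \<open>Comparison of the leftovers on the two sides\<close>

definition adj2 :: "letter list => letter list => bool" where
 "adj2 u v \<longleftrightarrow> hd v = nxt N (last u)"

text \<open>\<open>z\<close> is what the last block \<open>an\<close> and the first block
  \<open>a\<close> leave when \<gamma> is emitted. In both \<open>RL\<close> and \<open>RR\<close>
  its length is that of \<open>an\<close> and \<open>a\<close> together minus that of \<gamma>; in
  \<open>RL\<close> it begins like \<open>an\<close>, in \<open>RR\<close> it ends like
  \<open>a\<close>. The three clauses distinguish whether \<gamma> is shorter than, equal to or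
  longer than the outer block.\<close>

definition RL where
 "RL \<gamma> a y an z \<longleftrightarrow> (\<exists>x. x ~= [] \<and> a = \<gamma> @ x \<and> z = an @ x) \<or> (\<gamma> = a \<and> adj2 a (hd (y @ [an])) \<and> z = an) \<or>
  (\<exists>g x. g ~= [] \<and> x ~= [] \<and> \<gamma> = a @ g \<and> an = x @ g \<and> z = x)"

definition RR where
 "RR \<gamma> a y an z \<longleftrightarrow> (\<exists>x. x ~= [] \<and> an = x @ \<gamma> \<and> z = x @ a) \<or> (\<gamma> = an \<and> adj2 (last (a # y)) an \<and> z = a) \<or>
  (\<exists>g x. g ~= [] \<and> x ~= [] \<and> \<gamma> = g @ an \<and> a = g @ x \<and> z = x)"

lemma cf_links:
 assumes "cf N w (z # y) ~= 0"
 shows "z ~= []" "chain N z" "colored N z" "y ~= []" "hd (hd y) = nxt N (last z)" "hd z = nxt N (last (last y))"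
proof -
 have ny: "y ~= []" using assms cf_single[OF N] by auto
 obtain 1: "\<And>l. l \<in> set (z # y) ==> l ~= []" "\<And>l. l \<in> set (z # y) ==> chain N l"
  "\<And>l x. l \<in> set (z # y) ==> x \<in> set l ==> snd x \<in> {1..N}"
  "\<And>us l1 l2 vs. z # y = us @ l1 # l2 # vs ==> hd l2 = nxt N (last l1)"
  "hd (hd (z # y)) = nxt N (last (last (z # y)))"
  by (rule cf_nonzero[OF N assms]) blast
 show "z ~= []" "chain N z" using 1(1,2)[of z] by simp_all
 show "colored N z" unfolding colored_def using 1(3)[of z] by simp
 show "y ~= []" by (rule ny)
 show "hd (hd y) = nxt N (last z)" using 1(4)[of "[]" z "hd y" "tl y"] ny by simp
 show "hd z = nxt N (last (last y))" using 1(5) ny by simp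
qed

text \<open>A nonzero coefficient makes \<open>z\<close> a chain and fixes the letters that
  neighbour it in \<open>y\<close>. In each case two chains get the same last letter, so the shorter
  is a suffix of the longer; comparing their lengths yields the three clauses of
  \<open>RR\<close>.\<close>

lemma RL_imp_RR:
 assumes rl: "RL \<gamma> a y an z" and nz: "cf N w (z # y) ~= 0"
  and ch: "chain N a" "chain N an" "chain N \<gamma>" and col: "colored N a" "colored N an" "colored N \<gamma>"
  and ne: "a ~= []" "an ~= []" "\<gamma> ~= []"
 shows "RR \<gamma> a y an z"
proof -
 note lk = cf_links[OF nz]
 have adjI: "hd an = hd z ==> adj2 (last (a # y)) an" using lk by (simp add: adj2_def)
 consider x where "x ~= []" "a = \<gamma> @ x" "z = an @ x" | "\<gamma> = a" "adj2 a (hd (y @ [an]))" "z = an"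
  | g x where "g ~= []" "x ~= []" "\<gamma> = a @ g" "an = x @ g" "z = x" using rl unfolding RL_def by blast
 then show ?thesis
 proof cases
  case 1
  have "lk N (last \<gamma>) = lk N (last an)" using ch(1) lk(2) 1 ne by (simp add: chain_append)
  then have l: "last \<gamma> = last an" using lk_inj col ne unfolding colored_def by (metis last_in_set)
  consider "length \<gamma> < length an" | "length \<gamma> = length an" | "length an < length \<gamma>" by linarith
  then show ?thesis
  proof cases
   case a: 1
   then obtain u where "an = u @ \<gamma>" using chain_suffix[OF ch(3,2) col(3,2) ne(3,2) l] by auto
   then show ?thesis unfolding RR_def using 1 a by auto
  next
   case a: 2
   then have "an = \<gamma>" using chain_suffix[OF ch(3,2) col(3,2) ne(3,2) l] by auto
   then show ?thesis unfolding RR_def using 1 adjI ne by simp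
  next
   case a: 3
   then obtain u where "\<gamma> = u @ an" using chain_suffix[OF ch(2,3) col(2,3) ne(2,3) l[symmetric]] by auto
   then show ?thesis unfolding RR_def using 1 a ne by auto
  qed
 next
  case 2
  have "nxt N (last a) = nxt N (last an)" using 2 lk(4,5) by (simp add: adj2_def)
  then have l: "last a = last an" using nxt_inj col ne unfolding colored_def by (metis last_in_set)
  consider "length a < length an" | "length a = length an" | "length an < length a" by linarith
  then show ?thesis
  proof cases
   case a: 1
   then obtain u where "an = u @ a" using chain_suffix[OF ch(1,2) col(1,2) ne(1,2) l] by auto
   then show ?thesis unfolding RR_def using 2 a by auto
  next
   case a: 2
   then have "an = a" using chain_suffix[OF ch(1,2) col(1,2) ne(1,2) l] by auto
   then show ?thesis unfolding RR_def using 2 adjI ne by simp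
  next
   case a: 3
   then obtain u where "a = u @ an" using chain_suffix[OF ch(2,1) col(2,1) ne(2,1) l[symmetric]] by auto
   then show ?thesis unfolding RR_def using 2 a ne by auto
  qed
 next
  case 3
  have "lk N (last a) = lk N (last x)" using ch(2,3) 3 ne by (simp add: chain_append)
  moreover have cx: "colored N x" "chain N x" using col(2) ch(2) 3 by (simp_all add: colored_def chain_append)
  ultimately have l: "last a = last x" using lk_inj col(1) ne 3(2) unfolding colored_def by (metis last_in_set)
  consider "length a < length x" | "length a = length x" | "length x < length a" by linarith
  then show ?thesis
  proof cases
   case a: 1
   then obtain u where "x = u @ a" using chain_suffix[OF ch(1) cx(2) col(1) cx(1) ne(1) 3(2) l] by auto
   then show ?thesis unfolding RR_def using 3 a by auto
  next
   case a: 2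
   then have "x = a" using chain_suffix[OF ch(1) cx(2) col(1) cx(1) ne(1) 3(2) l] by auto
   then show ?thesis unfolding RR_def using 3 adjI ne by simp
  next
   case a: 3
   then obtain u where "a = u @ x" using chain_suffix[OF cx(2) ch(1) cx(1) col(1) 3(2) ne(1) l[symmetric]] by auto
   then show ?thesis unfolding RR_def using 3 a ne by auto
  qed
 qed
qed

lemma RR_imp_RL:
 assumes rr: "RR \<gamma> a y an z" and nz: "cf N w (z # y) ~= 0"
  and ch: "chain N a" "chain N an" "chain N \<gamma>"
  and ne: "a ~= []" "an ~= []" "\<gamma> ~= []"
 shows "RL \<gamma> a y an z"
proof -
 note lk = cf_links[OF nz]
 have adjI: "last a = last z ==> adj2 a (hd (y @ [an]))" using lk by (simp add: adj2_def)
 consider x where "x ~= []" "an = x @ \<gamma>" "z = x @ a" | "\<gamma> = an" "adj2 (last (a # y)) an" "z = a"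
  | g x where "g ~= []" "x ~= []" "\<gamma> = g @ an" "a = g @ x" "z = x" using rr unfolding RR_def by blast
 then show ?thesis
 proof cases
  case 1
  have l: "hd \<gamma> = hd a" using ch(2) lk(2) 1 ne by (simp add: chain_append)
  consider "length \<gamma> < length a" | "length \<gamma> = length a" | "length a < length \<gamma>" by linarith
  then show ?thesis
  proof cases
   case a: 1
   then obtain u where "a = \<gamma> @ u" using chain_prefix[OF ch(3,1) l] by auto
   then show ?thesis unfolding RL_def using 1 a by auto
  next
   case a: 2
   then have "a = \<gamma>" using chain_prefix[OF ch(3,1) l] by auto
   then show ?thesis unfolding RL_def using 1 adjI ne by simp
  next
   case a: 3
   then obtain u where "\<gamma> = a @ u" using chain_prefix[OF ch(1,3) l[symmetric]] by auto
   then show ?thesis unfolding RL_def using 1 a ne by auto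
  qed
 next
  case 2
  have l: "hd an = hd a" using 2 lk(4,6) by (simp add: adj2_def)
  consider "length an < length a" | "length an = length a" | "length a < length an" by linarith
  then show ?thesis
  proof cases
   case a: 1
   then obtain u where "a = an @ u" using chain_prefix[OF ch(2,1) l] by auto
   then show ?thesis unfolding RL_def using 2 a by auto
  next
   case a: 2
   then have "a = an" using chain_prefix[OF ch(2,1) l] by auto
   then show ?thesis unfolding RL_def using 2 adjI ne by simp
  next
   case a: 3
   then obtain u where "an = a @ u" using chain_prefix[OF ch(1,2) l[symmetric]] by auto
   then show ?thesis unfolding RL_def using 2 a ne by auto
  qed
 next
  case 3
  have l: "hd an = hd x" using ch(1,3) 3 ne by (simp add: chain_append)
  have cx: "chain N x" using ch(1) 3 by (simp add: chain_append)
  consider "length an < length x" | "length an = length x" | "length x < length an" by linarith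
  then show ?thesis
  proof cases
   case a: 1
   then obtain u where "x = an @ u" using chain_prefix[OF ch(2) cx l] by auto
   then show ?thesis unfolding RL_def using 3 a by auto
  next
   case a: 2
   then have "x = an" using chain_prefix[OF ch(2) cx l] by auto
   then show ?thesis unfolding RL_def using 3 adjI ne by simp
  next
   case a: 3
   then obtain u where "an = x @ u" using chain_prefix[OF cx ch(2) l[symmetric]] by auto
   then show ?thesis unfolding RL_def using 3 a ne by auto
  qed
 qed
qed

text \<open>The summands exclude one another. They arise from \<open>merge_left\<close>, from the
  product of the first input with an idempotent output, and from the product of the first input with
  a right extended output.\<close>

definition ZL where
 "ZL \<gamma> a y an = (if \<exists>x. a = \<gamma> @ x \<and> x ~= [] then cf N w ((an @ drop (length \<gamma>) a) # y) else 0) +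
  (if \<gamma> = a \<and> adj2 a (hd (y @ [an])) then cf N w (y @ [an]) else 0) +
  (if \<exists>g. \<gamma> = a @ g \<and> g ~= [] then cr N (drop (length a) \<gamma>) w (y @ [an]) else 0)"

definition ZR where
 "ZR \<gamma> a y an = (if \<exists>x. an = x @ \<gamma> \<and> x ~= [] then cf N w ((take (length an - length \<gamma>) an @ a) # y) else 0) +
  (if \<gamma> = an \<and> adj2 (last (a # y)) an then cf N w (a # y) else 0) +
  (if \<exists>g. \<gamma> = g @ an \<and> g ~= [] then cl N (take (length \<gamma> - length an) \<gamma>) w (a # y) else 0)"

lemma ZL_eq:
 assumes "RL \<gamma> a y an z"
 shows "ZL \<gamma> a y an = cf N w (z # y)"
proof -
 have rot: "cf N w (y @ [z]) = cf N w (z # y)" using cf_rotate[of N w y "[z]"] by simp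
 consider x where "x ~= []" "a = \<gamma> @ x" "z = an @ x" | "\<gamma> = a" "adj2 a (hd (y @ [an]))" "z = an"
  | g x where "g ~= []" "x ~= []" "\<gamma> = a @ g" "an = x @ g" "z = x" using assms unfolding RL_def by blast
 then show ?thesis
 proof cases
  case 1
  then have "\<exists>x. a = \<gamma> @ x \<and> x ~= []" "\<not> (\<gamma> = a \<and> adj2 a (hd (y @ [an])))" "\<nexists>g. \<gamma> = a @ g \<and> g ~= []" by auto
  then show ?thesis unfolding ZL_def by (simp only: if_True if_False add_0_right) (simp add: 1)
 next
  case 2
  then have "\<nexists>x. a = \<gamma> @ x \<and> x ~= []" "\<gamma> = a \<and> adj2 a (hd (y @ [an]))" "\<nexists>g. \<gamma> = a @ g \<and> g ~= []" by auto
  then show ?thesis unfolding ZL_def using rot 2(3) by (simp only: if_True if_False add_0_right add_0 simp_thms)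
 next
  case 3
  then have "\<nexists>x. a = \<gamma> @ x \<and> x ~= []" "\<not> (\<gamma> = a \<and> adj2 a (hd (y @ [an])))" "\<exists>g. \<gamma> = a @ g \<and> g ~= []" by auto
  then show ?thesis unfolding ZL_def by (simp only: if_True if_False add_0) (simp add: 3 rot[unfolded 3])
 qed
qed

lemma ZR_eq:
 assumes "RR \<gamma> a y an z"
 shows "ZR \<gamma> a y an = cf N w (z # y)"
proof -
 consider x where "x ~= []" "an = x @ \<gamma>" "z = x @ a" | "\<gamma> = an" "adj2 (last (a # y)) an" "z = a"
  | g x where "g ~= []" "x ~= []" "\<gamma> = g @ an" "a = g @ x" "z = x" using assms unfolding RR_def by blast
 then show ?thesis
 proof cases
  case 1
  then have "\<exists>x. an = x @ \<gamma> \<and> x ~= []" "\<not> (\<gamma> = an \<and> adj2 (last (a # y)) an)" "\<nexists>g. \<gamma> = g @ an \<and> g ~= []" by auto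
  then show ?thesis unfolding ZR_def by (simp only: if_True if_False add_0_right) (simp add: 1)
 next
  case 2
  then have "\<nexists>x. an = x @ \<gamma> \<and> x ~= []" "\<gamma> = an \<and> adj2 (last (a # y)) an" "\<nexists>g. \<gamma> = g @ an \<and> g ~= []" by auto
  then show ?thesis unfolding ZR_def using 2(3) by (simp only: if_True if_False add_0_right add_0 simp_thms)
 next
  case 3
  then have "\<nexists>x. an = x @ \<gamma> \<and> x ~= []" "\<not> (\<gamma> = an \<and> adj2 (last (a # y)) an)" "\<exists>g. \<gamma> = g @ an \<and> g ~= []" by auto
  then show ?thesis unfolding ZR_def by (simp only: if_True if_False add_0) (simp add: 3)
 qed
qed

lemma ZL_zero:
 assumes "\<nexists>z. RL \<gamma> a y an z"
 shows "ZL \<gamma> a y an = 0"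
proof -
 have "\<nexists>x. a = \<gamma> @ x \<and> x ~= []" "\<not> (\<gamma> = a \<and> adj2 a (hd (y @ [an])))" using assms unfolding RL_def by blast+
 moreover have "cr N (drop (length a) \<gamma>) w (y @ [an]) = 0" if ex: "\<exists>g. \<gamma> = a @ g \<and> g ~= []"
 proof (rule cr_other)
  obtain g where "\<gamma> = a @ g" "g ~= []" using ex by blast
  then show "\<nexists>x. an = x @ drop (length a) \<gamma> \<and> x ~= []" using assms unfolding RL_def by auto
 qed
 ultimately show ?thesis unfolding ZL_def by (simp only: if_False add_0 if_cancel cong: if_cong)
qed

lemma ZR_zero:
 assumes "\<nexists>z. RR \<gamma> a y an z"
 shows "ZR \<gamma> a y an = 0"
proof -
 have "\<nexists>x. an = x @ \<gamma> \<and> x ~= []" "\<not> (\<gamma> = an \<and> adj2 (last (a # y)) an)" using assms unfolding RR_def by blast+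
 moreover have "cl N (take (length \<gamma> - length an) \<gamma>) w (a # y) = 0" if ex: "\<exists>g. \<gamma> = g @ an \<and> g ~= []"
 proof (rule cl_other)
  obtain g where "\<gamma> = g @ an" "g ~= []" using ex by blast
  then show "\<nexists>x. a = take (length \<gamma> - length an) \<gamma> @ x \<and> x ~= []" using assms unfolding RR_def by auto
 qed
 ultimately show ?thesis unfolding ZR_def by (simp only: if_False add_0 if_cancel cong: if_cong)
qed

lemma ZL_ZR:
 assumes "chain N a" "chain N an" "chain N \<gamma>" "colored N a" "colored N an" "colored N \<gamma>" "a ~= []" "an ~= []" "\<gamma> ~= []"
 shows "ZL \<gamma> a y an = ZR \<gamma> a y an"
proof (cases "\<exists>z. RL \<gamma> a y an z \<and> cf N w (z # y) ~= 0")
 case True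
 then show ?thesis using RL_imp_RR[OF _ _ assms] ZL_eq ZR_eq by metis
next
 case False
 then have l: "ZL \<gamma> a y an = 0" using ZL_eq ZL_zero by metis
 have "ZR \<gamma> a y an = 0"
 proof (rule ccontr)
  assume nz: "ZR \<gamma> a y an ~= 0"
  then obtain z where "RR \<gamma> a y an z" using ZR_zero by blast
  then have "RL \<gamma> a y an z \<and> cf N w (z # y) ~= 0" using RR_imp_RL[OF _ _ assms(1-3,7-9)] ZR_eq nz by metis
  then show False using False by blast
 qed
 then show ?thesis using l by simp
qed

end

text \<open>The coefficient of the output word \<gamma> in the operations defined by graphs; the
  empty word stands for an idempotent.\<close>

definition Mop :: "nat => letter list => nat multiset => letter list list => scalar" where
 "Mop N \<gamma> w ls = (if \<gamma> = [] then cf N w ls else cl N \<gamma> w ls + cr N \<gamma> w ls)"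

lemma cf_strict: "N \<ge> 1 ==> [] \<in> set ls ==> cf N w ls = 0"
 by (metis cf_nonzero)

lemma cl_strict:
 assumes "N \<ge> 1" "[] \<in> set ls"
 shows "cl N \<gamma> w ls = 0"
proof (cases ls)
 case (Cons a r)
 then show ?thesis using assms cf_strict[OF assms(1), of "drop (length \<gamma>) a # r"] by (cases "a = []") (auto simp: cl_def)
qed (use assms in simp)

lemma cr_strict:
 assumes "N \<ge> 1" "[] \<in> set ls"
 shows "cr N \<gamma> w ls = 0"
proof (cases ls rule: rev_cases)
 case (snoc r a)
 then show ?thesis using assms cf_strict[OF assms(1), of "r @ [take (length a - length \<gamma>) a]"] by (cases "a = []") (auto simp: cr_def)
qed (use assms in simp)

lemma Mop_strict: "N \<ge> 1 ==> [] \<in> set ls ==> Mop N \<gamma> w ls = 0"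
 by (simp add: Mop_def cf_strict cl_strict cr_strict)

lemma Mop_Nil: "N \<ge> 1 ==> Mop N \<gamma> w [] = 0"
 by (simp add: Mop_def cf_Nil cl_def cr_def)

text \<open>A word that closes up can be moved past \<gamma>: each letter of \<gamma> that it passes
  rotates it by one place. The property \<open>P\<close> is either membership in \<open>kap\<close>
  or a given value of the coefficient in the relation for one input.\<close>

lemma shift_right:
 assumes rot: "\<And>u v. P (u @ v) ==> u ~= [] ==> v ~= [] ==> P (v @ u)"
  and closed: "\<And>x. P x ==> x ~= [] \<and> colored N x \<and> hd x = lk N (last x)"
 shows "P x ==> chain N (\<gamma> @ x) ==> colored N \<gamma> ==> \<exists>x'. P x' \<and> \<gamma> @ x = x' @ \<gamma>"
proof (induction \<gamma> arbitrary: x rule: rev_induct)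
 case (snoc l \<gamma>)
 have x: "x ~= []" "colored N x" "hd x = lk N (last x)" using closed[OF snoc.prems(1)] by auto
 have "hd x = lk N l" using snoc.prems(2) x(1) by (simp add: chain_append[of "\<gamma> @ [l]" x, simplified])
 then have "last x = l" using lk_inj[of "last x" N l] x snoc.prems(3) by (simp add: colored_def)
 then obtain x0 where x0: "x = x0 @ [l]" using x(1) by (metis append_butlast_last_id)
 have "P ([l] @ x0)" using rot[of x0 "[l]"] snoc.prems(1) x0 by (cases "x0 = []") simp_all
 moreover have "chain N (\<gamma> @ [l] @ x0)"
  using snoc.prems(2) unfolding x0 chain_def by (metis append_assoc successively_append_iff)
 moreover have "colored N \<gamma>" using snoc.prems(3) by (simp add: colored_def)
 ultimately obtain x' where "P x'" "\<gamma> @ [l] @ x0 = x' @ \<gamma>" using snoc.IH by blast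
 then show ?case unfolding x0 by (intro exI[of _ x']) simp
qed simp

lemma shift_left:
 assumes rot: "\<And>u v. P (u @ v) ==> u ~= [] ==> v ~= [] ==> P (v @ u)"
  and closed: "\<And>x. P x ==> x ~= [] \<and> colored N x \<and> hd x = lk N (last x)"
 shows "P x ==> chain N (x @ \<gamma>) ==> \<exists>x'. P x' \<and> x @ \<gamma> = \<gamma> @ x'"
proof (induction \<gamma> arbitrary: x)
 case (Cons l \<gamma>)
 have x: "x ~= []" "hd x = lk N (last x)" using closed[OF Cons.prems(1)] by auto
 have "hd x = l" using Cons.prems(2) x by (simp add: chain_append)
 then obtain x0 where x0: "x = l # x0" using x(1) by (metis list.collapse)
 have "P (x0 @ [l])" using rot[of "[l]" x0] Cons.prems(1) x0 by (cases "x0 = []") simp_all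
 moreover have "chain N ((x0 @ [l]) @ \<gamma>)"
  using Cons.prems(2) unfolding x0 chain_def by (cases x0) simp_all
 ultimately obtain x' where "P x'" "(x0 @ [l]) @ \<gamma> = \<gamma> @ x'" using Cons.IH by blast
 then show ?case unfolding x0 by (intro exI[of _ x']) simp
qed simp

lemma distinct_spath: "i \<in> {1..N} ==> distinct (spath N i N)"
 using bij_cyc_suc_funpow[of i N] unfolding spath_def distinct_map bij_betw_def
 by (auto simp: inj_on_def)

lemma kap_split:
 assumes "x @ l \<in> kap N k" "x ~= []" "l ~= []"
 obtains i where "i \<in> {1..N}" "x @ l = spath N i N" "hd x = (True, i)" "hd l = lk N (last x)" "hd l ~= hd x"
proof -
 obtain i where i: "i \<in> {1..N}" "x @ l = spath N i N"
  using assms by (auto simp: kap_def append_eq_Cons_conv split: if_splits)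
 have "hd (x @ l) = (True, i)" using i(1) hd_spath[of N N i] unfolding i(2) by simp
 then have "hd x = (True, i)" using assms(2) by simp
 moreover have "hd l = lk N (last x)" using kap_closed(2)[OF assms(1)] assms(2,3) by (simp add: chain_append)
 moreover have "hd l ~= hd x"
  using distinct_spath[OF i(1)] assms(2,3) unfolding i(2)[symmetric] by (metis disjoint_iff distinct_append hd_in_set)
 ultimately show ?thesis by (rule that[OF i])
qed

text \<open>A proper piece \<open>x\<close> of a closed path forces the other block to be a power of
  a single \<open>U\<^sub>i\<close>. Then the letter continuing \<open>x\<close> would have to be
  the first letter of \<open>x\<close>, whereas the path continues with a different one.\<close>

lemma cf_split_kap:
 assumes N: "N \<ge> 1" and k: "x @ l \<in> kap N k" "x ~= []" "l ~= []"
 shows "cf N v [a, x] = 0"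
proof (rule ccontr)
 assume nz: "cf N v [a, x] ~= 0"
 obtain i where i: "hd x = (True, i)" "hd l = lk N (last x)" "hd l ~= hd x" by (rule kap_split[OF k])
 note lks = cf_links[OF N nz]
 have h: "hd x = nxt N (last a)" "hd a = nxt N (last x)" using lks(5,6) by simp_all
 have fl: "\<not> fst (last a)" using h(1) i(1) by (metis fst_conv fst_nxt)
 have f: "\<not> fst (hd a)" using fl chain_fst[OF lks(2), of "last a"] lks(1) by simp
 have "last a = (lk N ^^ (length a - 1)) (hd a)"
  using lk_nth[OF lks(2), of "length a - 1"] lks(1) by (simp add: last_conv_nth)
 then have eq: "last a = hd a" using f by (cases "hd a") simp
 have "lk N (last x) = flip (last a)" by (simp add: lk_def h(2) eq)
 also have "\<dots> = nxt N (last a)" using fl by (cases "last a") simp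
 finally show False using i h(1) by simp
qed

lemma sum_pair_distrib:
 "(\<Sum>(a, b)\<in>A. f a b + g a b) = (\<Sum>(a, b)\<in>A. f a b) + (\<Sum>(a, b)\<in>A. g a b :: 'c::comm_monoid_add)"
 by (simp add: case_prod_unfold sum.distrib)

lemma sum_quad_distrib:
 "(\<Sum>(a, b, c, d)\<in>A. f a b c d + g a b c d) = (\<Sum>(a, b, c, d)\<in>A. f a b c d) + (\<Sum>(a, b, c, d)\<in>A. g a b c d :: 'c::comm_monoid_add)"
 by (simp add: case_prod_unfold sum.distrib)

context
 fixes N :: nat and w :: "nat multiset"
 assumes N: "N \<ge> 1"
begin

lemma TT_add: "TT N w (\<lambda>w l. \<Phi> w l + \<Psi> w l) as = TT N w \<Phi> as + TT N w \<Psi> as"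
proof (induction as arbitrary: \<Phi> \<Psi>)
 case Nil
 show ?case by (simp add: TT_Nil[OF N] KK_def[OF N] sum_pair_distrib)
next
 case (Cons a as)
 have c: "CC N w (\<lambda>w l. \<Phi> w l + \<Psi> w l) l1 l2 = CC N w \<Phi> l1 l2 + CC N w \<Psi> l1 l2" for l1 l2
  by (simp add: CC_def[OF N] distrib_right sum.distrib)
 have k: "KK N w (\<lambda>w l. \<Phi> w l + \<Psi> w l) l1 l2 = KK N w \<Phi> l1 l2 + KK N w \<Psi> l1 l2" for l1 l2
  by (simp add: KK_def[OF N] sum_pair_distrib)
 have p: "pr N w (\<lambda>w l. \<Phi> w l + \<Psi> w l) a as = pr N w \<Phi> a as + pr N w \<Psi> a as"
  by (simp add: pr_def[OF N] split: list.split)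
 have "T0 N w (\<lambda>w l. \<Phi> w l + \<Psi> w l) a as = T0 N w \<Phi> a as + T0 N w \<Psi> a as"
  unfolding T0_def[OF N] c k p sum_pair_distrib sum_quad_distrib by (simp only: ac_simps)
 then show ?case unfolding TT_Cons[OF N] Cons.IH by (simp only: ac_simps)
qed

text \<open>An empty word is an idempotent input. The operations defined by graphs vanish on it, so
  only the product with a neighbour can survive.\<close>

lemma T0_strict:
 assumes st: "\<And>w l. [] \<in> set l ==> \<Phi> w l = 0" and e: "[] \<in> set (a # rest)"
 shows "T0 N w \<Phi> a rest = pr N w \<Phi> a rest"
proof -
 have c: "CC N w \<Phi> l1 l2 = 0" if "[] \<in> set l1 \<or> [] \<in> set l2" for l1 l2
  using that st cf_strict[OF N] by (auto simp: CC_def[OF N])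
 have "KK N w \<Phi> [] (a # rest) = 0"
  unfolding KK_def[OF N] by (rule sum.neutral) (use st e in auto)
 moreover have "(\<Sum>(x, l)\<in>bsplit a. \<Sum>(ms, post)\<in>cuts rest. CC N w \<Phi> (x # post) (l # ms)) = 0"
 proof (cases "a = []")
  case False
  then have "CC N w \<Phi> (x # post) (l # ms) = 0" if "(ms, post) \<in> cuts rest" for x l ms post
   using that e by (intro c) (auto simp: cuts_def)
  then show ?thesis by (auto intro!: sum.neutral)
 next
  case True
  then have "bsplit a = {}" by (auto simp: bsplit_def)
  then show ?thesis by simp
 qed
 moreover have "(\<Sum>(q, x, l, post)\<in>splits rest. CC N w \<Phi> (l # post) (a # q @ [x])) = 0"
 proof -
  have "CC N w \<Phi> (l # post) (a # q @ [x]) = 0" if "(q, x, l, post) \<in> splits rest" for q x l post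
   using that e by (intro c) (auto simp: splits_def)
  then show ?thesis by (intro sum.neutral) auto
 qed
 ultimately show ?thesis by (simp add: T0_def[OF N])
qed

lemma TT_head_empty:
 assumes st: "\<And>w l. [] \<in> set l ==> \<Phi> w l = 0" and ch: "\<And>y. y \<in> set rest ==> chain N y"
 shows "TT N w \<Phi> ([] # rest) = (if rest = [] then 0 else \<Phi> w rest)"
proof -
 have "(\<lambda>w l. \<Phi> w ([] # l)) = (\<lambda>_ _. 0)" using st by simp
 then have "TT N w \<Phi> ([] # rest) = T0 N w \<Phi> [] rest" unfolding TT_Cons[OF N] using T_zero[OF N, of w rest] by simp
 also have "\<dots> = pr N w \<Phi> [] rest" by (rule T0_strict[OF st]) simp_all
 also have "\<dots> = (if rest = [] then 0 else \<Phi> w rest)" using ch by (cases rest) (simp_all add: pr_def[OF N])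
 finally show ?thesis .
qed

text \<open>An idempotent between two inputs can be multiplied with either neighbour, with the same
  result, so these terms cancel. If it is the last input, one term remains, to be matched by an
  outer product.\<close>

lemma TT_inner_empty:
 assumes st: "\<And>w l. [] \<in> set l ==> \<Phi> w l = 0" and ch: "\<And>y. y \<in> set (p @ b # q) ==> chain N y"
 shows "TT N w \<Phi> (p @ b # [] # q) = (if q = [] then \<Phi> w (p @ [b]) else 0)"
 using st ch
proof (induction p arbitrary: \<Phi>)
 case Nil
 have "TT N w (\<lambda>w l. \<Phi> w (b # l)) ([] # q) = (if q = [] then 0 else \<Phi> w (b # q))"
  by (rule TT_head_empty) (use Nil in auto)
 moreover have "T0 N w \<Phi> b ([] # q) = pr N w \<Phi> b ([] # q)" by (rule T0_strict) (use Nil in auto)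
 moreover have "pr N w \<Phi> b ([] # q) = \<Phi> w (b # q)" using Nil(2)[of b] by (simp add: pr_def[OF N])
 ultimately show ?case unfolding append_Nil TT_Cons[OF N] by simp
next
 case (Cons c p)
 have "TT N w (\<lambda>w l. \<Phi> w (c # l)) (p @ b # [] # q) = (if q = [] then \<Phi> w (c # p @ [b]) else 0)"
  by (rule Cons.IH) (use Cons.prems in auto)
 moreover have "T0 N w \<Phi> c (p @ b # [] # q) = pr N w \<Phi> c (p @ b # [] # q)" by (rule T0_strict) (use Cons.prems in auto)
 moreover have "pr N w \<Phi> c (p @ b # [] # q) = 0" using Cons.prems(1) by (cases p) (simp_all add: pr_def[OF N])
 ultimately show ?case unfolding append_Cons TT_Cons[OF N] by simp
qed

lemma ck_closed:
 assumes "KK N w (cf N) [x] [] ~= 0"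
 shows "x ~= []" "chain N x" "colored N x" "hd x = lk N (last x)"
proof -
 obtain k \<kappa> where k: "\<kappa> \<in> kap N k" and nz: "cf N (w - {#k#}) [x, \<kappa>] ~= 0"
  using sum.not_neutral_contains_not_neutral[OF assms[unfolded KK_def[OF N]]] unfolding case_prod_unfold mem_Sigma_iff
  by (metis append_Cons append_Nil mem_Times_iff SigmaE fst_conv snd_conv)
 note lks = cf_links[OF N nz]
 show "x ~= []" "chain N x" "colored N x" by (rule lks)+
 have "lk N (last x) = flip (hd \<kappa>)" using lks(5) by (simp add: lk_def)
 also have "\<dots> = flip (lk N (last \<kappa>))" using kap_closed(3)[OF k] by simp
 also have "\<dots> = hd x" using lks(6) by (simp add: lk_def)
 finally show "hd x = lk N (last x)" by simp
qed

text \<open>The cut identity for \<open>b @ a\<close> beside a single term \<kappa> of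
  \<open>\<mu>\<^sub>0\<close>; the terms that split \<kappa> vanish by \<open>cf_split_kap\<close>.
  The resulting double sum is symmetric under a rotation by two blocks, which exchanges
  \<open>a\<close> and \<open>b\<close>.\<close>

lemma ck_double:
 assumes "a ~= []" "b ~= []"
 shows "KK N w (cf N) [b @ a] [] =
  (\<Sum>(k, \<kappa>)\<in>(SIGMA k:set_mset w. kap N k). \<Sum>(k', \<kappa>')\<in>(SIGMA k':set_mset (w - {#k#}). kap N k').
   cf N (w - {#k#} - {#k'#}) [a, \<kappa>, b, \<kappa>'])"
 unfolding KK_def[OF N]
proof (rule sum.cong[OF refl], clarify)
 fix k \<kappa> assume k: "k \<in># w" "\<kappa> \<in> kap N k"
 let ?v = "w - {#k#}"
 have "cf N ?v ((b @ a) # [\<kappa>]) = KK N ?v (cf N) (a # [\<kappa>] @ [b]) [] +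
  (\<Sum>(pre, x, l, post)\<in>splits [\<kappa>]. CC N ?v (cf N) (a # pre @ [x]) (l # post @ [b]))"
  by (rule cut_K[OF N assms]) (use kap_closed(2)[OF k(2)] in simp)
 also have "(\<Sum>(pre, x, l, post)\<in>splits [\<kappa>]. CC N ?v (cf N) (a # pre @ [x]) (l # post @ [b])) = 0"
 proof (rule sum.neutral, clarify)
  fix pre x l post assume "(pre, x, l, post) \<in> splits [\<kappa>]"
  then have "pre = []" "x @ l \<in> kap N k" "x ~= []" "l ~= []" using k(2) by (auto simp: splits_def Cons_eq_append_conv)
  then show "CC N ?v (cf N) (a # pre @ [x]) (l # post @ [b]) = 0"
   by (simp add: CC_def[OF N] cf_split_kap[OF N])
 qed
 finally show "cf N ?v ([b @ a] @ \<kappa> # []) =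
  (\<Sum>(k', \<kappa>')\<in>(SIGMA k':set_mset (w - {#k#}). kap N k'). cf N (w - {#k#} - {#k'#}) [a, \<kappa>, b, \<kappa>'])"
  by (simp add: KK_def[OF N])
qed

lemma ck_rotate:
 assumes "a ~= []" "b ~= []"
 shows "KK N w (cf N) [b @ a] [] = KK N w (cf N) [a @ b] []"
proof -
 let ?J = "SIGMA k:set_mset w. kap N k" and ?J' = "\<lambda>p. SIGMA k':set_mset (w - {#fst p#}). kap N k'"
 have D: "KK N w (cf N) [b @ a] [] = (\<Sum>(p, q)\<in>Sigma ?J ?J'. cf N (w - {#fst p#} - {#fst q#}) [a, snd p, b, snd q])"
  if "a ~= []" "b ~= []" for a b
  unfolding ck_double[OF that] case_prod_unfold by (subst sum.Sigma) (auto simp: case_prod_unfold)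
 have sym: "(k \<in># w \<and> k' \<in># w - {#k#}) = (k' \<in># w \<and> k \<in># w - {#k'#})" for k k'
 proof -
  have "(k \<in># w \<and> k' \<in># w - {#k#}) = ({#k, k'#} \<subseteq># w)" for k k' by (simp add: insert_subset_eq_iff)
  then show ?thesis by (metis add_mset_commute)
 qed
 have comm: "w - {#k#} - {#k'#} = w - {#k'#} - {#k#}" for k k'
  by (rule multiset_eqI) simp
 show ?thesis
  unfolding D[OF assms] D[OF assms(2,1)]
 proof (rule sum.reindex_bij_witness[of _ prod.swap prod.swap])
  fix z assume "z \<in> Sigma ?J ?J'"
  then obtain k \<kappa> k' \<kappa>' where z: "z = ((k, \<kappa>), (k', \<kappa>'))" "k \<in># w" "k' \<in># w - {#k#}" "\<kappa> \<in> kap N k" "\<kappa>' \<in> kap N k'" by auto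
  then show "prod.swap z \<in> Sigma ?J ?J'" "prod.swap z \<in> Sigma ?J ?J'" "prod.swap (prod.swap z) = z" "prod.swap (prod.swap z) = z"
   using sym[of k k'] by auto
  show "(case prod.swap z of (p, q) => cf N (w - {#fst p#} - {#fst q#}) [b, snd p, a, snd q]) =
   (case z of (p, q) => cf N (w - {#fst p#} - {#fst q#}) [a, snd p, b, snd q])"
   using cf_rotate[of N "w - {#k#} - {#k'#}" "[a, \<kappa>]" "[b, \<kappa>']"] comm[of k k'] z(1) by simp
 qed
qed

text \<open>What remains is the curvature beside the rest \<open>x\<close> of the input, with
  \<gamma> removed from its left or its right end. A nonzero coefficient makes \<open>x\<close>
  close up, so it can be moved past \<gamma>, and \<open>ck_rotate\<close> keeps the
  coefficient.\<close>

lemma relation_single: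
 assumes ne: "\<gamma> ~= []" and ch: "chain N a" "a ~= []" and col: "colored N \<gamma>"
 shows "TT N w (cl N \<gamma>) [a] = TT N w (cr N \<gamma>) [a]"
proof -
 let ?c = "\<lambda>x. KK N w (cf N) [x] []"
 let ?L = "if \<exists>x. a = \<gamma> @ x \<and> x ~= [] then ?c (drop (length \<gamma>) a) else 0"
 let ?R = "if \<exists>x. a = x @ \<gamma> \<and> x ~= [] then ?c (take (length a - length \<gamma>) a) else 0"
 have rot: "?c (v @ u) = d \<and> d ~= 0" if "?c (u @ v) = d \<and> d ~= 0" "u ~= []" "v ~= []" for u v d
  using ck_rotate[of v u] that by simp
 have closed: "x ~= [] \<and> colored N x \<and> hd x = lk N (last x)" if "?c x = d \<and> d ~= 0" for x d
  using ck_closed[of x] that by simp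
 have k: "KK N w (cf N) [] [x] = ?c x" for x
  unfolding KK_def[OF N] using cf_rotate[of N _ "[\<kappa>]" "[x]" for \<kappa>] by simp
 have "TT N w (cl N \<gamma>) [a] = KK N w (cl N \<gamma>) [] [a] + Qq N w \<gamma> [a] + ?L"
  using T_left[OF N ne, of a "[]" w] ch by (simp add: pr_def[OF N] k cong: if_cong)
 moreover have "TT N w (cr N \<gamma>) [a] = KK N w (cr N \<gamma>) [a] [] + Qq N w \<gamma> [a] + ?R"
  using T_right[OF N ne, of "[]" a w] ch by (simp add: pr_r_def[OF N] cong: if_cong)
 moreover have "?L = ?R"
 proof (cases "?L = 0")
  case False
  then obtain x where x: "a = \<gamma> @ x" "x ~= []" "?L = ?c x" by (auto split: if_splits)
  then have "?c x = ?L \<and> ?L ~= 0" using False by simp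
  then have d: "?c x = d" "d ~= 0" if "d = ?L" for d using that by auto
  have "\<exists>x'. (?c x' = d \<and> d ~= 0) \<and> \<gamma> @ x = x' @ \<gamma>" if d': "d = ?L" for d
  proof (rule shift_right[where P = "\<lambda>x. ?c x = d \<and> d ~= 0" and N = N])
   show "?c (v @ u) = d \<and> d ~= 0" if "?c (u @ v) = d \<and> d ~= 0" "u ~= []" "v ~= []" for u v by (rule rot[OF that])
   show "x ~= [] \<and> colored N x \<and> hd x = lk N (last x)" if "?c x = d \<and> d ~= 0" for x by (rule closed[OF that])
   show "?c x = d \<and> d ~= 0" using d[OF d'] by simp
  qed (use ch(1) x(1) col in simp_all)
  then obtain x' where "?c x' = ?L" "\<gamma> @ x = x' @ \<gamma>" by blast
  moreover from this x have "x' ~= []" by auto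
  ultimately show ?thesis using x(1) by auto
 next
  case L: True
  show ?thesis
  proof (rule ccontr)
   assume n: "?L ~= ?R"
   then have "?R ~= 0" using L by simp
   then obtain x where x: "a = x @ \<gamma>" "x ~= []" "?R = ?c x" by (auto split: if_splits)
   then have "?c x = ?R \<and> ?R ~= 0" using \<open>?R ~= 0\<close> by simp
   then have d: "?c x = d" "d ~= 0" if "d = ?R" for d using that by auto
  have "\<exists>x'. (?c x' = d \<and> d ~= 0) \<and> x @ \<gamma> = \<gamma> @ x'" if d': "d = ?R" for d
  proof (rule shift_left[where P = "\<lambda>x. ?c x = d \<and> d ~= 0" and N = N])
   show "?c (v @ u) = d \<and> d ~= 0" if "?c (u @ v) = d \<and> d ~= 0" "u ~= []" "v ~= []" for u v by (rule rot[OF that])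
   show "x ~= [] \<and> colored N x \<and> hd x = lk N (last x)" if "?c x = d \<and> d ~= 0" for x by (rule closed[OF that])
   show "?c x = d \<and> d ~= 0" using d[OF d'] by simp
  qed (use ch(1) x(1) col in simp_all)
  then obtain x' where "?c x' = ?R" "x @ \<gamma> = \<gamma> @ x'" by blast
  moreover from this x have "x' ~= []" by auto
   ultimately have "?L = ?R" using x(1) by auto
   then show False using n by simp
  qed
 qed
 ultimately show ?thesis using KK_extended[OF N ne, of w "[a]"] by simp
qed

text \<open>When \<gamma> extends beyond the first input, multiplying the first two inputs inside
  has the same effect as multiplying the first input from outside to a left extended output.\<close>

lemma pr_cl_longer:
 assumes "chain N (a @ g)" "chain N b" "a ~= []" "b ~= []" "g ~= []"
 shows "pr N w (cl N (a @ g)) a (b # r) = cl N g w (b # r)"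
proof (cases "\<exists>x. b = g @ x \<and> x ~= []")
 case True
 then obtain x where x: "b = g @ x" "x ~= []" by blast
 have "chain N (a @ b)" using assms x by (simp add: chain_append[of a])
 moreover have "cl N (a @ g) w ((a @ b) # r) = cf N w (x # r)" using cl_prefix[of x N "a @ g"] x by simp
 ultimately show ?thesis using x by (simp add: pr_def[OF N])
next
 case False
 then have "\<nexists>x. a @ b = (a @ g) @ x \<and> x ~= []" by auto
 then have "cl N (a @ g) w ((a @ b) # r) = 0" by (rule cl_other)
 then show ?thesis using cl_other[OF False] by (simp add: pr_def[OF N])
qed

lemma pr_r_cr_longer:
 assumes "chain N (g @ an)" "chain N b" "an ~= []" "b ~= []" "g ~= []"
 shows "pr_r N w (cr N (g @ an)) (r @ [b]) an = cr N g w (r @ [b])"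
proof (cases "\<exists>x. b = x @ g \<and> x ~= []")
 case True
 then obtain x where x: "b = x @ g" "x ~= []" by blast
 have "chain N ((x @ g) @ an)" using assms x by (simp add: chain_append[of _ an] del: append_assoc)
 then have "chain N (b @ an)" by (simp add: x)
 moreover have "cr N (g @ an) w (r @ [b @ an]) = cf N w (r @ [x])" using cr_suffix[of x N "g @ an"] x by simp
 ultimately show ?thesis using x by (simp add: pr_r_def[OF N])
next
 case False
 then have "\<nexists>x. b @ an = x @ (g @ an) \<and> x ~= []" by auto
 then have "cr N (g @ an) w (r @ [b @ an]) = 0" by (rule cr_other)
 then show ?thesis using cr_other[OF False] by (simp add: pr_r_def[OF N])
qed

text \<open>The terms with the product as outer operation and the first input as left factor, as far
  as the inner operation is given by graphs. Inner products and curvature are left to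
  \<open>low_sym\<close>.\<close>

definition out_left where
 "out_left \<gamma> as = (if \<exists>g. \<gamma> = hd as @ g then Mop N (drop (length (hd as)) \<gamma>) w (tl as) else 0)"

definition out_right where
 "out_right \<gamma> as = (if \<exists>g. \<gamma> = g @ last as then Mop N (take (length \<gamma> - length (last as)) \<gamma>) w (butlast as) else 0)"

text \<open>The proof compares \<gamma> with the first input. The hypothesis \<open>lc\<close>
  expresses that neighbouring inputs have matching idempotents: either the second continues the
  first, or the type of the letters changes as it does at a boundary end.\<close>

lemma left_total:
 assumes ne: "\<gamma> ~= []" "chain N \<gamma>" and ch: "\<And>z. z \<in> set (a # y @ [an]) ==> chain N z \<and> z ~= []"
  and lc: "chain N (a @ hd (y @ [an])) \<longleftrightarrow> \<not> adj2 N a (hd (y @ [an]))"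
 shows "TT N w (cl N \<gamma>) (a # y @ [an]) + out_left \<gamma> (a # y @ [an]) =
  KK N w (cl N \<gamma>) [] (a # y @ [an]) + Qq N w \<gamma> (a # y @ [an]) + ZL N w \<gamma> a y an"
proof -
 let ?rest = "y @ [an]"
 obtain b r where b: "?rest = b # r" by (cases y) auto
 have cb: "chain N b" "b ~= []" "chain N a" "a ~= []" using ch[of b] ch[of a] b by (auto simp: set_conv_nth[symmetric] dest: arg_cong[where f = set])
 have L: "TT N w (cl N \<gamma>) (a # ?rest) =
  KK N w (cl N \<gamma>) [] (a # ?rest) + Qq N w \<gamma> (a # ?rest) + pr N w (cl N \<gamma>) a ?rest +
  (if \<exists>x. a = \<gamma> @ x \<and> x ~= [] then pr N w (cf N) (drop (length \<gamma>) a) ?rest + KK N w (cf N) [] (drop (length \<gamma>) a # ?rest) +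
   (\<Sum>(q, x, l, post)\<in>splits ?rest. CC N w (cf N) (l # post) (drop (length \<gamma>) a # q @ [x])) else 0)"
  by (rule T_left[OF N ne(1) ch])
 consider (1) g where "\<gamma> = a @ g" "g ~= []" | (2) "\<gamma> = a" | (3) x where "a = \<gamma> @ x" "x ~= []"
  | (4) "\<nexists>x. a = \<gamma> @ x" "\<nexists>g. \<gamma> = a @ g" by (metis append_Nil2)
 then show ?thesis
 proof cases
  case 1
  then have c: "\<nexists>x. a = \<gamma> @ x \<and> x ~= []" "\<gamma> ~= a" "\<exists>g. \<gamma> = a @ g \<and> g ~= []" by auto
  have "pr N w (cl N \<gamma>) a ?rest = cl N g w ?rest"
   unfolding b 1(1) by (rule pr_cl_longer) (use cb 1 ne in auto)
  moreover have "out_left \<gamma> (a # ?rest) = cl N g w ?rest + cr N g w ?rest" using 1 by (simp add: out_left_def Mop_def)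
  moreover have "ZL N w \<gamma> a y an = cr N g w ?rest" using c 1 unfolding ZL_def[OF N] by simp
  ultimately show ?thesis unfolding L if_not_P[OF c(1)] by (simp add: ac_simps)
 next
  case 2
  then have c: "\<nexists>x. a = \<gamma> @ x \<and> x ~= []" "\<nexists>g. \<gamma> = a @ g \<and> g ~= []" by auto
  have "pr N w (cl N \<gamma>) a ?rest = (if chain N (a @ b) then cf N w ?rest else 0)"
   unfolding b 2 using cb by (simp add: pr_def[OF N])
  moreover have "out_left \<gamma> (a # ?rest) = cf N w ?rest" using 2 by (simp add: out_left_def Mop_def)
  moreover have "ZL N w \<gamma> a y an = (if adj2 N a b then cf N w ?rest else 0)" using c 2 b unfolding ZL_def[OF N] by simp
  ultimately show ?thesis using lc b unfolding L if_not_P[OF c(1)] by (auto simp: ac_simps)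
 next
  case 3
  then have c: "\<exists>x. a = \<gamma> @ x \<and> x ~= []" "\<gamma> ~= a" "\<nexists>g. \<gamma> = a @ g \<and> g ~= []" "\<nexists>g. \<gamma> = a @ g" by auto
  have d: "drop (length \<gamma>) a = x" using 3 by simp
  have "chain N (a @ b) \<longleftrightarrow> chain N (x @ b)"
   using cb 3 ne by (simp add: chain_append[of _ b] chain_append[of \<gamma> x] del: append_assoc)
  then have "pr N w (cl N \<gamma>) a ?rest = pr N w (cf N) x ?rest"
   unfolding b using cl_prefix[of "x @ b" N \<gamma> w r] 3 by (simp add: pr_def[OF N])
  moreover have "out_left \<gamma> (a # ?rest) = 0" using c(4) by (simp add: out_left_def)
  moreover have "ZL N w \<gamma> a y an = cf N w ((an @ x) # y)" using c d unfolding ZL_def[OF N] by simp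
  moreover have "KK N w (cf N) [] (x # ?rest) + (\<Sum>(q, x', l, post)\<in>splits ?rest. CC N w (cf N) (l # post) (x # q @ [x'])) =
   cf N w ((an @ x) # y)" by (rule merge_left[OF N]) (use 3 ch in auto)
  ultimately show ?thesis unfolding L if_P[OF c(1)] d by (simp add: ac_simps)
 next
  case 4
  then have c: "\<nexists>x. a = \<gamma> @ x \<and> x ~= []" "\<gamma> ~= a" "\<nexists>g. \<gamma> = a @ g \<and> g ~= []" by auto
  have "\<nexists>x. a @ b = \<gamma> @ x \<and> x ~= []" using 4 by (auto simp: append_eq_append_conv2)
  then have "pr N w (cl N \<gamma>) a ?rest = 0" unfolding b using cl_other by (simp add: pr_def[OF N])
  moreover have "out_left \<gamma> (a # ?rest) = 0" using 4 by (simp add: out_left_def)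
  moreover have "ZL N w \<gamma> a y an = 0" unfolding ZL_def[OF N] by (simp only: c if_False simp_thms add_0)
  ultimately show ?thesis unfolding L if_not_P[OF c(1)] by simp
 qed
qed

lemma right_total:
 assumes ne: "\<gamma> ~= []" "chain N \<gamma>" and ch: "\<And>z. z \<in> set ((a # y) @ [an]) ==> chain N z \<and> z ~= []"
  and lc: "chain N (last (a # y) @ an) \<longleftrightarrow> \<not> adj2 N (last (a # y)) an"
 shows "TT N w (cr N \<gamma>) ((a # y) @ [an]) + out_right \<gamma> ((a # y) @ [an]) =
  KK N w (cr N \<gamma>) ((a # y) @ [an]) [] + Qq N w \<gamma> ((a # y) @ [an]) + ZR N w \<gamma> a y an"
proof -
 let ?init = "a # y"
 obtain b r where b: "?init = r @ [b]" by (metis append_butlast_last_id list.distinct(1))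
 have lb: "last ?init = b" using b by simp
 have cb: "chain N b" "b ~= []" "chain N an" "an ~= []" using ch[of b] ch[of an] b by auto
 have L: "TT N w (cr N \<gamma>) (?init @ [an]) =
  KK N w (cr N \<gamma>) (?init @ [an]) [] + Qq N w \<gamma> (?init @ [an]) + pr_r N w (cr N \<gamma>) ?init an +
  (if \<exists>x. an = x @ \<gamma> \<and> x ~= [] then pr_r N w (cf N) ?init (take (length an - length \<gamma>) an) +
   KK N w (cf N) (?init @ [take (length an - length \<gamma>) an]) [] +
   (\<Sum>(pre, x, l, q)\<in>splits ?init. CC N w (cf N) (pre @ [x]) (l # q @ [take (length an - length \<gamma>) an])) else 0)"
  by (rule T_right[OF N ne(1) ch])
 consider (1) g where "\<gamma> = g @ an" "g ~= []" | (2) "\<gamma> = an" | (3) x where "an = x @ \<gamma>" "x ~= []"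
  | (4) "\<nexists>x. an = x @ \<gamma>" "\<nexists>g. \<gamma> = g @ an" by (metis append_Nil)
 then show ?thesis
 proof cases
  case 1
  then have c: "\<nexists>x. an = x @ \<gamma> \<and> x ~= []" "\<gamma> ~= an" "\<exists>g. \<gamma> = g @ an \<and> g ~= []" by auto
  have "pr_r N w (cr N \<gamma>) ?init an = cr N g w ?init"
   unfolding b 1(1) by (rule pr_r_cr_longer) (use cb 1 ne in auto)
  moreover have "out_right \<gamma> (?init @ [an]) = cl N g w ?init + cr N g w ?init" using 1 by (simp add: out_right_def Mop_def)
  moreover have "ZR N w \<gamma> a y an = cl N g w ?init" using c 1 unfolding ZR_def[OF N] by simp
  ultimately show ?thesis unfolding L if_not_P[OF c(1)] by (simp add: ac_simps)
 next
  case 2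
  then have c: "\<nexists>x. an = x @ \<gamma> \<and> x ~= []" "\<nexists>g. \<gamma> = g @ an \<and> g ~= []" by auto
  have "pr_r N w (cr N \<gamma>) ?init an = (if chain N (b @ an) then cf N w ?init else 0)"
   unfolding b 2 using cb by (simp add: pr_r_def[OF N])
  moreover have "out_right \<gamma> (?init @ [an]) = cf N w ?init" using 2 by (simp add: out_right_def Mop_def)
  moreover have "ZR N w \<gamma> a y an = (if adj2 N b an then cf N w ?init else 0)" using c 2 lb unfolding ZR_def[OF N] by simp
  ultimately show ?thesis using lc unfolding L if_not_P[OF c(1)] lb by (auto simp: ac_simps)
 next
  case 3
  then have c: "\<exists>x. an = x @ \<gamma> \<and> x ~= []" "\<gamma> ~= an" "\<nexists>g. \<gamma> = g @ an \<and> g ~= []" "\<nexists>g. \<gamma> = g @ an" by auto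
  have d: "take (length an - length \<gamma>) an = x" using 3 by simp
  have "chain N (b @ an) \<longleftrightarrow> chain N (b @ x)"
   using cb 3 ne by (simp add: chain_append[of b] chain_append[of x \<gamma>])
  then have "pr_r N w (cr N \<gamma>) ?init an = pr_r N w (cf N) ?init x"
   unfolding b using cr_suffix[of "b @ x" N \<gamma> w r] 3 by (simp add: pr_r_def[OF N])
  moreover have "out_right \<gamma> (?init @ [an]) = 0" using c(4) by (simp add: out_right_def)
  moreover have "ZR N w \<gamma> a y an = cf N w ((x @ a) # y)" using c d unfolding ZR_def[OF N] by simp
  moreover have "KK N w (cf N) (?init @ [x]) [] + (\<Sum>(pre, x', l, q)\<in>splits ?init. CC N w (cf N) (pre @ [x']) (l # q @ [x])) =
   cf N w ((x @ a) # y)" by (rule merge_right[OF N]) (use 3 ch in auto)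
  ultimately show ?thesis unfolding L if_P[OF c(1)] d by (simp add: ac_simps)
 next
  case 4
  then have c: "\<nexists>x. an = x @ \<gamma> \<and> x ~= []" "\<gamma> ~= an" "\<nexists>g. \<gamma> = g @ an \<and> g ~= []" by auto
  have "\<nexists>x. b @ an = x @ \<gamma> \<and> x ~= []" using 4 by (auto simp: append_eq_append_conv2)
  then have "pr_r N w (cr N \<gamma>) ?init an = 0" unfolding b using cr_other by (simp add: pr_r_def[OF N])
  moreover have "out_right \<gamma> (?init @ [an]) = 0" using 4 by (simp add: out_right_def)
  moreover have "ZR N w \<gamma> a y an = 0" unfolding ZR_def[OF N] by (simp only: c if_False simp_thms add_0)
  ultimately show ?thesis unfolding L if_not_P[OF c(1)] by simp
 qed
qed

lemma scalar_cancel: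
 fixes k q z t1 t2 o1 o2 :: scalar
 assumes "t1 + o1 = k + q + z" "t2 + o2 = k + q + z"
 shows "t1 + t2 + o1 + o2 = 0"
proof -
 have "t1 + t2 + o1 + o2 = (t1 + o1) + (t2 + o2)" by (simp only: ac_simps)
 then show ?thesis unfolding assms by simp
qed

lemma relation_many:
 assumes ne: "\<gamma> ~= []" "chain N \<gamma>" "colored N \<gamma>"
  and ch: "\<And>z. z \<in> set (a # y @ [an]) ==> chain N z \<and> z ~= [] \<and> colored N z"
  and lc: "chain N (a @ hd (y @ [an])) \<longleftrightarrow> \<not> adj2 N a (hd (y @ [an]))"
   "chain N (last (a # y) @ an) \<longleftrightarrow> \<not> adj2 N (last (a # y)) an"
 shows "TT N w (cl N \<gamma>) (a # y @ [an]) + TT N w (cr N \<gamma>) (a # y @ [an]) +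
  out_left \<gamma> (a # y @ [an]) + out_right \<gamma> (a # y @ [an]) = 0"
proof (rule scalar_cancel)
 show "TT N w (cl N \<gamma>) (a # y @ [an]) + out_left \<gamma> (a # y @ [an]) =
  KK N w (cl N \<gamma>) [] (a # y @ [an]) + Qq N w \<gamma> (a # y @ [an]) + ZL N w \<gamma> a y an"
  by (rule left_total) (use ne ch lc in auto)
 have "TT N w (cr N \<gamma>) ((a # y) @ [an]) + out_right \<gamma> ((a # y) @ [an]) =
  KK N w (cr N \<gamma>) ((a # y) @ [an]) [] + Qq N w \<gamma> ((a # y) @ [an]) + ZR N w \<gamma> a y an"
  by (rule right_total) (use ne ch lc in auto)
 moreover have "ZL N w \<gamma> a y an = ZR N w \<gamma> a y an" by (rule ZL_ZR[OF N]) (use ne ch in auto)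
 ultimately show "TT N w (cr N \<gamma>) (a # y @ [an]) + out_right \<gamma> (a # y @ [an]) =
  KK N w (cl N \<gamma>) [] (a # y @ [an]) + Qq N w \<gamma> (a # y @ [an]) + ZL N w \<gamma> a y an"
  using KK_extended[OF N ne(1), of w "a # y @ [an]"] by simp
qed

text \<open>All terms in which at least one of the two operations is given by graphs. Idempotent
  inputs are treated apart, since the cut identity speaks about nonempty words.\<close>

theorem letter_relation:
 assumes ne: "as ~= []" and \<gamma>: "chain N \<gamma>" "colored N \<gamma>"
  and ch: "\<And>z. z \<in> set as ==> chain N z \<and> colored N z"
  and lc: "\<And>p a b q. as = p @ a # b # q ==> a ~= [] ==> b ~= [] ==> chain N (a @ b) \<longleftrightarrow> \<not> adj2 N a b"
 shows "TT N w (Mop N \<gamma>) as + out_left \<gamma> as + out_right \<gamma> as = 0"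
proof (cases "[] \<in> set as")
 case True
 note st = Mop_strict[OF N]
 show ?thesis
 proof (cases "hd as = []")
  case h: True
  then obtain rest where as: "as = [] # rest" using ne by (cases as) auto
  have t: "TT N w (Mop N \<gamma>) as = (if rest = [] then 0 else Mop N \<gamma> w rest)"
   unfolding as by (rule TT_head_empty[OF st]) (use ch as in auto)
  have l: "out_left \<gamma> as = Mop N \<gamma> w rest" by (simp add: out_left_def as)
  have r: "out_right \<gamma> as = 0"
  proof (cases "rest = []")
   case False
   then have "[] \<in> set (butlast as)" by (simp add: as)
   then show ?thesis by (simp add: out_right_def st)
  qed (simp add: out_right_def as Mop_Nil[OF N])
  show ?thesis unfolding t l r using Mop_Nil[OF N] by simp
 next
  case False
  obtain u q where uq: "as = u @ [] # q" using True by (metis split_list)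
  then obtain p b where as: "as = p @ b # [] # q" using False by (cases u rule: rev_cases) auto
  have t: "TT N w (Mop N \<gamma>) as = (if q = [] then Mop N \<gamma> w (p @ [b]) else 0)"
   unfolding as by (rule TT_inner_empty[OF st]) (use ch as in auto)
  have "[] \<in> set (tl as)" by (cases p) (simp_all add: as)
  then have l: "out_left \<gamma> as = 0" by (simp add: out_left_def st)
  have r: "out_right \<gamma> as = (if q = [] then Mop N \<gamma> w (p @ [b]) else 0)"
  proof (cases "q = []")
   case False
   then have "[] \<in> set (butlast as)" by (simp add: as butlast_append)
   then show ?thesis using False by (simp add: out_right_def st)
  qed (simp add: out_right_def as butlast_append)
  show ?thesis unfolding t l r by simp
 qed
next
 case nE: False
 show ?thesis
 proof (cases "\<gamma> = []")
  case True
  have "Mop N \<gamma> = cf N" using True by (simp add: Mop_def fun_eq_iff)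
  then have "TT N w (Mop N \<gamma>) as = 0" using TT_centered[OF N ne] ch nE by fastforce
  moreover have "hd as ~= []" "last as ~= []" using nE ne by (metis hd_in_set last_in_set)+
  ultimately show ?thesis using True by (simp add: out_left_def out_right_def)
 next
  case False
  have "TT N w (Mop N \<gamma>) as = TT N w (\<lambda>w l. cl N \<gamma> w l + cr N \<gamma> w l) as" by (rule arg_cong[where f = "\<lambda>\<Phi>. TT N w \<Phi> as"]) (simp add: Mop_def False fun_eq_iff)
  then have t: "TT N w (Mop N \<gamma>) as = TT N w (cl N \<gamma>) as + TT N w (cr N \<gamma>) as" by (simp add: TT_add)
  obtain a rest where as: "as = a # rest" using ne by (cases as) auto
  show ?thesis
  proof (cases rest rule: rev_cases)
   case Nil
   have "TT N w (cl N \<gamma>) [a] = TT N w (cr N \<gamma>) [a]"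
    by (rule relation_single[OF False]) (use ch[of a] nE \<gamma> as in auto)
   then show ?thesis unfolding t by (simp add: as Nil out_left_def out_right_def Mop_Nil[OF N])
  next
   case (snoc y an)
   have l1: "chain N (a @ hd (y @ [an])) \<longleftrightarrow> \<not> adj2 N a (hd (y @ [an]))"
    by (rule lc[of "[]" _ _ "tl (y @ [an])"]) (use nE as snoc in \<open>cases y; auto\<close>)+
   have l2: "chain N (last (a # y) @ an) \<longleftrightarrow> \<not> adj2 N (last (a # y)) an"
   proof (rule lc[of "butlast (a # y)" _ _ "[]"])
    have "butlast (a # y) @ [last (a # y)] = a # y" by (rule append_butlast_last_id) simp
    then have "as = (butlast (a # y) @ [last (a # y)]) @ [an]" by (simp only:) (simp add: as snoc)
    then show "as = butlast (a # y) @ last (a # y) # an # []" by (simp only: append_assoc append_Cons append_Nil)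
    have "last (a # y) \<in> set as" "an \<in> set as" using last_in_set[of "a # y"] by (auto simp: as snoc)
    then show "last (a # y) ~= []" "an ~= []" using nE by metis+
   qed
   have "TT N w (cl N \<gamma>) (a # y @ [an]) + TT N w (cr N \<gamma>) (a # y @ [an]) +
     out_left \<gamma> (a # y @ [an]) + out_right \<gamma> (a # y @ [an]) = 0"
    by (rule relation_many[OF False \<gamma> _ l1 l2]) (use ch nE as snoc in auto)
   then show ?thesis unfolding t by (simp add: as snoc)
  qed
 qed
qed

end

section \<open>Multilinear extension\<close>

definition ext :: "(basis_elt => scalar) => star => scalar" where
 "ext f b = (\<Sum>z\<in>Poly_Mapping.keys b. Poly_Mapping.lookup b z * f z)"

primrec mext :: "(basis_elt list => scalar) => star list => scalar" where
 "mext f [] = f []"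
| "mext f (a # as) = ext (\<lambda>x. mext (\<lambda>xs. f (x # xs)) as) a"

lemma ext_superset:
 assumes "finite A" "Poly_Mapping.keys b \<subseteq> A"
 shows "ext f b = (\<Sum>z\<in>A. Poly_Mapping.lookup b z * f z)"
 unfolding ext_def by (rule sum.mono_neutral_left) (use assms in \<open>auto simp: in_keys_iff\<close>)

lemma ext_add_right: "ext f (a + b) = ext f a + ext f b"
proof -
 let ?A = "Poly_Mapping.keys a \<union> Poly_Mapping.keys b"
 have "ext f (a + b) = (\<Sum>z\<in>?A. Poly_Mapping.lookup (a + b) z * f z)"
  by (rule ext_superset) (simp_all add: Poly_Mapping.keys_add)
 then show ?thesis
  by (simp add: ext_superset[of ?A] lookup_add distrib_right sum.distrib)
qed

lemma ext_zero_right [simp]: "ext f 0 = 0"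
 by (simp add: ext_def)

lemma ext_sum_right: "ext f (\<Sum>i\<in>I. b i) = (\<Sum>i\<in>I. ext f (b i))"
 by (induction I rule: infinite_finite_induct) (simp_all add: ext_add_right)

lemma lookup_scale [simp]: "Poly_Mapping.lookup (star_scale c a) x = c * Poly_Mapping.lookup a x"
 by (simp add: star_scale_def Poly_Mapping.map.rep_eq when_def)

lemma ext_scale_right: "ext f (star_scale c a) = c * ext f a"
proof -
 have "ext f (star_scale c a) = (\<Sum>z\<in>Poly_Mapping.keys a. Poly_Mapping.lookup (star_scale c a) z * f z)"
  by (rule ext_superset) (auto simp: in_keys_iff)
 then show ?thesis by (simp add: ext_def sum_distrib_left mult.assoc)
qed

lemma ext_elt [simp]: "ext f (elt x) = f x"
 by (simp add: ext_def elt_def)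

lemma ext_add_left: "ext (\<lambda>z. f z + g z) a = ext f a + ext g a"
 by (simp add: ext_def distrib_left sum.distrib)

lemma ext_cmult_left: "ext (\<lambda>z. c * f z) a = c * ext f a"
 by (simp add: ext_def sum_distrib_left mult.left_commute)

lemma ext_sum_left: "ext (\<lambda>z. \<Sum>i\<in>I. f i z) a = (\<Sum>i\<in>I. ext (f i) a)"
 unfolding ext_def sum_distrib_left by (rule sum.swap)

lemma ext_cong: "(\<And>z. z \<in> Poly_Mapping.keys a ==> f z = g z) ==> ext f a = ext g a"
 by (simp add: ext_def)

lemma ext_swap: "ext (\<lambda>x. ext (h x) b) a = ext (\<lambda>y. ext (\<lambda>x. h x y) a) b"
proof -
 have "ext (\<lambda>x. ext (h x) b) a =
   (\<Sum>x\<in>Poly_Mapping.keys a. \<Sum>y\<in>Poly_Mapping.keys b. Poly_Mapping.lookup a x * (Poly_Mapping.lookup b y * h x y))"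
  by (simp add: ext_def sum_distrib_left)
 also have "\<dots> = (\<Sum>y\<in>Poly_Mapping.keys b. \<Sum>x\<in>Poly_Mapping.keys a. Poly_Mapping.lookup a x * (Poly_Mapping.lookup b y * h x y))"
  by (rule sum.swap)
 also have "\<dots> = ext (\<lambda>y. ext (\<lambda>x. h x y) a) b"
  by (simp add: ext_def sum_distrib_left mult.left_commute)
 finally show ?thesis .
qed

lemma mext_append: "mext f (as @ bs) = mext (\<lambda>xs. mext (\<lambda>ys. f (xs @ ys)) bs) as"
 by (induction as arbitrary: f) simp_all

lemma mext_cong:
 "(\<And>xs. list_all2 (\<lambda>x a. x \<in> Poly_Mapping.keys a) xs as ==> f xs = g xs) ==> mext f as = mext g as"
proof (induction as arbitrary: f g)
 case (Cons a as)
 show ?case unfolding mext.simps by (intro ext_cong Cons.IH Cons.prems) simp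
qed simp

lemma mext_zero: "mext (\<lambda>_. 0) as = 0"
 by (induction as) (simp_all add: ext_def)

lemma mext_sum: "mext (\<lambda>xs. \<Sum>i\<in>I. f i xs) as = (\<Sum>i\<in>I. mext (f i) as)"
 by (induction as arbitrary: f) (simp_all add: ext_sum_left)

lemma mext_ext: "mext (\<lambda>ys. ext (\<lambda>z. h z ys) b) as = ext (\<lambda>z. mext (h z) as) b"
proof (induction as arbitrary: h)
 case (Cons a as)
 show ?case unfolding mext.simps Cons.IH by (rule ext_swap)
qed simp

lemma mext_add: "mext f (as @ [x + y] @ bs) = mext f (as @ [x] @ bs) + mext f (as @ [y] @ bs)"
 by (induction as arbitrary: f) (simp_all add: ext_add_right ext_add_left)

lemma mext_scale: "mext f (as @ [star_scale c x] @ bs) = c * mext f (as @ [x] @ bs)"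
 by (induction as arbitrary: f) (simp_all add: ext_scale_right ext_cmult_left)

text \<open>Summing over tuples of basis elements is the same as extending linearly in one argument
  after the other, which is easier to manipulate.\<close>

lemma sum_listset:
 "(\<Sum>xs\<in>listset (map Poly_Mapping.keys as). (\<Prod>k<length as. Poly_Mapping.lookup (as ! k) (xs ! k)) * f xs) = mext f as"
proof (induction as arbitrary: f)
 case (Cons a as)
 let ?L = "listset (map Poly_Mapping.keys as)"
 have "(\<Sum>xs\<in>listset (map Poly_Mapping.keys (a # as)). (\<Prod>k<length (a # as). Poly_Mapping.lookup ((a # as) ! k) (xs ! k)) * f xs) =
   (\<Sum>(x, xs)\<in>Poly_Mapping.keys a \<times> ?L. (\<Prod>k<length (a # as). Poly_Mapping.lookup ((a # as) ! k) ((x # xs) ! k)) * f (x # xs))"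
  by (rule sum.reindex_bij_witness[of _ "\<lambda>(x, xs). x # xs" "\<lambda>xs. (hd xs, tl xs)"]) (auto simp: set_Cons_def)
 also have "\<dots> = (\<Sum>x\<in>Poly_Mapping.keys a. \<Sum>xs\<in>?L. Poly_Mapping.lookup a x * ((\<Prod>k<length as. Poly_Mapping.lookup (as ! k) (xs ! k)) * f (x # xs)))"
  by (simp add: sum.cartesian_product[symmetric] prod.lessThan_Suc_shift mult.assoc del: prod.lessThan_Suc)
 also have "\<dots> = mext f (a # as)"
  by (simp add: sum_distrib_left[symmetric] Cons.IH ext_def)
 finally show ?case .
qed simp

lemma lookup_sum_star: "Poly_Mapping.lookup (\<Sum>i\<in>I. f i) x = (\<Sum>i\<in>I. Poly_Mapping.lookup (f i :: star) x)"
 by (rule Poly_Mapping.lookup_sum)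

lemma lookup_star_op: "Poly_Mapping.lookup (star_op N w as) \<gamma> = mext (\<lambda>xs. Poly_Mapping.lookup (basis_op N w xs) \<gamma>) as"
 unfolding star_op_def lookup_sum_star lookup_scale by (rule sum_listset)

lemma ext_star_op: "ext f (star_op N w as) = mext (\<lambda>xs. ext f (basis_op N w xs)) as"
 unfolding star_op_def ext_sum_right ext_scale_right by (rule sum_listset)

text \<open>The inner position is expressed by \<open>take\<close> and \<open>drop\<close> on the
  list of basis elements, so that the extension is over the same arguments for every position and
  commutes with the sum over positions.\<close>

lemma lookup_star_op_compose:
 "Poly_Mapping.lookup (star_op N w' (pre @ [star_op N w'' mid] @ post)) \<gamma> =
 mext (\<lambda>xs. ext (\<lambda>z. Poly_Mapping.lookup (basis_op N w' (take (length pre) xs @ [z] @ drop (length pre + length mid) xs)) \<gamma>)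
   (basis_op N w'' (take (length mid) (drop (length pre) xs)))) (pre @ mid @ post)"
proof -
 let ?f = "\<lambda>xs. Poly_Mapping.lookup (basis_op N w' xs) \<gamma>"
 have "Poly_Mapping.lookup (star_op N w' (pre @ [star_op N w'' mid] @ post)) \<gamma> =
   mext (\<lambda>p. mext (\<lambda>m. mext (\<lambda>q. ext (\<lambda>z. ?f (p @ [z] @ q)) (basis_op N w'' m)) post) mid) pre"
  unfolding lookup_star_op mext_append by (simp add: ext_star_op mext_ext)
 also have "\<dots> = mext (\<lambda>xs. ext (\<lambda>z. ?f (take (length pre) xs @ [z] @ drop (length pre + length mid) xs))
   (basis_op N w'' (take (length mid) (drop (length pre) xs)))) (pre @ mid @ post)"
  unfolding mext_append by (intro mext_cong) (simp add: list_all2_lengthD)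
 finally show ?thesis .
qed

definition relation :: "nat => nat multiset => basis_elt => basis_elt list => scalar" where
 "relation N w \<gamma> xs = (\<Sum>(w', w'') \<in> {(w', w''). w' + w'' = w}.
  \<Sum>(p, r) \<in> {(p, r). r \<le> length xs \<and> p \<le> length xs - r}.
   ext (\<lambda>z. Poly_Mapping.lookup (basis_op N w' (take p xs @ [z] @ drop (p + r) xs)) \<gamma>)
    (basis_op N w'' (take r (drop p xs))))"

lemma lookup_A_infinity_sum:
 "Poly_Mapping.lookup (A_infinity_sum (star_op N) w as) \<gamma> = mext (relation N w \<gamma>) as"
proof -
 let ?g = "\<lambda>w' w'' p r xs. ext (\<lambda>z. Poly_Mapping.lookup (basis_op N w' (take p xs @ [z] @ drop (p + r) xs)) \<gamma>)
    (basis_op N w'' (take r (drop p xs)))"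
 let ?I = "{(p, r). r \<le> length as \<and> p \<le> length as - r}"
 have 1: "Poly_Mapping.lookup (star_op N w' (take p as @ [star_op N w'' (take r (drop p as))] @ drop (p + r) as)) \<gamma> =
   mext (?g w' w'' p r) as" if "(p, r) \<in> ?I" for w' w'' p r
 proof -
  have "take p as @ take r (drop p as) @ drop (p + r) as = as"
   by (metis add.commute append_take_drop_id drop_drop)
  moreover have "length (take p as) = p" "length (take r (drop p as)) = r" using that by auto
  ultimately show ?thesis using lookup_star_op_compose[of N w' "take p as" w'' "take r (drop p as)" "drop (p + r) as" \<gamma>]
   by simp
 qed
 have "mext (relation N w \<gamma>) as = mext (\<lambda>xs. \<Sum>x\<in>{(w', w''). w' + w'' = w}. \<Sum>y\<in>?I. ?g (fst x) (snd x) (fst y) (snd y) xs) as"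
  by (rule mext_cong) (simp add: relation_def list_all2_lengthD case_prod_unfold)
 also have "\<dots> = (\<Sum>x\<in>{(w', w''). w' + w'' = w}. \<Sum>y\<in>?I. mext (?g (fst x) (snd x) (fst y) (snd y)) as)"
  unfolding mext_sum ..
 also have "\<dots> = Poly_Mapping.lookup (A_infinity_sum (star_op N) w as) \<gamma>"
  unfolding A_infinity_sum_def lookup_sum_star case_prod_unfold using 1 by (intro sum.cong refl) simp
 finally show ?thesis by simp
qed

section \<open>Scalars\<close>

lemma lookup_times_key:
 fixes a b :: scalar
 assumes "m \<in> Poly_Mapping.keys (a * b)"
 obtains u v where "u \<in> Poly_Mapping.keys a" "v \<in> Poly_Mapping.keys b" "m = u + v"
 using keys_mult[of a b] assms by blast

lemma ground_ring_zero: "0 \<in> ground_ring N"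
 by (simp add: ground_ring_def)

lemma ground_ring_one: "1 \<in> ground_ring N"
 by (simp add: ground_ring_def)

lemma ground_ring_add:
 assumes "a \<in> ground_ring N" "b \<in> ground_ring N"
 shows "a + b \<in> ground_ring N"
proof -
 have "Poly_Mapping.keys (a + b) \<subseteq> Poly_Mapping.keys a \<union> Poly_Mapping.keys b" by (rule Poly_Mapping.keys_add)
 then show ?thesis using assms unfolding ground_ring_def by blast
qed

lemma ground_ring_mult:
 assumes "a \<in> ground_ring N" "b \<in> ground_ring N"
 shows "a * b \<in> ground_ring N"
 unfolding ground_ring_def
proof (intro CollectI ballI)
 fix m assume "m \<in> Poly_Mapping.keys (a * b)"
 then obtain u v where "u \<in> Poly_Mapping.keys a" "v \<in> Poly_Mapping.keys b" "m = u + v" by (rule lookup_times_key)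
 moreover have "Poly_Mapping.keys (u + v) \<subseteq> Poly_Mapping.keys u \<union> Poly_Mapping.keys v" for u v :: "nat \<Rightarrow>\<^sub>0 nat"
  by (rule Poly_Mapping.keys_add)
 ultimately show "Poly_Mapping.keys m \<subseteq> {0..N + 1}" using assms unfolding ground_ring_def by blast
qed

lemma ground_ring_sum: "(\<And>i. i \<in> I ==> f i \<in> ground_ring N) ==> (\<Sum>i\<in>I. f i) \<in> ground_ring N"
 by (induction I rule: infinite_finite_induct) (simp_all add: ground_ring_zero ground_ring_add)

lemma ground_ring_of_nat: "of_nat n \<in> ground_ring N"
 by (induction n) (simp_all add: ground_ring_zero ground_ring_one ground_ring_add)

lemma ground_ring_power: "a \<in> ground_ring N ==> a ^ n \<in> ground_ring N"
 by (induction n) (simp_all add: ground_ring_one ground_ring_mult)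

lemma centered_coeff_ground_ring: "centered_coeff N w as \<in> ground_ring N"
proof -
 have "Vvar 0 \<in> ground_ring N" by (simp add: ground_ring_def Vvar_def)
 then show ?thesis
  unfolding centered_coeff_def by (intro ground_ring_sum ground_ring_mult ground_ring_of_nat ground_ring_power)
qed

text \<open>The type of basis elements also has values outside \<open>basis N\<close>, such as
  zeroth powers. There the coefficient has to be 0.\<close>

definition coeffs_at :: "nat => basis_elt => scalar set" where
 "coeffs_at N x = (if x \<in> basis N then ground_ring N else {0})"

lemma star_algebra_iff: "a \<in> star_algebra N \<longleftrightarrow> (\<forall>x. Poly_Mapping.lookup a x \<in> coeffs_at N x)"
 unfolding star_algebra_def coeffs_at_def by (auto simp: in_keys_iff ground_ring_zero)

lemma coeffs_at_sum: "(\<And>i. i \<in> I ==> f i \<in> coeffs_at N x) ==> (\<Sum>i\<in>I. f i) \<in> coeffs_at N x"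
 by (auto simp: coeffs_at_def intro: ground_ring_sum split: if_splits)

lemma coeffs_at_add: "c \<in> coeffs_at N x ==> d \<in> coeffs_at N x ==> c + d \<in> coeffs_at N x"
 by (cases "x \<in> basis N") (simp_all add: coeffs_at_def ground_ring_add)

lemma coeffs_at_mult: "c \<in> ground_ring N ==> d \<in> coeffs_at N x ==> c * d \<in> coeffs_at N x"
 by (auto simp: coeffs_at_def intro: ground_ring_mult split: if_splits)

lemma star_algebra_zero: "0 \<in> star_algebra N"
 by (simp add: star_algebra_def)

lemma star_algebra_add:
 assumes "a \<in> star_algebra N" "b \<in> star_algebra N"
 shows "a + b \<in> star_algebra N"
 using assms unfolding star_algebra_iff lookup_add by (blast intro: coeffs_at_add)

lemma star_algebra_sum: "(\<And>i. i \<in> I ==> f i \<in> star_algebra N) ==> (\<Sum>i\<in>I. f i) \<in> star_algebra N"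
 by (induction I rule: infinite_finite_induct) (simp_all add: star_algebra_zero star_algebra_add)

lemma star_algebra_scale: "c \<in> ground_ring N ==> a \<in> star_algebra N ==> star_scale c a \<in> star_algebra N"
 unfolding star_algebra_iff lookup_scale by (blast intro: coeffs_at_mult)

lemma star_algebra_elt: "x \<in> basis N ==> elt x \<in> star_algebra N"
 by (simp add: star_algebra_def elt_def ground_ring_one)

lemma basis_mult_basis:
 "x \<in> basis N ==> y \<in> basis N ==> basis_mult N x y = Some z ==> z \<in> basis N"
 unfolding basis_mult_def basis_def by (auto split: if_splits basis_elt.splits)

lemma initial_basis: "x \<in> basis N ==> initial x \<in> {1..N}"
 unfolding basis_def by auto

lemma nontrivial_basis: "x \<in> nontrivial N ==> x \<in> basis N"
 by (simp add: nontrivial_def)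

lemma basis_op_closed:
 assumes N: "N \<ge> 1" and xs: "set xs \<subseteq> basis N"
 shows "basis_op N w xs \<in> star_algebra N"
proof (cases "xs = []")
 case True
 have "curvature N w \<in> star_algebra N"
  unfolding curvature_def using N
  by (intro star_algebra_add star_algebra_sum) (auto simp: basis_def intro!: star_algebra_elt star_algebra_zero star_algebra_sum)
 then show ?thesis using True by (simp add: basis_op_def)
next
 case False
 then have h: "hd xs \<in> basis N" using xs by auto
 have "product_part N w xs \<in> star_algebra N"
 proof (cases "w = {#} \<and> length xs = 2")
  case True
  then have "xs ! 0 \<in> basis N" "xs ! 1 \<in> basis N" using xs by auto
  then show ?thesis unfolding product_part_def using basis_mult_basis[of "xs ! 0" N "xs ! 1"]
   by (auto intro: star_algebra_elt star_algebra_zero split: option.split)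
 qed (auto simp: product_part_def star_algebra_zero)
 moreover have "centered_part N w xs \<in> star_algebra N"
  unfolding centered_part_def using initial_basis[OF h]
  by (intro star_algebra_scale centered_coeff_ground_ring star_algebra_elt) (auto simp: basis_def)
 moreover have "left_extended_part N w xs \<in> star_algebra N" "right_extended_part N w xs \<in> star_algebra N"
  unfolding left_extended_part_def right_extended_part_def
  by (auto intro!: star_algebra_sum star_algebra_scale centered_coeff_ground_ring star_algebra_elt nontrivial_basis)
 ultimately show ?thesis using False by (simp add: basis_op_def star_algebra_add)
qed

lemma ext_closed:
 assumes "b \<in> star_algebra N" "\<And>z. z \<in> basis N ==> f z \<in> coeffs_at N \<gamma>"
 shows "ext f b \<in> coeffs_at N \<gamma>"
 unfolding ext_def by (rule coeffs_at_sum, rule coeffs_at_mult) (use assms in \<open>auto simp: star_algebra_def\<close>)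

lemma mext_closed:
 assumes "set as \<subseteq> star_algebra N" "\<And>xs. set xs \<subseteq> basis N ==> f xs \<in> coeffs_at N \<gamma>"
 shows "mext f as \<in> coeffs_at N \<gamma>"
 using assms
proof (induction as arbitrary: f)
 case (Cons a as)
 show ?case unfolding mext.simps
  by (rule ext_closed) (use Cons.prems in \<open>auto intro!: Cons.IH\<close>)
qed simp

lemma star_op_multilinear:
 assumes "N \<ge> 1"
 shows "multilinear_op (ground_ring N) star_scale (star_algebra N) (star_op N w)"
 unfolding multilinear_op_def
proof (intro conjI allI impI)
 fix as :: "star list"
 assume "set as \<subseteq> star_algebra N"
 then show "star_op N w as \<in> star_algebra N"
  unfolding star_algebra_iff lookup_star_op
  by (intro allI mext_closed) (use basis_op_closed[OF assms] in \<open>auto simp: star_algebra_iff\<close>)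
next
 fix as bs x y
 show "star_op N w (as @ [x + y] @ bs) = star_op N w (as @ [x] @ bs) + star_op N w (as @ [y] @ bs)"
  by (rule poly_mapping_eqI) (simp only: lookup_star_op lookup_add mext_add)
next
 fix as bs c x
 show "star_op N w (as @ [star_scale c x] @ bs) = star_scale c (star_op N w (as @ [x] @ bs))"
  by (rule poly_mapping_eqI) (simp only: lookup_star_op lookup_scale mext_scale)
qed

lemma A_infinity_sum_zero:
 assumes "set as \<subseteq> star_algebra N" "\<And>\<gamma> xs. set xs \<subseteq> basis N ==> relation N w \<gamma> xs = 0"
 shows "A_infinity_sum (star_op N) w as = 0"
proof (rule poly_mapping_eqI)
 fix \<gamma>
 have "mext (relation N w \<gamma>) as = mext (\<lambda>_. 0) as"
 proof (rule mext_cong)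
  fix xs assume l: "list_all2 (\<lambda>x a. x \<in> Poly_Mapping.keys a) xs as"
  have "set xs \<subseteq> basis N"
   using l assms(1) by (induction xs as rule: list_all2_induct) (auto simp: star_algebra_def)
  then show "relation N w \<gamma> xs = 0" by (rule assms(2))
 qed
 then show "Poly_Mapping.lookup (A_infinity_sum (star_op N) w as) \<gamma> = Poly_Mapping.lookup 0 \<gamma>"
  by (simp add: lookup_A_infinity_sum mext_zero)
qed

section \<open>Letters of basis elements\<close>

lemma cyc_funpow_add: "(cyc_suc N ^^ (m + k)) i = (cyc_suc N ^^ k) ((cyc_suc N ^^ m) i)"
 by (simp add: add.commute[of m] funpow_add)

lemma spath_Suc: "spath N i (Suc k) = spath N i k @ [(True, (cyc_suc N ^^ k) i)]"
 by (simp add: spath_def)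

lemma spath_add: "spath N i (m + k) = spath N i m @ spath N ((cyc_suc N ^^ m) i) k"
 by (induction k) (simp_all add: spath_Suc cyc_funpow_add, simp add: spath_def)

lemma basis_nontrivial: "x \<in> basis N ==> x \<notin> nontrivial N ==> \<exists>i\<in>{1..N}. x = Idem i"
 by (auto simp: nontrivial_def basis_def)

lemma chain_letters: "x \<in> basis N ==> chain N (letters N x)"
 using basis_nontrivial[of x N] letters_nontrivial(2)[of x N] by (cases "x \<in> nontrivial N") (auto simp: chain_def)

lemma letters_Nil_iff: "x \<in> basis N ==> letters N x = [] \<longleftrightarrow> x \<notin> nontrivial N"
 using basis_nontrivial[of x N] letters_nontrivial(1)[of x N] by auto

lemma colored_letters:
 assumes "x \<in> basis N"
 shows "colored N (letters N x)"
proof (cases "x \<in> nontrivial N")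
 case True
 then show ?thesis
 proof (cases rule: nontrivial_cases)
  case (2 i m)
  have "(cyc_suc N ^^ j) i \<in> {1..N}" for j using 2 by (auto simp: cyc_suc_funpow Suc_leI)
  then show ?thesis using 2 by (auto simp: colored_def spath_def)
 qed (auto simp: colored_def)
next
 case False
 then show ?thesis using letters_Nil_iff[OF assms] by (simp add: colored_def)
qed

lemma initial_letters: "x \<in> nontrivial N ==> initial x = snd (hd (letters N x))"
 by (erule nontrivial_cases) (simp_all add: hd_spath hd_replicate)

lemma final_letters: "x \<in> nontrivial N ==> final N x = snd (lk N (last (letters N x)))"
proof (erule nontrivial_cases)
 fix i m assume m: "x = Path i m" "m \<ge> 1"
 then obtain k where "m = Suc k" by (cases m) auto
 then show ?thesis using m by (simp add: spath_Suc)
qed (simp add: last_replicate)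

text \<open>All idempotents have the empty word, so the word has to be supplemented by the initial
  idempotent.\<close>

lemma letters_inj:
 assumes "x \<in> basis N" "y \<in> basis N" "letters N x = letters N y" "initial x = initial y"
 shows "x = y"
proof (cases "x \<in> nontrivial N")
 case True
 then have "y \<in> nontrivial N" using letters_Nil_iff[OF assms(1)] letters_Nil_iff[OF assms(2)] assms(3) by simp
 then show ?thesis using True letters_nontrivial(3) assms(3) by metis
next
 case False
 then have "y \<notin> nontrivial N" using letters_Nil_iff[OF assms(1)] letters_Nil_iff[OF assms(2)] assms(3) by simp
 then show ?thesis using False basis_nontrivial[OF assms(1)] basis_nontrivial[OF assms(2)] assms(4) by auto
qed

lemma basis_mult_SomeD:
 assumes "basis_mult N x y = Some z"
 shows "final N x = initial y" "initial z = initial x" "final N z = final N y" "letters N z = letters N x @ letters N y"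
 using assms unfolding basis_mult_def
 by (auto split: if_splits basis_elt.splits simp: replicate_add spath_add cyc_funpow_add)

text \<open>With matching idempotents a product vanishes only if a power of some
  \<open>U\<^sub>i\<close> meets a path, and a letter is never continued by one of the other
  type.\<close>

lemma basis_mult_NoneD:
 assumes "x \<in> basis N" "y \<in> basis N" "final N x = initial y" "basis_mult N x y = None"
 shows "\<not> chain N (letters N x @ letters N y)"
proof -
 have nt: "x \<in> nontrivial N" "y \<in> nontrivial N"
  using assms basis_nontrivial[of x N] basis_nontrivial[of y N]
  by (auto simp: basis_mult_def split: if_splits basis_elt.splits)
 note l = letters_nontrivial[OF nt(1)] letters_nontrivial[OF nt(2)]
 have "fst (last (letters N x)) = fst (hd (letters N x))" by (rule chain_fst[OF l(2) last_in_set[OF l(1)]])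
 moreover have "fst (hd (letters N y)) ~= fst (hd (letters N x))"
  using nt assms(3,4) by (elim nontrivial_cases) (auto simp: basis_mult_def hd_spath hd_replicate split: if_splits)
 ultimately have ne: "fst (hd (letters N y)) ~= fst (last (letters N x))" by simp
 show ?thesis
 proof
  assume "chain N (letters N x @ letters N y)"
  then have "hd (letters N y) = lk N (last (letters N x))" by (simp add: chain_append[OF l(1) l(5)])
  then show False using ne by simp
 qed
qed

lemma basis_mult_iff:
 assumes "x \<in> basis N" "y \<in> basis N" "z \<in> basis N" "final N x = initial y" "initial z = initial x"
 shows "basis_mult N x y = Some z \<longleftrightarrow> letters N z = letters N x @ letters N y"
proof
 assume l: "letters N z = letters N x @ letters N y"
 then have "basis_mult N x y ~= None" using basis_mult_NoneD[OF assms(1,2,4)] chain_letters[OF assms(3)] by auto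
 then obtain z' where z': "basis_mult N x y = Some z'" by auto
 have "z' = z"
  by (rule letters_inj[OF basis_mult_basis[OF assms(1,2) z'] assms(3)]) (use basis_mult_SomeD[OF z'] l assms(5) in simp_all)
 then show "basis_mult N x y = Some z" using z' by simp
qed (rule basis_mult_SomeD)

lemma basis_of_letters:
 assumes "chain N ls" "colored N ls" "i \<in> {1..N}" "ls ~= [] ==> snd (hd ls) = i"
 obtains z where "z \<in> basis N" "letters N z = ls" "initial z = i"
proof (cases "ls = []")
 case True
 then show ?thesis using that[of "Idem i"] assms(3) by (simp add: basis_def)
next
 case False
 have nt: "of_letters ls \<in> nontrivial N" using of_letters_nontrivial[OF False] assms(3,4) False by simp
 have l: "letters N (of_letters ls) = ls" by (rule letters_of_letters[OF False assms(1)])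
 then show ?thesis using that[of "of_letters ls"] nontrivial_basis[OF nt] initial_letters[OF nt] assms(4) False by simp
qed

lemma bsplit_letters:
 assumes h: "h \<in> basis N" and uv: "(u, v) \<in> bsplit (letters N h)"
 shows "h \<in> nontrivial N" "of_letters u \<in> nontrivial N" "of_letters v \<in> nontrivial N"
  "letters N (of_letters u) = u" "letters N (of_letters v) = v" "basis_mult N (of_letters u) (of_letters v) = Some h"
proof -
 have l: "letters N h = u @ v" "u ~= []" "v ~= []" using uv by (auto simp: bsplit_def)
 show hn: "h \<in> nontrivial N" using l letters_Nil_iff[OF h] by auto
 have c: "chain N u" "chain N v" "hd v = lk N (last u)" using chain_letters[OF h] l by (simp_all add: chain_append)
 have col: "snd (hd u) \<in> {1..N}" "snd (hd v) \<in> {1..N}" using colored_letters[OF h] l by (simp_all add: colored_def)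
 show u: "of_letters u \<in> nontrivial N" and v: "of_letters v \<in> nontrivial N"
  using of_letters_nontrivial[OF l(2)] of_letters_nontrivial[OF l(3)] col by auto
 show lu: "letters N (of_letters u) = u" and lv: "letters N (of_letters v) = v"
  using letters_of_letters l(2,3) c by auto
 show "basis_mult N (of_letters u) (of_letters v) = Some h"
  by (subst basis_mult_iff)
   (use u v h nontrivial_basis lu lv l c initial_letters[OF u] initial_letters[OF v] initial_letters[OF hn] final_letters[OF u] in auto)
qed

lemma centered_coeff_letters:
 assumes "N \<ge> 1" "set as \<subseteq> basis N"
 shows "centered_coeff N w as = cf N w (map (letters N) as)"
proof (cases "set as \<subseteq> nontrivial N")
 case False
 then obtain x where "x \<in> set as" "x \<notin> nontrivial N" by blast
 then have "letters N x = []" using assms(2) letters_Nil_iff[of x N] by auto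
 then have "[] \<in> set (map (letters N) as)" using \<open>x \<in> set as\<close> by (metis image_eqI set_map)
 then show ?thesis using centered_coeff_cf[OF assms(1)] False cf_strict[OF assms(1)] by simp
qed (simp add: centered_coeff_cf[OF assms(1)])

section \<open>The operations on letters\<close>

context
 fixes N :: nat
 assumes N: "N \<ge> 1"
begin

text \<open>Factorizations of \<open>h\<close> with two nontrivial factors are the cuts of its word
  into nonempty parts. Those with an idempotent second factor contribute nothing, as no region of a
  graph has an empty label.\<close>

lemma ext_left_extended:
 assumes h: "h \<in> basis N" and t: "set t \<subseteq> basis N"
 shows "ext f (left_extended_part N w (h # t)) =
  (\<Sum>(u, v)\<in>bsplit (letters N h). cf N w (v # map (letters N) t) * f (of_letters u))"
proof -
 let ?S = "{(\<alpha>, x). \<alpha> \<in> nontrivial N \<and> x \<in> basis N \<and> basis_mult N \<alpha> x = Some h}"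
 let ?g = "\<lambda>(\<alpha>, x). (letters N \<alpha>, letters N x)"
 \<comment> \<open>A factorization is determined by the words of its factors, and the word of
   \<open>h\<close> has only finitely many cuts.\<close>
 have fin: "finite ?S"
 proof (rule inj_on_finite[where f = ?g and B = "cuts (letters N h)"])
  show "inj_on ?g ?S"
  proof (rule inj_onI, clarify)
   fix a x b y assume *: "a \<in> nontrivial N" "x \<in> basis N" "basis_mult N a x = Some h"
    "b \<in> nontrivial N" "y \<in> basis N" "basis_mult N b y = Some h" "letters N a = letters N b" "letters N x = letters N y"
   have "a = b" using * letters_nontrivial(3) by metis
   moreover have "initial x = initial y" using * basis_mult_SomeD(1) calculation by metis
   ultimately show "a = b \<and> x = y" using letters_inj[of x N y] * by simp
  qed
  show "?g ` ?S \<le> cuts (letters N h)" using basis_mult_SomeD(4) by (auto simp: cuts_def)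
 qed simp
 have "ext f (left_extended_part N w (h # t)) = (\<Sum>(\<alpha>, x)\<in>?S. centered_coeff N w (x # t) * f \<alpha>)"
  by (simp add: left_extended_part_def ext_sum_right ext_scale_right case_prod_unfold)
 also have "\<dots> = (\<Sum>(\<alpha>, x)\<in>{(\<alpha>, x) \<in> ?S. x \<in> nontrivial N}. centered_coeff N w (x # t) * f \<alpha>)"
  by (rule sum.mono_neutral_right[OF fin]) (auto simp: centered_coeff_cf[OF N] split: if_splits)
 also have "\<dots> = (\<Sum>(u, v)\<in>bsplit (letters N h). cf N w (v # map (letters N) t) * f (of_letters u))"
 proof (rule sum.reindex_bij_witness[of _ "\<lambda>(u, v). (of_letters u, of_letters v)" ?g])
  fix p assume "p \<in> {(\<alpha>, x) \<in> ?S. x \<in> nontrivial N}"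
  then obtain \<alpha> x where p: "p = (\<alpha>, x)" "\<alpha> \<in> nontrivial N" "x \<in> nontrivial N" "basis_mult N \<alpha> x = Some h" by auto
  show "(case ?g p of (u, v) => (of_letters u, of_letters v)) = p"
   using p letters_nontrivial(3) by simp
  show "?g p \<in> bsplit (letters N h)"
   using p letters_nontrivial(1) basis_mult_SomeD(4)[OF p(4)] by (auto simp: bsplit_def)
  show "(case ?g p of (u, v) => cf N w (v # map (letters N) t) * f (of_letters u)) = (case p of (\<alpha>, x) => centered_coeff N w (x # t) * f \<alpha>)"
   using p letters_nontrivial(3) t nontrivial_basis by (simp add: centered_coeff_letters[OF N])
 next
  fix p assume "p \<in> bsplit (letters N h)"
  then obtain u v where p: "p = (u, v)" "(u, v) \<in> bsplit (letters N h)" by (cases p) auto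
  note b = bsplit_letters[OF h p(2)]
  show "?g (case p of (u, v) => (of_letters u, of_letters v)) = p" using p b by simp
  show "(case p of (u, v) => (of_letters u, of_letters v)) \<in> {(\<alpha>, x) \<in> ?S. x \<in> nontrivial N}"
   using p b nontrivial_basis by simp
 qed
 finally show ?thesis .
qed

lemma ext_right_extended:
 assumes h: "h \<in> basis N" and t: "set t \<subseteq> basis N"
 shows "ext f (right_extended_part N w (t @ [h])) =
  (\<Sum>(v, u)\<in>bsplit (letters N h). cf N w (map (letters N) t @ [v]) * f (of_letters u))"
proof -
 let ?S = "{(x, \<alpha>). x \<in> basis N \<and> \<alpha> \<in> nontrivial N \<and> basis_mult N x \<alpha> = Some h}"
 let ?g = "\<lambda>(x, \<alpha>). (letters N x, letters N \<alpha>)"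
 have fin: "finite ?S"
 proof (rule inj_on_finite[where f = ?g and B = "cuts (letters N h)"])
  show "inj_on ?g ?S"
  proof (rule inj_onI, clarify)
   fix a x b y assume *: "x \<in> basis N" "a \<in> nontrivial N" "basis_mult N x a = Some h"
    "y \<in> basis N" "b \<in> nontrivial N" "basis_mult N y b = Some h" "letters N x = letters N y" "letters N a = letters N b"
   have "a = b" using * letters_nontrivial(3) by metis
   moreover have "initial x = initial y" using * basis_mult_SomeD(2) by metis
   ultimately show "x = y \<and> a = b" using letters_inj[of x N y] * by simp
  qed
  show "?g ` ?S \<le> cuts (letters N h)" using basis_mult_SomeD(4) by (auto simp: cuts_def)
 qed simp
 have "ext f (right_extended_part N w (t @ [h])) = (\<Sum>(x, \<alpha>)\<in>?S. centered_coeff N w (t @ [x]) * f \<alpha>)"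
  by (simp add: right_extended_part_def ext_sum_right ext_scale_right case_prod_unfold)
 also have "\<dots> = (\<Sum>(x, \<alpha>)\<in>{(x, \<alpha>) \<in> ?S. x \<in> nontrivial N}. centered_coeff N w (t @ [x]) * f \<alpha>)"
  by (rule sum.mono_neutral_right[OF fin]) (auto simp: centered_coeff_cf[OF N] split: if_splits)
 also have "\<dots> = (\<Sum>(v, u)\<in>bsplit (letters N h). cf N w (map (letters N) t @ [v]) * f (of_letters u))"
 proof (rule sum.reindex_bij_witness[of _ "\<lambda>(v, u). (of_letters v, of_letters u)" ?g])
  fix p assume "p \<in> {(x, \<alpha>) \<in> ?S. x \<in> nontrivial N}"
  then obtain \<alpha> x where p: "p = (x, \<alpha>)" "\<alpha> \<in> nontrivial N" "x \<in> nontrivial N" "basis_mult N x \<alpha> = Some h" by auto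
  show "(case ?g p of (u, v) => (of_letters u, of_letters v)) = p"
   using p letters_nontrivial(3) by simp
  show "?g p \<in> bsplit (letters N h)"
   using p letters_nontrivial(1) basis_mult_SomeD(4)[OF p(4)] by (auto simp: bsplit_def)
  show "(case ?g p of (v, u) => cf N w (map (letters N) t @ [v]) * f (of_letters u)) = (case p of (x, \<alpha>) => centered_coeff N w (t @ [x]) * f \<alpha>)"
   using p letters_nontrivial(3) t nontrivial_basis by (simp add: centered_coeff_letters[OF N])
 next
  fix p assume "p \<in> bsplit (letters N h)"
  then obtain u v where p: "p = (u, v)" "(u, v) \<in> bsplit (letters N h)" by (cases p) auto
  note b = bsplit_letters[OF h p(2)]
  show "?g (case p of (u, v) => (of_letters u, of_letters v)) = p" using p b by simp
  show "(case p of (u, v) => (of_letters u, of_letters v)) \<in> {(x, \<alpha>) \<in> ?S. x \<in> nontrivial N}"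
   using p b nontrivial_basis by simp
 qed
 finally show ?thesis .
qed

lemma lookup_ext: "Poly_Mapping.lookup b \<gamma> = ext (\<lambda>z. if z = \<gamma> then 1 else 0) b"
 by (auto simp: ext_def in_keys_iff if_distrib cong: if_cong)

lemma lookup_left_extended:
 assumes h: "h \<in> basis N" and t: "set t \<subseteq> basis N" and g: "\<gamma> \<in> basis N"
 shows "Poly_Mapping.lookup (left_extended_part N w (h # t)) \<gamma> =
  (if letters N \<gamma> = [] then 0 else cl N (letters N \<gamma>) w (map (letters N) (h # t)))"
proof -
 let ?l = "letters N h" and ?g = "letters N \<gamma>"
 have "Poly_Mapping.lookup (left_extended_part N w (h # t)) \<gamma> =
   (\<Sum>(u, v)\<in>bsplit ?l. cf N w (v # map (letters N) t) * (if of_letters u = \<gamma> then 1 else 0))"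
  unfolding lookup_ext by (rule ext_left_extended[OF h t])
 also have "\<dots> = (\<Sum>p\<in>bsplit ?l. if p = (?g, drop (length ?g) ?l) then cf N w (drop (length ?g) ?l # map (letters N) t) else 0)"
 proof (rule sum.cong[OF refl], clarify)
  fix u v assume uv: "(u, v) \<in> bsplit ?l"
  note b = bsplit_letters[OF h uv]
  have "of_letters u = \<gamma> \<longleftrightarrow> u = ?g"
   using b(2,4) letters_Nil_iff[OF g] letters_nontrivial(3)[of \<gamma> N] uv by (auto simp: bsplit_def)
  moreover have "v = drop (length u) ?l" using uv by (auto simp: bsplit_def)
  ultimately show "cf N w (v # map (letters N) t) * (if of_letters u = \<gamma> then 1 else 0) =
    (if (u, v) = (?g, drop (length ?g) ?l) then cf N w (drop (length ?g) ?l # map (letters N) t) else 0)" by auto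
 qed
 also have "\<dots> = (if (?g, drop (length ?g) ?l) \<in> bsplit ?l then cf N w (drop (length ?g) ?l # map (letters N) t) else 0)"
  by (simp add: sum.delta)
 also have "(?g, drop (length ?g) ?l) \<in> bsplit ?l \<longleftrightarrow> ?g ~= [] \<and> (\<exists>y. ?l = ?g @ y \<and> y ~= [])"
  by (auto simp: bsplit_def)
 finally show ?thesis by (auto simp: cl_def)
qed

lemma lookup_right_extended:
 assumes h: "h \<in> basis N" and t: "set t \<subseteq> basis N" and g: "\<gamma> \<in> basis N"
 shows "Poly_Mapping.lookup (right_extended_part N w (t @ [h])) \<gamma> =
  (if letters N \<gamma> = [] then 0 else cr N (letters N \<gamma>) w (map (letters N) (t @ [h])))"
proof -
 let ?l = "letters N h" and ?g = "letters N \<gamma>"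
 let ?d = "take (length ?l - length ?g) ?l"
 have "Poly_Mapping.lookup (right_extended_part N w (t @ [h])) \<gamma> =
   (\<Sum>(v, u)\<in>bsplit ?l. cf N w (map (letters N) t @ [v]) * (if of_letters u = \<gamma> then 1 else 0))"
  unfolding lookup_ext by (rule ext_right_extended[OF h t])
 also have "\<dots> = (\<Sum>p\<in>bsplit ?l. if p = (?d, ?g) then cf N w (map (letters N) t @ [?d]) else 0)"
 proof (rule sum.cong[OF refl], clarify)
  fix v u assume uv: "(v, u) \<in> bsplit ?l"
  note b = bsplit_letters[OF h uv]
  have "of_letters u = \<gamma> \<longleftrightarrow> u = ?g"
   using b(3,5) letters_Nil_iff[OF g] letters_nontrivial(3)[of \<gamma> N] uv by (auto simp: bsplit_def)
  moreover have "v = take (length ?l - length u) ?l" using uv by (auto simp: bsplit_def)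
  ultimately show "cf N w (map (letters N) t @ [v]) * (if of_letters u = \<gamma> then 1 else 0) =
    (if (v, u) = (?d, ?g) then cf N w (map (letters N) t @ [?d]) else 0)" by auto
 qed
 also have "\<dots> = (if (?d, ?g) \<in> bsplit ?l then cf N w (map (letters N) t @ [?d]) else 0)"
  by (simp add: sum.delta)
 also have "(?d, ?g) \<in> bsplit ?l \<longleftrightarrow> ?g ~= [] \<and> (\<exists>y. ?l = y @ ?g \<and> y ~= [])"
  by (auto simp: bsplit_def)
 finally show ?thesis by (auto simp: cr_def)
qed

definition higher :: "nat multiset => basis_elt list => star" where
 "higher w xs = centered_part N w xs + left_extended_part N w xs + right_extended_part N w xs"

definition lower :: "nat multiset => basis_elt list => star" where
 "lower w xs = (if xs = [] then curvature N w else product_part N w xs)"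

lemma basis_op_split: "basis_op N w xs = lower w xs + (if xs = [] then 0 else higher w xs)"
 by (simp add: basis_op_def lower_def higher_def add.assoc)

text \<open>The exceptional case is needed because the empty word does not tell at which idempotent
  a centered output is placed.\<close>

lemma lookup_higher:
 assumes xs: "set xs \<subseteq> basis N" "xs ~= []" and g: "\<gamma> \<in> basis N"
 shows "Poly_Mapping.lookup (higher w xs) \<gamma> =
  (if letters N \<gamma> = [] \<and> initial \<gamma> ~= initial (hd xs) then 0 else Mop N (letters N \<gamma>) w (map (letters N) xs))"
proof -
 obtain h t where ht: "xs = h # t" using xs(2) by (cases xs) auto
 obtain t' h' where ht': "xs = t' @ [h']" using xs(2) by (cases xs rule: rev_cases) auto
 have l: "Poly_Mapping.lookup (left_extended_part N w xs) \<gamma> = (if letters N \<gamma> = [] then 0 else cl N (letters N \<gamma>) w (map (letters N) xs))"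
  unfolding ht by (rule lookup_left_extended) (use xs ht g in auto)
 have r: "Poly_Mapping.lookup (right_extended_part N w xs) \<gamma> = (if letters N \<gamma> = [] then 0 else cr N (letters N \<gamma>) w (map (letters N) xs))"
  unfolding ht' by (rule lookup_right_extended) (use xs ht' g in auto)
 have c: "Poly_Mapping.lookup (centered_part N w xs) \<gamma> = (if letters N \<gamma> = [] \<and> initial \<gamma> = initial (hd xs) then cf N w (map (letters N) xs) else 0)"
 proof -
  have "\<gamma> = Idem (initial (hd xs)) \<longleftrightarrow> letters N \<gamma> = [] \<and> initial \<gamma> = initial (hd xs)"
   using letters_Nil_iff[OF g] basis_nontrivial[OF g] by auto
  then show ?thesis
   by (auto simp: centered_part_def elt_def lookup_single when_def centered_coeff_letters[OF N xs(1)])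
 qed
 show ?thesis unfolding higher_def lookup_add l r c by (simp add: Mop_def)
qed

lemma curvature_kap: "curvature N {#k#} = (\<Sum>\<kappa>\<in>kap N k. elt (of_letters \<kappa>))"
proof -
 have inj: "inj_on (\<lambda>i. spath N i N) {1..N}"
  by (rule inj_onI) (metis N hd_spath snd_conv)
 have s: "of_letters (spath N i N) = Path i N" if "i \<in> {1..N}" for i
  using N by (simp add: of_letters_def hd_spath)
 consider "k \<in> {1..N}" | "k = N + 1" | "k \<notin> {1..N}" "k ~= N + 1" by blast
 then show ?thesis
 proof cases
  case 1
  then show ?thesis by (simp add: curvature_def kap_def of_letters_def sum.delta)
 next
  case 2
  have k: "kap N (N + 1) = (\<lambda>i. spath N i N) ` {1..N}" by (simp add: kap_def)
  have "(\<Sum>\<kappa>\<in>kap N (N + 1). elt (of_letters \<kappa>)) = (\<Sum>i\<in>{1..N}. elt (of_letters (spath N i N)))"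
   unfolding k by (subst sum.reindex[OF inj]) simp
  also have "\<dots> = (\<Sum>i\<in>{1..N}. elt (Path i N))" by (rule sum.cong[OF refl]) (simp only: s)
  finally have "(\<Sum>\<kappa>\<in>kap N (N + 1). elt (of_letters \<kappa>)) = (\<Sum>i\<in>{1..N}. elt (Path i N))" .
  moreover have "(\<Sum>i\<in>{1..N}. if {#N + 1#} = {#i#} then elt (Upow i 1) else 0) = (0::star)"
   by (rule sum.neutral) auto
  ultimately show ?thesis unfolding 2 curvature_def by simp
 next
  case 3
  then show ?thesis by (auto simp: curvature_def kap_def)
 qed
qed

lemma curvature_zero: "(\<And>k. w ~= {#k#}) ==> curvature N w = 0"
 by (simp add: curvature_def)

lemma kap_letters:
 assumes "\<kappa> \<in> kap N k"
 shows "of_letters \<kappa> \<in> nontrivial N" "letters N (of_letters \<kappa>) = \<kappa>" "colored N \<kappa>"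
proof -
 show l: "letters N (of_letters \<kappa>) = \<kappa>" using letters_of_letters kap_closed[OF assms] by blast
 have "snd (hd \<kappa>) \<in> {1..N}" using assms N by (auto simp: kap_def hd_spath split: if_splits)
 then show nt: "of_letters \<kappa> \<in> nontrivial N" using of_letters_nontrivial kap_closed(1)[OF assms] by blast
 show "colored N \<kappa>" using colored_letters[OF nontrivial_basis[OF nt]] l by simp
qed

section \<open>Matching of idempotents\<close>

definition composable :: "basis_elt list => bool" where
 "composable xs \<longleftrightarrow> successively (\<lambda>x y. final N x = initial y) xs"

lemma snd_lk: "snd (lk N l) = snd (nxt N l)"
 by (cases l; cases "fst l") auto

lemma cf_ends:
 assumes xs: "set xs \<subseteq> basis N" and nz: "cf N w (map (letters N) xs) ~= 0"
 shows "composable xs" "initial (hd xs) = final N (last xs)" "xs ~= []" "tl xs ~= []"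
proof -
 let ?ls = "map (letters N) xs"
 obtain *: "?ls ~= []" "\<And>l. l \<in> set ?ls ==> l ~= []"
  "\<And>us l1 l2 vs. ?ls = us @ l1 # l2 # vs ==> hd l2 = nxt N (last l1)" "hd (hd ?ls) = nxt N (last (last ?ls))"
  by (rule cf_nonzero[OF N nz]) blast
 show ne: "xs ~= []" using *(1) by simp
 have nt: "x \<in> nontrivial N" if "x \<in> set xs" for x using *(2)[of "letters N x"] letters_Nil_iff[of x N] xs that by auto
 show "tl xs ~= []" using nz ne cf_single[OF N] by (cases xs; cases "tl xs") auto
 have "hd xs \<in> nontrivial N" "last xs \<in> nontrivial N" using nt ne by auto
 then show "initial (hd xs) = final N (last xs)"
  using *(4) ne by (simp add: initial_letters final_letters snd_lk hd_map last_map)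
 show "composable xs"
  unfolding composable_def successively_conv_nth
 proof (intro allI impI)
  fix i assume i: "Suc i < length xs"
  then have "xs = take i xs @ xs ! i # xs ! Suc i # drop (Suc (Suc i)) xs"
   by (metis Cons_nth_drop_Suc Suc_lessD id_take_nth_drop)
  then have "?ls = map (letters N) (take i xs) @ letters N (xs ! i) # letters N (xs ! Suc i) # map (letters N) (drop (Suc (Suc i)) xs)"
   by (metis list.simps(9) map_append)
  then have "hd (letters N (xs ! Suc i)) = nxt N (last (letters N (xs ! i)))" by (rule *(3))
  moreover have "xs ! i \<in> set xs" "xs ! Suc i \<in> set xs" using i by (simp_all only: nth_mem Suc_lessD)
  ultimately show "final N (xs ! i) = initial (xs ! Suc i)"
   using initial_letters[OF nt] final_letters[OF nt] by (simp add: snd_lk)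
 qed
qed

lemma op_ends:
 assumes xs: "set xs \<subseteq> basis N" and nz: "Poly_Mapping.lookup (basis_op N w xs) z ~= 0"
 shows "composable xs" "xs = [] ==> initial z = final N z"
  "xs ~= [] ==> initial z = initial (hd xs) \<and> final N z = final N (last xs)"
proof -
 have z: "z \<in> basis N" using basis_op_closed[OF N xs, of w] nz by (auto simp: star_algebra_def in_keys_iff)
 show "initial z = final N z" if "xs = []"
 proof -
  have c: "Poly_Mapping.lookup (curvature N w) z ~= 0" using nz that by (simp add: basis_op_def)
  then obtain k where k: "w = {#k#}" using curvature_zero[of w] by fastforce
  have "\<exists>\<kappa>\<in>kap N k. Poly_Mapping.lookup (elt (of_letters \<kappa>)) z ~= 0"
   using c unfolding k curvature_kap lookup_sum_star by (meson sum.not_neutral_contains_not_neutral)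
  then obtain \<kappa> where "\<kappa> \<in> kap N k" "z = of_letters \<kappa>" by (auto simp: elt_def lookup_single when_def split: if_splits)
  then show ?thesis
   using kap_letters[of \<kappa> k] kap_closed(3)[of \<kappa> N k] by (simp add: initial_letters final_letters)
 qed
 have "composable xs \<and> (xs ~= [] \<longrightarrow> initial z = initial (hd xs) \<and> final N z = final N (last xs))"
 proof (cases "xs = []")
  case ne: False
  show ?thesis
  proof (cases "Poly_Mapping.lookup (product_part N w xs) z = 0")
   case False
   then obtain x y where xy: "xs = [x, y]" "basis_mult N x y = Some z"
    by (auto simp: product_part_def elt_def lookup_single when_def length_Suc_conv numeral_2_eq_2 split: if_splits option.splits)
   then show ?thesis using basis_mult_SomeD[OF xy(2)] by (simp add: composable_def)
  next
   case True
   then have h: "Poly_Mapping.lookup (higher w xs) z ~= 0"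
    using nz ne by (simp add: basis_op_split lower_def lookup_add)
   show ?thesis
   proof (cases "letters N z = []")
    case True
    then have "cf N w (map (letters N) xs) ~= 0" "initial z = initial (hd xs)"
     using h unfolding lookup_higher[OF xs ne z] by (auto simp: Mop_def split: if_splits)
    moreover have "final N z = initial z" using True letters_Nil_iff[OF z] basis_nontrivial[OF z] by auto
    ultimately show ?thesis using cf_ends[OF xs] by simp
   next
    case lz: False
    have zn: "of_letters (letters N z) = z" using lz letters_Nil_iff[OF z] letters_nontrivial(3) by blast
    consider "cl N (letters N z) w (map (letters N) xs) ~= 0" | "cr N (letters N z) w (map (letters N) xs) ~= 0"
     using h lz unfolding lookup_higher[OF xs ne z]
     by (cases "cl N (letters N z) w (map (letters N) xs) = 0") (auto simp: Mop_def)
    then show ?thesis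
    proof cases
     case 1
     obtain h t where ht: "xs = h # t" using ne by (cases xs) auto
     obtain y where y: "letters N h = letters N z @ y" "y ~= []" "cf N w (y # map (letters N) t) ~= 0"
      using 1 by (auto simp: ht cl_def split: if_splits)
     have hb: "h \<in> basis N" and b: "(letters N z, y) \<in> bsplit (letters N h)" using xs ht y lz by (auto simp: bsplit_def)
     note s = bsplit_letters[OF hb b, unfolded zn]
     have v: "set (of_letters y # t) \<subseteq> basis N" "cf N w (map (letters N) (of_letters y # t)) ~= 0"
      using s(3,5) nontrivial_basis xs ht y by auto
     note e = cf_ends[OF v] and m = basis_mult_SomeD[OF s(6)]
     show ?thesis using e m ht by (auto simp: composable_def successively_Cons)
    next
     case 2
     obtain t h where ht: "xs = t @ [h]" using ne by (cases xs rule: rev_cases) auto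
     obtain y where y: "letters N h = y @ letters N z" "y ~= []" "cf N w (map (letters N) t @ [y]) ~= 0"
      using 2 by (auto simp: ht cr_def split: if_splits)
     have hb: "h \<in> basis N" and b: "(y, letters N z) \<in> bsplit (letters N h)" using xs ht y lz by (auto simp: bsplit_def)
     note s = bsplit_letters[OF hb b, unfolded zn]
     have v: "set (t @ [of_letters y]) \<subseteq> basis N" "cf N w (map (letters N) (t @ [of_letters y])) ~= 0"
      using s(2,4) nontrivial_basis xs ht y by auto
     note e = cf_ends[OF v] and m = basis_mult_SomeD[OF s(6)]
     have "t ~= []" using e(4) by (cases t) auto
     then show ?thesis using e(1,2) m ht by (auto simp: composable_def successively_append_iff)
    qed
   qed
  qed
 qed (simp add: composable_def)
 then show "composable xs" "xs ~= [] ==> initial z = initial (hd xs) \<and> final N z = final N (last xs)" by auto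
qed

text \<open>Words do not record idempotents. This restricts the relation to inputs and outputs whose
  idempotents match, where the words carry the remaining information.\<close>

lemma term_ends:
 assumes "set (pre @ mid @ post) \<subseteq> basis N"
  and "ext (\<lambda>z. Poly_Mapping.lookup (basis_op N w' (pre @ [z] @ post)) \<gamma>) (basis_op N w'' mid) ~= 0"
  and ne: "pre @ mid @ post ~= []"
 shows "composable (pre @ mid @ post)" "initial \<gamma> = initial (hd (pre @ mid @ post))" "final N \<gamma> = final N (last (pre @ mid @ post))"
  "\<gamma> \<in> basis N"
proof -
 obtain z where "z \<in> Poly_Mapping.keys (basis_op N w'' mid)"
  and o: "Poly_Mapping.lookup (basis_op N w' (pre @ [z] @ post)) \<gamma> ~= 0"
  using sum.not_neutral_contains_not_neutral[OF assms(2)[unfolded ext_def]] by auto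
 then have i: "Poly_Mapping.lookup (basis_op N w'' mid) z ~= 0" by (simp add: in_keys_iff)
 have m: "set mid \<subseteq> basis N" and z: "z \<in> basis N"
  using assms(1) basis_op_closed[OF N, of mid w''] i by (auto simp: star_algebra_def in_keys_iff)
 have sub: "set (pre @ [z] @ post) \<subseteq> basis N" using assms(1) z by auto
 show "\<gamma> \<in> basis N" using basis_op_closed[OF N sub, of w'] o by (auto simp: star_algebra_def in_keys_iff)
 note O = op_ends[OF sub o] and I = op_ends[OF m i]
 show "composable (pre @ mid @ post)"
  using O(1) I unfolding composable_def successively_append_iff by (cases "mid = []"; cases "post = []"; cases "pre = []") auto
 show "initial \<gamma> = initial (hd (pre @ mid @ post))"
  using O I ne unfolding composable_def successively_append_iff by (cases "pre = []"; cases "mid = []"; cases "post = []") auto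
 show "final N \<gamma> = final N (last (pre @ mid @ post))"
  using O I ne unfolding composable_def successively_append_iff by (cases "pre = []"; cases "mid = []"; cases "post = []") auto
qed

lemma sum_product_inner:
 assumes "set mid \<subseteq> basis N" "composable mid"
 shows "(\<Sum>w1\<in>{w1. w1 \<subseteq># w}. ext (\<lambda>z. \<Phi> w1 (pre @ letters N z # post)) (product_part N (w - w1) mid)) =
  (case mid of [x, y] => if chain N (letters N x @ letters N y) then \<Phi> w (pre @ (letters N x @ letters N y) # post) else 0 | _ => 0)"
proof -
 have eq: "w1 = w" if "w1 \<subseteq># w" "w - w1 = {#}" for w1
  using that by (simp add: Diff_eq_empty_iff_mset subset_mset.antisym)
 have "(\<Sum>w1\<in>{w1. w1 \<subseteq># w}. ext (\<lambda>z. \<Phi> w1 (pre @ letters N z # post)) (product_part N (w - w1) mid)) =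
   (\<Sum>w1\<in>{w}. ext (\<lambda>z. \<Phi> w1 (pre @ letters N z # post)) (product_part N (w - w1) mid))"
  by (rule sum.mono_neutral_right[OF finite_submultisets]) (use eq in \<open>auto simp: product_part_def\<close>)
 also have "\<dots> = ext (\<lambda>z. \<Phi> w (pre @ letters N z # post)) (product_part N {#} mid)" by simp
 also have "\<dots> = (case mid of [x, y] => if chain N (letters N x @ letters N y) then \<Phi> w (pre @ (letters N x @ letters N y) # post) else 0 | _ => 0)"
 proof (cases "length mid = 2")
  case True
  then obtain x y where mid: "mid = [x, y]" by (auto simp: length_Suc_conv numeral_2_eq_2)
  have xy: "x \<in> basis N" "y \<in> basis N" "final N x = initial y" using assms mid by (auto simp: composable_def)
  show ?thesis
  proof (cases "basis_mult N x y")
   case None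
   then show ?thesis using basis_mult_NoneD[OF xy None] by (simp add: mid product_part_def)
  next
   case (Some z)
   have "chain N (letters N x @ letters N y)"
    using chain_letters[OF basis_mult_basis[OF xy(1,2) Some]] basis_mult_SomeD(4)[OF Some] by simp
   then show ?thesis using basis_mult_SomeD(4)[OF Some] Some by (simp add: mid product_part_def)
  qed
 next
  case False
  then show ?thesis by (auto simp: product_part_def split: list.split)
 qed
 finally show ?thesis .
qed

text \<open>Curvature needs a single symbol as its weight, so the outer weights that contribute are
  \<open>w\<close> with one element removed, each counted once.\<close>

lemma sum_curvature_inner:
 "(\<Sum>w1\<in>{w1. w1 \<subseteq># w}. ext (\<lambda>z. \<Phi> w1 (pre @ letters N z # post)) (curvature N (w - w1))) = KK N w \<Phi> pre post"
proof -
 let ?f = "\<lambda>w1. ext (\<lambda>z. \<Phi> w1 (pre @ letters N z # post)) (curvature N (w - w1))"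
 have d: "w - (w - {#k#}) = {#k#}" if k: "k \<in># w" for k
 proof -
  have "{#k#} \<subseteq># w" using k by simp
  then have "w - (w - {#k#}) = w + {#k#} - w" by (rule subset_mset.diff_diff_right)
  also have "\<dots> = {#k#}" by (rule add_diff_cancel_left')
  finally show ?thesis .
 qed
 have inj: "inj_on (\<lambda>k. w - {#k#}) (set_mset w)"
 proof (rule inj_onI)
  fix x y assume *: "x \<in># w" "y \<in># w" "w - {#x#} = w - {#y#}"
  have "{#x#} = w - (w - {#x#})" by (rule d[OF *(1), symmetric])
  also have "\<dots> = w - (w - {#y#})" by (simp only: *(3))
  also have "\<dots> = {#y#}" by (rule d[OF *(2)])
  finally show "x = y" by simp
 qed
 have "sum ?f {w1. w1 \<subseteq># w} = sum ?f ((\<lambda>k. w - {#k#}) ` set_mset w)"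
 proof (rule sum.mono_neutral_right[OF finite_submultisets])
  show "\<forall>w1\<in>{w1. w1 \<subseteq># w} - (\<lambda>k. w - {#k#}) ` set_mset w. ?f w1 = 0"
  proof
   fix w1 assume w1: "w1 \<in> {w1. w1 \<subseteq># w} - (\<lambda>k. w - {#k#}) ` set_mset w"
   have "w - w1 ~= {#k#}" for k
   proof
    assume k: "w - w1 = {#k#}"
    have "w1 \<subseteq># w" using w1 by simp
    then have "w = w1 + {#k#}" using subset_mset.add_diff_inverse[of w1 w] k by simp
    then have "w1 = w - {#k#}" "k \<in># w" by simp_all
    then show False using w1 by blast
   qed
   then show "?f w1 = 0" by (simp add: curvature_zero)
  qed
 qed auto
 also have "\<dots> = (\<Sum>k\<in>set_mset w. ?f (w - {#k#}))" by (simp add: sum.reindex[OF inj])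
 also have "\<dots> = (\<Sum>k\<in>set_mset w. \<Sum>\<kappa>\<in>kap N k. \<Phi> (w - {#k#}) (pre @ \<kappa> # post))"
  by (intro sum.cong refl) (simp add: d curvature_kap ext_sum_right kap_letters(2))
 also have "\<dots> = KK N w \<Phi> pre post" unfolding KK_def[OF N] by (rule sum.Sigma) auto
 finally show ?thesis .
qed

text \<open>The condition \<open>st\<close> removes the centered inner operations, whose output has
  the empty word.\<close>

lemma sum_inner:
 assumes mid: "set mid \<subseteq> basis N" "composable mid" and st: "\<And>v. \<Phi> v (pre @ [] # post) = 0"
 shows "(\<Sum>w1\<in>{w1. w1 \<subseteq># w}. ext (\<lambda>z. \<Phi> w1 (pre @ letters N z # post)) (basis_op N (w - w1) mid)) =
  inn N w \<Phi> pre (map (letters N) mid) post"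
proof (cases mid)
 case Nil
 then show ?thesis using sum_curvature_inner[where w = w and \<Phi> = \<Phi> and pre = pre and post = post] by (simp add: basis_op_def inn_def[OF N])
next
 case (Cons h t)
 have "mid = butlast mid @ [last mid]" using Cons by simp
 then obtain t' h' where snoc: "mid = t' @ [h']" by blast
 let ?F = "\<lambda>w1 z. \<Phi> w1 (pre @ letters N z # post)"
 have hb: "h \<in> basis N" "set t \<subseteq> basis N" using mid Cons by auto
 have hb': "h' \<in> basis N" "set t' \<subseteq> basis N" using mid snoc by auto
 have split: "basis_op N v mid = product_part N v mid + centered_part N v mid + left_extended_part N v mid + right_extended_part N v mid" for v
  using Cons by (simp add: basis_op_def)
 have c: "ext (?F w1) (centered_part N v mid) = 0" for v w1
  by (simp add: centered_part_def ext_scale_right st)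
 have l: "(\<Sum>w1\<in>{w1. w1 \<subseteq># w}. ext (?F w1) (left_extended_part N (w - w1) mid)) =
   (\<Sum>(x, l)\<in>bsplit (letters N h). CC N w \<Phi> (pre @ x # post) (l # map (letters N) t))"
 proof -
  have "(\<Sum>w1\<in>{w1. w1 \<subseteq># w}. ext (?F w1) (left_extended_part N (w - w1) mid)) =
    (\<Sum>w1\<in>{w1. w1 \<subseteq># w}. \<Sum>(x, l)\<in>bsplit (letters N h). \<Phi> w1 (pre @ x # post) * cf N (w - w1) (l # map (letters N) t))"
   unfolding Cons ext_left_extended[OF hb] by (intro sum.cong refl) (auto simp: bsplit_letters(4)[OF hb(1)] mult.commute)
  also have "\<dots> = (\<Sum>p\<in>bsplit (letters N h). \<Sum>w1\<in>{w1. w1 \<subseteq># w}. \<Phi> w1 (pre @ fst p # post) * cf N (w - w1) (snd p # map (letters N) t))"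
   unfolding case_prod_unfold by (rule sum.swap)
  finally show ?thesis by (simp add: CC_def[OF N] case_prod_unfold)
 qed
 have r: "(\<Sum>w1\<in>{w1. w1 \<subseteq># w}. ext (?F w1) (right_extended_part N (w - w1) mid)) =
   (\<Sum>(x, l)\<in>bsplit (letters N h'). CC N w \<Phi> (pre @ l # post) (map (letters N) t' @ [x]))"
 proof -
  have "(\<Sum>w1\<in>{w1. w1 \<subseteq># w}. ext (?F w1) (right_extended_part N (w - w1) mid)) =
    (\<Sum>w1\<in>{w1. w1 \<subseteq># w}. \<Sum>(x, l)\<in>bsplit (letters N h'). \<Phi> w1 (pre @ l # post) * cf N (w - w1) (map (letters N) t' @ [x]))"
   unfolding snoc ext_right_extended[OF hb'] by (intro sum.cong refl) (auto simp: bsplit_letters(5)[OF hb'(1)] mult.commute)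
  also have "\<dots> = (\<Sum>p\<in>bsplit (letters N h'). \<Sum>w1\<in>{w1. w1 \<subseteq># w}. \<Phi> w1 (pre @ snd p # post) * cf N (w - w1) (map (letters N) t' @ [fst p]))"
   unfolding case_prod_unfold by (rule sum.swap)
  finally show ?thesis by (simp add: CC_def[OF N] case_prod_unfold)
 qed
 have I: "inn N w \<Phi> pre (map (letters N) mid) post =
   (case mid of [x, y] => if chain N (letters N x @ letters N y) then \<Phi> w (pre @ (letters N x @ letters N y) # post) else 0 | _ => 0) +
   ((\<Sum>(x, l)\<in>bsplit (letters N h). CC N w \<Phi> (pre @ x # post) (l # map (letters N) t)) +
   (\<Sum>(x, l)\<in>bsplit (last (map (letters N) mid)). CC N w \<Phi> (pre @ l # post) (butlast (map (letters N) mid) @ [x])))"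
  unfolding Cons inn_def[OF N] by (simp split: list.split)
 have lb: "last (map (letters N) mid) = letters N h'" "butlast (map (letters N) mid) = map (letters N) t'" by (simp_all add: snoc)
 show ?thesis
  unfolding I lb split ext_add_right sum.distrib sum_product_inner[OF mid] c l r by (simp add: add.assoc)
qed

section \<open>The terms built from products and curvature only\<close>

definition low :: "nat multiset => letter list => letter list list => scalar" where
 "low w g ls = (case ls of [] => of_bool (\<exists>k. w = {#k#} \<and> g \<in> kap N k)
  | a # r => (case r of [b] => of_bool (w = {#} \<and> g = a @ b) | _ => 0))"

text \<open>For one input this is the centrality of \<open>\<mu>\<^sub>0\<close>, where moving the
  input past \<kappa> rotates \<kappa>; for three inputs it is associativity. For other numbers of
  inputs both sides vanish.\<close>

lemma low_sym:
 assumes "chain N \<gamma>" "colored N (hd as)" "as ~= []"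
 shows "(if \<exists>g. \<gamma> = hd as @ g then low w (drop (length (hd as)) \<gamma>) (tl as) else 0) =
  (if \<exists>g. \<gamma> = g @ last as then low w (take (length \<gamma> - length (last as)) \<gamma>) (butlast as) else 0)"
proof -
 obtain a r where as: "as = a # r" using assms(3) by (cases as) auto
 consider "r = []" | b where "r = [b]" | b c where "r = [b, c]" | b c d r' where "r = b # c # d # r'"
  by (cases r; cases "tl r"; cases "tl (tl r)") auto
 then show ?thesis
 proof cases
  case 1
  have "(\<exists>g. \<gamma> = a @ g \<and> (\<exists>k. w = {#k#} \<and> g \<in> kap N k)) \<longleftrightarrow> (\<exists>g. \<gamma> = g @ a \<and> (\<exists>k. w = {#k#} \<and> g \<in> kap N k))"
  proof -
   have closed: "x ~= [] \<and> colored N x \<and> hd x = lk N (last x)" if "x \<in> kap N k" for x k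
    using kap_closed[OF that] kap_letters(3)[OF that] by simp
   have "\<exists>x'. x' \<in> kap N k \<and> a @ x = x' @ a" if "x \<in> kap N k" "chain N (a @ x)" for x k
    by (rule shift_right[where P = "\<lambda>x. x \<in> kap N k" and N = N, OF kap_rotate closed that])
     (use assms(2) as in simp_all)
   moreover have "\<exists>x'. x' \<in> kap N k \<and> x @ a = a @ x'" if "x \<in> kap N k" "chain N (x @ a)" for x k
    by (rule shift_left[where P = "\<lambda>x. x \<in> kap N k" and N = N, OF kap_rotate closed that])
   ultimately show ?thesis using assms(1) by blast
  qed
  moreover have "(if \<exists>g. \<gamma> = a @ g then low w (drop (length a) \<gamma>) [] else 0) =
    of_bool (\<exists>g. \<gamma> = a @ g \<and> (\<exists>k. w = {#k#} \<and> g \<in> kap N k))"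
   by (cases "\<exists>g. \<gamma> = a @ g") (auto simp: low_def)
  moreover have "(if \<exists>g. \<gamma> = g @ a then low w (take (length \<gamma> - length a) \<gamma>) [] else 0) =
    of_bool (\<exists>g. \<gamma> = g @ a \<and> (\<exists>k. w = {#k#} \<and> g \<in> kap N k))"
   by (cases "\<exists>g. \<gamma> = g @ a") (auto simp: low_def)
  ultimately have "(if \<exists>g. \<gamma> = a @ g then low w (drop (length a) \<gamma>) [] else 0) =
    (if \<exists>g. \<gamma> = g @ a then low w (take (length \<gamma> - length a) \<gamma>) [] else 0)" by (simp only:)
  then show ?thesis by (simp only: as 1 list.sel last.simps butlast.simps if_True simp_thms)
 next
  case 3
  have "(if \<exists>g. \<gamma> = a @ g then low w (drop (length a) \<gamma>) [b, c] else 0) = of_bool (w = {#} \<and> \<gamma> = a @ b @ c)"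
   by (cases "\<exists>g. \<gamma> = a @ g") (auto simp: low_def)
  moreover have "(if \<exists>g. \<gamma> = g @ c then low w (take (length \<gamma> - length c) \<gamma>) [a, b] else 0) =
    of_bool (w = {#} \<and> \<gamma> = (a @ b) @ c)"
   by (cases "\<exists>g. \<gamma> = g @ c") (auto simp: low_def simp del: append_assoc)
  ultimately have "(if \<exists>g. \<gamma> = a @ g then low w (drop (length a) \<gamma>) [b, c] else 0) =
    (if \<exists>g. \<gamma> = g @ c then low w (take (length \<gamma> - length c) \<gamma>) [a, b] else 0)" by (simp only: append_assoc)
  then show ?thesis by (simp only: as 3 list.sel last.simps butlast.simps list.distinct if_True if_False simp_thms)
 qed (simp_all add: as low_def)
qed

lemma lookup_lower:
 assumes xs: "set xs \<subseteq> basis N" "composable xs" and z: "z \<in> basis N" "xs ~= [] ==> initial z = initial (hd xs)"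
 shows "Poly_Mapping.lookup (lower w xs) z = low w (letters N z) (map (letters N) xs)"
proof (cases "xs = []")
 case True
 have "Poly_Mapping.lookup (curvature N w) z = of_bool (\<exists>k. w = {#k#} \<and> letters N z \<in> kap N k)"
 proof (cases "\<exists>k. w = {#k#}")
  case False
  then show ?thesis using curvature_zero[of w] by simp
 next
  case True
  then obtain k where k: "w = {#k#}" by blast
  have eq: "of_letters \<kappa> = z \<longleftrightarrow> \<kappa> = letters N z" if "\<kappa> \<in> kap N k" for \<kappa>
  proof
   assume "\<kappa> = letters N z"
   moreover from this have "z \<in> nontrivial N" using kap_closed(1)[OF that] letters_Nil_iff[OF z(1)] by auto
   ultimately show "of_letters \<kappa> = z" using letters_nontrivial(3) by simp
  qed (use kap_letters(2)[OF that] in auto)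
  have "Poly_Mapping.lookup (curvature N w) z = (\<Sum>\<kappa>\<in>kap N k. if \<kappa> = letters N z then 1 else 0)"
   unfolding k curvature_kap lookup_sum_star by (rule sum.cong[OF refl]) (auto simp: elt_def lookup_single when_def eq)
  then show ?thesis by (simp add: k sum.delta)
 qed
 then show ?thesis using True by (simp add: lower_def low_def)
next
 case ne: False
 show ?thesis
 proof (cases "length xs = 2")
  case True
  then obtain x y where xy: "xs = [x, y]" by (auto simp: length_Suc_conv numeral_2_eq_2)
  then have b: "x \<in> basis N" "y \<in> basis N" "final N x = initial y" "initial z = initial x"
   using xs z by (auto simp: composable_def)
  have "Poly_Mapping.lookup (product_part N w xs) z = of_bool (w = {#} \<and> basis_mult N x y = Some z)"
   by (auto simp: xy product_part_def elt_def lookup_single when_def split: option.split)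
  then show ?thesis by (simp add: lower_def low_def xy basis_mult_iff[OF b(1,2) z(1) b(3,4)])
 next
  case False
  then show ?thesis using ne by (auto simp: lower_def low_def product_part_def split: list.split)
 qed
qed

lemma lookup_op:
 assumes xs: "set xs \<subseteq> basis N" "composable xs" and z: "z \<in> basis N" "xs ~= [] ==> initial z = initial (hd xs)"
 shows "Poly_Mapping.lookup (basis_op N w xs) z =
  low w (letters N z) (map (letters N) xs) + Mop N (letters N z) w (map (letters N) xs)"
proof -
 have "Poly_Mapping.lookup (lower w xs) z = low w (letters N z) (map (letters N) xs)"
  by (rule lookup_lower[OF assms])
 then show ?thesis
  using lookup_higher[OF xs(1) _ z(1), of w] z(2) Mop_Nil[OF N]
  by (cases "xs = []") (simp_all add: basis_op_split lookup_add)
qed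

lemma final_basis: "x \<in> basis N ==> final N x \<in> {1..N}"
 using N by (auto simp: basis_def cyc_suc_funpow Suc_leI)

text \<open>A left factor \<open>x\<close> can be cancelled: the word of the other factor is the
  rest of the word of \<gamma>, and its initial idempotent is the final one of \<open>x\<close>. So
  a single basis element \<open>z0\<close> contributes.\<close>

lemma ext_product_left:
 assumes x: "x \<in> basis N" and t: "set t \<subseteq> basis N" and c: "composable (x # t)"
  and g: "\<gamma> \<in> basis N" "initial \<gamma> = initial x"
 shows "ext (\<lambda>z. if basis_mult N x z = Some \<gamma> then 1 else 0) (basis_op N w t) =
  (if \<exists>g. letters N \<gamma> = letters N x @ g then
   low w (drop (length (letters N x)) (letters N \<gamma>)) (map (letters N) t) +
   Mop N (drop (length (letters N x)) (letters N \<gamma>)) w (map (letters N) t) else 0)"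
proof -
 have keys: "z \<in> basis N" if "z \<in> Poly_Mapping.keys (basis_op N w t)" for z
  using that basis_op_closed[OF N t, of w] by (auto simp: star_algebra_def)
 show ?thesis
 proof (cases "\<exists>g. letters N \<gamma> = letters N x @ g")
  case False
  then have "basis_mult N x z ~= Some \<gamma>" for z using basis_mult_SomeD(4) by metis
  then have "ext (\<lambda>z. if basis_mult N x z = Some \<gamma> then 1 else 0) (basis_op N w t) = ext (\<lambda>_. 0) (basis_op N w t)"
   by simp
  then show ?thesis using False by (simp add: ext_def)
 next
  case True
  then obtain d where d: "letters N \<gamma> = letters N x @ d" by blast
  have i: "snd (hd d) = final N x" if "d ~= []"
  proof (cases "x \<in> nontrivial N")
   case True
   then show ?thesis using chain_letters[OF g(1)] d that letters_nontrivial(1)[OF True]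
    by (simp add: final_letters chain_append)
  next
   case False
   then have lx: "letters N x = []" "final N x = initial x" using letters_Nil_iff[OF x] basis_nontrivial[OF x] by auto
   then have "\<gamma> \<in> nontrivial N" using that d letters_Nil_iff[OF g(1)] by auto
   then show ?thesis using d lx g(2) initial_letters[of \<gamma> N] by simp
  qed
  have "chain N d" using chain_letters[OF g(1)] unfolding d chain_def by (simp add: successively_append_iff)
  moreover have "colored N d" using colored_letters[OF g(1)] d by (simp add: colored_def)
  ultimately obtain z0 where z0: "z0 \<in> basis N" "letters N z0 = d" "initial z0 = final N x"
   using basis_of_letters[of N d "final N x"] final_basis[OF x] i by blast
  have "basis_mult N x z = Some \<gamma> \<longleftrightarrow> z = z0" if "z \<in> basis N" for z
  proof
   assume m: "basis_mult N x z = Some \<gamma>"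
   show "z = z0"
    by (rule letters_inj[OF that z0(1)]) (use basis_mult_SomeD[OF m] d z0 in simp_all)
  next
   assume "z = z0"
   then show "basis_mult N x z = Some \<gamma>" using basis_mult_iff[OF x z0(1) g(1) _ g(2)] z0 d by simp
  qed
  then have "ext (\<lambda>z. if basis_mult N x z = Some \<gamma> then 1 else 0) (basis_op N w t) = ext (\<lambda>z. if z = z0 then 1 else 0) (basis_op N w t)"
   using keys by (intro ext_cong) simp
  also have "\<dots> = Poly_Mapping.lookup (basis_op N w t) z0" by (rule lookup_ext[symmetric])
  also have "\<dots> = low w d (map (letters N) t) + Mop N d w (map (letters N) t)"
   using lookup_op[OF t _ z0(1), of w] c z0 by (auto simp: composable_def successively_Cons)
  finally show ?thesis by (simp add: d)
 qed
qed

lemma ext_product_right: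
 assumes y: "y \<in> basis N" and t: "set t \<subseteq> basis N" and c: "composable (t @ [y])"
  and g: "\<gamma> \<in> basis N" "initial \<gamma> = initial (hd (t @ [y]))" "final N \<gamma> = final N y"
 shows "ext (\<lambda>z. if basis_mult N z y = Some \<gamma> then 1 else 0) (basis_op N w t) =
  (if \<exists>g. letters N \<gamma> = g @ letters N y then
   low w (take (length (letters N \<gamma>) - length (letters N y)) (letters N \<gamma>)) (map (letters N) t) +
   Mop N (take (length (letters N \<gamma>) - length (letters N y)) (letters N \<gamma>)) w (map (letters N) t) else 0)"
proof -
 have keys: "z \<in> basis N" if "z \<in> Poly_Mapping.keys (basis_op N w t)" for z
  using that basis_op_closed[OF N t, of w] by (auto simp: star_algebra_def)
 show ?thesis
 proof (cases "\<exists>g. letters N \<gamma> = g @ letters N y")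
  case False
  then have "basis_mult N z y ~= Some \<gamma>" for z using basis_mult_SomeD(4) by metis
  then have "ext (\<lambda>z. if basis_mult N z y = Some \<gamma> then 1 else 0) (basis_op N w t) = ext (\<lambda>_. 0) (basis_op N w t)"
   by simp
  then show ?thesis using False by (simp add: ext_def)
 next
  case True
  then obtain d where d: "letters N \<gamma> = d @ letters N y" by blast
  have gi: "initial \<gamma> = snd (hd (letters N \<gamma>))" if "letters N \<gamma> ~= []"
   using that letters_Nil_iff[OF g(1)] by (auto intro: initial_letters)
  have gf: "final N \<gamma> = snd (lk N (last (letters N \<gamma>)))" if "letters N \<gamma> ~= []"
   using that letters_Nil_iff[OF g(1)] by (auto intro: final_letters)
  have i: "snd (hd d) = initial \<gamma>" if "d ~= []" using gi d that by simp
  have "chain N d" using chain_letters[OF g(1)] unfolding d chain_def by (simp add: successively_append_iff)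
  moreover have "colored N d" using colored_letters[OF g(1)] d by (simp add: colored_def)
  ultimately obtain z0 where z0: "z0 \<in> basis N" "letters N z0 = d" "initial z0 = initial \<gamma>"
   using basis_of_letters[of N d "initial \<gamma>"] initial_basis[OF g(1)] i by blast
  have yt: "final N y = initial y" if "y \<notin> nontrivial N" using basis_nontrivial[OF y that] by auto
  \<comment> \<open>When the rest \<open>d\<close> or the word of \<open>y\<close> is empty, the
    idempotent cannot be read from adjacent letters and is taken from the ends of \<gamma>.\<close>
  have "final N z0 = initial y"
  proof (cases "d = []")
   case True
   then have "z0 \<notin> nontrivial N" using letters_Nil_iff[OF z0(1)] z0(2) by simp
   then have f: "final N z0 = initial \<gamma>" using basis_nontrivial[OF z0(1)] z0(3) by auto
   show ?thesis
   proof (cases "y \<in> nontrivial N")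
    case True
    then show ?thesis using f gi d \<open>d = []\<close> letters_nontrivial(1)[OF True] by (simp add: initial_letters)
   next
    case False
    then have "\<gamma> \<notin> nontrivial N" using letters_Nil_iff[OF y] letters_Nil_iff[OF g(1)] d \<open>d = []\<close> by simp
    then have "final N \<gamma> = initial \<gamma>" using basis_nontrivial[OF g(1)] by auto
    then show ?thesis using f yt[OF False] g(3) by simp
   qed
  next
   case dne: False
   then have "z0 \<in> nontrivial N" using letters_Nil_iff[OF z0(1)] z0(2) by blast
   then have f: "final N z0 = snd (lk N (last d))" using z0(2) by (simp add: final_letters)
   show ?thesis
   proof (cases "y \<in> nontrivial N")
    case True
    then show ?thesis using f chain_letters[OF g(1)] d dne letters_nontrivial(1)[OF True]
     by (simp add: initial_letters chain_append)
   next
    case False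
    then have "letters N y = []" using letters_Nil_iff[OF y] by simp
    then show ?thesis using f gf d dne yt[OF False] g(3) by simp
   qed
  qed
  then have "basis_mult N z y = Some \<gamma> \<longleftrightarrow> z = z0" if "z \<in> basis N" for z
  proof -
   assume f: "final N z0 = initial y"
   show ?thesis
   proof
    assume m: "basis_mult N z y = Some \<gamma>"
    show "z = z0"
     by (rule letters_inj[OF that z0(1)]) (use basis_mult_SomeD[OF m] d z0 in simp_all)
   next
    assume "z = z0"
    then show "basis_mult N z y = Some \<gamma>" using basis_mult_iff[OF z0(1) y g(1) f] z0 d by simp
   qed
  qed
  then have "ext (\<lambda>z. if basis_mult N z y = Some \<gamma> then 1 else 0) (basis_op N w t) = ext (\<lambda>z. if z = z0 then 1 else 0) (basis_op N w t)"
   using keys by (intro ext_cong) simp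
  also have "\<dots> = Poly_Mapping.lookup (basis_op N w t) z0" by (rule lookup_ext[symmetric])
  also have "\<dots> = low w d (map (letters N) t) + Mop N d w (map (letters N) t)"
   using lookup_op[OF t _ z0(1), of w] c z0 g(2) by (auto simp: composable_def successively_append_iff z0)
  finally show ?thesis by (simp add: d)
 qed
qed

lemma Mop_single: "Mop N \<gamma> w [a] = 0"
 by (auto simp: Mop_def cl_def cr_def cf_single[OF N])

lemma op_single:
 assumes "z \<in> basis N"
 shows "Poly_Mapping.lookup (basis_op N w [z]) \<gamma> = 0"
proof (rule ccontr)
 assume nz: "Poly_Mapping.lookup (basis_op N w [z]) \<gamma> ~= 0"
 have s: "set [z] \<subseteq> basis N" "[z] ~= []" using assms by auto
 have "\<gamma> \<in> basis N" using basis_op_closed[OF N s(1), of w] nz by (auto simp: star_algebra_def in_keys_iff)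
 then show False
  using nz lookup_higher[OF s, of \<gamma> w] by (simp add: basis_op_split lower_def product_part_def Mop_single split: if_splits)
qed

lemma sum_weights:
 "(\<Sum>(w', w'')\<in>{(w', w''). w' + w'' = w}. g w' w'') = (\<Sum>w1\<in>{w1. w1 \<subseteq># w}. g w1 (w - w1))"
 by (rule sum.reindex_bij_witness[of _ "\<lambda>w1. (w1, w - w1)" fst]) auto

lemma trip_sum: "trip f as = (\<Sum>(x, y, z)\<in>{(x, y, z). as = x @ y @ z}. f x y z)"
proof -
 have "finite {(x, y, z). as = x @ y @ z} \<and> trip f as = (\<Sum>(x, y, z)\<in>{(x, y, z). as = x @ y @ z}. f x y z)"
 proof (induction as arbitrary: f)
  case Nil
  have "{(x, y, z). [] = x @ y @ z} = {([], [], [])}" by auto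
  then show ?case by simp
 next
  case (Cons a as)
  let ?g = "\<lambda>(y, z). ([], y, z)" and ?h = "\<lambda>(x, y, z). (a # x, y, z)" and ?S = "{(x, y, z). as = x @ y @ z}"
  have eq: "{(x, y, z). a # as = x @ y @ z} = ?g ` cuts (a # as) \<union> ?h ` ?S"
   by (auto simp: cuts_def Cons_eq_append_conv image_iff)
  have d: "?g ` cuts (a # as) \<inter> ?h ` ?S = {}" by auto
  have i: "inj_on ?g (cuts (a # as))" "inj_on ?h ?S" by (auto simp: inj_on_def)
  have f: "finite (?g ` cuts (a # as))" "finite (?h ` ?S)" using Cons.IH by simp_all
  have "trip f (a # as) = (\<Sum>(x, y, z)\<in>{(x, y, z). a # as = x @ y @ z}. f x y z)"
   unfolding eq sum.union_disjoint[OF f d] sum.reindex[OF i(1)] sum.reindex[OF i(2)]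
   using Cons.IH by (simp add: comp_def case_prod_unfold)
  then show ?case using f eq by simp
 qed
 then show ?thesis by simp
qed

lemma take_take_drop: "take p as @ take r (drop p as) @ drop (p + r) as = as"
 by (metis add.commute append_take_drop_id drop_drop)

lemma sum_index_trip:
 "(\<Sum>(p, r)\<in>{(p, r). r \<le> length as \<and> p \<le> length as - r}. f (take p as) (take r (drop p as)) (drop (p + r) as)) = trip f as"
 unfolding trip_sum
 by (rule sum.reindex_bij_witness[of _ "\<lambda>(x, y, z). (length x, length y)" "\<lambda>(p, r). (take p as, take r (drop p as), drop (p + r) as)"])
  (auto simp: take_take_drop)

lemma lookup_product:
 "Poly_Mapping.lookup (product_part N {#} [x, y]) \<gamma> = (if basis_mult N x y = Some \<gamma> then 1 else 0)"
 by (auto simp: product_part_def elt_def lookup_single when_def split: option.split)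

text \<open>The exceptional case of \<open>lookup_higher\<close> does not disturb: with an empty
  output word, a nonzero coefficient makes the inputs close up, so one of the unchanged ends of the
  input list fixes the idempotent of \<gamma>.\<close>

lemma lookup_higher_inner:
 assumes xs: "set (pre @ mid @ post) \<subseteq> basis N" "pre @ mid @ post ~= []" and z: "z \<in> basis N" and g: "\<gamma> \<in> basis N"
  and e: "initial \<gamma> = initial (hd (pre @ mid @ post))" "final N \<gamma> = final N (last (pre @ mid @ post))"
 shows "Poly_Mapping.lookup (higher w (pre @ [z] @ post)) \<gamma> =
  Mop N (letters N \<gamma>) w (map (letters N) pre @ letters N z # map (letters N) post)"
proof -
 let ?ys = "pre @ [z] @ post"
 have ys: "set ?ys \<subseteq> basis N" "?ys ~= []" using xs z by auto
 have "Mop N (letters N \<gamma>) w (map (letters N) ?ys) = 0" if l: "letters N \<gamma> = []" and ne: "initial \<gamma> ~= initial (hd ?ys)"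
 proof (rule ccontr)
  assume "Mop N (letters N \<gamma>) w (map (letters N) ?ys) ~= 0"
  then have "cf N w (map (letters N) ?ys) ~= 0" using l by (simp add: Mop_def)
  note c = cf_ends[OF ys(1) this]
  have fi: "final N \<gamma> = initial \<gamma>" using l letters_Nil_iff[OF g] basis_nontrivial[OF g] by auto
  show False
  proof (cases "pre = []")
   case True
   then have "post ~= []" using c(4) by auto
   then show False using True c(2) e(2) fi ne by simp
  qed (use e(1) ne in simp)
 qed
 then show ?thesis using lookup_higher[OF ys g, of w] by auto
qed

theorem relation_zero:
 assumes xs: "set xs \<subseteq> basis N"
 shows "relation N w \<gamma> xs = 0"
proof (cases "xs = []")
 case True
 have "ext (\<lambda>z. Poly_Mapping.lookup (basis_op N w' [z]) \<gamma>) (basis_op N w'' []) = ext (\<lambda>_. 0) (basis_op N w'' [])" for w' w''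
  by (rule ext_cong, rule op_single) (use basis_op_closed[OF N, of "[]" w''] in \<open>auto simp: star_algebra_def\<close>)
 then show ?thesis unfolding relation_def True by (intro sum.neutral) (auto simp: ext_def)
next
 case ne: False
 let ?I = "{(p, r). r \<le> length xs \<and> p \<le> length xs - r}"
 have pieces: "set (take p xs @ take r (drop p xs) @ drop (p + r) xs) \<subseteq> basis N"
  "take p xs @ take r (drop p xs) @ drop (p + r) xs ~= []" for p r
  unfolding take_take_drop using xs ne by auto
 show ?thesis
 proof (cases "\<gamma> \<in> basis N \<and> composable xs \<and> initial \<gamma> = initial (hd xs) \<and> final N \<gamma> = final N (last xs)")
  case False
  have "ext (\<lambda>z. Poly_Mapping.lookup (basis_op N w' (take p xs @ [z] @ drop (p + r) xs)) \<gamma>)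
    (basis_op N w'' (take r (drop p xs))) = 0" for w' w'' p r
   using term_ends[OF pieces(1) _ pieces(2), of w' p r \<gamma> w'', unfolded take_take_drop] False by blast
  then show ?thesis unfolding relation_def by (intro sum.neutral) auto
 next
  case True
  then have g: "\<gamma> \<in> basis N" and c: "composable xs" and e: "initial \<gamma> = initial (hd xs)" "final N \<gamma> = final N (last xs)"
   by auto
  let ?g = "letters N \<gamma>" and ?ls = "map (letters N) xs" and ?n = "length xs"
  let ?in = "\<lambda>w1 r p. basis_op N (w - w1) (take r (drop p xs))"
  let ?A = "\<lambda>w1 p r. ext (\<lambda>z. Poly_Mapping.lookup (product_part N w1 (take p xs @ [z] @ drop (p + r) xs)) \<gamma>) (?in w1 r p)"
  let ?B = "\<lambda>w1 p r. ext (\<lambda>z. Mop N ?g w1 (map (letters N) (take p xs) @ letters N z # map (letters N) (drop (p + r) xs))) (?in w1 r p)"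
  \<comment> \<open>The outer operation is either the product, giving \<open>?A\<close>, or an
    operation defined by graphs, giving \<open>?B\<close>.\<close>
  have AB: "ext (\<lambda>z. Poly_Mapping.lookup (basis_op N w1 (take p xs @ [z] @ drop (p + r) xs)) \<gamma>) (?in w1 r p) = ?A w1 p r + ?B w1 p r" for w1 p r
   unfolding ext_add_left[symmetric]
  proof (rule ext_cong)
   fix z assume "z \<in> Poly_Mapping.keys (?in w1 r p)"
   then have z: "z \<in> basis N"
    using basis_op_closed[OF N, of "take r (drop p xs)" "w - w1"] pieces(1)[of p r] by (auto simp: star_algebra_def)
   have "Poly_Mapping.lookup (higher w1 (take p xs @ [z] @ drop (p + r) xs)) \<gamma> =
     Mop N ?g w1 (map (letters N) (take p xs) @ letters N z # map (letters N) (drop (p + r) xs))"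
    by (rule lookup_higher_inner[OF pieces z g]) (use e in \<open>simp_all only: take_take_drop\<close>)
   then show "Poly_Mapping.lookup (basis_op N w1 (take p xs @ [z] @ drop (p + r) xs)) \<gamma> =
     Poly_Mapping.lookup (product_part N w1 (take p xs @ [z] @ drop (p + r) xs)) \<gamma> +
     Mop N ?g w1 (map (letters N) (take p xs) @ letters N z # map (letters N) (drop (p + r) xs))"
    by (simp add: basis_op_split lower_def lookup_add)
  qed
  have B: "(\<Sum>w1\<in>{w1. w1 \<subseteq># w}. \<Sum>(p, r)\<in>?I. ?B w1 p r) = TT N w (Mop N ?g) ?ls"
  proof -
   have inner: "(\<Sum>w1\<in>{w1. w1 \<subseteq># w}. ?B w1 p r) = inn N w (Mop N ?g) (take p ?ls) (take r (drop p ?ls)) (drop (p + r) ?ls)" for p r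
   proof -
    have m: "set (take r (drop p xs)) \<subseteq> basis N" using pieces(1)[of p r] by auto
    have "composable (take p xs @ take r (drop p xs) @ drop (p + r) xs)" unfolding take_take_drop by (rule c)
    then have "composable (take r (drop p xs))" unfolding composable_def successively_append_iff by blast
    from sum_inner[OF m this, of "Mop N ?g" "map (letters N) (take p xs)" "map (letters N) (drop (p + r) xs)" w]
    show ?thesis using Mop_strict[OF N] by (simp add: take_map drop_map)
   qed
   have "(\<Sum>w1\<in>{w1. w1 \<subseteq># w}. \<Sum>(p, r)\<in>?I. ?B w1 p r) = (\<Sum>q\<in>?I. \<Sum>w1\<in>{w1. w1 \<subseteq># w}. ?B w1 (fst q) (snd q))"
    unfolding case_prod_unfold by (rule sum.swap)
   also have "\<dots> = (\<Sum>(p, r)\<in>{(p, r). r \<le> length ?ls \<and> p \<le> length ?ls - r}.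
     inn N w (Mop N ?g) (take p ?ls) (take r (drop p ?ls)) (drop (p + r) ?ls))"
    unfolding inner by (simp add: case_prod_unfold)
   also have "\<dots> = TT N w (Mop N ?g) ?ls" unfolding sum_index_trip TT_def[OF N] ..
   finally show ?thesis .
  qed
  \<comment> \<open>The product has weight 0 and two inputs, so the inner operation takes the whole
    weight and all inputs except the first or except the last.\<close>
  have A: "(\<Sum>w1\<in>{w1. w1 \<subseteq># w}. \<Sum>(p, r)\<in>?I. ?A w1 p r) = ?A {#} 1 (?n - 1) + ?A {#} 0 (?n - 1)"
  proof -
   have "(\<Sum>w1\<in>{w1. w1 \<subseteq># w}. \<Sum>(p, r)\<in>?I. ?A w1 p r) = (\<Sum>w1\<in>{{#}}. \<Sum>(p, r)\<in>?I. ?A w1 p r)"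
    by (rule sum.mono_neutral_right[OF finite_submultisets])
     (auto simp: product_part_def ext_def intro!: sum.neutral)
   also have "\<dots> = (\<Sum>(p, r)\<in>?I. ?A {#} p r)" by simp
   also have "\<dots> = (\<Sum>(p, r)\<in>{(1, ?n - 1), (0, ?n - 1)}. ?A {#} p r)"
   proof (rule sum.mono_neutral_right)
    show "finite ?I" by (rule finite_subset[of _ "{..?n} \<times> {..?n}"]) auto
    have "?n \<ge> 1" using ne by (cases xs) auto
    then show "{(1, ?n - 1), (0, ?n - 1)} \<subseteq> ?I" by auto
    show "\<forall>i\<in>?I - {(1, ?n - 1), (0, ?n - 1)}. (case i of (p, r) => ?A {#} p r) = 0"
    proof
     fix i assume i: "i \<in> ?I - {(1, ?n - 1), (0, ?n - 1)}"
     obtain p r where pr: "i = (p, r)" by (cases i)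
     then have "length (take p xs @ [z] @ drop (p + r) xs) ~= 2" for z using i \<open>?n \<ge> 1\<close> by auto
     then have "product_part N {#} (take p xs @ [z] @ drop (p + r) xs) = 0" for z unfolding product_part_def by metis
     then show "(case i of (p, r) => ?A {#} p r) = 0" by (simp add: pr ext_def)
    qed
   qed
   finally show ?thesis by simp
  qed
  obtain x t where xt: "xs = x # t" using ne by (cases xs) auto
  have A1: "?A {#} 1 (?n - 1) = (if \<exists>g. ?g = hd ?ls @ g then low w (drop (length (hd ?ls)) ?g) (tl ?ls) else 0) + out_left N w ?g ?ls"
  proof -
   have "?A {#} 1 (?n - 1) = ext (\<lambda>z. if basis_mult N x z = Some \<gamma> then 1 else 0) (basis_op N w t)"
    by (simp add: xt lookup_product)
   also have "\<dots> = (if \<exists>g. ?g = letters N x @ g then low w (drop (length (letters N x)) ?g) (map (letters N) t) +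
     Mop N (drop (length (letters N x)) ?g) w (map (letters N) t) else 0)"
    by (rule ext_product_left) (use xs c g e xt in auto)
   finally show ?thesis by (simp add: xt out_left_def[OF N])
  qed
  have A0: "?A {#} 0 (?n - 1) = (if \<exists>g. ?g = g @ last ?ls then low w (take (length ?g - length (last ?ls)) ?g) (butlast ?ls) else 0) + out_right N w ?g ?ls"
  proof -
   have "xs = butlast xs @ [last xs]" using ne by simp
   then obtain t' y where ty: "xs = t' @ [y]" by blast
   have "?A {#} 0 (?n - 1) = ext (\<lambda>z. if basis_mult N z y = Some \<gamma> then 1 else 0) (basis_op N w t')"
    by (simp add: ty lookup_product)
   also have "\<dots> = (if \<exists>g. ?g = g @ letters N y then low w (take (length ?g - length (letters N y)) ?g) (map (letters N) t') +
     Mop N (take (length ?g - length (letters N y)) ?g) w (map (letters N) t') else 0)"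
    by (rule ext_product_right) (use xs c g e ty in auto)
   finally show ?thesis by (simp add: ty out_right_def[OF N])
  qed
  have L: "TT N w (Mop N ?g) ?ls + out_left N w ?g ?ls + out_right N w ?g ?ls = 0"
  proof (rule letter_relation[OF N])
   show "chain N ?g" by (rule chain_letters[OF g])
   show "colored N ?g" by (rule colored_letters[OF g])
   show "chain N z \<and> colored N z" if "z \<in> set ?ls" for z
    using that xs chain_letters colored_letters by auto
   show "chain N (a @ b) \<longleftrightarrow> \<not> adj2 N a b" if ab: "?ls = p @ a # b # q" "a ~= []" "b ~= []" for p a b q
   proof -
   from ab obtain p' x y q' where xy: "xs = p' @ x # y # q'" "a = letters N x" "b = letters N y"
    by (auto simp: map_eq_append_conv map_eq_Cons_conv)
   have nt: "x \<in> nontrivial N" "y \<in> nontrivial N"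
    using ab xy xs letters_Nil_iff[of x N] letters_Nil_iff[of y N] by auto
   have "final N x = initial y" using c xy by (simp add: composable_def successively_append_iff)
   then have s: "snd (hd b) = snd (lk N (last a))" using nt xy by (simp add: initial_letters final_letters)
   have "chain N (a @ b) \<longleftrightarrow> hd b = lk N (last a)"
    using ab xy letters_nontrivial(2) nt by (simp add: chain_append)
   also have "\<dots> \<longleftrightarrow> fst (hd b) = fst (last a)" using s by (auto simp: prod_eq_iff)
   also have "\<dots> \<longleftrightarrow> \<not> adj2 N a b" using s unfolding adj2_def[OF N] by (auto simp: prod_eq_iff snd_lk)
   finally show ?thesis .
   qed
  qed (use ne in simp)
  \<comment> \<open>The terms without any graph operation agree for the two outer products and
    cancel.\<close>
  have S: "(if \<exists>g. ?g = hd ?ls @ g then low w (drop (length (hd ?ls)) ?g) (tl ?ls) else 0) =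
    (if \<exists>g. ?g = g @ last ?ls then low w (take (length ?g - length (last ?ls)) ?g) (butlast ?ls) else 0)"
   by (rule low_sym) (use chain_letters[OF g] colored_letters[of x N] xs xt in auto)
  have "relation N w \<gamma> xs = (\<Sum>w1\<in>{w1. w1 \<subseteq># w}. \<Sum>(p, r)\<in>?I. ?A w1 p r + ?B w1 p r)"
   unfolding relation_def sum_weights AB ..
  also have "\<dots> = (?A {#} 1 (?n - 1) + ?A {#} 0 (?n - 1)) + TT N w (Mop N ?g) ?ls"
   unfolding sum_pair_distrib sum.distrib A B ..
  also have "\<dots> = TT N w (Mop N ?g) ?ls + out_left N w ?g ?ls + out_right N w ?g ?ls"
   unfolding A1 A0 S by (simp only: ac_simps scalar_add_self scalar_add_self_left add_0_right add_0)
  also have "\<dots> = 0" by (rule L)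
  finally show ?thesis .
 qed
qed

end

theorem theorem4p12:
 fixes N :: nat
 assumes "N \<ge> 3"
 shows "weighted_A_infinity_algebra (ground_ring N) star_scale (star_algebra N) {0..N + 1} (star_op N)"
proof -
 have N: "N \<ge> 1" using assms by simp
 show ?thesis
  unfolding weighted_A_infinity_algebra_def
  using star_op_multilinear[OF N] A_infinity_sum_zero[OF _ relation_zero[OF N]] by blast
qed

end
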